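(* Let $1<\beta<\alpha<2$, $a>0$, and let $p^a(s,x,t,y)$ be the density of the semigroup generated by $\Delta^{\alpha/2}+a^\beta\Delta^{\beta/2}$ on $\mathbb{R}^d$. If $b\in\mathcal{N}(\eta,Q,p^a)$ with $0\le\eta<\frac12$, then there exists a transition density $\widetilde{p^a}$ such that: (i) there is a constant $C>1$ such that for all $-\infty<s<t<\infty$ and $x,y\in\mathbb{R}^d$, $$\frac{p^a(s,x,t,y)}{C^{1+Q(s,t)}}\le \widetilde{p^a}(s,x,t,y)\le p^a(s,x,t,y)\begin{cases}\left(\frac{1}{1-2\eta}\right)^{1+\frac{Q(s,t)}{\eta}}, & \text{if } 0<\eta<\frac12,\\[4pt] e^{Q(s,t)}, & \text{if } \eta=0;\end{cases}$$ (ii) for all $s\in\mathbb{R}$, $x\in\mathbb{R}^d$ and $\phi\in C_c^\infty(\mathbb{R}\times\mathbb{R}^d)$, $$\int_s^\infty\int_{\mathbb{R}^d}\widetilde{p^a}(s,x,u,z)\Big[\partial_u\phi(u,z)+\big(\Delta_z^{\alpha/2}+a^\beta\Delta_z^{\beta/2}\big)\phi(u,z)+b(u,z)\cdot\nabla_z\phi(u,z)\Big]\,dz\,du=-\phi(s,x).$$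
   Context: Here $d\ge1$ is an integer and $b\colon\mathbb{R}\times\mathbb{R}^d\to\mathbb{R}^d$ is Borel measurable. A transition density is a function $q\colon\mathbb{R}\times\mathbb{R}^d\times\mathbb{R}\times\mathbb{R}^d\to[0,\infty)$ satisfying $\int_{\mathbb{R}^d}q(s,x,u,z)q(u,z,t,y)\,dz=q(s,x,t,y)$ for all $s<u<t$ and $x,y\in\mathbb{R}^d$. Density $p^a$: $p^a(s,x,t,y)=p^a(t-s,y-x)$, where for $t>0$, $x\in\mathbb{R}^d$, $$p^a(t,x)=\frac1{(2\pi)^d}\int_{\mathbb{R}^d}e^{-t(|\xi|^\alpha+a^\beta|\xi|^\beta)}e^{-ix\cdot\xi}\,d\xi,$$ and $p^a(t,x)=0$ for $t\le0$. Generator: for $f\in C_c^\infty(\mathbb{R}^d)$, $$\big(\Delta^{\alpha/2}+a^\beta\Delta^{\beta/2}\big)f(x)=\lim_{\varepsilon\to0^+}\int_{|y|>\varepsilon}\left(\frac{\mathcal{A}_{d,-\alpha}}{|y|^{d+\alpha}}+\frac{a^\beta\mathcal{A}_{d,-\beta}}{|y|^{d+\beta}}\right)[f(x+y)-f(x)]\,dy,$$ where $\mathcal{A}_{d,\gamma}=\Gamma((d-\gamma)/2)/(2^\gamma\pi^{d/2}|\Gamma(\gamma/2)|)$; the subscript $z$ on the operators means that they act in the spatial variable $z$. Definition of $\mathcal{N}(\eta,Q,p)$: let $\eta\ge0$ and let $Q\colon\mathbb{R}\times\mathbb{R}\to[0,\infty)$ satisfy $Q(r,u)+Q(u,v)\le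 Q(r,v)$ for all $r<u<v$. We say $b\in\mathcal{N}(\eta,Q,p)$ if for all $-\infty<s<t<\infty$ and $x,y\in\mathbb{R}^d$, $$\int_s^t\int_{\mathbb{R}^d}p(s,x,u,z)\,|b(u,z)|\,|\nabla_z p(u,z,t,y)|\,dz\,du\le[\eta+Q(s,t)]\,p(s,x,t,y).$$ *)

theory Defs
  imports "HOL-Analysis.Analysis"
begin

primrec cont_diff :: "nat \<Rightarrow> ('a::euclidean_space \<Rightarrow> real) \<Rightarrow> bool" where
  "cont_diff 0 f \<longleftrightarrow> continuous_on UNIV f"
| "cont_diff (Suc k) f \<longleftrightarrow> (\<forall>x. f differentiable (at x)) \<and>
     (\<forall>v. cont_diff k (\<lambda>x. frechet_derivative f (at x) v))"

definition Cc_infinity :: "('a::euclidean_space \<Rightarrow> real) set" where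
  "Cc_infinity = {f. (\<forall>k. cont_diff k f) \<and> compact (closure {x. f x \<noteq> 0})}"

definition grad :: "('a::euclidean_space \<Rightarrow> real) \<Rightarrow> 'a \<Rightarrow> 'a" where
  "grad f x = (THE D. GDERIV f x :> D)"

definition transition_density :: "(real \<Rightarrow> 'a::euclidean_space \<Rightarrow> real \<Rightarrow> 'a \<Rightarrow> real) \<Rightarrow> bool" where
  "transition_density q \<longleftrightarrow>
     (\<forall>s x t y. 0 \<le> q s x t y) \<and>
     (\<forall>s u t x y. s < u \<longrightarrow> u < t \<longrightarrow>
        has_bochner_integral lborel (\<lambda>z. q s x u z * q u z t y) (q s x t y))"

(* Taking Re loses nothing: the imaginary part of the Fourier integral vanishes, as the symbol is even. *)
definition stable_kernel ::
    "real \<Rightarrow> real \<Rightarrow> real \<Rightarrow> real \<Rightarrow> 'a::euclidean_space \<Rightarrow> real" where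
  "stable_kernel \<alpha> \<beta> a t x =
     (if t > 0 then
        1 / (2 * pi) ^ DIM('a) *
        Re (LINT \<xi>|lborel.
              exp (complex_of_real (- t * (norm \<xi> powr \<alpha> + a powr \<beta> * norm \<xi> powr \<beta>))) *
              exp (- (\<i> * complex_of_real (x \<bullet> (\<xi>::'a)))))
      else 0)"

definition stable_density ::
    "real \<Rightarrow> real \<Rightarrow> real \<Rightarrow> real \<Rightarrow> 'a::euclidean_space \<Rightarrow> real \<Rightarrow> 'a \<Rightarrow> real" where
  "stable_density \<alpha> \<beta> a s x t y = stable_kernel \<alpha> \<beta> a (t - s) (y - x)"

definition riesz_const :: "nat \<Rightarrow> real \<Rightarrow> real" where
  "riesz_const d \<gamma> =
     Gamma ((real d - \<gamma>) / 2) / (2 powr \<gamma> * pi powr (real d / 2) * \<bar>Gamma (\<gamma> / 2)\<bar>)"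

definition stable_generator ::
    "real \<Rightarrow> real \<Rightarrow> real \<Rightarrow> ('a::euclidean_space \<Rightarrow> real) \<Rightarrow> 'a \<Rightarrow> real" where
  "stable_generator \<alpha> \<beta> a f x =
     Lim (at_right 0) (\<lambda>\<epsilon>. LINT y:{y. norm y > \<epsilon>}|lborel.
       (riesz_const DIM('a) (- \<alpha>) / norm y powr (real DIM('a) + \<alpha>) +
        a powr \<beta> * riesz_const DIM('a) (- \<beta>) / norm y powr (real DIM('a) + \<beta>)) *
       (f (x + y) - f x))"

definition superadditive :: "(real \<Rightarrow> real \<Rightarrow> real) \<Rightarrow> bool" where
  "superadditive Q \<longleftrightarrow> (\<forall>r u v. r < u \<longrightarrow> u < v \<longrightarrow> Q r u + Q u v \<le> Q r v)"

definition class_N ::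
    "real \<Rightarrow> (real \<Rightarrow> real \<Rightarrow> real) \<Rightarrow> (real \<Rightarrow> 'a::euclidean_space \<Rightarrow> real \<Rightarrow> 'a \<Rightarrow> real)
       \<Rightarrow> (real \<Rightarrow> 'a \<Rightarrow> 'a) set" where
  "class_N \<eta> Q p = {b. \<forall>s t x y. s < t \<longrightarrow>
     (\<integral>\<^sup>+u\<in>{s<..<t}. (\<integral>\<^sup>+z.
        ennreal (p s x u z * norm (b u z) * norm (grad (\<lambda>w. p u w t y) z)) \<partial>lborel) \<partial>lborel)
     \<le> ennreal ((\<eta> + Q s t) * p s x t y)}"

end

theory Submission
  imports Defs "HOL-Probability.Probability"
begin

text \<open>
  The perturbed density is the sum \<open>q = \<Sum>n. p\<^sub>n\<close> of the perturbation series, where \<open>p\<^sub>0 = p\<close> and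
  \<open>p\<^sub>n\<^sub>+\<^sub>1 = \<integral> p\<^sub>n b \<cdot> \<nabla>p\<close>. On an interval on which \<open>Q \<le> h\<close> the class condition makes the series
  geometric with ratio \<open>\<eta> + h\<close>, so \<open>q \<le> p / (1 - \<eta> - h)\<close>, and \<open>\<eta> + h < 1/2\<close> gives a lower bound
  \<open>q \<ge> c p\<close>. The majorant of the series is the least solution of its integral equation, hence it is
  submultiplicative over a subdivision of time; superadditivity cuts \<open>(s, t)\<close> into at most
  \<open>1 + Q s t / h\<close> intervals of this kind, and \<open>h = \<eta>\<close> yields the upper estimate.
  The Chapman-Kolmogorov equation for \<open>q\<close> follows from uniqueness in \<open>q = p + \<integral> q b \<cdot> \<nabla>p\<close>.

  No heat kernel estimates are needed: positivity, convolution and differentiability of \<open>p\<close> come from its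
  Fourier representation and the Levy-Khintchine formula. Integrating the class condition
  over the end point shows that \<open>b\<close> is integrable against \<open>p\<close> and that \<open>\<nabla>p\<close> is integrable in space-time
  wherever \<open>b\<close> matters, which is what the weak equation requires.
\<close>

section \<open>Integration over Euclidean spaces\<close>

text \<open>The terms of the series are signed, so the sign of \<open>q\<close> cannot be read off
  termwise. With ratio \<open>\<theta> = \<eta> + h\<close> the sum differs from \<open>p\<close> by
  at most \<open>\<theta> / (1 - \<theta>)\<close> times \<open>p\<close>, a factor below 1 exactly
  if \<open>\<theta> < 1/2\<close>; the condition \<open>\<eta> < 1/2\<close> is what leaves room
  for a positive \<open>h\<close>. On longer intervals this lower bound is passed on by the
  Chapman-Kolmogorov equation for \<open>q\<close>, which therefore has to be proved before
  \<open>q\<close> is known to be nonnegative, from absolute convergence alone. The upper bound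
  works with \<open>\<theta> < 1\<close> and goes through the majorant, for which an inequality at
  each cut is enough: every piece costs one factor \<open>1 / (1 - \<eta> - h)\<close>. There
  \<open>k\<close> pieces with \<open>h = R / k\<close> give \<open>1 - R / k\<close> to the power
  \<open>-k\<close>, whose limit is \<open>exp R\<close>, for every
  \<open>R > Q s t\<close>.\<close>

lemma integral_lborel_translation:
  fixes f :: "'a::euclidean_space \<Rightarrow> 'b::{banach, second_countable_topology}"
  shows "(LBINT x. f (c + x)) = (LBINT x. f x)"
proof (cases "integrable lborel f")
  case True
  then have [measurable]: "f \<in> borel_measurable borel" by auto
  have "(LBINT x. f x) = (LINT x|distr lborel borel ((+) c). f x)"
    by (simp add: lborel_distr_plus)
  also have "\<dots> = (LBINT x. f (c + x))"
    by (rule integral_distr) auto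
  finally show ?thesis by simp
next
  case False
  \<comment> \<open>Without integrability both Bochner integrals take the default value 0, so the
    identity holds for every \<open>f\<close>.\<close>
  have "\<not> integrable lborel (\<lambda>x. f (c + x))"
  proof
    assume *: "integrable lborel (\<lambda>x. f (c + x))"
    have "integrable (distr lborel borel ((+) (- c))) (\<lambda>x. f (c + x))"
      using * by (simp add: lborel_distr_plus)
    then have "integrable lborel (\<lambda>x. f (c + ((- c) + x)))"
      using borel_measurable_integrable[OF *]
      by (subst (asm) integrable_distr_eq) auto
    with False show False by simp
  qed
  with False show ?thesis by (simp add: not_integrable_integral_eq)
qed

lemma integrable_lborel_translation:
  fixes f :: "'a::euclidean_space \<Rightarrow> 'b::{banach, second_countable_topology}"
  assumes "integrable lborel f"
  shows "integrable lborel (\<lambda>x. f (c + x))"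
proof -
  have [measurable]: "f \<in> borel_measurable borel" using assms by auto
  have "integrable (distr lborel borel ((+) c)) f"
    using assms by (simp add: lborel_distr_plus)
  then show ?thesis by (subst (asm) integrable_distr_eq) auto
qed

lemma nn_integral_lborel_translation:
  fixes f :: "'a::euclidean_space \<Rightarrow> ennreal"
  assumes [measurable]: "f \<in> borel_measurable borel"
  shows "(\<integral>\<^sup>+x. f (c + x) \<partial>lborel) = (\<integral>\<^sup>+x. f x \<partial>lborel)"
proof -
  have "(\<integral>\<^sup>+x. f x \<partial>lborel) = (\<integral>\<^sup>+x. f x \<partial>distr lborel borel ((+) c))"
    by (simp add: lborel_distr_plus)
  also have "\<dots> = (\<integral>\<^sup>+x. f (c + x) \<partial>lborel)"
    by (rule nn_integral_distr) auto
  finally show ?thesis by simp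
qed

lemma lborel_distr_reflect:
  "distr lborel borel (\<lambda>x. - x) = (lborel :: 'a::euclidean_space measure)"
  by (subst (2) lborel_affine[of "-1" 0])
     (auto simp: density_1 one_ennreal_def[symmetric])

lemma integrable_lborel_reflect:
  fixes f :: "'a::euclidean_space \<Rightarrow> 'b::{banach, second_countable_topology}"
  assumes "integrable lborel f"
  shows "integrable lborel (\<lambda>x. f (- x))"
proof -
  have [measurable]: "f \<in> borel_measurable borel" using assms by auto
  have "integrable (distr lborel borel (\<lambda>x. - x)) f"
    using assms by (simp add: lborel_distr_reflect)
  then show ?thesis by (subst (asm) integrable_distr_eq) auto
qed

lemma integral_lborel_reflect:
  fixes f :: "'a::euclidean_space \<Rightarrow> 'b::{banach, second_countable_topology}"
  assumes [measurable]: "f \<in> borel_measurable borel"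
  shows "(LBINT x. f (- x)) = (LBINT x. f x)"
proof -
  have "(LBINT x. f x) = (LINT x|distr lborel borel (\<lambda>x. - x). f x)"
    by (simp add: lborel_distr_reflect)
  also have "\<dots> = (LBINT x. f (- x))"
    by (rule integral_distr) auto
  finally show ?thesis by simp
qed

section \<open>Gaussian and exponential integrals in several variables\<close>

lemma has_bochner_integral_lborel_prod:
  fixes f :: "'a::euclidean_space \<Rightarrow> real \<Rightarrow> 'b::{real_normed_field, banach, second_countable_topology}"
  assumes f: "\<And>b. b \<in> Basis \<Longrightarrow> has_bochner_integral lborel (f b) (I b)"
  shows "has_bochner_integral lborel (\<lambda>x::'a. \<Prod>b\<in>Basis. f b (x \<bullet> b)) (\<Prod>b\<in>Basis. I b)"
proof -
  interpret product_sigma_finite "\<lambda>b::'a. lborel :: real measure" ..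
  have [measurable]: "\<And>b. b \<in> Basis \<Longrightarrow> f b \<in> borel_measurable borel"
    using f[THEN integrable.intros] by auto
  have int: "integrable (Pi\<^sub>M Basis (\<lambda>b::'a. lborel)) (\<lambda>x. \<Prod>b\<in>Basis. f b (x b))"
    by (rule product_integrable_prod) (use f in \<open>auto simp: has_bochner_integral_iff\<close>)
  have val: "(LINT x|(Pi\<^sub>M Basis (\<lambda>b::'a. lborel)). (\<Prod>b\<in>Basis. f b (x b))) = (\<Prod>b\<in>Basis. I b)"
    by (subst product_integral_prod) (use f in \<open>auto simp: has_bochner_integral_iff\<close>)
  have coord: "(\<Prod>b\<in>Basis. f b ((\<Sum>c\<in>Basis. x c *\<^sub>R c) \<bullet> b)) = (\<Prod>b\<in>Basis. f b (x b))" for x :: "'a \<Rightarrow> real"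
    by (intro prod.cong refl) (simp add: inner_sum_left_Basis)
  have T: "(\<lambda>f. \<Sum>b\<in>Basis. f b *\<^sub>R b) \<in> measurable (Pi\<^sub>M Basis (\<lambda>b::'a. lborel :: real measure)) (borel :: 'a measure)"
    by simp
  show ?thesis
    unfolding has_bochner_integral_iff lborel_eq[where 'a='a]
    using int val
    by (subst integrable_distr_eq[OF T], simp, subst integral_distr[OF T], simp, simp add: coord)
qed

text \<open>Rescaling by \<open>k = sqrt (2 * c)\<close> turns the weight into a multiple of the
  standard normal density, whose characteristic function is known.\<close>

lemma gaussian_fourier_real:
  fixes x c :: real
  assumes c: "c > 0"
  shows "has_bochner_integral lborel (\<lambda>u. complex_of_real (exp (- c * u\<^sup>2)) * iexp (x * u))
           (complex_of_real (sqrt (pi / c) * exp (- x\<^sup>2 / (4 * c))))"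
proof -
  define k where "k = sqrt (2 * c)"
  have k: "k > 0" "k\<^sup>2 = 2 * c" using c by (auto simp: k_def)
  let ?f = "\<lambda>u. complex_of_real (std_normal_density u) * iexp (x / k * u)"
  have int: "integrable lborel ?f"
  proof (rule Bochner_Integration.integrable_bound)
    show "integrable lborel (\<lambda>u. std_normal_density u)" by (rule integrable_normal_density) simp
  qed (auto simp: norm_mult)
  have val: "(LBINT u. ?f u) = complex_of_real (exp (- ((x / k)\<^sup>2) / 2))"
    using fun_cong[OF char_std_normal_distribution, of "x / k"]
    by (simp add: char_def integral_density normal_density_nonneg scaleR_conv_of_real)
  have "has_bochner_integral lborel ?f (complex_of_real (exp (- ((x / k)\<^sup>2) / 2)))"
    using int val by (simp add: has_bochner_integral_iff)
  then have "has_bochner_integral lborel (\<lambda>u. ?f (0 + k * u)) (complex_of_real (exp (- ((x / k)\<^sup>2) / 2)) /\<^sub>R \<bar>k\<bar>)"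
    using k by (subst (asm) lborel_has_bochner_integral_real_affine_iff[where c=k and t=0]) auto
  then have "has_bochner_integral lborel (\<lambda>u. complex_of_real (sqrt (2 * pi)) * ?f (0 + k * u)) (complex_of_real (sqrt (2 * pi)) * (complex_of_real (exp (- ((x / k)\<^sup>2) / 2)) /\<^sub>R \<bar>k\<bar>))"
    by (rule has_bochner_integral_mult_right)
  also have "(\<lambda>u. complex_of_real (sqrt (2 * pi)) * ?f (0 + k * u)) = (\<lambda>u. complex_of_real (exp (- c * u\<^sup>2)) * iexp (x * u))"
  proof
    fix u :: real
    have "sqrt (2 * pi) * std_normal_density (k * u) = exp (- c * u\<^sup>2)"
      using k by (simp add: std_normal_density_def power_mult_distrib)
    moreover have "x / k * (k * u) = x * u" using k by simp
    ultimately show "complex_of_real (sqrt (2 * pi)) * ?f (0 + k * u) = complex_of_real (exp (- c * u\<^sup>2)) * iexp (x * u)"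
      by (simp only: mult.assoc[symmetric] of_real_mult[symmetric] add_0)
  qed
  also have "complex_of_real (sqrt (2 * pi)) * (complex_of_real (exp (- ((x / k)\<^sup>2) / 2)) /\<^sub>R \<bar>k\<bar>) = complex_of_real (sqrt (pi / c) * exp (- x\<^sup>2 / (4 * c)))"
  proof -
    have "(x / k)\<^sup>2 / 2 = x\<^sup>2 / (4 * c)" using k by (simp add: power_divide)
    moreover have "sqrt (2 * pi) / \<bar>k\<bar> = sqrt (pi / c)"
      using k c by (simp add: k_def real_sqrt_divide[symmetric])
    ultimately have "sqrt (2 * pi) * (exp (- ((x / k)\<^sup>2) / 2) / \<bar>k\<bar>) = sqrt (pi / c) * exp (- x\<^sup>2 / (4 * c))"
      by (metis (no_types, lifting) minus_divide_left times_divide_eq_left times_divide_eq_right)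
    then show ?thesis
      by (simp only: scaleR_conv_of_real of_real_mult[symmetric] divide_inverse mult_ac)
  qed
  finally show ?thesis .
qed

lemma gaussian_fourier:
  fixes x :: "'a::euclidean_space" and c :: real
  assumes c: "c > 0"
  shows "has_bochner_integral lborel (\<lambda>\<xi>. exp (- c * (norm \<xi>)\<^sup>2) * cos (x \<bullet> \<xi>))
           (sqrt (pi / c) ^ DIM('a) * exp (- (norm x)\<^sup>2 / (4 * c)))"
proof -
  have nrm: "(norm y)\<^sup>2 = (\<Sum>b\<in>Basis. (y \<bullet> b)\<^sup>2)" for y :: 'a
    by (simp only: power2_norm_eq_inner euclidean_inner[of y y]) (simp only: power2_eq_square)
  have "has_bochner_integral lborel
      (\<lambda>\<xi>::'a. \<Prod>b\<in>Basis. complex_of_real (exp (- c * (\<xi> \<bullet> b)\<^sup>2)) * iexp ((x \<bullet> b) * (\<xi> \<bullet> b)))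
      (\<Prod>b\<in>(Basis::'a set). complex_of_real (sqrt (pi / c) * exp (- (x \<bullet> b)\<^sup>2 / (4 * c))))"
    by (rule has_bochner_integral_lborel_prod) (rule gaussian_fourier_real[OF c])
  also have "(\<lambda>\<xi>::'a. \<Prod>b\<in>Basis. complex_of_real (exp (- c * (\<xi> \<bullet> b)\<^sup>2)) * iexp ((x \<bullet> b) * (\<xi> \<bullet> b))) =
      (\<lambda>\<xi>. complex_of_real (exp (- c * (norm \<xi>)\<^sup>2)) * iexp (x \<bullet> \<xi>))"
  proof
    fix \<xi> :: 'a
    have "(\<Prod>b\<in>Basis. exp (- c * (\<xi> \<bullet> b)\<^sup>2)) = exp (- c * (norm \<xi>)\<^sup>2)"
      by (simp add: nrm exp_sum[symmetric] sum_distrib_left sum_negf)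
    moreover have "(\<Prod>b\<in>Basis. iexp ((x \<bullet> b) * (\<xi> \<bullet> b))) = iexp (x \<bullet> \<xi>)"
      unfolding euclidean_inner[of x \<xi>] by (simp add: exp_sum[symmetric] sum_distrib_left)
    ultimately show "(\<Prod>b\<in>Basis. complex_of_real (exp (- c * (\<xi> \<bullet> b)\<^sup>2)) * iexp ((x \<bullet> b) * (\<xi> \<bullet> b))) =
        complex_of_real (exp (- c * (norm \<xi>)\<^sup>2)) * iexp (x \<bullet> \<xi>)"
      by (simp only: prod.distrib of_real_prod[symmetric])
  qed
  also have "(\<Prod>b\<in>(Basis::'a set). complex_of_real (sqrt (pi / c) * exp (- (x \<bullet> b)\<^sup>2 / (4 * c)))) =
      complex_of_real (sqrt (pi / c) ^ DIM('a) * exp (- (norm x)\<^sup>2 / (4 * c)))"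
    unfolding of_real_prod[symmetric]
    by (simp add: prod.distrib nrm exp_sum[symmetric] sum_divide_distrib sum_negf)
  finally have "has_bochner_integral lborel (\<lambda>\<xi>. Re (complex_of_real (exp (- c * (norm \<xi>)\<^sup>2)) * iexp (x \<bullet> \<xi>)))
      (Re (complex_of_real (sqrt (pi / c) ^ DIM('a) * exp (- (norm x)\<^sup>2 / (4 * c)))))"
    by (rule has_bochner_integral_bounded_linear[OF bounded_linear_Re])
  then show ?thesis by (simp add: Re_exp)
qed

text \<open>\<open>DIM('a)\<close> times the norm dominates the sum of the moduli of the
  coordinates, so the integrand lies below a product of one-dimensional exponentials with rate
  \<open>c / DIM('a)\<close> each.\<close>

lemma integrable_exp_minus_norm:
  assumes c: "c > 0"
  shows "integrable lborel (\<lambda>\<xi>::'a::euclidean_space. exp (- c * norm \<xi>))"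
proof -
  define k where "k = c / DIM('a)"
  have k: "k > 0" using c by (simp add: k_def)
  have "integrable lborel (\<lambda>u::real. exp (- k * \<bar>u\<bar>))"
  proof -
    interpret prob_space "density lborel (exponential_density k)"
      using k by (rule prob_space_exponential_density)
    have "(\<integral>\<^sup>+u. exponential_density k u \<partial>lborel) = 1"
      using emeasure_space_1 by (simp add: emeasure_density)
    then have e: "integrable lborel (exponential_density k)"
      using k by (intro integrableI_nonneg) (auto simp: exponential_density_nonneg)
    \<comment> \<open>The exponential density lives on the positive half line; adding its reflection
      covers the two-sided exponential.\<close>
    have "integrable lborel (\<lambda>u. (exponential_density k u + exponential_density k (- u)) / k)"
      by (intro Bochner_Integration.integrable_divide Bochner_Integration.integrable_add e
          integrable_lborel_reflect[OF e])
    then show ?thesis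
      by (rule Bochner_Integration.integrable_bound)
         (use k in \<open>auto simp: exponential_density_def mult_ac\<close>)
  qed
  then have "has_bochner_integral lborel (\<lambda>\<xi>::'a. \<Prod>b\<in>Basis. exp (- k * \<bar>\<xi> \<bullet> b\<bar>))
     (\<Prod>b\<in>(Basis::'a set). LBINT u. exp (- k * \<bar>u\<bar>))"
    by (intro has_bochner_integral_lborel_prod has_bochner_integral_integrable)
  then have "integrable lborel (\<lambda>\<xi>::'a. \<Prod>b\<in>Basis. exp (- k * \<bar>\<xi> \<bullet> b\<bar>))"
    by (simp add: has_bochner_integral_iff)
  then show ?thesis
  proof (rule Bochner_Integration.integrable_bound)
    show "AE \<xi>::'a in lborel. norm (exp (- c * norm \<xi>)) \<le> norm (\<Prod>b\<in>Basis. exp (- k * \<bar>\<xi> \<bullet> b\<bar>))"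
    proof (rule AE_I2)
      fix \<xi> :: 'a
      have "(\<Sum>b\<in>Basis. \<bar>\<xi> \<bullet> b\<bar>) \<le> DIM('a) * norm \<xi>"
        using sum_bounded_above[of Basis "\<lambda>b. \<bar>\<xi> \<bullet> b\<bar>" "norm \<xi>"] by (simp add: Basis_le_norm)
      then have "k * (\<Sum>b\<in>Basis. \<bar>\<xi> \<bullet> b\<bar>) \<le> c * norm \<xi>"
        using k c by (simp add: k_def field_simps)
      then show "norm (exp (- c * norm \<xi>)) \<le> norm (\<Prod>b\<in>Basis. exp (- k * \<bar>\<xi> \<bullet> b\<bar>))"
        by (simp add: exp_sum[symmetric] sum_distrib_left sum_negf)
    qed
  qed simp
qed

section \<open>The symbol of the Riesz kernel\<close>

text \<open>Substitution of \<open>s * r\<close> in the Euler integral. Read from right to left, it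
  writes a negative power of \<open>r\<close> as a mixture of exponentials; with \<open>r\<close> a
  squared norm this is a mixture of Gaussians.\<close>

lemma nn_integral_Gamma_scaled:
  fixes k r :: real
  assumes k: "k > 0" and r: "r > 0"
  shows "(\<integral>\<^sup>+s. ennreal (indicator {0<..} s * s powr (k - 1) * exp (- s * r)) \<partial>lborel) = ennreal (Gamma k * r powr (- k))"
proof -
  have eq: "indicator {0..} (0 + r * s) * (0 + r * s) powr (k - 1) / exp (0 + r * s) =
      r powr (k - 1) * (indicator {0<..} s * s powr (k - 1) * exp (- s * r))" for s :: real
    using r by (cases "s > 0") (auto simp: indicator_def powr_mult exp_minus field_simps zero_le_mult_iff)
  have "ennreal (Gamma k) = ennreal \<bar>r\<bar> * (\<integral>\<^sup>+s. ennreal (indicator {0..} (0 + r * s) * (0 + r * s) powr (k - 1) / exp (0 + r * s)) \<partial>lborel)"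
    unfolding Gamma_conv_nn_integral_real[OF k]
    using r by (intro nn_integral_real_affine) auto
  also have "\<dots> = ennreal r * (ennreal (r powr (k - 1)) * (\<integral>\<^sup>+s. ennreal (indicator {0<..} s * s powr (k - 1) * exp (- s * r)) \<partial>lborel))"
    unfolding eq using r by (subst nn_integral_cmult[symmetric]) (auto simp: ennreal_mult')
  also have "\<dots> = ennreal (r powr k) * (\<integral>\<^sup>+s. ennreal (indicator {0<..} s * s powr (k - 1) * exp (- s * r)) \<partial>lborel)"
    using r by (simp add: mult.assoc[symmetric] ennreal_mult[symmetric] powr_diff)
  finally have "ennreal (r powr (- k)) * ennreal (Gamma k) =
      (ennreal (r powr (- k)) * ennreal (r powr k)) * (\<integral>\<^sup>+s. ennreal (indicator {0<..} s * s powr (k - 1) * exp (- s * r)) \<partial>lborel)"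
    by (simp add: mult.assoc)
  also have "ennreal (r powr (- k)) * ennreal (r powr k) = 1"
    using r by (simp add: ennreal_mult[symmetric] powr_add[symmetric] del: powr_minus)
  finally show ?thesis
    using k by (simp add: ennreal_mult[symmetric] mult.commute)
qed

lemma nn_integral_powr_interval:
  fixes k c :: real
  assumes k: "k > 0" and c: "c > 0"
  shows "(\<integral>\<^sup>+s. ennreal (indicator {0<..c} s * s powr (k - 1)) \<partial>lborel) = ennreal (c powr k / k)"
proof -
  have "((\<lambda>x. x powr (k - 1)) has_integral (c powr (k - 1 + 1) / (k - 1 + 1))) {0..c}"
    using k c by (intro has_integral_powr_from_0) auto
  then have "((\<lambda>x. x powr (k - 1)) has_integral (c powr k / k)) {0..c}"
    by simp
  then have "(\<integral>\<^sup>+s. ennreal (indicator {0..c} s * s powr (k - 1)) \<partial>lborel) = ennreal (c powr k / k)"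
    by (intro nn_integral_has_integral_lebesgue) auto
  moreover have "(\<integral>\<^sup>+s. ennreal (indicator {0<..c} s * s powr (k - 1)) \<partial>lborel) = (\<integral>\<^sup>+s. ennreal (indicator {0..c} s * s powr (k - 1)) \<partial>lborel)"
    by (intro nn_integral_cong) (auto simp: indicator_def)
  ultimately show ?thesis by simp
qed

lemma nn_integral_exp_minus_interval:
  fixes x :: real
  assumes "x \<ge> 0"
  shows "(\<integral>\<^sup>+v. ennreal (indicator {0<..x} v * exp (- v)) \<partial>lborel) = ennreal (1 - exp (- x))"
proof -
  have "((\<lambda>v. exp (- v)) has_integral (- exp (- x) - (- exp (- 0)))) {0..x}"
    using assms by (intro fundamental_theorem_of_calculus)
      (auto intro!: derivative_eq_intros simp: has_real_derivative_iff_has_vector_derivative[symmetric])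
  then have "(\<integral>\<^sup>+v. ennreal (indicator {0..x} v * exp (- v)) \<partial>lborel) = ennreal (1 - exp (- x))"
    by (intro nn_integral_has_integral_lebesgue) auto
  moreover have "(\<integral>\<^sup>+v. ennreal (indicator {0<..x} v * exp (- v)) \<partial>lborel) = (\<integral>\<^sup>+v. ennreal (indicator {0..x} v * exp (- v)) \<partial>lborel)"
    by (rule nn_integral_cong_AE) (use AE_lborel_singleton[of 0] in eventually_elim, auto simp: indicator_def)
  ultimately show ?thesis by simp
qed

text \<open>Layer cake: $1 - e^{-c/s}$ is the mass that the exponential law gives to $\{v : sv \le c\}$.\<close>

lemma nn_integral_powr_one_minus_exp:
  fixes \<gamma> c :: real
  assumes \<gamma>: "0 < \<gamma>" "\<gamma> < 2" and c: "c \<ge> 0"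
  shows "(\<integral>\<^sup>+s. ennreal (indicator {0<..} s * s powr (\<gamma> / 2 - 1) * (1 - exp (- c / s))) \<partial>lborel)
       = ennreal (c powr (\<gamma> / 2) * (2 / \<gamma>) * Gamma (1 - \<gamma> / 2))"
proof (cases "c = 0")
  case True
  then show ?thesis by simp
next
  case False
  with c have c: "c > 0" by simp
  let ?h = "\<lambda>s v::real. ennreal (indicator {0<..} s * indicator {0<..} v * indicator {..c} (s * v) * s powr (\<gamma> / 2 - 1) * exp (- v))"
  have "(\<integral>\<^sup>+s. ennreal (indicator {0<..} s * s powr (\<gamma> / 2 - 1) * (1 - exp (- c / s))) \<partial>lborel) = (\<integral>\<^sup>+s. (\<integral>\<^sup>+v. ?h s v \<partial>lborel) \<partial>lborel)"
  proof (rule nn_integral_cong)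
    fix s :: real
    show "ennreal (indicator {0<..} s * s powr (\<gamma> / 2 - 1) * (1 - exp (- c / s))) = (\<integral>\<^sup>+v. ?h s v \<partial>lborel)"
    proof (cases "s > 0")
      case True
      have "(\<integral>\<^sup>+v. ?h s v \<partial>lborel) = (\<integral>\<^sup>+v. ennreal (s powr (\<gamma> / 2 - 1)) * ennreal (indicator {0<..c/s} v * exp (- v)) \<partial>lborel)"
        using True by (intro nn_integral_cong) (auto simp: indicator_def field_simps ennreal_mult[symmetric])
      also have "\<dots> = ennreal (s powr (\<gamma> / 2 - 1)) * ennreal (1 - exp (- (c / s)))"
        using True c by (subst nn_integral_cmult) (auto simp: nn_integral_exp_minus_interval)
      finally show ?thesis using True c by (simp add: ennreal_mult[symmetric])
    qed simp
  qed
  also have "\<dots> = (\<integral>\<^sup>+v. (\<integral>\<^sup>+s. ?h s v \<partial>lborel) \<partial>lborel)"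
    by (rule lborel_pair.Fubini') measurable
  also have "\<dots> = (\<integral>\<^sup>+v. ennreal (c powr (\<gamma> / 2) * (2 / \<gamma>)) * ennreal (indicator {0<..} v * v powr ((1 - \<gamma> / 2) - 1) * exp (- v * 1)) \<partial>lborel)"
  proof (rule nn_integral_cong)
    fix v :: real
    show "(\<integral>\<^sup>+s. ?h s v \<partial>lborel) = ennreal (c powr (\<gamma> / 2) * (2 / \<gamma>)) * ennreal (indicator {0<..} v * v powr ((1 - \<gamma> / 2) - 1) * exp (- v * 1))"
    proof (cases "v > 0")
      case True
      have "(\<integral>\<^sup>+s. ?h s v \<partial>lborel) = (\<integral>\<^sup>+s. ennreal (exp (- v)) * ennreal (indicator {0<..c/v} s * s powr (\<gamma> / 2 - 1)) \<partial>lborel)"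
        using True by (intro nn_integral_cong) (auto simp: indicator_def field_simps ennreal_mult[symmetric])
      also have "\<dots> = ennreal (exp (- v)) * ennreal ((c / v) powr (\<gamma> / 2) / (\<gamma> / 2))"
        using True c \<gamma> by (subst nn_integral_cmult) (auto simp: nn_integral_powr_interval)
      also have "\<dots> = ennreal (exp (- v) * ((c / v) powr (\<gamma> / 2) / (\<gamma> / 2)))"
        using \<gamma> by (intro ennreal_mult[symmetric]) auto
      also have "exp (- v) * ((c / v) powr (\<gamma> / 2) / (\<gamma> / 2)) = (c powr (\<gamma> / 2) * (2 / \<gamma>)) * (indicator {0<..} v * v powr ((1 - \<gamma> / 2) - 1) * exp (- v * 1))"
        using True c \<gamma> by (simp add: powr_divide powr_minus field_simps)
      finally show ?thesis using \<gamma> c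
        by (subst ennreal_mult[symmetric]) (auto simp: divide_nonneg_nonneg)
    qed simp
  qed
  also have "\<dots> = ennreal (c powr (\<gamma> / 2) * (2 / \<gamma>)) * ennreal (Gamma (1 - \<gamma> / 2) * 1 powr (- (1 - \<gamma> / 2)))"
    using \<gamma> by (subst nn_integral_cmult, simp, subst nn_integral_Gamma_scaled) auto
  also have "\<dots> = ennreal (c powr (\<gamma> / 2) * (2 / \<gamma>) * Gamma (1 - \<gamma> / 2))"
    using \<gamma> c by (subst ennreal_mult[symmetric]) (auto intro!: less_imp_le)
  finally show ?thesis .
qed

lemma nn_integral_gaussian_one_minus_cos:
  fixes \<xi> :: "'a::euclidean_space" and s :: real
  assumes s: "s > 0"
  shows "(\<integral>\<^sup>+y. ennreal (exp (- s * (norm y)\<^sup>2) * (1 - cos (\<xi> \<bullet> y))) \<partial>lborel) =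
     ennreal (sqrt (pi / s) ^ DIM('a) * (1 - exp (- (norm \<xi>)\<^sup>2 / (4 * s))))"
proof -
  have "has_bochner_integral lborel (\<lambda>y. exp (- s * (norm y)\<^sup>2) * cos (0 \<bullet> y) - exp (- s * (norm y)\<^sup>2) * cos (\<xi> \<bullet> y))
     (sqrt (pi / s) ^ DIM('a) * exp (- (norm (0::'a))\<^sup>2 / (4 * s)) - sqrt (pi / s) ^ DIM('a) * exp (- (norm \<xi>)\<^sup>2 / (4 * s)))"
    by (intro has_bochner_integral_diff gaussian_fourier s)
  then have "has_bochner_integral lborel (\<lambda>y. exp (- s * (norm y)\<^sup>2) * (1 - cos (\<xi> \<bullet> y)))
     (sqrt (pi / s) ^ DIM('a) * (1 - exp (- (norm \<xi>)\<^sup>2 / (4 * s))))"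
    by (simp add: right_diff_distrib)
  then show ?thesis
    using nn_integral_eq_integral[of lborel "\<lambda>y. exp (- s * (norm y)\<^sup>2) * (1 - cos (\<xi> \<bullet> y))"]
    by (auto simp: has_bochner_integral_iff)
qed

lemma sqrt_power_eq_powr:
  assumes "x > 0" shows "sqrt x ^ n = x powr (real n / 2)"
proof -
  have "sqrt x ^ n = (x powr (1 / 2)) powr real n"
    using assms by (simp add: powr_realpow powr_half_sqrt)
  then show ?thesis by (simp only: powr_powr) simp
qed

text \<open>The functional equation moves the argument from the interval (-1, 0), where Gamma is
  negative, to (0, 1), where it is positive. This accounts for the modulus in
  \<open>riesz_const\<close>.\<close>

lemma abs_Gamma_negative_half:
  fixes \<gamma> :: real
  assumes "0 < \<gamma>" "\<gamma> < 2"
  shows "\<bar>Gamma (- \<gamma> / 2)\<bar> = (2 / \<gamma>) * Gamma (1 - \<gamma> / 2)"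
proof -
  have "- \<gamma> / 2 \<notin> \<int>\<^sub>\<le>\<^sub>0"
  proof
    assume "- \<gamma> / 2 \<in> \<int>\<^sub>\<le>\<^sub>0"
    then obtain k where "- \<gamma> / 2 = real_of_int k" by (auto elim!: nonpos_Ints_cases)
    with assms have "-1 < real_of_int k" "real_of_int k < 0" by auto
    then have "real_of_int (- 1) < real_of_int k" "real_of_int k < real_of_int 0" by simp_all
    then show False unfolding of_int_less_iff by simp
  qed
  then have "Gamma (- \<gamma> / 2 + 1) = (- \<gamma> / 2) * Gamma (- \<gamma> / 2)"
    by (rule Gamma_plus1)
  then have e: "Gamma (1 - \<gamma> / 2) = (- \<gamma> / 2) * Gamma (- \<gamma> / 2)" by (simp add: add.commute)
  have "Gamma (1 - \<gamma> / 2) > 0" using assms by (intro Gamma_real_pos) auto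
  then have "Gamma (1 - \<gamma> / 2) = \<bar>- \<gamma> / 2\<bar> * \<bar>Gamma (- \<gamma> / 2)\<bar>"
    unfolding e abs_mult[symmetric] by simp
  then have "Gamma (1 - \<gamma> / 2) = \<gamma> / 2 * \<bar>Gamma (- \<gamma> / 2)\<bar>" using assms by simp
  then show ?thesis using assms by (simp only: mult.assoc[symmetric]) simp
qed

text \<open>The power of \<open>norm y\<close> is a mixture of Gaussians. Tonelli brings the
  \<open>y\<close> integral inside, where the Fourier transform of a Gaussian is explicit, and an
  integral of \<open>1 - exp (- c / s)\<close> against a power of \<open>s\<close> remains.
  \<open>riesz_const\<close> is the normalisation that cancels all Gamma factors.\<close>

lemma riesz_levy_khintchine:
  fixes \<xi> :: "'a::euclidean_space" and \<gamma> :: real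
  assumes \<gamma>: "0 < \<gamma>" "\<gamma> < 2"
  shows "(\<integral>\<^sup>+y. ennreal (riesz_const DIM('a) (- \<gamma>) / norm y powr (real DIM('a) + \<gamma>) * (1 - cos (\<xi> \<bullet> y))) \<partial>lborel)
       = ennreal (norm \<xi> powr \<gamma>)"
proof -
  define d where "d = real DIM('a)"
  \<comment> \<open>Half of the exponent, because the Gaussians depend on the square of
    \<open>norm y\<close>.\<close>
  define k where "k = (d + \<gamma>) / 2"
  have k2: "2 * k = d + \<gamma>" by (simp add: k_def)
  have d: "d > 0" by (simp add: d_def)
  have k: "k > 0" using d \<gamma> by (simp add: k_def)
  define A where "A = riesz_const DIM('a) (- \<gamma>)"
  have A: "A = Gamma k / (2 powr (- \<gamma>) * pi powr (d / 2) * ((2 / \<gamma>) * Gamma (1 - \<gamma> / 2)))"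
    unfolding A_def riesz_const_def abs_Gamma_negative_half[OF \<gamma>] by (simp add: k_def d_def)
  have G: "Gamma (1 - \<gamma> / 2) > 0" "Gamma k > 0" using \<gamma> k by (auto intro!: Gamma_real_pos)
  have A0: "A > 0" unfolding A using G \<gamma> by simp
  have "(\<integral>\<^sup>+y. ennreal (A / norm y powr (d + \<gamma>) * (1 - cos (\<xi> \<bullet> y))) \<partial>lborel) =
     (\<integral>\<^sup>+y. (\<integral>\<^sup>+s. ennreal (A / Gamma k * (indicator {0<..} s * s powr (k - 1) * exp (- s * (norm y)\<^sup>2) * (1 - cos (\<xi> \<bullet> y)))) \<partial>lborel) \<partial>lborel)"
  proof (rule nn_integral_cong)
    fix y :: 'a
    show "ennreal (A / norm y powr (d + \<gamma>) * (1 - cos (\<xi> \<bullet> y))) =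
      (\<integral>\<^sup>+s. ennreal (A / Gamma k * (indicator {0<..} s * s powr (k - 1) * exp (- s * (norm y)\<^sup>2) * (1 - cos (\<xi> \<bullet> y)))) \<partial>lborel)"
    proof (cases "y = 0")
      case False
      have "(\<integral>\<^sup>+s. ennreal (A / Gamma k * (indicator {0<..} s * s powr (k - 1) * exp (- s * (norm y)\<^sup>2) * (1 - cos (\<xi> \<bullet> y)))) \<partial>lborel) =
         (\<integral>\<^sup>+s. ennreal (A / Gamma k * (1 - cos (\<xi> \<bullet> y))) * ennreal (indicator {0<..} s * s powr (k - 1) * exp (- s * (norm y)\<^sup>2)) \<partial>lborel)"
        using A0 G by (intro nn_integral_cong) (subst ennreal_mult[symmetric], auto simp: mult_ac)
      also have "\<dots> = ennreal (A / Gamma k * (1 - cos (\<xi> \<bullet> y))) * ennreal (Gamma k * ((norm y)\<^sup>2) powr (- k))"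
        using False k by (subst nn_integral_cmult, simp, subst nn_integral_Gamma_scaled) auto
      also have "((norm y)\<^sup>2) powr (- k) = 1 / norm y powr (d + \<gamma>)"
      proof -
        have "((norm y)\<^sup>2) powr (- k) = (norm y powr 2) powr (- k)" using False by simp
        also have "\<dots> = norm y powr (- (d + \<gamma>))" unfolding powr_powr
          by (rule arg_cong[where f="\<lambda>u. norm y powr u"]) (simp only: mult_minus_right k2)
        finally show ?thesis by (simp only: powr_minus inverse_eq_divide)
      qed
      also have "ennreal (A / Gamma k * (1 - cos (\<xi> \<bullet> y))) * ennreal (Gamma k * (1 / norm y powr (d + \<gamma>))) =
          ennreal (A / norm y powr (d + \<gamma>) * (1 - cos (\<xi> \<bullet> y)))"
      proof -
        have "A / Gamma k * (1 - cos (\<xi> \<bullet> y)) * (Gamma k * (1 / norm y powr (d + \<gamma>))) =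
            A * (1 - cos (\<xi> \<bullet> y)) * (1 / norm y powr (d + \<gamma>)) * (Gamma k / Gamma k)"
          by (simp only: divide_inverse mult_ac)
        also have "Gamma k / Gamma k = 1" using G(2) by simp
        finally have "A / Gamma k * (1 - cos (\<xi> \<bullet> y)) * (Gamma k * (1 / norm y powr (d + \<gamma>))) =
            A / norm y powr (d + \<gamma>) * (1 - cos (\<xi> \<bullet> y))"
          by (simp only: divide_inverse mult_ac mult_1_left)
        moreover have "0 \<le> A / Gamma k * (1 - cos (\<xi> \<bullet> y))" "0 \<le> Gamma k * (1 / norm y powr (d + \<gamma>))"
          using A0 G(2) by (auto intro!: mult_nonneg_nonneg divide_nonneg_nonneg)
        ultimately show ?thesis by (simp only: ennreal_mult[symmetric])
      qed
      finally show ?thesis by (rule sym)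
    qed simp
  qed
  also have "\<dots> = (\<integral>\<^sup>+s. (\<integral>\<^sup>+y. ennreal (A / Gamma k * (indicator {0<..} s * s powr (k - 1) * exp (- s * (norm y)\<^sup>2) * (1 - cos (\<xi> \<bullet> y)))) \<partial>lborel) \<partial>lborel)"
    by (rule lborel_pair.Fubini'[symmetric]) measurable
  also have "\<dots> = (\<integral>\<^sup>+s. ennreal (A / Gamma k * pi powr (d / 2)) * ennreal (indicator {0<..} s * s powr (\<gamma> / 2 - 1) * (1 - exp (- ((norm \<xi>)\<^sup>2 / 4) / s))) \<partial>lborel)"
  proof (rule nn_integral_cong)
    fix s :: real
    show "(\<integral>\<^sup>+y. ennreal (A / Gamma k * (indicator {0<..} s * s powr (k - 1) * exp (- s * (norm y)\<^sup>2) * (1 - cos (\<xi> \<bullet> y)))) \<partial>lborel) =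
      ennreal (A / Gamma k * pi powr (d / 2)) * ennreal (indicator {0<..} s * s powr (\<gamma> / 2 - 1) * (1 - exp (- ((norm \<xi>)\<^sup>2 / 4) / s)))"
    proof (cases "s > 0")
      case True
      have "(\<integral>\<^sup>+y. ennreal (A / Gamma k * (indicator {0<..} s * s powr (k - 1) * exp (- s * (norm y)\<^sup>2) * (1 - cos (\<xi> \<bullet> y)))) \<partial>lborel) =
        (\<integral>\<^sup>+y. ennreal (A / Gamma k * s powr (k - 1)) * ennreal (exp (- s * (norm y)\<^sup>2) * (1 - cos (\<xi> \<bullet> y))) \<partial>lborel)"
        using True A0 G by (intro nn_integral_cong) (subst ennreal_mult[symmetric], auto simp: mult_ac)
      also have "\<dots> = ennreal (A / Gamma k * s powr (k - 1)) * ennreal (sqrt (pi / s) ^ DIM('a) * (1 - exp (- (norm \<xi>)\<^sup>2 / (4 * s))))"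
        using True by (subst nn_integral_cmult, simp, subst nn_integral_gaussian_one_minus_cos) auto
      also have "\<dots> = ennreal (A / Gamma k * s powr (k - 1) * (sqrt (pi / s) ^ DIM('a) * (1 - exp (- (norm \<xi>)\<^sup>2 / (4 * s)))))"
        using True A0 G by (subst ennreal_mult[symmetric]) (auto intro!: mult_nonneg_nonneg)
      also have "A / Gamma k * s powr (k - 1) * (sqrt (pi / s) ^ DIM('a) * (1 - exp (- (norm \<xi>)\<^sup>2 / (4 * s)))) =
         A / Gamma k * pi powr (d / 2) * (indicator {0<..} s * s powr (\<gamma> / 2 - 1) * (1 - exp (- ((norm \<xi>)\<^sup>2 / 4) / s)))"
      proof -
        have "s powr (k - 1) * sqrt (pi / s) ^ DIM('a) = pi powr (d / 2) * (s powr (k - 1) * s powr (- (d / 2)))"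
          using True by (simp add: sqrt_power_eq_powr powr_divide powr_minus d_def field_simps)
        also have "s powr (k - 1) * s powr (- (d / 2)) = s powr (\<gamma> / 2 - 1)"
          unfolding powr_add[symmetric] by (simp add: k_def add_divide_distrib)
        finally have e: "s powr (k - 1) * sqrt (pi / s) ^ DIM('a) = pi powr (d / 2) * s powr (\<gamma> / 2 - 1)" .
        have "A / Gamma k * s powr (k - 1) * (sqrt (pi / s) ^ DIM('a) * (1 - exp (- (norm \<xi>)\<^sup>2 / (4 * s)))) =
           A / Gamma k * (s powr (k - 1) * sqrt (pi / s) ^ DIM('a)) * (1 - exp (- (norm \<xi>)\<^sup>2 / (4 * s)))"
          by (simp only: mult.assoc)
        then show ?thesis unfolding e using True by simp
      qed
      finally show ?thesis
        using True A0 G by (subst ennreal_mult[symmetric]) (auto intro!: mult_nonneg_nonneg)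
    qed simp
  qed
  also have "\<dots> = ennreal (A / Gamma k * pi powr (d / 2)) * ennreal (((norm \<xi>)\<^sup>2 / 4) powr (\<gamma> / 2) * (2 / \<gamma>) * Gamma (1 - \<gamma> / 2))"
    using \<gamma> by (subst nn_integral_cmult, simp, subst nn_integral_powr_one_minus_exp) auto
  also have "\<dots> = ennreal (A / Gamma k * pi powr (d / 2) * (((norm \<xi>)\<^sup>2 / 4) powr (\<gamma> / 2) * (2 / \<gamma>) * Gamma (1 - \<gamma> / 2)))"
    using A0 G \<gamma> by (subst ennreal_mult[symmetric]) auto
  also have "A / Gamma k * pi powr (d / 2) * (((norm \<xi>)\<^sup>2 / 4) powr (\<gamma> / 2) * (2 / \<gamma>) * Gamma (1 - \<gamma> / 2)) = norm \<xi> powr \<gamma>"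
  proof -
    have "((norm \<xi>)\<^sup>2 / 4) powr (\<gamma> / 2) = ((norm \<xi> / 2)\<^sup>2) powr (\<gamma> / 2)" by (simp add: power_divide)
    also have "\<dots> = (norm \<xi> / 2) powr \<gamma>"
    proof (cases "\<xi> = 0")
      case False
      then have "((norm \<xi> / 2)\<^sup>2) powr (\<gamma> / 2) = ((norm \<xi> / 2) powr 2) powr (\<gamma> / 2)" by simp
      then show ?thesis unfolding powr_powr by simp
    qed simp
    also have "\<dots> = norm \<xi> powr \<gamma> * 2 powr (- \<gamma>)"
      by (subst powr_divide) (simp_all add: powr_minus_divide)
    finally have e: "((norm \<xi>)\<^sup>2 / 4) powr (\<gamma> / 2) = norm \<xi> powr \<gamma> * 2 powr (- \<gamma>)" .
    have cancel: "c / (T * P * (w * g)) / c * P * (N * T * w * g) = N"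
      if "c > 0" "T > 0" "P > 0" "w > 0" "g > 0" for c T P w g N :: real
      using that by (simp add: field_simps)
    show ?thesis unfolding e A by (rule cancel) (use G \<gamma> in auto)
  qed
  finally show ?thesis by (simp add: A_def d_def)
qed

lemma riesz_const_nonneg:
  assumes "0 < \<gamma>" shows "0 \<le> riesz_const d (- \<gamma>)"
proof -
  have "Gamma ((real d + \<gamma>) / 2) > 0" using assms by (intro Gamma_real_pos) auto
  then show ?thesis by (auto simp: riesz_const_def intro!: divide_nonneg_nonneg)
qed

section \<open>Levy exponents\<close>

text \<open>\<open>\<psi>\<close> is a symmetric characteristic exponent and \<open>n\<close> the
  density of its Levy measure. Linear growth from below makes
  \<open>exp (- t * \<psi> \<xi>)\<close> decay exponentially, so that the Fourier integrals
  converge; quadratic growth from above makes \<open>\<psi>\<close> an admissible polynomial weight.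
  The Levy-Khintchine formula is stated with the nonnegative integral, so that the integrability of
  \<open>n\<close> is a consequence and not an axiom.\<close>

locale levy_exponent =
  fixes \<psi> n :: "'a::euclidean_space \<Rightarrow> real" and C :: real
  assumes \<psi>_cont: "continuous_on UNIV \<psi>"
    and \<psi>_nonneg: "\<And>\<xi>. 0 \<le> \<psi> \<xi>"
    and \<psi>_lower: "\<And>\<xi>. norm \<xi> - 1 \<le> \<psi> \<xi>"
    and \<psi>_upper: "\<And>\<xi>. \<psi> \<xi> \<le> C * (1 + (norm \<xi>)\<^sup>2)"
    and n_meas [measurable]: "n \<in> borel_measurable borel"
    and n_nonneg: "\<And>y. 0 \<le> n y"
    and n_even: "\<And>y. n (- y) = n y"
    and levy_khintchine: "\<And>\<xi>. (\<integral>\<^sup>+y. ennreal (n y * (1 - cos (\<xi> \<bullet> y))) \<partial>lborel) = ennreal (\<psi> \<xi>)"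
begin

lemma \<psi>_meas [measurable]: "\<psi> \<in> borel_measurable borel"
  using \<psi>_cont by (rule borel_measurable_continuous_onI)

lemma \<psi>_even: "\<psi> (- \<xi>) = \<psi> \<xi>"
proof -
  have "ennreal (\<psi> (- \<xi>)) = ennreal (\<psi> \<xi>)"
    by (simp flip: levy_khintchine)
  then show ?thesis by (simp add: \<psi>_nonneg)
qed

lemma C_nonneg: "0 \<le> C"
  using \<psi>_upper[of 0] \<psi>_nonneg[of 0] by simp

text \<open>Half of the exponential decay absorbs the polynomial, by
  \<open>c * (1 + r) \<le> exp (c * (1 + r))\<close> raised to the power \<open>k\<close>; the other
  half is integrable.\<close>

lemma integrable_damped:
  fixes f :: "'a \<Rightarrow> 'b::{banach, second_countable_topology}"
  assumes t: "t > 0" and [measurable]: "f \<in> borel_measurable borel"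
    and bound: "\<And>\<xi>. norm (f \<xi>) \<le> B * (1 + norm \<xi>) ^ k"
  shows "integrable lborel (\<lambda>\<xi>. exp (- t * \<psi> \<xi>) *\<^sub>R f \<xi>)"
proof -
  \<comment> \<open>Any positive \<open>c\<close> with \<open>k * c \<le> t / 2\<close> serves; the
    1 added to \<open>k\<close> keeps the quotient meaningful for \<open>k = 0\<close>.\<close>
  define c where "c = t / (2 * (real k + 1))"
  have c: "c > 0" using t by (simp add: c_def)
  have B: "B \<ge> 0" using order.trans[OF norm_ge_zero bound[of 0]] by simp
  have int: "integrable lborel (\<lambda>\<xi>::'a. B * (exp (t + c * k) / c ^ k) * exp (- (t / 2) * norm \<xi>))"
    by (intro integrable_mult_right integrable_exp_minus_norm) (use t in simp)
  show ?thesis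
  proof (rule Bochner_Integration.integrable_bound[OF int])
    show "AE \<xi> in lborel. norm (exp (- t * \<psi> \<xi>) *\<^sub>R f \<xi>) \<le> norm (B * (exp (t + c * k) / c ^ k) * exp (- (t / 2) * norm \<xi>))"
    proof (rule AE_I2)
      fix \<xi> :: 'a
      let ?r = "norm \<xi>"
      have "c * (1 + ?r) \<le> exp (c * (1 + ?r))"
        using exp_ge_add_one_self[of "c * (1 + ?r)"] by linarith
      then have "(c * (1 + ?r)) ^ k \<le> exp (c * (1 + ?r)) ^ k"
        using c by (intro power_mono) auto
      also have "\<dots> = exp (real k * (c * (1 + ?r)))" by (simp add: exp_of_nat_mult)
      also have "\<dots> \<le> exp (c * k + t / 2 * ?r)"
      proof -
        have "real k * c \<le> t / 2" using t by (simp add: c_def field_simps)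
        then have "real k * c * ?r \<le> t / 2 * ?r" by (intro mult_right_mono) auto
        then show ?thesis by (simp add: algebra_simps)
      qed
      finally have 1: "(1 + ?r) ^ k \<le> exp (c * k + t / 2 * ?r) / c ^ k"
        unfolding power_mult_distrib using c by (simp add: pos_le_divide_eq mult.commute)
      have 2: "exp (- t * \<psi> \<xi>) \<le> exp (t - t * ?r)"
        using mult_left_mono[OF \<psi>_lower[of \<xi>], of t] t by (simp add: algebra_simps)
      have "norm (exp (- t * \<psi> \<xi>) *\<^sub>R f \<xi>) \<le> exp (t - t * ?r) * (B * (1 + ?r) ^ k)"
        unfolding norm_scaleR using 2 bound[of \<xi>] by (intro mult_mono) auto
      also have "\<dots> \<le> exp (t - t * ?r) * (B * (exp (c * k + t / 2 * ?r) / c ^ k))"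
        using 1 B by (intro mult_left_mono) auto
      also have "\<dots> = B / c ^ k * (exp (t - t * ?r) * exp (c * k + t / 2 * ?r))" by simp
      also have "exp (t - t * ?r) * exp (c * k + t / 2 * ?r) = exp (t + c * k) * exp (- (t / 2) * ?r)"
        unfolding exp_add[symmetric] by (simp add: algebra_simps)
      finally show "norm (exp (- t * \<psi> \<xi>) *\<^sub>R f \<xi>) \<le> norm (B * (exp (t + c * k) / c ^ k) * exp (- (t / 2) * norm \<xi>))"
        using B c by (simp add: abs_mult)
    qed
  qed measurable
qed

text \<open>The Levy-Khintchine formula is integrated against a Gaussian in \<open>\<xi>\<close>.
  The side with \<open>\<psi>\<close> is finite by quadratic growth; on the other side Tonelli
  produces a multiple of \<open>1 - exp (- (norm y)\<^sup>2 / 4)\<close>, which is comparable with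
  the weight in the claim.\<close>

lemma integrable_n_min: "integrable lborel (\<lambda>y. n y * min 1 ((norm y)\<^sup>2))"
proof -
  have e: "(1 + r) * exp (- r) \<le> 2 * exp (- (1 / 2) * r)" if "r \<ge> 0" for r :: real
  proof -
    have "1 + r \<le> 2 * (1 + r / 2)" using that by simp
    also have "\<dots> \<le> 2 * exp (r / 2)" by (intro mult_left_mono exp_ge_add_one_self) simp
    finally have "(1 + r) * exp (- r) \<le> 2 * exp (r / 2) * exp (- r)" by (intro mult_right_mono) auto
    also have "\<dots> = 2 * exp (- (1 / 2) * r)" by (simp add: mult.assoc flip: exp_add)
    finally show ?thesis .
  qed
  have G: "has_bochner_integral lborel (\<lambda>\<xi>::'a. exp (- (1 / 2) * (norm \<xi>)\<^sup>2) * cos (0 \<bullet> \<xi>))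
      (sqrt (pi / (1 / 2)) ^ DIM('a) * exp (- (norm (0::'a))\<^sup>2 / (4 * (1 / 2))))"
    by (rule gaussian_fourier) simp
  then have G': "integrable lborel (\<lambda>\<xi>::'a. exp (- (1 / 2) * (norm \<xi>)\<^sup>2))"
    by (simp add: has_bochner_integral_iff)
  let ?I = "\<integral>\<^sup>+\<xi>. ennreal (exp (- 1 * (norm \<xi>)\<^sup>2) * \<psi> \<xi>) \<partial>lborel"
  have "?I \<le> (\<integral>\<^sup>+\<xi>. ennreal (2 * C * exp (- (1 / 2) * (norm \<xi>)\<^sup>2)) \<partial>(lborel :: 'a measure))"
  proof (intro nn_integral_mono ennreal_leI)
    fix \<xi> :: 'a
    have "exp (- 1 * (norm \<xi>)\<^sup>2) * \<psi> \<xi> \<le> exp (- 1 * (norm \<xi>)\<^sup>2) * (C * (1 + (norm \<xi>)\<^sup>2))"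
      by (intro mult_left_mono \<psi>_upper) auto
    also have "\<dots> = C * ((1 + (norm \<xi>)\<^sup>2) * exp (- (norm \<xi>)\<^sup>2))" by simp
    also have "\<dots> \<le> C * (2 * exp (- (1 / 2) * (norm \<xi>)\<^sup>2))"
      by (intro mult_left_mono e C_nonneg) auto
    finally show "exp (- 1 * (norm \<xi>)\<^sup>2) * \<psi> \<xi> \<le> 2 * C * exp (- (1 / 2) * (norm \<xi>)\<^sup>2)" by simp
  qed
  also have "\<dots> < \<infinity>"
    using integrable_mult_right[OF G', of "2 * C"] C_nonneg
    by (subst nn_integral_eq_integral) auto
  finally have I: "?I < \<infinity>" .
  have "?I = (\<integral>\<^sup>+\<xi>. (\<integral>\<^sup>+y. ennreal (exp (- 1 * (norm \<xi>)\<^sup>2) * (n y * (1 - cos (\<xi> \<bullet> y)))) \<partial>lborel) \<partial>lborel)"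
  proof (rule nn_integral_cong)
    fix \<xi> :: 'a
    have "ennreal (exp (- 1 * (norm \<xi>)\<^sup>2) * \<psi> \<xi>) = ennreal (exp (- 1 * (norm \<xi>)\<^sup>2)) * (\<integral>\<^sup>+y. ennreal (n y * (1 - cos (\<xi> \<bullet> y))) \<partial>lborel)"
      by (simp add: levy_khintchine ennreal_mult \<psi>_nonneg)
    also have "\<dots> = (\<integral>\<^sup>+y. ennreal (exp (- 1 * (norm \<xi>)\<^sup>2) * (n y * (1 - cos (\<xi> \<bullet> y)))) \<partial>lborel)"
      by (subst nn_integral_cmult[symmetric]) (auto simp: ennreal_mult n_nonneg)
    finally show "ennreal (exp (- 1 * (norm \<xi>)\<^sup>2) * \<psi> \<xi>) = \<dots>" .
  qed
  also have "\<dots> = (\<integral>\<^sup>+y. (\<integral>\<^sup>+\<xi>. ennreal (exp (- 1 * (norm \<xi>)\<^sup>2) * (n y * (1 - cos (\<xi> \<bullet> y)))) \<partial>lborel) \<partial>lborel)"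
    by (rule lborel_pair.Fubini') measurable
  also have "\<dots> = (\<integral>\<^sup>+y. ennreal (n y * (sqrt (pi / 1) ^ DIM('a) * (1 - exp (- (norm y)\<^sup>2 / (4 * 1))))) \<partial>lborel)"
  proof (rule nn_integral_cong)
    fix y :: 'a
    have "(\<integral>\<^sup>+\<xi>. ennreal (exp (- 1 * (norm \<xi>)\<^sup>2) * (n y * (1 - cos (\<xi> \<bullet> y)))) \<partial>lborel) =
       (\<integral>\<^sup>+\<xi>. ennreal (n y) * ennreal (exp (- 1 * (norm \<xi>)\<^sup>2) * (1 - cos (y \<bullet> \<xi>))) \<partial>lborel)"
      by (intro nn_integral_cong) (subst ennreal_mult[symmetric], auto simp: n_nonneg mult_ac inner_commute)
    also have "\<dots> = ennreal (n y * (sqrt (pi / 1) ^ DIM('a) * (1 - exp (- (norm y)\<^sup>2 / (4 * 1)))))"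
      by (subst nn_integral_cmult, simp, subst nn_integral_gaussian_one_minus_cos) (auto simp: ennreal_mult n_nonneg)
    finally show "(\<integral>\<^sup>+\<xi>. ennreal (exp (- 1 * (norm \<xi>)\<^sup>2) * (n y * (1 - cos (\<xi> \<bullet> y)))) \<partial>lborel) = \<dots>" .
  qed
  finally have J: "(\<integral>\<^sup>+y. ennreal (n y * (sqrt (pi / 1) ^ DIM('a) * (1 - exp (- (norm y)\<^sup>2 / (4 * 1))))) \<partial>lborel) < \<infinity>"
    using I by simp
  then have "integrable lborel (\<lambda>y. n y * (sqrt (pi / 1) ^ DIM('a) * (1 - exp (- (norm y)\<^sup>2 / (4 * 1)))))"
    by (intro integrableI_nonneg) (auto simp: n_nonneg)
  then have "integrable lborel (\<lambda>y. 8 / sqrt pi ^ DIM('a) * (n y * (sqrt (pi / 1) ^ DIM('a) * (1 - exp (- (norm y)\<^sup>2 / (4 * 1))))))"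
    by (rule integrable_mult_right)
  then show ?thesis
  proof (rule Bochner_Integration.integrable_bound)
    show "AE y in lborel. norm (n y * min 1 ((norm y)\<^sup>2)) \<le> norm (8 / sqrt pi ^ DIM('a) * (n y * (sqrt (pi / 1) ^ DIM('a) * (1 - exp (- (norm y)\<^sup>2 / (4 * 1))))))"
    proof (rule AE_I2)
      fix y :: 'a
      \<comment> \<open>On [0, 1] one has \<open>exp (- v) \<le> 1 - v / 2\<close>. With
        \<open>v = u / 4\<close> this gives \<open>u \<le> 8 * (1 - exp (- v))\<close>, whence the
        factor 8.\<close>
      define u where "u = min 1 ((norm y)\<^sup>2)"
      define v where "v = u / 4"
      have u: "0 \<le> u" "u \<le> 1" "u \<le> (norm y)\<^sup>2" by (auto simp: u_def)
      have v: "0 \<le> v" "v \<le> 1" using u by (auto simp: v_def)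
      have "1 \<le> (1 - v / 2) * (1 + v)"
        using v mult_left_mono[of v 1 v] by (simp add: algebra_simps)
      also have "\<dots> \<le> (1 - v / 2) * exp v"
        using v by (intro mult_left_mono exp_ge_add_one_self) auto
      finally have "exp (- v) \<le> 1 - v / 2" by (simp add: exp_minus field_simps)
      moreover have "exp (- (norm y)\<^sup>2 / 4) \<le> exp (- v)" using u by (simp add: v_def)
      ultimately have "exp (- (norm y)\<^sup>2 / 4) \<le> 1 - v / 2" by (rule order.trans[rotated])
      then have "u \<le> 8 * (1 - exp (- (norm y)\<^sup>2 / 4))" by (simp add: v_def)
      then have "n y * u \<le> n y * (8 * (1 - exp (- (norm y)\<^sup>2 / 4)))"
        by (intro mult_left_mono n_nonneg)
      then show "norm (n y * min 1 ((norm y)\<^sup>2)) \<le> norm (8 / sqrt pi ^ DIM('a) * (n y * (sqrt (pi / 1) ^ DIM('a) * (1 - exp (- (norm y)\<^sup>2 / (4 * 1))))))"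
        using u by (simp add: u_def[symmetric] abs_mult n_nonneg mult.left_commute[of 8] del: right_diff_distrib_numeral)
    qed
  qed simp
qed

lemma integrable_n_outside:
  assumes \<epsilon>: "\<epsilon> > 0"
  shows "integrable lborel (\<lambda>y. indicator {y. norm y > \<epsilon>} y * n y)"
proof -
  define m where "m = min 1 (\<epsilon>\<^sup>2)"
  have m: "m > 0" using \<epsilon> by (simp add: m_def)
  have "integrable lborel (\<lambda>y. 1 / m * (n y * min 1 ((norm y)\<^sup>2)))"
    by (intro integrable_mult_right integrable_n_min)
  then show ?thesis
  proof (rule Bochner_Integration.integrable_bound)
    show "AE y in lborel. norm (indicator {y. norm y > \<epsilon>} y * n y) \<le> norm (1 / m * (n y * min 1 ((norm y)\<^sup>2)))"
    proof (rule AE_I2)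
      fix y :: 'a
      have "m \<le> min 1 ((norm y)\<^sup>2)" if "norm y > \<epsilon>"
        using that \<epsilon> power_mono[of \<epsilon> "norm y" 2] by (auto simp: m_def intro: min.coboundedI2)
      then have "n y * m \<le> n y * min 1 ((norm y)\<^sup>2)" if "norm y > \<epsilon>"
        using that by (intro mult_left_mono n_nonneg) auto
      then show "norm (indicator {y. norm y > \<epsilon>} y * n y) \<le> norm (1 / m * (n y * min 1 ((norm y)\<^sup>2)))"
        using m by (auto simp: indicator_def n_nonneg abs_mult field_simps)
    qed
  qed simp
qed

lemma integrable_n_one_minus_cos: "integrable lborel (\<lambda>y. n y * (1 - cos (\<xi> \<bullet> y)))"
  using levy_khintchine[of \<xi>] by (intro integrableI_nonneg) (auto simp: n_nonneg)

lemma integral_n_one_minus_cos: "(LBINT y. n y * (1 - cos (\<xi> \<bullet> y))) = \<psi> \<xi>"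
  using levy_khintchine[of \<xi>] integrable_n_one_minus_cos[of \<xi>]
  by (subst (asm) nn_integral_eq_integral) (auto simp: n_nonneg \<psi>_nonneg)

end

section \<open>Positive inverse Fourier transforms\<close>

lemma integral_lborel_scale:
  fixes f :: "'a::euclidean_space \<Rightarrow> real"
  assumes c: "c > 0" and [measurable]: "f \<in> borel_measurable borel"
  shows "(LBINT x. f x) = c ^ DIM('a) * (LBINT x. f (t + c *\<^sub>R x))"
proof -
  have "(LBINT x. f x) = (LINT x|density (distr lborel borel (\<lambda>x. t + c *\<^sub>R x)) (\<lambda>_. ennreal (\<bar>c\<bar> ^ DIM('a))). f x)"
    using c lborel_affine[of c t] by simp
  also have "\<dots> = (LINT x|distr lborel borel (\<lambda>x. t + c *\<^sub>R x). c ^ DIM('a) * f x)"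
    using c by (subst integral_density) auto
  also have "\<dots> = (LBINT x. c ^ DIM('a) * f (t + c *\<^sub>R x))"
    by (rule integral_distr) auto
  finally show ?thesis by simp
qed

lemma integrable_lborel_tensor:
  fixes f :: "'a::euclidean_space \<Rightarrow> real" and g :: "'b::euclidean_space \<Rightarrow> real"
  assumes f: "integrable lborel f" and g: "integrable lborel g"
  shows "integrable (lborel \<Otimes>\<^sub>M lborel) (\<lambda>(x, y). f x * g y)"
proof (rule lborel_pair.Fubini_integrable)
  have [measurable]: "f \<in> borel_measurable borel" "g \<in> borel_measurable borel" using f g by auto
  show "(\<lambda>(x, y). f x * g y) \<in> borel_measurable (lborel \<Otimes>\<^sub>M lborel)" by measurable
  show "integrable lborel (\<lambda>x. LBINT y. norm (case (x, y) of (x, y) \<Rightarrow> f x * g y))"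
    using f by (simp add: abs_mult)
  show "AE x in lborel. integrable lborel (\<lambda>y. case (x, y) of (x, y) \<Rightarrow> f x * g y)"
    using g by simp
qed

lemma integrable_gaussian:
  assumes "\<delta> > 0" shows "integrable lborel (\<lambda>\<xi>::'a::euclidean_space. exp (- \<delta> * (norm \<xi>)\<^sup>2))"
  using gaussian_fourier[OF assms, of "0::'a"] by (simp add: has_bochner_integral_iff)

lemma integral_gaussian:
  assumes "\<delta> > 0" shows "(LBINT \<xi>. exp (- \<delta> * (norm (\<xi>::'a::euclidean_space))\<^sup>2)) = sqrt (pi / \<delta>) ^ DIM('a)"
  using gaussian_fourier[OF assms, of "0::'a"] by (simp add: has_bochner_integral_iff)

text \<open>Positivity of the inverse Fourier transform of \<open>\<phi>\<close>, tested after Gaussian damping so that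
  only boundedness of \<open>\<phi>\<close> is needed.\<close>

definition pos_transform :: "('a::euclidean_space \<Rightarrow> real) \<Rightarrow> bool" where
  "pos_transform \<phi> \<longleftrightarrow> \<phi> \<in> borel_measurable borel \<and> (\<exists>B. \<forall>\<xi>. \<bar>\<phi> \<xi>\<bar> \<le> B) \<and>
     (\<forall>\<delta>>0. \<forall>x. 0 \<le> (LBINT \<xi>. exp (- \<delta> * (norm \<xi>)\<^sup>2) * (\<phi> \<xi> * cos (x \<bullet> \<xi>))))"

lemma integrable_gaussian_mult:
  fixes f :: "'a::euclidean_space \<Rightarrow> real"
  assumes \<delta>: "\<delta> > 0" and [measurable]: "f \<in> borel_measurable borel" and B: "\<And>\<xi>. \<bar>f \<xi>\<bar> \<le> B"
  shows "integrable lborel (\<lambda>\<xi>. exp (- \<delta> * (norm \<xi>)\<^sup>2) * f \<xi>)"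
  by (rule Bochner_Integration.integrable_bound[OF integrable_mult_right[OF integrable_gaussian[OF \<delta>], of B]])
     (auto simp: abs_mult intro!: AE_I2 mult_mono[of _ _ "B :: real"] order.trans[OF B] simp: mult.commute[of _ "exp _"])

lemma pos_transformD:
  assumes "pos_transform \<phi>"
  shows "\<phi> \<in> borel_measurable borel" "\<exists>B. \<forall>\<xi>. \<bar>\<phi> \<xi>\<bar> \<le> B"
    "\<delta> > 0 \<Longrightarrow> 0 \<le> (LBINT \<xi>. exp (- \<delta> * (norm \<xi>)\<^sup>2) * (\<phi> \<xi> * cos (x \<bullet> \<xi>)))"
  using assms by (auto simp: pos_transform_def)

lemma pos_transform_integrable:
  assumes "pos_transform \<phi>" "\<delta> > 0"
  shows "integrable lborel (\<lambda>\<xi>. exp (- \<delta> * (norm \<xi>)\<^sup>2) * (\<phi> \<xi> * cos (x \<bullet> \<xi>)))"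
proof -
  have [measurable]: "\<phi> \<in> borel_measurable borel" using assms by (simp add: pos_transform_def)
  obtain B where B: "\<And>\<xi>. \<bar>\<phi> \<xi>\<bar> \<le> B" using assms by (auto simp: pos_transform_def)
  have "\<bar>\<phi> \<xi> * cos (x \<bullet> \<xi>)\<bar> \<le> B" for \<xi>
    using mult_mono[OF B[of \<xi>] abs_cos_le_one[of "x \<bullet> \<xi>"]] order.trans[OF abs_ge_zero B] by (simp add: abs_mult)
  then show ?thesis using assms(2) by (intro integrable_gaussian_mult) auto
qed

lemma pos_transform_const:
  assumes c: "c \<ge> 0"
  shows "pos_transform (\<lambda>_::'a::euclidean_space. c)"
proof -
  have "0 \<le> (LBINT \<xi>. exp (- \<delta> * (norm \<xi>)\<^sup>2) * (c * cos (x \<bullet> \<xi>)))" if \<delta>: "\<delta> > 0" for \<delta> and x :: 'a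
  proof -
    have "(LBINT \<xi>. exp (- \<delta> * (norm \<xi>)\<^sup>2) * (c * cos (x \<bullet> \<xi>))) = c * (LBINT \<xi>. exp (- \<delta> * (norm \<xi>)\<^sup>2) * cos (x \<bullet> \<xi>))"
      by (simp add: mult.left_commute[of _ c])
    also have "\<dots> \<ge> 0" using gaussian_fourier[OF \<delta>, of x] c \<delta> by (simp add: has_bochner_integral_iff)
    finally show ?thesis .
  qed
  then show ?thesis by (auto simp: pos_transform_def)
qed

lemma pos_transform_add:
  assumes "pos_transform f" "pos_transform g" shows "pos_transform (\<lambda>\<xi>. f \<xi> + g \<xi>)"
proof -
  obtain A B where AB: "\<And>\<xi>. \<bar>f \<xi>\<bar> \<le> A" "\<And>\<xi>. \<bar>g \<xi>\<bar> \<le> B" using assms by (auto simp: pos_transform_def)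
  have "\<bar>f \<xi> + g \<xi>\<bar> \<le> A + B" for \<xi> using AB[of \<xi>] by linarith
  moreover have "0 \<le> (LBINT \<xi>. exp (- \<delta> * (norm \<xi>)\<^sup>2) * ((f \<xi> + g \<xi>) * cos (x \<bullet> \<xi>)))" if "\<delta> > 0" for \<delta> x
    using pos_transformD(3)[OF assms(1) that, of x] pos_transformD(3)[OF assms(2) that, of x]
      pos_transform_integrable[OF assms(1) that, of x] pos_transform_integrable[OF assms(2) that, of x]
    by (simp add: distrib_left distrib_right)
  ultimately show ?thesis using assms by (auto simp: pos_transform_def)
qed

lemma pos_transform_sum:
  "(\<And>k. k < (N::nat) \<Longrightarrow> pos_transform (f k)) \<Longrightarrow> pos_transform (\<lambda>\<xi>. \<Sum>k<N. f k \<xi>)"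
  by (induction N) (auto intro: pos_transform_const pos_transform_add)

lemma pos_transform_cmult:
  assumes "pos_transform f" "c \<ge> 0" shows "pos_transform (\<lambda>\<xi>. c * f \<xi>)"
proof -
  obtain A where A: "\<And>\<xi>. \<bar>f \<xi>\<bar> \<le> A" using assms by (auto simp: pos_transform_def)
  have "\<bar>c * f \<xi>\<bar> \<le> c * A" for \<xi> using A[of \<xi>] assms(2) by (simp add: abs_mult mult_left_mono)
  moreover have "0 \<le> (LBINT \<xi>. exp (- \<delta> * (norm \<xi>)\<^sup>2) * (c * f \<xi> * cos (x \<bullet> \<xi>)))" if "\<delta> > 0" for \<delta> x
    using pos_transformD(3)[OF assms(1) that, of x] assms(2)
    by (simp add: mult.left_commute[of _ c] mult.assoc)
  ultimately show ?thesis using assms by (auto simp: pos_transform_def)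
qed

text \<open>The Gaussian weight times \<open>B\<close> dominates, so pointwise convergence under a
  uniform bound preserves positivity. This is the benefit of testing with damping.\<close>

lemma pos_transform_limit:
  assumes f: "\<And>k. pos_transform (f k)" and B: "\<And>k \<xi>. \<bar>f k \<xi>\<bar> \<le> B"
    and lim: "\<And>\<xi>. (\<lambda>k. f k \<xi>) \<longlonglongrightarrow> g \<xi>"
  shows "pos_transform g"
proof -
  have [measurable]: "f k \<in> borel_measurable borel" for k using f by (simp add: pos_transform_def)
  have [measurable]: "g \<in> borel_measurable borel"
    by (rule borel_measurable_LIMSEQ_real[where u=f]) (use lim in auto)
  have gB: "\<bar>g \<xi>\<bar> \<le> B" for \<xi>
    using tendsto_rabs[OF lim[of \<xi>]] by (rule LIMSEQ_le_const2) (use B in auto)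
  have "0 \<le> (LBINT \<xi>. exp (- \<delta> * (norm \<xi>)\<^sup>2) * (g \<xi> * cos (x \<bullet> \<xi>)))" if \<delta>: "\<delta> > 0" for \<delta> x
  proof (rule LIMSEQ_le_const)
    have "0 \<le> B" using order.trans[OF abs_ge_zero B] .
    show "(\<lambda>k. LBINT \<xi>. exp (- \<delta> * (norm \<xi>)\<^sup>2) * (f k \<xi> * cos (x \<bullet> \<xi>))) \<longlonglongrightarrow> (LBINT \<xi>. exp (- \<delta> * (norm \<xi>)\<^sup>2) * (g \<xi> * cos (x \<bullet> \<xi>)))"
    proof (rule integral_dominated_convergence)
      show "integrable lborel (\<lambda>\<xi>::'a. B * exp (- \<delta> * (norm \<xi>)\<^sup>2))"
        by (intro integrable_mult_right integrable_gaussian \<delta>)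
      show "AE \<xi> in lborel. (\<lambda>k. exp (- \<delta> * (norm \<xi>)\<^sup>2) * (f k \<xi> * cos (x \<bullet> \<xi>))) \<longlonglongrightarrow> exp (- \<delta> * (norm \<xi>)\<^sup>2) * (g \<xi> * cos (x \<bullet> \<xi>))"
        by (intro AE_I2 tendsto_intros lim)
      show "AE \<xi> in lborel. norm (exp (- \<delta> * (norm \<xi>)\<^sup>2) * (f k \<xi> * cos (x \<bullet> \<xi>))) \<le> B * exp (- \<delta> * (norm \<xi>)\<^sup>2)" for k
      proof (rule AE_I2)
        fix \<xi>
        have "\<bar>f k \<xi>\<bar> * \<bar>cos (x \<bullet> \<xi>)\<bar> \<le> B * 1"
          using \<open>0 \<le> B\<close> by (intro mult_mono B) auto
        then show "norm (exp (- \<delta> * (norm \<xi>)\<^sup>2) * (f k \<xi> * cos (x \<bullet> \<xi>))) \<le> B * exp (- \<delta> * (norm \<xi>)\<^sup>2)"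
          by (simp add: abs_mult mult.commute[of B])
      qed
    qed measurable
  qed (use pos_transformD(3)[OF f \<delta>] in auto)
  then show ?thesis using gB by (auto simp: pos_transform_def)
qed

text \<open>By the product formula for cosines, the new transform is the average of two shifts of
  the old one.\<close>

lemma pos_transform_mult_cos:
  assumes f: "pos_transform f" shows "pos_transform (\<lambda>\<xi>. f \<xi> * cos (y \<bullet> \<xi>))"
proof -
  obtain A where A: "\<And>\<xi>. \<bar>f \<xi>\<bar> \<le> A" using f by (auto simp: pos_transform_def)
  have [measurable]: "f \<in> borel_measurable borel" using f by (simp add: pos_transform_def)
  have "\<bar>f \<xi> * cos (y \<bullet> \<xi>)\<bar> \<le> A" for \<xi>
    using mult_mono[OF A[of \<xi>] abs_cos_le_one[of "y \<bullet> \<xi>"]] order.trans[OF abs_ge_zero A] by (simp add: abs_mult)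
  moreover have "0 \<le> (LBINT \<xi>. exp (- \<delta> * (norm \<xi>)\<^sup>2) * (f \<xi> * cos (y \<bullet> \<xi>) * cos (x \<bullet> \<xi>)))" if \<delta>: "\<delta> > 0" for \<delta> x
  proof -
    have "exp (- \<delta> * (norm \<xi>)\<^sup>2) * (f \<xi> * cos (y \<bullet> \<xi>) * cos (x \<bullet> \<xi>)) =
      (exp (- \<delta> * (norm \<xi>)\<^sup>2) * (f \<xi> * cos ((y - x) \<bullet> \<xi>)) + exp (- \<delta> * (norm \<xi>)\<^sup>2) * (f \<xi> * cos ((y + x) \<bullet> \<xi>))) / 2" for \<xi>
      by (simp add: inner_diff_left inner_add_left cos_add cos_diff algebra_simps)
    note eq = this
    show ?thesis unfolding eq
      using pos_transformD(3)[OF f \<delta>, of "y - x"] pos_transformD(3)[OF f \<delta>, of "y + x"]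
        pos_transform_integrable[OF f \<delta>, of "y - x"] pos_transform_integrable[OF f \<delta>, of "y + x"]
      by simp
  qed
  ultimately show ?thesis by (auto simp: pos_transform_def)
qed

text \<open>Multiplication by a cosine, averaged over its frequency with a finite nonnegative
  weight; the Gaussian damping justifies Fubini.\<close>

lemma pos_transform_mult_mixture:
  fixes f m :: "'a::euclidean_space \<Rightarrow> real"
  assumes f: "pos_transform f" and m: "integrable lborel m" "\<And>y. 0 \<le> m y"
  shows "pos_transform (\<lambda>\<xi>. f \<xi> * (LBINT y. m y * cos (\<xi> \<bullet> y)))"
proof -
  obtain A where A: "\<And>\<xi>. \<bar>f \<xi>\<bar> \<le> A" using f by (auto simp: pos_transform_def)
  have [measurable]: "f \<in> borel_measurable borel" using f by (simp add: pos_transform_def)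
  have [measurable]: "m \<in> borel_measurable borel" using m by auto
  have A0: "0 \<le> A" using order.trans[OF abs_ge_zero A] .
  have M: "\<bar>LBINT y. m y * cos (\<xi> \<bullet> y)\<bar> \<le> (LBINT y. m y)" for \<xi>
  proof -
    have "\<bar>LBINT y. m y * cos (\<xi> \<bullet> y)\<bar> \<le> (LBINT y. \<bar>m y * cos (\<xi> \<bullet> y)\<bar>)"
      by (rule integral_abs_bound)
    also have "\<dots> \<le> (LBINT y. m y)"
      by (rule integral_mono')
         (use m in \<open>auto simp: abs_mult intro!: mult_right_le_one_le\<close>)
    finally show ?thesis .
  qed
  have "\<bar>f \<xi> * (LBINT y. m y * cos (\<xi> \<bullet> y))\<bar> \<le> A * (LBINT y. m y)" for \<xi>
    unfolding abs_mult by (intro mult_mono A M A0) auto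
  moreover have "0 \<le> (LBINT \<xi>. exp (- \<delta> * (norm \<xi>)\<^sup>2) * (f \<xi> * (LBINT y. m y * cos (\<xi> \<bullet> y)) * cos (x \<bullet> \<xi>)))" if \<delta>: "\<delta> > 0" for \<delta> x
  proof -
    let ?h = "\<lambda>\<xi> y. exp (- \<delta> * (norm \<xi>)\<^sup>2) * (f \<xi> * cos (y \<bullet> \<xi>) * cos (x \<bullet> \<xi>)) * m y"
    have int: "integrable (lborel \<Otimes>\<^sub>M lborel) (\<lambda>(\<xi>, y). ?h \<xi> y)"
    proof (rule Bochner_Integration.integrable_bound)
      show "integrable (lborel \<Otimes>\<^sub>M lborel) (\<lambda>(\<xi>::'a, y). (A * exp (- \<delta> * (norm \<xi>)\<^sup>2)) * m y)"
        by (intro integrable_lborel_tensor integrable_mult_right integrable_gaussian \<delta> m)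
      show "AE z in lborel \<Otimes>\<^sub>M lborel. norm (case z of (\<xi>, y) \<Rightarrow> ?h \<xi> y) \<le> norm (case z of (\<xi>::'a, y) \<Rightarrow> (A * exp (- \<delta> * (norm \<xi>)\<^sup>2)) * m y)"
      proof (rule AE_I2, safe)
        fix \<xi> y :: 'a
        have "\<bar>f \<xi>\<bar> * \<bar>cos (y \<bullet> \<xi>)\<bar> * \<bar>cos (x \<bullet> \<xi>)\<bar> \<le> A * 1 * 1"
          using A0 by (intro mult_mono A) auto
        then have "exp (- \<delta> * (norm \<xi>)\<^sup>2) * (\<bar>f \<xi>\<bar> * \<bar>cos (y \<bullet> \<xi>)\<bar> * \<bar>cos (x \<bullet> \<xi>)\<bar>) * m y \<le> exp (- \<delta> * (norm \<xi>)\<^sup>2) * A * m y"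
          using m by (intro mult_right_mono mult_left_mono) auto
        then show "norm (?h \<xi> y) \<le> norm ((A * exp (- \<delta> * (norm \<xi>)\<^sup>2)) * m y)"
          using m A0 by (simp add: abs_mult mult.commute[of A])
      qed
    qed measurable
    have "(LBINT \<xi>. exp (- \<delta> * (norm \<xi>)\<^sup>2) * (f \<xi> * (LBINT y. m y * cos (\<xi> \<bullet> y)) * cos (x \<bullet> \<xi>))) =
        (LBINT \<xi>. (LBINT y. ?h \<xi> y))"
    proof (intro Bochner_Integration.integral_cong refl)
      fix \<xi> :: 'a
      have "(LBINT y. ?h \<xi> y) = (LBINT y. (exp (- \<delta> * (norm \<xi>)\<^sup>2) * f \<xi> * cos (x \<bullet> \<xi>)) * (m y * cos (\<xi> \<bullet> y)))"
        by (intro Bochner_Integration.integral_cong refl) (simp add: mult_ac inner_commute)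
      also have "\<dots> = (exp (- \<delta> * (norm \<xi>)\<^sup>2) * f \<xi> * cos (x \<bullet> \<xi>)) * (LBINT y. m y * cos (\<xi> \<bullet> y))"
        by (rule integral_mult_right_zero)
      finally show "exp (- \<delta> * (norm \<xi>)\<^sup>2) * (f \<xi> * (LBINT y. m y * cos (\<xi> \<bullet> y)) * cos (x \<bullet> \<xi>)) = (LBINT y. ?h \<xi> y)"
        by (simp only: mult_ac)
    qed
    also have "\<dots> = (LBINT y. (LBINT \<xi>. ?h \<xi> y))"
      using lborel_pair.Fubini_integral[OF int] by simp
    also have "\<dots> = (LBINT y. (LBINT \<xi>. exp (- \<delta> * (norm \<xi>)\<^sup>2) * (f \<xi> * cos (y \<bullet> \<xi>) * cos (x \<bullet> \<xi>))) * m y)"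
      by simp
    also have "\<dots> \<ge> 0"
      by (intro Bochner_Integration.integral_nonneg mult_nonneg_nonneg m pos_transformD(3)[OF pos_transform_mult_cos[OF f] \<delta>])
    finally show ?thesis .
  qed
  moreover have "(\<lambda>\<xi>. f \<xi> * (LBINT y. m y * cos (\<xi> \<bullet> y))) \<in> borel_measurable borel"
    by measurable
  ultimately show ?thesis by (auto simp: pos_transform_def)
qed

section \<open>The kernel: positivity, unit mass, Fourier transform\<close>

context levy_exponent
begin

text \<open>The transition density of the Levy process with exponent \<open>\<psi>\<close>. As
  \<open>\<psi>\<close> is even, the inverse Fourier transform reduces to its cosine part.\<close>

definition K :: "real \<Rightarrow> 'a \<Rightarrow> real" where
  "K t x = (if t > 0 then 1 / (2 * pi) ^ DIM('a) * (LBINT \<xi>. exp (- t * \<psi> \<xi>) * cos (x \<bullet> \<xi>)) else 0)"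

text \<open>The expression obtained from \<open>K\<close> by differentiating under the integral sign
  in space; \<open>GDERIV_K\<close> confirms that it is the gradient.\<close>

definition G :: "real \<Rightarrow> 'a \<Rightarrow> 'a" where
  "G t x = (if t > 0 then (- 1 / (2 * pi) ^ DIM('a)) *\<^sub>R (LBINT \<xi>. exp (- t * \<psi> \<xi>) *\<^sub>R (sin (x \<bullet> \<xi>) *\<^sub>R \<xi>)) else 0)"

text \<open>Compound Poisson approximation. Removing a ball around the origin leaves a finite
  measure with mass \<open>L j\<close> and cosine transform \<open>\<nu> j\<close>, and
  \<open>exp (t * \<nu> j \<xi>)\<close> is a power series in \<open>\<nu> j\<close> with
  nonnegative coefficients. As the ball shrinks, \<open>L j - \<nu> j \<xi>\<close> tends to
  \<open>\<psi> \<xi>\<close> by the Levy-Khintchine formula.\<close>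

lemma pos_transform_exp:
  assumes t: "t > 0" shows "pos_transform (\<lambda>\<xi>. exp (- t * \<psi> \<xi>))"
proof -
  define m where "m j y = indicator {y. norm y > 1 / real (Suc j)} y * n y" for j y
  have m_int: "integrable lborel (m j)" for j
    unfolding m_def by (rule integrable_n_outside) simp
  have m_pos: "0 \<le> m j y" "m j y \<le> n y" for j y by (auto simp: m_def n_nonneg indicator_def)
  have [measurable]: "m j \<in> borel_measurable borel" for j using m_int by auto
  define \<nu> where "\<nu> j \<xi> = (LBINT y. m j y * cos (\<xi> \<bullet> y))" for j \<xi>
  define L where "L j = (LBINT y. m j y)" for j
  have m_cos: "integrable lborel (\<lambda>y. m j y * cos (\<xi> \<bullet> y))" for j \<xi>
    by (rule Bochner_Integration.integrable_bound[OF m_int[of j]])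
       (auto intro!: AE_I2 simp: abs_mult m_pos mult_right_le_one_le)
  have \<nu>_bound: "\<bar>\<nu> j \<xi>\<bar> \<le> L j" for j \<xi>
  proof -
    have "\<bar>\<nu> j \<xi>\<bar> \<le> (LBINT y. \<bar>m j y * cos (\<xi> \<bullet> y)\<bar>)" unfolding \<nu>_def by (rule integral_abs_bound)
    also have "\<dots> \<le> L j" unfolding L_def
      by (rule integral_mono') (auto simp: m_int abs_mult m_pos intro!: mult_right_le_one_le)
    finally show ?thesis .
  qed
  have L0: "0 \<le> L j" for j unfolding L_def by (intro Bochner_Integration.integral_nonneg m_pos)
  have pow: "pos_transform (\<lambda>\<xi>. \<nu> j \<xi> ^ k)" for j k
  proof (induction k)
    case 0 then show ?case using pos_transform_const[of 1] by simp
  next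
    case (Suc k)
    have "pos_transform (\<lambda>\<xi>. \<nu> j \<xi> ^ k * (LBINT y. m j y * cos (\<xi> \<bullet> y)))"
      by (intro pos_transform_mult_mixture Suc m_int m_pos)
    then show ?case by (simp add: \<nu>_def mult.commute)
  qed
  have ex: "pos_transform (\<lambda>\<xi>. exp (t * \<nu> j \<xi>))" for j
  proof (rule pos_transform_limit)
    show "pos_transform (\<lambda>\<xi>. \<Sum>k<N. t ^ k / fact k * \<nu> j \<xi> ^ k)" for N
      using t by (intro pos_transform_sum pos_transform_cmult pow) auto
    show "\<bar>\<Sum>k<N. t ^ k / fact k * \<nu> j \<xi> ^ k\<bar> \<le> exp (t * L j)" for N \<xi>
    proof -
      have "\<bar>\<Sum>k<N. t ^ k / fact k * \<nu> j \<xi> ^ k\<bar> \<le> (\<Sum>k<N. \<bar>t ^ k / fact k * \<nu> j \<xi> ^ k\<bar>)" by (rule sum_abs)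
      also have "\<dots> \<le> (\<Sum>k<N. (t * L j) ^ k /\<^sub>R fact k)"
      proof (rule sum_mono)
        fix k
        have "\<bar>t ^ k / fact k * \<nu> j \<xi> ^ k\<bar> = t ^ k / fact k * \<bar>\<nu> j \<xi>\<bar> ^ k"
          using t by (simp add: abs_mult power_abs)
        also have "\<dots> \<le> t ^ k / fact k * L j ^ k"
          using t \<nu>_bound by (intro mult_left_mono power_mono) auto
        finally show "\<bar>t ^ k / fact k * \<nu> j \<xi> ^ k\<bar> \<le> (t * L j) ^ k /\<^sub>R fact k"
          by (simp add: power_mult_distrib divide_inverse mult_ac)
      qed
      also have "\<dots> \<le> exp (t * L j)"
        unfolding exp_def using t L0 summable_exp_generic[of "t * L j"] by (intro sum_le_suminf) auto
      finally show ?thesis .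
    qed
    show "(\<lambda>N. \<Sum>k<N. t ^ k / fact k * \<nu> j \<xi> ^ k) \<longlonglongrightarrow> exp (t * \<nu> j \<xi>)" for \<xi>
      using exp_converges[of "t * \<nu> j \<xi>"]
      by (simp add: sums_def power_mult_distrib divide_inverse mult_ac)
  qed
  show ?thesis
  proof (rule pos_transform_limit)
    show "pos_transform (\<lambda>\<xi>. exp (- t * L j) * exp (t * \<nu> j \<xi>))" for j
      by (intro pos_transform_cmult ex) simp
    show "\<bar>exp (- t * L j) * exp (t * \<nu> j \<xi>)\<bar> \<le> 1" for j \<xi>
      using t \<nu>_bound[of j \<xi>] by (simp add: abs_mult mult_left_mono flip: exp_add)
    fix \<xi>
    have "(\<lambda>j. LBINT y. m j y * (1 - cos (\<xi> \<bullet> y))) \<longlonglongrightarrow> (LBINT y. n y * (1 - cos (\<xi> \<bullet> y)))"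
    proof (rule integral_dominated_convergence[OF _ _ integrable_n_one_minus_cos[of \<xi>]])
      show "AE y in lborel. (\<lambda>j. m j y * (1 - cos (\<xi> \<bullet> y))) \<longlonglongrightarrow> n y * (1 - cos (\<xi> \<bullet> y))"
      proof (rule AE_I2)
        fix y :: 'a
        show "(\<lambda>j. m j y * (1 - cos (\<xi> \<bullet> y))) \<longlonglongrightarrow> n y * (1 - cos (\<xi> \<bullet> y))"
        proof (cases "y = 0")
          case False
          have "(\<lambda>j. 1 / real (Suc j)) \<longlonglongrightarrow> 0" by (rule LIMSEQ_Suc[OF lim_1_over_n])
          then have "eventually (\<lambda>j. 1 / real (Suc j) < norm y) sequentially"
            using False by (intro order_tendstoD) auto
          then have "eventually (\<lambda>j. m j y * (1 - cos (\<xi> \<bullet> y)) = n y * (1 - cos (\<xi> \<bullet> y))) sequentially"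
            by eventually_elim (simp add: m_def)
          then show ?thesis by (rule tendsto_eventually)
        qed simp
      qed
      show "AE y in lborel. norm (m j y * (1 - cos (\<xi> \<bullet> y))) \<le> n y * (1 - cos (\<xi> \<bullet> y))" for j
        by (intro AE_I2) (auto simp: abs_mult m_pos intro!: mult_right_mono)
    qed measurable
    moreover have "(LBINT y. m j y * (1 - cos (\<xi> \<bullet> y))) = L j - \<nu> j \<xi>" for j
      using m_cos m_int by (simp add: L_def \<nu>_def right_diff_distrib)
    ultimately have "(\<lambda>j. L j - \<nu> j \<xi>) \<longlonglongrightarrow> \<psi> \<xi>"
      by (simp only: integral_n_one_minus_cos)
    then have "(\<lambda>j. exp (- t * (L j - \<nu> j \<xi>))) \<longlonglongrightarrow> exp (- t * \<psi> \<xi>)"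
      by (intro tendsto_intros)
    also have "(\<lambda>j. exp (- t * (L j - \<nu> j \<xi>))) = (\<lambda>j. exp (- t * L j) * exp (t * \<nu> j \<xi>))"
      by (simp add: right_diff_distrib flip: exp_add)
    finally show "(\<lambda>j. exp (- t * L j) * exp (t * \<nu> j \<xi>)) \<longlonglongrightarrow> exp (- t * \<psi> \<xi>)" .
  qed
qed

lemma integrable_exp_cos:
  assumes "t > 0" shows "integrable lborel (\<lambda>\<xi>. exp (- t * \<psi> \<xi>) * cos (x \<bullet> \<xi>))"
  using integrable_damped[OF assms, of "\<lambda>\<xi>. cos (x \<bullet> \<xi>)" 1 0] by simp

lemma integrable_exp: assumes "t > 0" shows "integrable lborel (\<lambda>\<xi>. exp (- t * \<psi> \<xi>))"
  using integrable_exp_cos[OF assms, of 0] by simp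

text \<open>Positivity is known for the damped integrals; since
  \<open>exp (- t * \<psi> \<xi>)\<close> is itself integrable, dominated convergence removes the
  damping.\<close>

lemma K_nonneg: "0 \<le> K t x"
proof (cases "t > 0")
  case t: True
  have "0 \<le> (LBINT \<xi>. exp (- t * \<psi> \<xi>) * cos (x \<bullet> \<xi>))"
  proof (rule LIMSEQ_le_const)
    show "(\<lambda>j. LBINT \<xi>. exp (- (1 / real (Suc j)) * (norm \<xi>)\<^sup>2) * (exp (- t * \<psi> \<xi>) * cos (x \<bullet> \<xi>))) \<longlonglongrightarrow> (LBINT \<xi>. exp (- t * \<psi> \<xi>) * cos (x \<bullet> \<xi>))"
    proof (rule integral_dominated_convergence[OF _ _ integrable_exp[OF t]])
      have "(\<lambda>j. 1 / real (Suc j)) \<longlonglongrightarrow> 0" by (rule LIMSEQ_Suc[OF lim_1_over_n])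
      then have "(\<lambda>j. exp (- (1 / real (Suc j)) * (norm \<xi>)\<^sup>2) * (exp (- t * \<psi> \<xi>) * cos (x \<bullet> \<xi>))) \<longlonglongrightarrow> exp (- 0 * (norm \<xi>)\<^sup>2) * (exp (- t * \<psi> \<xi>) * cos (x \<bullet> \<xi>))" for \<xi>
        by (intro tendsto_intros)
      then show "AE \<xi> in lborel. (\<lambda>j. exp (- (1 / real (Suc j)) * (norm \<xi>)\<^sup>2) * (exp (- t * \<psi> \<xi>) * cos (x \<bullet> \<xi>))) \<longlonglongrightarrow> exp (- t * \<psi> \<xi>) * cos (x \<bullet> \<xi>)"
        by simp
      show "AE \<xi> in lborel. norm (exp (- (1 / real (Suc j)) * (norm \<xi>)\<^sup>2) * (exp (- t * \<psi> \<xi>) * cos (x \<bullet> \<xi>))) \<le> exp (- t * \<psi> \<xi>)" for j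
      proof (rule AE_I2)
        fix \<xi> :: 'a
        have "exp (- (1 / real (Suc j)) * (norm \<xi>)\<^sup>2) * (exp (- t * \<psi> \<xi>) * \<bar>cos (x \<bullet> \<xi>)\<bar>) \<le> 1 * (exp (- t * \<psi> \<xi>) * 1)"
          by (intro mult_mono) auto
        then show "norm (exp (- (1 / real (Suc j)) * (norm \<xi>)\<^sup>2) * (exp (- t * \<psi> \<xi>) * cos (x \<bullet> \<xi>))) \<le> exp (- t * \<psi> \<xi>)"
          by (simp add: abs_mult)
      qed
    qed measurable
  next
    show "\<exists>N. \<forall>j\<ge>N. 0 \<le> (LBINT \<xi>. exp (- (1 / real (Suc j)) * (norm \<xi>)\<^sup>2) * (exp (- t * \<psi> \<xi>) * cos (x \<bullet> \<xi>)))"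
      by (intro exI allI impI pos_transformD(3)[OF pos_transform_exp[OF t]]) simp
  qed
  then show ?thesis using t by (simp add: K_def)
qed (simp add: K_def)

lemma K_even: "K t (- x) = K t x"
  by (simp add: K_def)

lemma K_meas [measurable]: "(\<lambda>z. K (fst z) (snd z)) \<in> borel_measurable borel"
  unfolding borel_prod[symmetric] K_def by measurable

lemma G_meas [measurable]: "(\<lambda>z. G (fst z) (snd z)) \<in> borel_measurable borel"
  unfolding borel_prod[symmetric] G_def by measurable

lemma K_meas' [measurable (raw)]:
  assumes "f \<in> borel_measurable M" "g \<in> borel_measurable M"
  shows "(\<lambda>x. K (f x) (g x)) \<in> borel_measurable M"
  using measurable_compose[OF borel_measurable_Pair[OF assms] K_meas] by simp

lemma G_meas' [measurable (raw)]:
  assumes "f \<in> borel_measurable M" "g \<in> borel_measurable M"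
  shows "(\<lambda>x. G (f x) (g x)) \<in> borel_measurable M"
  using measurable_compose[OF borel_measurable_Pair[OF assms] G_meas] by simp

text \<open>\<open>K t\<close> is not yet known to be integrable, so the inversion is carried out
  under a Gaussian weight. Fubini moves the weight to the frequency side as a Gaussian of width
  \<open>c\<close> around \<open>\<xi>\<close>; the factor \<open>c\<^sup>2 / 4\<close> is chosen
  such that the substitution \<open>\<eta> = \<xi> + c w\<close> leaves exactly
  \<open>exp (- (norm w)\<^sup>2)\<close>.\<close>

lemma K_gaussian_damped:
  assumes t: "t > 0" and c: "c > 0"
  shows "has_bochner_integral lborel (\<lambda>x. K t x * (exp (- (c\<^sup>2 / 4) * (norm x)\<^sup>2) * cos (\<xi> \<bullet> x)))
     (1 / sqrt pi ^ DIM('a) * (LBINT w. exp (- t * \<psi> (\<xi> + c *\<^sub>R w)) * exp (- (norm w)\<^sup>2)))"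
proof -
  define \<epsilon> where "\<epsilon> = c\<^sup>2 / 4"
  have \<epsilon>: "\<epsilon> > 0" using c by (simp add: \<epsilon>_def)
  define g where "g z = sqrt (pi / \<epsilon>) ^ DIM('a) * exp (- (norm z)\<^sup>2 / (4 * \<epsilon>))" for z :: 'a
  have [measurable]: "g \<in> borel_measurable borel" unfolding g_def by measurable
  let ?h = "\<lambda>x \<eta>. exp (- \<epsilon> * (norm x)\<^sup>2) * cos (\<xi> \<bullet> x) * (exp (- t * \<psi> \<eta>) * cos (x \<bullet> \<eta>))"
  have int: "integrable (lborel \<Otimes>\<^sub>M lborel) (\<lambda>(x, \<eta>). ?h x \<eta>)"
  proof (rule Bochner_Integration.integrable_bound)
    show "integrable (lborel \<Otimes>\<^sub>M lborel) (\<lambda>(x::'a, \<eta>). exp (- \<epsilon> * (norm x)\<^sup>2) * exp (- t * \<psi> \<eta>))"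
      by (intro integrable_lborel_tensor integrable_gaussian \<epsilon> integrable_exp t)
    show "AE z in lborel \<Otimes>\<^sub>M lborel. norm (case z of (x, \<eta>) \<Rightarrow> ?h x \<eta>) \<le> norm (case z of (x::'a, \<eta>) \<Rightarrow> exp (- \<epsilon> * (norm x)\<^sup>2) * exp (- t * \<psi> \<eta>))"
    proof (rule AE_I2, safe)
      fix x \<eta> :: 'a
      have "exp (- \<epsilon> * (norm x)\<^sup>2) * \<bar>cos (\<xi> \<bullet> x)\<bar> * (exp (- t * \<psi> \<eta>) * \<bar>cos (x \<bullet> \<eta>)\<bar>) \<le> exp (- \<epsilon> * (norm x)\<^sup>2) * 1 * (exp (- t * \<psi> \<eta>) * 1)"
        by (intro mult_mono) auto
      then show "norm (?h x \<eta>) \<le> norm (exp (- \<epsilon> * (norm x)\<^sup>2) * exp (- t * \<psi> \<eta>))"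
        by (simp add: abs_mult)
    qed
  qed measurable
  have inner_x: "(LBINT \<eta>. ?h x \<eta>) = (2 * pi) ^ DIM('a) * (K t x * (exp (- \<epsilon> * (norm x)\<^sup>2) * cos (\<xi> \<bullet> x)))" for x
    using t by (simp add: K_def)
  have "integrable lborel (\<lambda>x. LBINT \<eta>. ?h x \<eta>)"
    using lborel_pair.integrable_fst'[OF int] by simp
  then have I: "integrable lborel (\<lambda>x. K t x * (exp (- \<epsilon> * (norm x)\<^sup>2) * cos (\<xi> \<bullet> x)))"
    unfolding inner_x by simp
  have inner_\<eta>: "(LBINT x. ?h x \<eta>) = exp (- t * \<psi> \<eta>) * ((g (\<eta> - \<xi>) + g (\<eta> + \<xi>)) / 2)" for \<eta>
  proof -
    have "has_bochner_integral lborel (\<lambda>x. (exp (- \<epsilon> * (norm x)\<^sup>2) * cos ((\<eta> - \<xi>) \<bullet> x) + exp (- \<epsilon> * (norm x)\<^sup>2) * cos ((\<eta> + \<xi>) \<bullet> x)) / 2)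
       ((g (\<eta> - \<xi>) + g (\<eta> + \<xi>)) / 2)"
      unfolding g_def by (intro has_bochner_integral_divide has_bochner_integral_add gaussian_fourier \<epsilon>)
    also have "(\<lambda>x. (exp (- \<epsilon> * (norm x)\<^sup>2) * cos ((\<eta> - \<xi>) \<bullet> x) + exp (- \<epsilon> * (norm x)\<^sup>2) * cos ((\<eta> + \<xi>) \<bullet> x)) / 2) =
      (\<lambda>x. exp (- \<epsilon> * (norm x)\<^sup>2) * (cos (\<xi> \<bullet> x) * cos (x \<bullet> \<eta>)))"
      by (rule ext) (simp add: inner_diff_left inner_add_left inner_commute[of \<eta>] cos_add cos_diff algebra_simps)
    finally have "(LBINT x. exp (- \<epsilon> * (norm x)\<^sup>2) * (cos (\<xi> \<bullet> x) * cos (x \<bullet> \<eta>))) = (g (\<eta> - \<xi>) + g (\<eta> + \<xi>)) / 2"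
      by (rule has_bochner_integral_integral_eq)
    moreover have "?h x \<eta> = exp (- t * \<psi> \<eta>) * (exp (- \<epsilon> * (norm x)\<^sup>2) * (cos (\<xi> \<bullet> x) * cos (x \<bullet> \<eta>)))" for x
      by (simp only: mult_ac)
    ultimately show ?thesis by (simp only: integral_mult_right_zero)
  qed
  have gb: "\<bar>g z\<bar> \<le> sqrt (pi / \<epsilon>) ^ DIM('a)" for z
    using \<epsilon> by (auto simp: g_def abs_mult intro!: mult_right_le_one_le)
  have Ig: "integrable lborel (\<lambda>\<eta>. exp (- t * \<psi> \<eta>) * g (\<eta> + z))" for z
    using integrable_damped[OF t, of "\<lambda>\<eta>. g (\<eta> + z)" "sqrt (pi / \<epsilon>) ^ DIM('a)" 0] gb by simp
  have "(2 * pi) ^ DIM('a) * (LBINT x. K t x * (exp (- \<epsilon> * (norm x)\<^sup>2) * cos (\<xi> \<bullet> x))) = (LBINT x. (LBINT \<eta>. ?h x \<eta>))"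
    unfolding inner_x by simp
  also have "\<dots> = (LBINT \<eta>. (LBINT x. ?h x \<eta>))"
    using lborel_pair.Fubini_integral[OF int] by simp
  also have "\<dots> = (LBINT \<eta>. (exp (- t * \<psi> \<eta>) * g (\<eta> + (- \<xi>)) + exp (- t * \<psi> \<eta>) * g (\<eta> + \<xi>)) / 2)"
    unfolding inner_\<eta> by (simp add: distrib_left)
  also have "\<dots> = ((LBINT \<eta>. exp (- t * \<psi> \<eta>) * g (\<eta> + (- \<xi>))) + (LBINT \<eta>. exp (- t * \<psi> \<eta>) * g (\<eta> + \<xi>))) / 2"
    using Ig[of "- \<xi>"] Ig[of \<xi>] by simp
  \<comment> \<open>The cosine produced Gaussians around both \<open>\<xi>\<close> and
    \<open>- \<xi>\<close>; evenness of \<open>\<psi>\<close> makes their contributions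
    equal.\<close>
  also have "(LBINT \<eta>. exp (- t * \<psi> \<eta>) * g (\<eta> + \<xi>)) = (LBINT \<eta>. exp (- t * \<psi> \<eta>) * g (\<eta> + (- \<xi>)))"
  proof -
    have "(LBINT \<eta>. exp (- t * \<psi> \<eta>) * g (\<eta> + \<xi>)) = (LBINT \<eta>. exp (- t * \<psi> (- \<eta>)) * g (- \<eta> + \<xi>))"
      by (rule integral_lborel_reflect[symmetric]) measurable
    moreover have "g (- \<eta> + \<xi>) = g (\<eta> + (- \<xi>))" for \<eta>
      using norm_minus_commute[of \<xi> \<eta>] by (simp add: g_def)
    ultimately show ?thesis by (simp only: \<psi>_even)
  qed
  also have "(LBINT \<eta>. exp (- t * \<psi> \<eta>) * g (\<eta> + (- \<xi>))) =
     c ^ DIM('a) * (LBINT w. exp (- t * \<psi> (\<xi> + c *\<^sub>R w)) * g ((\<xi> + c *\<^sub>R w) + (- \<xi>)))"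
    by (rule integral_lborel_scale[OF c]) measurable
  also have "(\<lambda>w. exp (- t * \<psi> (\<xi> + c *\<^sub>R w)) * g ((\<xi> + c *\<^sub>R w) + (- \<xi>))) =
     (\<lambda>w. sqrt (pi / \<epsilon>) ^ DIM('a) * (exp (- t * \<psi> (\<xi> + c *\<^sub>R w)) * exp (- (norm w)\<^sup>2)))"
    using c by (simp add: g_def \<epsilon>_def power_mult_distrib mult_ac fun_eq_iff)
  also have "c ^ DIM('a) * (LBINT w. sqrt (pi / \<epsilon>) ^ DIM('a) * (exp (- t * \<psi> (\<xi> + c *\<^sub>R w)) * exp (- (norm w)\<^sup>2))) =
     (c * sqrt (pi / \<epsilon>)) ^ DIM('a) * (LBINT w. exp (- t * \<psi> (\<xi> + c *\<^sub>R w)) * exp (- (norm w)\<^sup>2))"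
    by (simp only: integral_mult_right_zero power_mult_distrib mult.assoc)
  also have "c * sqrt (pi / \<epsilon>) = 2 * sqrt pi"
    using c by (simp add: \<epsilon>_def real_sqrt_divide real_sqrt_mult)
  finally have "(2 * pi) ^ DIM('a) * (LBINT x. K t x * (exp (- \<epsilon> * (norm x)\<^sup>2) * cos (\<xi> \<bullet> x))) =
    (2 * sqrt pi) ^ DIM('a) * (LBINT w. exp (- t * \<psi> (\<xi> + c *\<^sub>R w)) * exp (- (norm w)\<^sup>2))"
    by simp
  moreover have "(2 * sqrt pi) ^ DIM('a) = (2 * pi) ^ DIM('a) * (1 / sqrt pi ^ DIM('a))"
  proof -
    have "2 * sqrt pi = 2 * pi * (1 / sqrt pi)" using real_div_sqrt[of pi] by simp
    then show ?thesis by (simp only: power_mult_distrib power_one_over)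
  qed
  ultimately have "(2 * pi) ^ DIM('a) * (LBINT x. K t x * (exp (- \<epsilon> * (norm x)\<^sup>2) * cos (\<xi> \<bullet> x))) =
     (2 * pi) ^ DIM('a) * (1 / sqrt pi ^ DIM('a) * (LBINT w. exp (- t * \<psi> (\<xi> + c *\<^sub>R w)) * exp (- (norm w)\<^sup>2)))"
    by (simp only: mult.assoc)
  moreover have "(2 * pi) ^ DIM('a) \<noteq> 0" by simp
  ultimately have "(LBINT x. K t x * (exp (- \<epsilon> * (norm x)\<^sup>2) * cos (\<xi> \<bullet> x))) =
     1 / sqrt pi ^ DIM('a) * (LBINT w. exp (- t * \<psi> (\<xi> + c *\<^sub>R w)) * exp (- (norm w)\<^sup>2))"
    by (rule mult_left_cancel[THEN iffD1, rotated])
  with I show ?thesis by (simp add: has_bochner_integral_iff \<epsilon>_def)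
qed

lemma K_gaussian_damped_limit:
  assumes t: "t > 0"
  shows "(\<lambda>j. LBINT x. K t x * (exp (- ((1 / real (Suc j))\<^sup>2 / 4) * (norm x)\<^sup>2) * cos (\<xi> \<bullet> x))) \<longlonglongrightarrow> exp (- t * \<psi> \<xi>)"
proof -
  have c0: "(\<lambda>j. 1 / real (Suc j)) \<longlonglongrightarrow> 0" by (rule LIMSEQ_Suc[OF lim_1_over_n])
  have "(\<lambda>j. LBINT w. exp (- t * \<psi> (\<xi> + (1 / real (Suc j)) *\<^sub>R w)) * exp (- (norm w)\<^sup>2)) \<longlonglongrightarrow> (LBINT w. exp (- t * \<psi> \<xi>) * exp (- (norm (w::'a))\<^sup>2))"
  proof (rule integral_dominated_convergence)
    show "integrable lborel (\<lambda>w::'a. exp (- (norm w)\<^sup>2))" using integrable_gaussian[of 1, where 'a='a] by simp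
    show "AE w in lborel. (\<lambda>j. exp (- t * \<psi> (\<xi> + (1 / real (Suc j)) *\<^sub>R w)) * exp (- (norm w)\<^sup>2)) \<longlonglongrightarrow> exp (- t * \<psi> \<xi>) * exp (- (norm w)\<^sup>2)"
    proof (rule AE_I2)
      fix w :: 'a
      have "(\<lambda>j. \<xi> + (1 / real (Suc j)) *\<^sub>R w) \<longlonglongrightarrow> \<xi> + 0 *\<^sub>R w"
        by (intro tendsto_intros c0)
      then have "(\<lambda>j. \<psi> (\<xi> + (1 / real (Suc j)) *\<^sub>R w)) \<longlonglongrightarrow> \<psi> (\<xi> + 0 *\<^sub>R w)"
        by (intro continuous_on_tendsto_compose[OF \<psi>_cont]) auto
      then show "(\<lambda>j. exp (- t * \<psi> (\<xi> + (1 / real (Suc j)) *\<^sub>R w)) * exp (- (norm w)\<^sup>2)) \<longlonglongrightarrow> exp (- t * \<psi> \<xi>) * exp (- (norm w)\<^sup>2)"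
        by (intro tendsto_intros) simp
    qed
    show "AE w in lborel. norm (exp (- t * \<psi> (\<xi> + (1 / real (Suc j)) *\<^sub>R w)) * exp (- (norm w)\<^sup>2)) \<le> exp (- (norm w)\<^sup>2)" for j
      using t by (auto intro!: AE_I2 mult_left_le_one_le simp: abs_mult \<psi>_nonneg)
  qed measurable
  then have "(\<lambda>j. 1 / sqrt pi ^ DIM('a) * (LBINT w. exp (- t * \<psi> (\<xi> + (1 / real (Suc j)) *\<^sub>R w)) * exp (- (norm w)\<^sup>2))) \<longlonglongrightarrow>
      1 / sqrt pi ^ DIM('a) * (LBINT w. exp (- t * \<psi> \<xi>) * exp (- (norm (w::'a))\<^sup>2))"
    by (intro tendsto_intros)
  moreover have "1 / sqrt pi ^ DIM('a) * (LBINT w. exp (- t * \<psi> \<xi>) * exp (- (norm (w::'a))\<^sup>2)) = exp (- t * \<psi> \<xi>)"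
    using integral_gaussian[of 1, where 'a='a] by simp
  ultimately show ?thesis
    using has_bochner_integral_integral_eq[OF K_gaussian_damped[OF t, of "1 / real (Suc _)" \<xi>]] by simp
qed

text \<open>The Gaussian weights increase to 1 and \<open>K\<close> is nonnegative, so monotone
  convergence yields integrability together with the value. The value is 1 once
  \<open>\<psi> 0 = 0\<close> is known.\<close>

lemma K_has_integral_1:
  assumes t: "t > 0"
  shows "has_bochner_integral lborel (K t) (exp (- t * \<psi> 0))"
proof -
  let ?f = "\<lambda>j x. K t x * exp (- ((1 / real (Suc j))\<^sup>2 / 4) * (norm x)\<^sup>2)"
  show ?thesis
  proof (rule has_bochner_integral_monotone_convergence[where f="?f"])
    show "integrable lborel (?f j)" for j
      using K_gaussian_damped[OF t, of "1 / real (Suc j)" 0] by (simp add: has_bochner_integral_iff)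
    show "AE x in lborel. mono (\<lambda>j. ?f j x)"
    proof (intro AE_I2 monoI mult_left_mono K_nonneg)
      fix x :: 'a and i j :: nat assume "i \<le> j"
      then have "(1 / real (Suc j))\<^sup>2 \<le> (1 / real (Suc i))\<^sup>2"
        by (intro power_mono) (auto simp: frac_le)
      then have "(1 / real (Suc j))\<^sup>2 / 4 * (norm x)\<^sup>2 \<le> (1 / real (Suc i))\<^sup>2 / 4 * (norm x)\<^sup>2"
        by (intro mult_right_mono) auto
      then show "exp (- ((1 / real (Suc i))\<^sup>2 / 4) * (norm x)\<^sup>2) \<le> exp (- ((1 / real (Suc j))\<^sup>2 / 4) * (norm x)\<^sup>2)"
        by simp
    qed
    show "AE x in lborel. (\<lambda>j. ?f j x) \<longlonglongrightarrow> K t x"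
    proof (rule AE_I2)
      fix x :: 'a
      have c0: "(\<lambda>j. 1 / real (Suc j)) \<longlonglongrightarrow> 0" by (rule LIMSEQ_Suc[OF lim_1_over_n])
      have "(\<lambda>j. ?f j x) \<longlonglongrightarrow> K t x * exp (- (0\<^sup>2 / 4) * (norm x)\<^sup>2)"
        by (intro tendsto_intros c0) simp
      then show "(\<lambda>j. ?f j x) \<longlonglongrightarrow> K t x" by simp
    qed
    show "(\<lambda>j. LBINT x. ?f j x) \<longlonglongrightarrow> exp (- t * \<psi> 0)"
      using K_gaussian_damped_limit[OF t, of 0] by simp
  qed measurable
qed

lemma \<psi>_0: "\<psi> 0 = 0"
proof -
  have "ennreal (\<psi> 0) = 0" by (simp flip: levy_khintchine)
  then show ?thesis using \<psi>_nonneg[of 0] by (simp add: ennreal_eq_0_iff)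
qed

lemma K_integrable: "integrable lborel (K t)"
proof (cases "t > 0")
  case True
  then show ?thesis using K_has_integral_1[of t] by (simp add: has_bochner_integral_iff)
next
  case False
  then have "K t = (\<lambda>x. 0)" by (simp add: K_def fun_eq_iff)
  then show ?thesis by simp
qed

lemma K_integral: "t > 0 \<Longrightarrow> (LBINT x. K t x) = 1"
  using K_has_integral_1[of t] by (simp add: \<psi>_0 has_bochner_integral_iff)

lemma integrable_K_mult:
  fixes f :: "'a \<Rightarrow> 'b::{banach, second_countable_topology}"
  assumes [measurable]: "f \<in> borel_measurable borel" and B: "\<And>x. norm (f x) \<le> B"
  shows "integrable lborel (\<lambda>x. K t x *\<^sub>R f x)"
proof (rule Bochner_Integration.integrable_bound)
  show "integrable lborel (\<lambda>x. B * K t x)" by (intro integrable_mult_right K_integrable)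
  show "AE x in lborel. norm (K t x *\<^sub>R f x) \<le> norm (B * K t x)"
    by (rule AE_I2) (auto simp: abs_mult K_nonneg mult.commute[of B] intro!: mult_left_mono order.trans[OF B])
qed measurable

text \<open>Now that \<open>K t\<close> is integrable, it dominates the damped integrands and the
  damping can be removed at every frequency.\<close>

lemma K_fourier_cos:
  assumes t: "t > 0"
  shows "(LBINT x. K t x * cos (x \<bullet> \<xi>)) = exp (- t * \<psi> \<xi>)"
proof -
  have c0: "(\<lambda>j. 1 / real (Suc j)) \<longlonglongrightarrow> 0" by (rule LIMSEQ_Suc[OF lim_1_over_n])
  have "(\<lambda>j. LBINT x. K t x * (exp (- ((1 / real (Suc j))\<^sup>2 / 4) * (norm x)\<^sup>2) * cos (\<xi> \<bullet> x))) \<longlonglongrightarrow> (LBINT x. K t x * cos (x \<bullet> \<xi>))"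
  proof (rule integral_dominated_convergence[OF _ _ K_integrable[of t]])
    show "AE x in lborel. (\<lambda>j. K t x * (exp (- ((1 / real (Suc j))\<^sup>2 / 4) * (norm x)\<^sup>2) * cos (\<xi> \<bullet> x))) \<longlonglongrightarrow> K t x * cos (x \<bullet> \<xi>)"
    proof (rule AE_I2)
      fix x
      have "(\<lambda>j. K t x * (exp (- ((1 / real (Suc j))\<^sup>2 / 4) * (norm x)\<^sup>2) * cos (\<xi> \<bullet> x))) \<longlonglongrightarrow> K t x * (exp (- (0\<^sup>2 / 4) * (norm x)\<^sup>2) * cos (\<xi> \<bullet> x))"
        by (intro tendsto_intros c0) simp
      then show "(\<lambda>j. K t x * (exp (- ((1 / real (Suc j))\<^sup>2 / 4) * (norm x)\<^sup>2) * cos (\<xi> \<bullet> x))) \<longlonglongrightarrow> K t x * cos (x \<bullet> \<xi>)"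
        by (simp add: inner_commute)
    qed
    show "AE x in lborel. norm (K t x * (exp (- ((1 / real (Suc j))\<^sup>2 / 4) * (norm x)\<^sup>2) * cos (\<xi> \<bullet> x))) \<le> K t x" for j
      by (rule AE_I2) (auto simp: abs_mult K_nonneg intro!: mult_right_le_one_le mult_le_one)
  qed measurable
  then show ?thesis using K_gaussian_damped_limit[OF t, of \<xi>] LIMSEQ_unique by blast
qed

lemma K_fourier_sin: "(LBINT x. K t x * sin (x \<bullet> \<xi>)) = 0"
proof -
  have "(LBINT x. K t x * sin (x \<bullet> \<xi>)) = (LBINT x. K t (- x) * sin ((- x) \<bullet> \<xi>))"
    by (rule integral_lborel_reflect[symmetric]) measurable
  then show ?thesis by (simp add: K_even)
qed

end

section \<open>Convolution and gradient of the transition kernel\<close>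

text \<open>A remainder of second order is what Taylor bounds under an integral sign deliver; the
  kernel is differentiated this way in space and in time.\<close>

lemma has_derivative_quadratic:
  fixes f :: "'a::real_normed_vector \<Rightarrow> 'b::real_normed_vector"
  assumes bl: "bounded_linear f'" and r: "r > 0"
    and bound: "\<And>h. norm h \<le> r \<Longrightarrow> norm (f (x + h) - f x - f' h) \<le> C * (norm h)\<^sup>2"
  shows "(f has_derivative f') (at x)"
  unfolding has_derivative_at
proof
  show "(\<lambda>h. norm (f (x + h) - f x - f' h) / norm h) \<midarrow>0\<rightarrow> 0"
  proof (rule Lim_null_comparison)
    have "eventually (\<lambda>h::'a. norm h < r) (at 0)"
      using r eventually_at[of "\<lambda>h::'a. norm h < r" 0 UNIV] by (auto simp: dist_norm)
    then show "eventually (\<lambda>h. norm (norm (f (x + h) - f x - f' h) / norm h) \<le> C * norm h) (at 0)"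
    proof eventually_elim
      case (elim h)
      show ?case
      proof (cases "h = 0")
        case False
        then show ?thesis using bound[of h] elim by (simp add: field_simps power2_eq_square)
      qed simp
    qed
    show "((\<lambda>h::'a. C * norm h) \<longlongrightarrow> 0) (at 0)"
      by (rule tendsto_eq_intros refl | simp)+
  qed
qed (rule bl)

lemma abs_sin_diff_le: "\<bar>sin a - sin b\<bar> \<le> \<bar>a - b\<bar>" for a b :: real
proof -
  have "norm (sin a - sin b) \<le> 1 * norm (a - b)"
    by (rule field_differentiable_bound[where S=UNIV and f'=cos])
       (auto intro!: derivative_eq_intros)
  then show ?thesis by simp
qed

lemma cos_taylor_bound: "\<bar>cos (a + u) - cos a + u * sin a\<bar> \<le> u\<^sup>2" for a u :: real
proof -
  have "norm ((cos (a + u) + u * sin a) - (cos (a + 0) + 0 * sin a)) \<le> \<bar>u\<bar> * norm (u - 0)"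
  proof (rule field_differentiable_bound[where S="closed_segment 0 u" and f'="\<lambda>v. sin a - sin (a + v)" and f="\<lambda>v. cos (a + v) + v * sin a"])
    fix v :: real assume v: "v \<in> closed_segment 0 u"
    show "((\<lambda>v. cos (a + v) + v * sin a) has_field_derivative sin a - sin (a + v)) (at v within closed_segment 0 u)"
      by (auto intro!: derivative_eq_intros)
    show "norm (sin a - sin (a + v)) \<le> \<bar>u\<bar>"
      using abs_sin_diff_le[of a "a + v"] v by (auto simp: closed_segment_eq_real_ivl split: if_splits)
  qed auto
  then show ?thesis by (simp add: power2_eq_square abs_mult[symmetric] algebra_simps)
qed

lemma exp_taylor_bound: "\<bar>exp u - 1 - u\<bar> \<le> u\<^sup>2 * exp \<bar>u\<bar>" for u :: real
proof -
  have 1: "\<bar>exp v - 1\<bar> \<le> exp \<bar>v\<bar> * \<bar>v\<bar>" for v :: real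
  proof -
    have "norm (exp v - exp 0) \<le> exp \<bar>v\<bar> * norm (v - 0)"
    proof (rule field_differentiable_bound[where S="closed_segment 0 v" and f'=exp])
      fix w assume "w \<in> closed_segment 0 v"
      then show "norm (exp w) \<le> exp \<bar>v\<bar>" by (auto simp: closed_segment_eq_real_ivl split: if_splits)
    qed (auto intro!: derivative_eq_intros)
    then show ?thesis by simp
  qed
  have "norm ((exp u - u) - (exp 0 - 0)) \<le> (exp \<bar>u\<bar> * \<bar>u\<bar>) * norm (u - 0)"
  proof (rule field_differentiable_bound[where S="closed_segment 0 u" and f'="\<lambda>v. exp v - 1" and f="\<lambda>v. exp v - v"])
    fix v assume "v \<in> closed_segment 0 u"
    then have "\<bar>v\<bar> \<le> \<bar>u\<bar>" by (auto simp: closed_segment_eq_real_ivl split: if_splits)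
    then have "exp \<bar>v\<bar> * \<bar>v\<bar> \<le> exp \<bar>u\<bar> * \<bar>u\<bar>" by (intro mult_mono) auto
    then show "norm (exp v - 1) \<le> exp \<bar>u\<bar> * \<bar>u\<bar>" using 1[of v] by simp
  qed (auto intro!: derivative_eq_intros)
  then show ?thesis by (simp add: power2_eq_square abs_mult[symmetric] algebra_simps)
qed

text \<open>\<open>grad\<close> is a definite description, so uniqueness is needed as well: the
  difference of two gradients is tested against itself.\<close>

lemma grad_eqI: "GDERIV f x :> D \<Longrightarrow> grad f x = D"
  unfolding grad_def
proof (rule the_equality)
  fix E assume D: "GDERIV f x :> D" and E: "GDERIV f x :> E"
  have "(\<lambda>h. h \<bullet> E) = (\<lambda>h. h \<bullet> D)"
    using D E unfolding gderiv_def by (rule has_derivative_unique[rotated])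
  then have "(E - D) \<bullet> E = (E - D) \<bullet> D" by (rule fun_cong)
  then have "(E - D) \<bullet> (E - D) = 0" by (simp add: inner_diff_right)
  then show "E = D" by simp
qed

context levy_exponent
begin

text \<open>A common form for \<open>K\<close>, \<open>G\<close> and the time derivative: the weight
  \<open>w\<close> is the Fourier multiplier, and the phase is 0 for even weights and
  \<open>pi / 2\<close> for odd ones, where the cosine becomes minus the sine. One convolution proof
  then serves them all.\<close>

definition trig :: "real \<Rightarrow> ('a \<Rightarrow> real) \<Rightarrow> real \<Rightarrow> 'a \<Rightarrow> real" where
  "trig t w \<phi> x = (LBINT \<xi>. exp (- t * \<psi> \<xi>) * (w \<xi> * cos (x \<bullet> \<xi> + \<phi>)))"

lemma integrable_damped_real:
  assumes "t > 0" "w \<in> borel_measurable borel" "\<And>\<xi>. \<bar>w \<xi>\<bar> \<le> B * (1 + norm \<xi>) ^ k"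
  shows "integrable lborel (\<lambda>\<xi>. exp (- t * \<psi> \<xi>) * w \<xi>)"
  using integrable_damped[of t w B k] assms by simp

lemma mult_cos_bound:
  fixes w :: "'a \<Rightarrow> real"
  assumes "\<And>\<xi>. \<bar>w \<xi>\<bar> \<le> B * (1 + norm \<xi>) ^ k"
  shows "\<bar>w \<xi> * cos \<theta>\<bar> \<le> B * (1 + norm \<xi>) ^ k"
proof -
  have "\<bar>w \<xi> * cos \<theta>\<bar> \<le> \<bar>w \<xi>\<bar>" by (simp add: abs_mult mult_right_le_one_le)
  then show ?thesis using assms[of \<xi>] by linarith
qed

lemma integrable_trig:
  assumes "t > 0" and [measurable]: "w \<in> borel_measurable borel" and "\<And>\<xi>. \<bar>w \<xi>\<bar> \<le> B * (1 + norm \<xi>) ^ k"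
  shows "integrable lborel (\<lambda>\<xi>. exp (- t * \<psi> \<xi>) * (w \<xi> * cos (x \<bullet> \<xi> + \<phi>)))"
  by (rule integrable_damped_real[where B=B and k=k, OF assms(1)]) (use mult_cos_bound[OF assms(3)] in auto)

lemma trig_bound:
  assumes "t > 0" and [measurable]: "w \<in> borel_measurable borel" and B: "\<And>\<xi>. \<bar>w \<xi>\<bar> \<le> B * (1 + norm \<xi>) ^ k"
  shows "\<bar>trig t w \<phi> x\<bar> \<le> (LBINT \<xi>. exp (- t * \<psi> \<xi>) * \<bar>w \<xi>\<bar>)"
proof -
  have "\<bar>trig t w \<phi> x\<bar> \<le> (LBINT \<xi>. \<bar>exp (- t * \<psi> \<xi>) * (w \<xi> * cos (x \<bullet> \<xi> + \<phi>))\<bar>)"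
    unfolding trig_def by (rule integral_abs_bound)
  also have "\<dots> \<le> (LBINT \<xi>. exp (- t * \<psi> \<xi>) * \<bar>w \<xi>\<bar>)"
  proof (rule integral_mono')
    show "integrable lborel (\<lambda>\<xi>. exp (- t * \<psi> \<xi>) * \<bar>w \<xi>\<bar>)"
      by (rule integrable_damped_real[where B=B and k=k]) (use assms in auto)
  qed (auto intro!: mult_right_le_one_le simp: abs_mult)
  finally show ?thesis .
qed

text \<open>Convolution with \<open>K s\<close> multiplies the frequency \<open>\<xi>\<close> by
  \<open>exp (- s * \<psi> \<xi>)\<close>. The addition formula splits off a sine part in
  \<open>z\<close>, which integrates to 0 because \<open>K s\<close> is even.\<close>

lemma trig_convolution:
  assumes s: "s > 0" and t: "t > 0"
    and [measurable]: "w \<in> borel_measurable borel" and B: "\<And>\<xi>. \<bar>w \<xi>\<bar> \<le> B * (1 + norm \<xi>) ^ k"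
  shows "has_bochner_integral lborel (\<lambda>z. K s z * trig t w \<phi> (y - z)) (trig (s + t) w \<phi> y)"
proof -
  let ?h = "\<lambda>z \<xi>. K s z * (exp (- t * \<psi> \<xi>) * (w \<xi> * cos ((y - z) \<bullet> \<xi> + \<phi>)))"
  have int: "integrable (lborel \<Otimes>\<^sub>M lborel) (\<lambda>(z, \<xi>). ?h z \<xi>)"
  proof (rule Bochner_Integration.integrable_bound)
    show "integrable (lborel \<Otimes>\<^sub>M lborel) (\<lambda>(z, \<xi>). K s z * (exp (- t * \<psi> \<xi>) * \<bar>w \<xi>\<bar>))"
      by (intro integrable_lborel_tensor K_integrable integrable_damped_real[where B=B and k=k] t) (use B in auto)
    show "AE p in lborel \<Otimes>\<^sub>M lborel. norm (case p of (z, \<xi>) \<Rightarrow> ?h z \<xi>) \<le> norm (case p of (z, \<xi>) \<Rightarrow> K s z * (exp (- t * \<psi> \<xi>) * \<bar>w \<xi>\<bar>))"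
      by (rule AE_I2) (auto simp: abs_mult K_nonneg intro!: mult_left_mono mult_right_le_one_le)
  qed measurable
  have inner_z: "(LBINT \<xi>. ?h z \<xi>) = K s z * trig t w \<phi> (y - z)" for z
    by (simp add: trig_def)
  have "integrable lborel (\<lambda>z. LBINT \<xi>. ?h z \<xi>)"
    using lborel_pair.integrable_fst'[OF int] by simp
  then have I: "integrable lborel (\<lambda>z. K s z * trig t w \<phi> (y - z))" unfolding inner_z .
  have inner_\<xi>: "(LBINT z. ?h z \<xi>) = exp (- (s + t) * \<psi> \<xi>) * (w \<xi> * cos (y \<bullet> \<xi> + \<phi>))" for \<xi>
  proof -
    have i1: "integrable lborel (\<lambda>z. K s z * cos (z \<bullet> \<xi>))"
      using integrable_K_mult[of "\<lambda>z. cos (z \<bullet> \<xi>)" 1] by simp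
    have i2: "integrable lborel (\<lambda>z. K s z * sin (z \<bullet> \<xi>))"
      using integrable_K_mult[of "\<lambda>z. sin (z \<bullet> \<xi>)" 1] by simp
    have "?h z \<xi> = (exp (- t * \<psi> \<xi>) * w \<xi> * cos (y \<bullet> \<xi> + \<phi>)) * (K s z * cos (z \<bullet> \<xi>)) +
        (exp (- t * \<psi> \<xi>) * w \<xi> * sin (y \<bullet> \<xi> + \<phi>)) * (K s z * sin (z \<bullet> \<xi>))" for z
    proof -
      have "(y - z) \<bullet> \<xi> + \<phi> = (y \<bullet> \<xi> + \<phi>) - z \<bullet> \<xi>" by (simp add: inner_diff_left)
      then show ?thesis by (simp only: cos_diff algebra_simps)
    qed
    then have "(LBINT z. ?h z \<xi>) = (exp (- t * \<psi> \<xi>) * w \<xi> * cos (y \<bullet> \<xi> + \<phi>)) * (LBINT z. K s z * cos (z \<bullet> \<xi>)) +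
        (exp (- t * \<psi> \<xi>) * w \<xi> * sin (y \<bullet> \<xi> + \<phi>)) * (LBINT z. K s z * sin (z \<bullet> \<xi>))"
      using i1 i2 by (simp only: Bochner_Integration.integral_add integrable_mult_right integral_mult_right_zero)
    also have "\<dots> = (exp (- t * \<psi> \<xi>) * w \<xi> * cos (y \<bullet> \<xi> + \<phi>)) * exp (- s * \<psi> \<xi>)"
      by (simp add: K_fourier_cos[OF s] K_fourier_sin)
    also have "\<dots> = (exp (- s * \<psi> \<xi>) * exp (- t * \<psi> \<xi>)) * (w \<xi> * cos (y \<bullet> \<xi> + \<phi>))" by (simp only: mult_ac)
    also have "exp (- s * \<psi> \<xi>) * exp (- t * \<psi> \<xi>) = exp (- (s + t) * \<psi> \<xi>)"
      by (simp add: algebra_simps flip: exp_add)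
    finally show ?thesis .
  qed
  have "(LBINT z. K s z * trig t w \<phi> (y - z)) = (LBINT z. (LBINT \<xi>. ?h z \<xi>))" unfolding inner_z ..
  also have "\<dots> = (LBINT \<xi>. (LBINT z. ?h z \<xi>))"
    using lborel_pair.Fubini_integral[OF int] by simp
  also have "\<dots> = trig (s + t) w \<phi> y" unfolding inner_\<xi> trig_def ..
  finally show ?thesis using I by (simp add: has_bochner_integral_iff)
qed

lemma K_trig: "t > 0 \<Longrightarrow> K t x = (1 / (2 * pi) ^ DIM('a)) * trig t (\<lambda>_. 1) 0 x"
  by (simp add: K_def trig_def)

lemma inner_bound: "\<bar>\<xi> \<bullet> v\<bar> \<le> norm v * (1 + norm \<xi>) ^ 1" for v \<xi> :: 'a
proof -
  have "norm \<xi> * norm v \<le> norm v * (1 + norm \<xi>) ^ 1" by (simp add: algebra_simps)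
  then show ?thesis using Cauchy_Schwarz_ineq2[of \<xi> v] by linarith
qed

lemma integrable_G:
  assumes "t > 0" shows "integrable lborel (\<lambda>\<xi>. exp (- t * \<psi> \<xi>) *\<^sub>R (sin (x \<bullet> \<xi>) *\<^sub>R \<xi>))"
proof (rule integrable_damped[OF assms, where B=1 and k=1])
  fix \<xi> :: 'a
  have "\<bar>sin (x \<bullet> \<xi>)\<bar> * norm \<xi> \<le> 1 * norm \<xi>" by (intro mult_right_mono) auto
  then show "norm (sin (x \<bullet> \<xi>) *\<^sub>R \<xi>) \<le> 1 * (1 + norm \<xi>) ^ 1" by simp
qed measurable

lemma G_trig:
  assumes "t > 0" shows "G t x \<bullet> v = (1 / (2 * pi) ^ DIM('a)) * trig t (\<lambda>\<xi>. \<xi> \<bullet> v) (pi / 2) x"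
proof -
  have "G t x \<bullet> v = - (1 / (2 * pi) ^ DIM('a)) * ((LBINT \<xi>. exp (- t * \<psi> \<xi>) *\<^sub>R (sin (x \<bullet> \<xi>) *\<^sub>R \<xi>)) \<bullet> v)"
    using assms by (simp add: G_def)
  also have "(LBINT \<xi>. exp (- t * \<psi> \<xi>) *\<^sub>R (sin (x \<bullet> \<xi>) *\<^sub>R \<xi>)) \<bullet> v = (LBINT \<xi>. (exp (- t * \<psi> \<xi>) *\<^sub>R (sin (x \<bullet> \<xi>) *\<^sub>R \<xi>)) \<bullet> v)"
    by (rule integral_inner_left[symmetric]) (rule integrable_G[OF assms])
  also have "\<dots> = - trig t (\<lambda>\<xi>. \<xi> \<bullet> v) (pi / 2) x"
    unfolding trig_def by (simp add: cos_add mult_ac)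
  finally show ?thesis by simp
qed

lemma K_convolution:
  assumes "s > 0" "t > 0"
  shows "has_bochner_integral lborel (\<lambda>z. K s z * K t (y - z)) (K (s + t) y)"
proof -
  have "has_bochner_integral lborel (\<lambda>z. (1 / (2 * pi) ^ DIM('a)) * (K s z * trig t (\<lambda>_. 1) 0 (y - z))) ((1 / (2 * pi) ^ DIM('a)) * trig (s + t) (\<lambda>_. 1) 0 y)"
    by (intro has_bochner_integral_mult_right trig_convolution[where B=1 and k=0] assms) auto
  then show ?thesis using assms by (simp add: K_trig mult.left_commute)
qed

lemma G_convolution:
  assumes "s > 0" "t > 0"
  shows "has_bochner_integral lborel (\<lambda>z. K s z * (G t (y - z) \<bullet> v)) (G (s + t) y \<bullet> v)"
proof -
  have "has_bochner_integral lborel (\<lambda>z. (1 / (2 * pi) ^ DIM('a)) * (K s z * trig t (\<lambda>\<xi>. \<xi> \<bullet> v) (pi / 2) (y - z))) ((1 / (2 * pi) ^ DIM('a)) * trig (s + t) (\<lambda>\<xi>. \<xi> \<bullet> v) (pi / 2) y)"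
    by (intro has_bochner_integral_mult_right trig_convolution[where B="norm v" and k=1] assms inner_bound) auto
  then show ?thesis using assms by (simp add: G_trig mult.left_commute)
qed

lemma K_le: "K t x \<le> K t 0"
proof (cases "t > 0")
  case True
  have "(LBINT \<xi>. exp (- t * \<psi> \<xi>) * cos (x \<bullet> \<xi>)) \<le> (LBINT \<xi>. exp (- t * \<psi> \<xi>) * cos (0 \<bullet> \<xi>))"
    by (intro integral_mono integrable_exp_cos True) simp
  then show ?thesis using True unfolding K_def by (simp add: divide_right_mono)
qed (simp add: K_def)

text \<open>The second-order Taylor bound of the cosine, integrated against
  \<open>exp (- t * \<psi> \<xi>)\<close>, whose second moment is finite.\<close>

lemma GDERIV_K:
  assumes t: "t > 0" shows "GDERIV (K t) x :> G t x"
  unfolding gderiv_def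
proof (rule has_derivative_quadratic[where r=1])
  show "bounded_linear (\<lambda>h. h \<bullet> G t x)" by (rule bounded_linear_inner_left)
  fix h :: 'a
  have i1: "integrable lborel (\<lambda>\<xi>. exp (- t * \<psi> \<xi>) * cos (y \<bullet> \<xi>))" for y by (rule integrable_exp_cos[OF t])
  have i2: "integrable lborel (\<lambda>\<xi>. exp (- t * \<psi> \<xi>) * ((\<xi> \<bullet> h) * cos (x \<bullet> \<xi> + pi / 2)))"
    by (rule integrable_trig[OF t _ inner_bound]) auto
  have i3: "integrable lborel (\<lambda>\<xi>. exp (- t * \<psi> \<xi>) * (norm \<xi>)\<^sup>2)"
    by (rule integrable_damped_real[OF t, where B=1 and k=2]) (auto intro!: power_mono)
  have "K t (x + h) - K t x - h \<bullet> G t x =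
     (1 / (2 * pi) ^ DIM('a)) * ((LBINT \<xi>. exp (- t * \<psi> \<xi>) * cos ((x + h) \<bullet> \<xi>)) - (LBINT \<xi>. exp (- t * \<psi> \<xi>) * cos (x \<bullet> \<xi>)) - trig t (\<lambda>\<xi>. \<xi> \<bullet> h) (pi / 2) x)"
    using t by (simp add: K_def inner_commute[of h] G_trig diff_divide_distrib)
  also have "(LBINT \<xi>. exp (- t * \<psi> \<xi>) * cos ((x + h) \<bullet> \<xi>)) - (LBINT \<xi>. exp (- t * \<psi> \<xi>) * cos (x \<bullet> \<xi>)) - trig t (\<lambda>\<xi>. \<xi> \<bullet> h) (pi / 2) x =
     (LBINT \<xi>. exp (- t * \<psi> \<xi>) * cos ((x + h) \<bullet> \<xi>) - exp (- t * \<psi> \<xi>) * cos (x \<bullet> \<xi>) - exp (- t * \<psi> \<xi>) * ((\<xi> \<bullet> h) * cos (x \<bullet> \<xi> + pi / 2)))"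
    unfolding trig_def using i1 i2 by simp
  finally have "norm (K t (x + h) - K t x - h \<bullet> G t x) =
     (1 / (2 * pi) ^ DIM('a)) * \<bar>LBINT \<xi>. exp (- t * \<psi> \<xi>) * cos ((x + h) \<bullet> \<xi>) - exp (- t * \<psi> \<xi>) * cos (x \<bullet> \<xi>) - exp (- t * \<psi> \<xi>) * ((\<xi> \<bullet> h) * cos (x \<bullet> \<xi> + pi / 2))\<bar>"
    by (simp add: abs_mult)
  also have "\<dots> \<le> (1 / (2 * pi) ^ DIM('a)) * (LBINT \<xi>. (norm h)\<^sup>2 * (exp (- t * \<psi> \<xi>) * (norm \<xi>)\<^sup>2))"
  proof (intro mult_left_mono order.trans[OF integral_abs_bound] integral_mono')
    show "integrable lborel (\<lambda>\<xi>. (norm h)\<^sup>2 * (exp (- t * \<psi> \<xi>) * (norm \<xi>)\<^sup>2))"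
      by (intro integrable_mult_right i3)
    fix \<xi> :: 'a
    have "exp (- t * \<psi> \<xi>) * cos ((x + h) \<bullet> \<xi>) - exp (- t * \<psi> \<xi>) * cos (x \<bullet> \<xi>) - exp (- t * \<psi> \<xi>) * ((\<xi> \<bullet> h) * cos (x \<bullet> \<xi> + pi / 2)) =
       exp (- t * \<psi> \<xi>) * (cos (x \<bullet> \<xi> + h \<bullet> \<xi>) - cos (x \<bullet> \<xi>) + (h \<bullet> \<xi>) * sin (x \<bullet> \<xi>))"
      by (simp add: inner_add_left cos_add[of _ "pi / 2"] inner_commute[of h] algebra_simps)
    also have "\<bar>\<dots>\<bar> \<le> exp (- t * \<psi> \<xi>) * (h \<bullet> \<xi>)\<^sup>2"
      unfolding abs_mult by (simp add: cos_taylor_bound)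
    also have "\<dots> \<le> exp (- t * \<psi> \<xi>) * ((norm h)\<^sup>2 * (norm \<xi>)\<^sup>2)"
      using Cauchy_Schwarz_ineq[of h \<xi>] by (intro mult_left_mono) (auto simp: power2_norm_eq_inner)
    finally show "\<bar>exp (- t * \<psi> \<xi>) * cos ((x + h) \<bullet> \<xi>) - exp (- t * \<psi> \<xi>) * cos (x \<bullet> \<xi>) - exp (- t * \<psi> \<xi>) * ((\<xi> \<bullet> h) * cos (x \<bullet> \<xi> + pi / 2))\<bar> \<le> (norm h)\<^sup>2 * (exp (- t * \<psi> \<xi>) * (norm \<xi>)\<^sup>2)"
      by (simp add: mult_ac)
  qed auto
  also have "\<dots> = ((1 / (2 * pi) ^ DIM('a)) * (LBINT \<xi>. exp (- t * \<psi> \<xi>) * (norm \<xi>)\<^sup>2)) * (norm h)\<^sup>2" by simp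
  finally show "norm (K t (x + h) - K t x - h \<bullet> G t x) \<le> \<dots>" .
qed simp

section \<open>Time derivative, gradient mass and approximate identity\<close>

definition K' :: "real \<Rightarrow> 'a \<Rightarrow> real" where
  "K' t x = - (1 / (2 * pi) ^ DIM('a)) * trig t \<psi> 0 x"

lemma \<psi>_poly: "\<bar>\<psi> \<xi>\<bar> \<le> C * (1 + norm \<xi>) ^ 2"
proof -
  have "1 + (norm \<xi>)\<^sup>2 \<le> (1 + norm \<xi>)\<^sup>2" by (simp add: power2_eq_square algebra_simps)
  then have "C * (1 + (norm \<xi>)\<^sup>2) \<le> C * (1 + norm \<xi>)\<^sup>2" by (intro mult_left_mono C_nonneg)
  then show ?thesis using \<psi>_upper[of \<xi>] \<psi>_nonneg[of \<xi>] by linarith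
qed

text \<open>For increments up to \<open>t / 2\<close> the exponential in the Taylor remainder is at
  most \<open>exp (t / 2 * \<psi> \<xi>)\<close>. It uses up half of the decay, and the other half
  integrates the square of \<open>\<psi>\<close>.\<close>

lemma K_has_derivative_t:
  assumes t: "t > 0" shows "((\<lambda>t. K t x) has_real_derivative K' t x) (at t)"
  unfolding has_field_derivative_def
proof (rule has_derivative_quadratic[where r="t / 2"])
  show "bounded_linear ((*) (K' t x))" by (rule bounded_linear_mult_right)
  show "t / 2 > 0" using t by simp
  fix h :: real assume "norm h \<le> t / 2"
  then have h: "\<bar>h\<bar> \<le> t / 2" by simp
  then have th: "t + h > 0" using t by (auto simp: abs_if split: if_splits)
  have i1: "integrable lborel (\<lambda>\<xi>. exp (- (t + h) * \<psi> \<xi>) * cos (x \<bullet> \<xi>))"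
    "integrable lborel (\<lambda>\<xi>. exp (- t * \<psi> \<xi>) * cos (x \<bullet> \<xi>))"
    using integrable_exp_cos[OF th] integrable_exp_cos[OF t] by auto
  have i2: "integrable lborel (\<lambda>\<xi>. exp (- t * \<psi> \<xi>) * (\<psi> \<xi> * cos (x \<bullet> \<xi> + 0)))"
    by (rule integrable_trig[OF t \<psi>_meas \<psi>_poly])
  have i3: "integrable lborel (\<lambda>\<xi>. exp (- (t / 2) * \<psi> \<xi>) * (\<psi> \<xi>)\<^sup>2)"
  proof (rule integrable_damped_real[where B="C\<^sup>2" and k=4])
    fix \<xi>
    have "(\<psi> \<xi>)\<^sup>2 \<le> (C * (1 + norm \<xi>)\<^sup>2)\<^sup>2" using \<psi>_poly[of \<xi>] by (intro power2_le_iff_abs_le[THEN iffD2]) (auto simp: C_nonneg)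
    then show "\<bar>(\<psi> \<xi>)\<^sup>2\<bar> \<le> C\<^sup>2 * (1 + norm \<xi>) ^ 4" by (simp add: power_mult_distrib)
  qed (use t in auto)
  have "K (t + h) x - K t x - K' t x * h =
     1 / (2 * pi) ^ DIM('a) * ((LBINT \<xi>. exp (- (t + h) * \<psi> \<xi>) * cos (x \<bullet> \<xi>)) - (LBINT \<xi>. exp (- t * \<psi> \<xi>) * cos (x \<bullet> \<xi>)) + h * trig t \<psi> 0 x)"
    using t th by (simp add: K_def K'_def diff_divide_distrib add_divide_distrib)
  also have "(LBINT \<xi>. exp (- (t + h) * \<psi> \<xi>) * cos (x \<bullet> \<xi>)) - (LBINT \<xi>. exp (- t * \<psi> \<xi>) * cos (x \<bullet> \<xi>)) + h * trig t \<psi> 0 x =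
     (LBINT \<xi>. exp (- (t + h) * \<psi> \<xi>) * cos (x \<bullet> \<xi>) - exp (- t * \<psi> \<xi>) * cos (x \<bullet> \<xi>) + h * (exp (- t * \<psi> \<xi>) * (\<psi> \<xi> * cos (x \<bullet> \<xi> + 0))))"
    unfolding trig_def using i1 i2 by (simp only: Bochner_Integration.integral_add Bochner_Integration.integral_diff Bochner_Integration.integrable_diff integrable_mult_right integral_mult_right_zero)
  finally have "norm (K (t + h) x - K t x - K' t x * h) =
     1 / (2 * pi) ^ DIM('a) * \<bar>LBINT \<xi>. exp (- (t + h) * \<psi> \<xi>) * cos (x \<bullet> \<xi>) - exp (- t * \<psi> \<xi>) * cos (x \<bullet> \<xi>) + h * (exp (- t * \<psi> \<xi>) * (\<psi> \<xi> * cos (x \<bullet> \<xi> + 0)))\<bar>"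
    by (simp add: abs_mult)
  also have "\<dots> \<le> 1 / (2 * pi) ^ DIM('a) * (LBINT \<xi>. h\<^sup>2 * (exp (- (t / 2) * \<psi> \<xi>) * (\<psi> \<xi>)\<^sup>2))"
  proof (intro mult_left_mono order.trans[OF integral_abs_bound] integral_mono')
    show "integrable lborel (\<lambda>\<xi>. h\<^sup>2 * (exp (- (t / 2) * \<psi> \<xi>) * (\<psi> \<xi>)\<^sup>2))"
      by (intro integrable_mult_right i3)
    fix \<xi> :: 'a
    define u where "u = - h * \<psi> \<xi>"
    have "exp (- (t + h) * \<psi> \<xi>) = exp (- t * \<psi> \<xi>) * exp u"
      unfolding exp_add[symmetric] by (simp add: u_def algebra_simps)
    then have "exp (- (t + h) * \<psi> \<xi>) * cos (x \<bullet> \<xi>) - exp (- t * \<psi> \<xi>) * cos (x \<bullet> \<xi>) + h * (exp (- t * \<psi> \<xi>) * (\<psi> \<xi> * cos (x \<bullet> \<xi> + 0))) =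
       exp (- t * \<psi> \<xi>) * (exp u - 1 - u) * cos (x \<bullet> \<xi>)"
      by (simp add: u_def algebra_simps)
    also have "\<bar>\<dots>\<bar> \<le> exp (- t * \<psi> \<xi>) * (u\<^sup>2 * exp \<bar>u\<bar>) * 1"
      unfolding abs_mult using exp_taylor_bound[of u] by (intro mult_mono) auto
    also have "\<dots> \<le> exp (- t * \<psi> \<xi>) * (u\<^sup>2 * exp (t / 2 * \<psi> \<xi>)) * 1"
    proof -
      have "\<bar>u\<bar> = \<bar>h\<bar> * \<psi> \<xi>" using \<psi>_nonneg[of \<xi>] by (simp add: u_def abs_mult)
      also have "\<dots> \<le> t / 2 * \<psi> \<xi>" using h \<psi>_nonneg[of \<xi>] by (rule mult_right_mono)
      finally have "exp \<bar>u\<bar> \<le> exp (t / 2 * \<psi> \<xi>)" by simp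
      then show ?thesis by (intro mult_right_mono mult_left_mono) auto
    qed
    also have "\<dots> = h\<^sup>2 * ((exp (- t * \<psi> \<xi>) * exp (t / 2 * \<psi> \<xi>)) * (\<psi> \<xi>)\<^sup>2)"
      by (simp add: u_def power_mult_distrib)
    also have "exp (- t * \<psi> \<xi>) * exp (t / 2 * \<psi> \<xi>) = exp (- (t / 2) * \<psi> \<xi>)"
      unfolding exp_add[symmetric] by (simp add: algebra_simps)
    finally show "\<bar>exp (- (t + h) * \<psi> \<xi>) * cos (x \<bullet> \<xi>) - exp (- t * \<psi> \<xi>) * cos (x \<bullet> \<xi>) + h * (exp (- t * \<psi> \<xi>) * (\<psi> \<xi> * cos (x \<bullet> \<xi> + 0)))\<bar> \<le> h\<^sup>2 * (exp (- (t / 2) * \<psi> \<xi>) * (\<psi> \<xi>)\<^sup>2)" .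
  qed auto
  also have "\<dots> = (1 / (2 * pi) ^ DIM('a) * (LBINT \<xi>. exp (- (t / 2) * \<psi> \<xi>) * (\<psi> \<xi>)\<^sup>2)) * (norm h)\<^sup>2" by simp
  finally show "norm (K (t + h) x - K t x - K' t x * h) \<le> \<dots>" .
qed

lemma K_second_difference:
  assumes t: "t > 0"
  shows "K t (x + y) + K t (x - y) - 2 * K t x = - 2 / (2 * pi) ^ DIM('a) * (LBINT \<xi>. (1 - cos (\<xi> \<bullet> y)) * (exp (- t * \<psi> \<xi>) * cos (x \<bullet> \<xi>)))"
proof -
  have e: "- 2 * ((1 - cos (\<xi> \<bullet> y)) * (exp (- t * \<psi> \<xi>) * cos (x \<bullet> \<xi>))) =
     exp (- t * \<psi> \<xi>) * cos ((x + y) \<bullet> \<xi>) + exp (- t * \<psi> \<xi>) * cos ((x - y) \<bullet> \<xi>) - 2 * (exp (- t * \<psi> \<xi>) * cos (x \<bullet> \<xi>))" for \<xi>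
    by (simp add: inner_add_left inner_diff_left cos_add cos_diff inner_commute[of \<xi>] algebra_simps)
  have "- 2 * (LBINT \<xi>. (1 - cos (\<xi> \<bullet> y)) * (exp (- t * \<psi> \<xi>) * cos (x \<bullet> \<xi>))) =
     (LBINT \<xi>. - 2 * ((1 - cos (\<xi> \<bullet> y)) * (exp (- t * \<psi> \<xi>) * cos (x \<bullet> \<xi>))))" by simp
  also have "\<dots> = (LBINT \<xi>. exp (- t * \<psi> \<xi>) * cos ((x + y) \<bullet> \<xi>)) + (LBINT \<xi>. exp (- t * \<psi> \<xi>) * cos ((x - y) \<bullet> \<xi>)) - 2 * (LBINT \<xi>. exp (- t * \<psi> \<xi>) * cos (x \<bullet> \<xi>))"
    unfolding e using integrable_exp_cos[OF t] by simp
  finally show ?thesis using t by (simp add: K_def field_simps)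
qed

text \<open>In the Fourier representation \<open>1 - cos\<close> is nonnegative, so the modulus is
  largest at the origin. The bound is free of \<open>x\<close>, which provides the dominating
  function for the Fubini argument on the generator.\<close>

lemma K_second_difference_bound:
  assumes t: "t > 0"
  shows "\<bar>K t (x + y) + K t (x - y) - 2 * K t x\<bar> \<le> 2 * (K t 0 - K t y)"
proof -
  have i: "integrable lborel (\<lambda>\<xi>. (1 - cos (\<xi> \<bullet> y)) * exp (- t * \<psi> \<xi>))"
    using Bochner_Integration.integrable_diff[OF integrable_exp[OF t] integrable_exp_cos[OF t, of y]]
    by (simp add: algebra_simps inner_commute)
  have "K t (0 + y) + K t (0 - y) - 2 * K t 0 = - 2 / (2 * pi) ^ DIM('a) * (LBINT \<xi>. (1 - cos (\<xi> \<bullet> y)) * (exp (- t * \<psi> \<xi>) * cos (0 \<bullet> \<xi>)))"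
    by (rule K_second_difference[OF t])
  then have 1: "2 * (K t 0 - K t y) = 2 / (2 * pi) ^ DIM('a) * (LBINT \<xi>. (1 - cos (\<xi> \<bullet> y)) * exp (- t * \<psi> \<xi>))"
    by (simp add: K_even)
  have "\<bar>LBINT \<xi>. (1 - cos (\<xi> \<bullet> y)) * (exp (- t * \<psi> \<xi>) * cos (x \<bullet> \<xi>))\<bar> \<le> (LBINT \<xi>. (1 - cos (\<xi> \<bullet> y)) * exp (- t * \<psi> \<xi>))"
    by (intro order.trans[OF integral_abs_bound] integral_mono' i)
       (auto simp: abs_mult intro!: mult_left_mono mult_right_le_one_le)
  then show ?thesis unfolding K_second_difference[OF t] 1 by (simp add: abs_mult divide_right_mono)
qed

lemma K_levy_fubini:
  assumes t: "t > 0"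
  shows "integrable (lborel \<Otimes>\<^sub>M lborel) (\<lambda>(\<xi>, y). n y * (1 - cos (\<xi> \<bullet> y)) * (exp (- t * \<psi> \<xi>) * cos (x \<bullet> \<xi>)))"
proof (rule lborel_pair.Fubini_integrable)
  have e: "(LBINT y. norm (n y * (1 - cos (\<xi> \<bullet> y)) * (exp (- t * \<psi> \<xi>) * cos (x \<bullet> \<xi>)))) = exp (- t * \<psi> \<xi>) * (\<psi> \<xi> * \<bar>cos (x \<bullet> \<xi>)\<bar>)" for \<xi>
  proof -
    have "norm (n y * (1 - cos (\<xi> \<bullet> y)) * (exp (- t * \<psi> \<xi>) * cos (x \<bullet> \<xi>))) = n y * (1 - cos (\<xi> \<bullet> y)) * (exp (- t * \<psi> \<xi>) * \<bar>cos (x \<bullet> \<xi>)\<bar>)" for y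
      by (simp add: abs_mult n_nonneg)
    then show ?thesis by (simp only: integral_mult_left_zero integral_n_one_minus_cos) (simp only: mult_ac)
  qed
  have "integrable lborel (\<lambda>\<xi>. exp (- t * \<psi> \<xi>) * (\<psi> \<xi> * \<bar>cos (x \<bullet> \<xi>)\<bar>))"
  proof (rule integrable_damped_real[OF t, where B=C and k=2])
    fix \<xi> show "\<bar>\<psi> \<xi> * \<bar>cos (x \<bullet> \<xi>)\<bar>\<bar> \<le> C * (1 + norm \<xi>)\<^sup>2"
      using mult_cos_bound[OF \<psi>_poly, of \<xi> "x \<bullet> \<xi>"] by (simp add: abs_mult)
  qed measurable
  then show "integrable lborel (\<lambda>\<xi>. LBINT y. norm (case (\<xi>, y) of (\<xi>, y) \<Rightarrow> n y * (1 - cos (\<xi> \<bullet> y)) * (exp (- t * \<psi> \<xi>) * cos (x \<bullet> \<xi>))))"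
    unfolding prod.case e .
  show "AE \<xi> in lborel. integrable lborel (\<lambda>y. case (\<xi>, y) of (\<xi>, y) \<Rightarrow> n y * (1 - cos (\<xi> \<bullet> y)) * (exp (- t * \<psi> \<xi>) * cos (x \<bullet> \<xi>)))"
    unfolding prod.case by (intro AE_I2 integrable_mult_left integrable_n_one_minus_cos)
qed measurable

text \<open>The heat equation for \<open>K\<close>: inserting the Levy-Khintchine formula under the
  Fourier integral produces the multiplier \<open>\<psi>\<close>. The factor 2 comes from the
  symmetric second difference, which counts \<open>y\<close> and \<open>- y\<close>
  together.\<close>

lemma K_generator:
  assumes t: "t > 0"
  shows "has_bochner_integral lborel (\<lambda>y. n y * (K t (x + y) + K t (x - y) - 2 * K t x)) (2 * K' t x)"
proof -
  let ?h = "\<lambda>\<xi> y. n y * (1 - cos (\<xi> \<bullet> y)) * (exp (- t * \<psi> \<xi>) * cos (x \<bullet> \<xi>))"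
  note int = K_levy_fubini[OF t, of x]
  have iy: "n y * (K t (x + y) + K t (x - y) - 2 * K t x) = - 2 / (2 * pi) ^ DIM('a) * (LBINT \<xi>. ?h \<xi> y)" for y
    unfolding K_second_difference[OF t] by (simp only: mult.assoc integral_mult_right_zero) (simp only: mult_ac)
  have "integrable lborel (\<lambda>y. LBINT \<xi>. ?h \<xi> y)"
    using lborel_pair.integrable_snd[OF int] by simp
  then have I: "integrable lborel (\<lambda>y. n y * (K t (x + y) + K t (x - y) - 2 * K t x))"
    unfolding iy by (rule integrable_mult_right)
  have i\<xi>: "(LBINT y. ?h \<xi> y) = exp (- t * \<psi> \<xi>) * (\<psi> \<xi> * cos (x \<bullet> \<xi> + 0))" for \<xi>
    by (simp only: integral_mult_left_zero integral_n_one_minus_cos) (simp only: mult_ac add_0_right)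
  have "(LBINT y. n y * (K t (x + y) + K t (x - y) - 2 * K t x)) = - 2 / (2 * pi) ^ DIM('a) * (LBINT y. (LBINT \<xi>. ?h \<xi> y))"
    unfolding iy by (rule integral_mult_right_zero)
  also have "(LBINT y. (LBINT \<xi>. ?h \<xi> y)) = (LBINT \<xi>. (LBINT y. ?h \<xi> y))"
    using lborel_pair.Fubini_integral[OF int] by simp
  also have "\<dots> = trig t \<psi> 0 x" unfolding i\<xi> trig_def ..
  finally show ?thesis using I by (simp add: has_bochner_integral_iff K'_def)
qed

lemma integrable_n_K_difference:
  assumes t: "t > 0" shows "integrable lborel (\<lambda>y. n y * (K t 0 - K t y))"
proof -
  have "integrable lborel (\<lambda>y. (- 1 / 2) * (n y * (K t (0 + y) + K t (0 - y) - 2 * K t 0)))"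
    using K_generator[OF t, of 0] by (intro integrable_mult_right) (simp add: has_bochner_integral_iff)
  also have "(\<lambda>y. (- 1 / 2) * (n y * (K t (0 + y) + K t (0 - y) - 2 * K t 0))) = (\<lambda>y. n y * (K t 0 - K t y))"
    by (simp add: K_even fun_eq_iff algebra_simps)
  finally show ?thesis .
qed

lemma G_inner_continuous:
  assumes t: "t > 0" shows "continuous_on UNIV (\<lambda>x. G t x \<bullet> v)"
proof (rule continuous_on_sequentiallyI)
  fix u :: "nat \<Rightarrow> 'a" and a assume lim: "u \<longlonglongrightarrow> a"
  have "(\<lambda>k. trig t (\<lambda>\<xi>. \<xi> \<bullet> v) (pi / 2) (u k)) \<longlonglongrightarrow> trig t (\<lambda>\<xi>. \<xi> \<bullet> v) (pi / 2) a"
    unfolding trig_def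
  proof (rule integral_dominated_convergence)
    show "integrable lborel (\<lambda>\<xi>. exp (- t * \<psi> \<xi>) * \<bar>\<xi> \<bullet> v\<bar>)"
      by (rule integrable_damped_real[OF t, where B="norm v" and k=1]) (use inner_bound[of _ v] in auto)
    show "AE \<xi> in lborel. (\<lambda>k. exp (- t * \<psi> \<xi>) * (\<xi> \<bullet> v * cos (u k \<bullet> \<xi> + pi / 2))) \<longlonglongrightarrow> exp (- t * \<psi> \<xi>) * (\<xi> \<bullet> v * cos (a \<bullet> \<xi> + pi / 2))"
      by (intro AE_I2 tendsto_intros lim)
    show "AE \<xi> in lborel. norm (exp (- t * \<psi> \<xi>) * (\<xi> \<bullet> v * cos (u k \<bullet> \<xi> + pi / 2))) \<le> exp (- t * \<psi> \<xi>) * \<bar>\<xi> \<bullet> v\<bar>" for k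
      by (auto simp: abs_mult intro!: AE_I2 mult_right_le_one_le)
  qed measurable
  then show "(\<lambda>k. G t (u k) \<bullet> v) \<longlonglongrightarrow> G t a \<bullet> v"
    unfolding G_trig[OF t] by (intro tendsto_intros)
qed

lemma K_line_integral:
  assumes t: "t > 0" and h: "0 \<le> (h::real)"
  shows "(LBINT r. (G t (x + r *\<^sub>R v) \<bullet> v) * indicator {0..h} r) = K t (x + h *\<^sub>R v) - K t x"
proof -
  have "(LBINT r. (G t (x + r *\<^sub>R v) \<bullet> v) * indicator {0..h} r) = K t (x + h *\<^sub>R v) - K t (x + 0 *\<^sub>R v)"
  proof (rule integral_FTC_Icc_real[OF h])
    fix r :: real
    have "(K t has_derivative (\<lambda>k. k \<bullet> G t (x + r *\<^sub>R v))) (at (x + r *\<^sub>R v))"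
      using GDERIV_K[OF t] by (simp add: gderiv_def)
    moreover have "((\<lambda>r. x + r *\<^sub>R v) has_derivative (\<lambda>k. k *\<^sub>R v)) (at r)"
      by (auto intro!: derivative_eq_intros)
    ultimately have "((\<lambda>r. K t (x + r *\<^sub>R v)) has_derivative (\<lambda>k. (k *\<^sub>R v) \<bullet> G t (x + r *\<^sub>R v))) (at r)"
      by (rule has_derivative_compose[rotated])
    then show "((\<lambda>r. K t (x + r *\<^sub>R v)) has_real_derivative G t (x + r *\<^sub>R v) \<bullet> v) (at r)"
      by (simp add: has_field_derivative_def inner_commute mult.commute[of _ "_ \<bullet> _"])
    show "isCont (\<lambda>r. G t (x + r *\<^sub>R v) \<bullet> v) r"
      by (rule continuous_on_interior[where S=UNIV, OF continuous_on_compose2[OF G_inner_continuous[OF t]]])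
         (auto intro!: continuous_intros)
  qed
  then show ?thesis by simp
qed

text \<open>The total variation of a translate by \<open>v\<close> is tested against the character at frequency \<open>v\<close>.\<close>

lemma gradient_mass_lower:
  assumes t: "t > 0" and v: "norm v = 1"
  shows "ennreal ((1 - cos 1) * exp (- t * \<psi> v)) \<le> (\<integral>\<^sup>+y. ennreal (norm (G t y)) \<partial>lborel)"
proof -
  have vv: "v \<bullet> v = 1" using v by (simp add: norm_eq_sqrt_inner)
  have i0: "integrable lborel (\<lambda>y. K t y * cos (y \<bullet> v))" "integrable lborel (\<lambda>y. K t y * sin (y \<bullet> v))"
    "integrable lborel (\<lambda>y. K t y * cos (y \<bullet> v - 1))"
    using integrable_K_mult[of "\<lambda>z. cos (z \<bullet> v)" 1 t] integrable_K_mult[of "\<lambda>z. sin (z \<bullet> v)" 1 t]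
      integrable_K_mult[of "\<lambda>z. cos (z \<bullet> v - 1)" 1 t] by auto
  have i1: "integrable lborel (\<lambda>y. K t (v + y) * cos ((v + y) \<bullet> v - 1))"
    using integrable_lborel_translation[OF i0(3), of v] by simp
  \<comment> \<open>\<open>v\<close> is a unit vector, so a translation by \<open>v\<close> shifts
    the phase by exactly 1; hence the constant \<open>1 - cos 1\<close>.\<close>
  have e: "(v + y) \<bullet> v - 1 = y \<bullet> v" for y by (simp add: inner_add_left vv)
  have "(LBINT y. K t (v + y) * cos (y \<bullet> v)) = (LBINT y. K t (v + y) * cos ((v + y) \<bullet> v - 1))"
    unfolding e ..
  also have "\<dots> = (LBINT y. K t y * cos (y \<bullet> v - 1))"
    by (rule integral_lborel_translation[where f="\<lambda>y. K t y * cos (y \<bullet> v - 1)"])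
  also have "\<dots> = (LBINT y. cos 1 * (K t y * cos (y \<bullet> v)) + sin 1 * (K t y * sin (y \<bullet> v)))"
    by (simp add: cos_diff algebra_simps)
  also have "\<dots> = cos 1 * exp (- t * \<psi> v)"
    using i0 by (simp add: K_fourier_cos[OF t] K_fourier_sin)
  finally have A: "(LBINT y. K t (v + y) * cos (y \<bullet> v)) = cos 1 * exp (- t * \<psi> v)" .
  have i2: "integrable lborel (\<lambda>y. K t (v + y) * cos (y \<bullet> v))" using i1 unfolding e .
  have "(LBINT y. (K t (v + y) - K t y) * cos (y \<bullet> v)) = (cos 1 - 1) * exp (- t * \<psi> v)"
    using A i0 i2 by (simp add: left_diff_distrib K_fourier_cos[OF t])
  then have "(1 - cos 1) * exp (- t * \<psi> v) = \<bar>LBINT y. (K t (v + y) - K t y) * cos (y \<bullet> v)\<bar>"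
    by (simp add: abs_mult)
  also have "ennreal \<dots> \<le> (\<integral>\<^sup>+y. norm ((K t (v + y) - K t y) * cos (y \<bullet> v)) \<partial>lborel)"
    using integral_norm_bound_ennreal[of lborel "\<lambda>y. (K t (v + y) - K t y) * cos (y \<bullet> v)"] i0 i2
    by (simp add: left_diff_distrib)
  also have "\<dots> \<le> (\<integral>\<^sup>+y. (\<integral>\<^sup>+r. ennreal (norm (G t (y + r *\<^sub>R v))) * indicator {0..1} r \<partial>lborel) \<partial>lborel)"
  proof (rule nn_integral_mono)
    fix y
    have m: "continuous_on UNIV (\<lambda>r. G t (y + r *\<^sub>R v) \<bullet> v)"
      by (rule continuous_on_compose2[OF G_inner_continuous[OF t]]) (auto intro!: continuous_intros)
    have "ennreal (norm ((K t (v + y) - K t y) * cos (y \<bullet> v))) \<le> ennreal \<bar>K t (v + y) - K t y\<bar>"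
      by (intro ennreal_leI) (simp add: abs_mult mult_right_le_one_le)
    also have "ennreal \<bar>K t (v + y) - K t y\<bar> = ennreal \<bar>LBINT r. (G t (y + r *\<^sub>R v) \<bullet> v) * indicator {0..1} r\<bar>"
      using K_line_integral[OF t, of 1 y v] by (simp add: add.commute)
    also have "\<dots> \<le> (\<integral>\<^sup>+r. norm ((G t (y + r *\<^sub>R v) \<bullet> v) * indicator {0..1} r) \<partial>lborel)"
    proof -
      have "set_integrable lborel {0..1} (\<lambda>r. G t (y + r *\<^sub>R v) \<bullet> v)"
        using m by (intro borel_integrable_atLeastAtMost') (auto intro: continuous_on_subset)
      then have "integrable lborel (\<lambda>r. (G t (y + r *\<^sub>R v) \<bullet> v) * indicator {0..1} r)"
        by (simp add: set_integrable_def mult.commute)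
      from integral_norm_bound_ennreal[OF this] show ?thesis by simp
    qed
    also have "\<dots> \<le> (\<integral>\<^sup>+r. ennreal (norm (G t (y + r *\<^sub>R v))) * indicator {0..1} r \<partial>lborel)"
    proof (rule nn_integral_mono)
      fix r :: real
      have "\<bar>G t (y + r *\<^sub>R v) \<bullet> v\<bar> \<le> norm (G t (y + r *\<^sub>R v))"
        using Cauchy_Schwarz_ineq2[of "G t (y + r *\<^sub>R v)" v] v by simp
      then show "ennreal (norm ((G t (y + r *\<^sub>R v) \<bullet> v) * indicator {0..1} r)) \<le> ennreal (norm (G t (y + r *\<^sub>R v))) * indicator {0..1} r"
        by (auto simp: indicator_def intro: ennreal_leI)
    qed
    finally show "ennreal (norm ((K t (v + y) - K t y) * cos (y \<bullet> v))) \<le> (\<integral>\<^sup>+r. ennreal (norm (G t (y + r *\<^sub>R v))) * indicator {0..1} r \<partial>lborel)" .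
  qed
  also have "\<dots> = (\<integral>\<^sup>+r. (\<integral>\<^sup>+y. ennreal (norm (G t (y + r *\<^sub>R v))) * indicator {0..1} r \<partial>lborel) \<partial>lborel)"
    by (rule lborel_pair.Fubini'[symmetric]) measurable
  \<comment> \<open>By translation invariance every point of the segment from 0 to \<open>v\<close>
    contributes the same gradient mass, and the segment has length 1.\<close>
  also have "\<dots> = (\<integral>\<^sup>+r. (\<integral>\<^sup>+y. ennreal (norm (G t y)) \<partial>lborel) * indicator {0..1} (r::real) \<partial>lborel)"
  proof (rule nn_integral_cong)
    fix r :: real
    have "(\<integral>\<^sup>+y. ennreal (norm (G t (y + r *\<^sub>R v))) * indicator {0..1} r \<partial>lborel) = (\<integral>\<^sup>+y. ennreal (norm (G t (r *\<^sub>R v + y))) \<partial>lborel) * indicator {0..1} r"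
      by (subst nn_integral_multc) (auto simp: add.commute)
    also have "(\<integral>\<^sup>+y. ennreal (norm (G t (r *\<^sub>R v + y))) \<partial>lborel) = (\<integral>\<^sup>+y. ennreal (norm (G t y)) \<partial>lborel)"
      by (rule nn_integral_lborel_translation) measurable
    finally show "(\<integral>\<^sup>+y. ennreal (norm (G t (y + r *\<^sub>R v))) * indicator {0..1} r \<partial>lborel) = (\<integral>\<^sup>+y. ennreal (norm (G t y)) \<partial>lborel) * indicator {0..1} r" .
  qed
  also have "\<dots> = (\<integral>\<^sup>+y. ennreal (norm (G t y)) \<partial>lborel)"
    by (subst nn_integral_cmult) auto
  finally show ?thesis .
qed

text \<open>A smooth substitute for the mass outside a ball: the integral of \<open>K\<close>
  against a Gaussian is explicit on the frequency side, so concentration at the origin follows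
  without a tail estimate.\<close>

lemma K_gaussian_tail:
  assumes T: "\<And>j. T j > 0" "T \<longlonglongrightarrow> 0"
  shows "(\<lambda>j. LBINT z. K (T j) z * (1 - exp (- (1 / 4) * (norm z)\<^sup>2))) \<longlonglongrightarrow> 0"
proof -
  have "(\<lambda>j. LBINT w. exp (- T j * \<psi> w) * exp (- (norm w)\<^sup>2)) \<longlonglongrightarrow> (LBINT w. exp (- (norm (w::'a))\<^sup>2))"
  proof (rule integral_dominated_convergence)
    show "integrable lborel (\<lambda>w::'a. exp (- (norm w)\<^sup>2))" using integrable_gaussian[of 1, where 'a='a] by simp
    show "AE w in lborel. (\<lambda>j. exp (- T j * \<psi> w) * exp (- (norm w)\<^sup>2)) \<longlonglongrightarrow> exp (- (norm w)\<^sup>2)"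
    proof (rule AE_I2)
      fix w
      have "(\<lambda>j. exp (- T j * \<psi> w) * exp (- (norm w)\<^sup>2)) \<longlonglongrightarrow> exp (- 0 * \<psi> w) * exp (- (norm w)\<^sup>2)"
        by (intro tendsto_intros T)
      then show "(\<lambda>j. exp (- T j * \<psi> w) * exp (- (norm w)\<^sup>2)) \<longlonglongrightarrow> exp (- (norm w)\<^sup>2)" by simp
    qed
    show "AE w in lborel. norm (exp (- T j * \<psi> w) * exp (- (norm w)\<^sup>2)) \<le> exp (- (norm w)\<^sup>2)" for j
      using T(1)[of j] by (auto intro!: AE_I2 mult_left_le_one_le simp: abs_mult \<psi>_nonneg)
  qed measurable
  then have "(\<lambda>j. 1 - 1 / sqrt pi ^ DIM('a) * (LBINT w. exp (- T j * \<psi> w) * exp (- (norm w)\<^sup>2))) \<longlonglongrightarrow> 1 - 1 / sqrt pi ^ DIM('a) * (LBINT w. exp (- (norm (w::'a))\<^sup>2))"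
    by (intro tendsto_intros)
  moreover have "1 - 1 / sqrt pi ^ DIM('a) * (LBINT w. exp (- (norm (w::'a))\<^sup>2)) = 0"
    using integral_gaussian[of 1, where 'a='a] by simp
  moreover have "(LBINT z. K (T j) z * (1 - exp (- (1 / 4) * (norm z)\<^sup>2))) = 1 - 1 / sqrt pi ^ DIM('a) * (LBINT w. exp (- T j * \<psi> w) * exp (- (norm w)\<^sup>2))" for j
  proof -
    have d: "has_bochner_integral lborel (\<lambda>z. K (T j) z * exp (- (1 / 4) * (norm z)\<^sup>2)) (1 / sqrt pi ^ DIM('a) * (LBINT w. exp (- T j * \<psi> w) * exp (- (norm w)\<^sup>2)))"
      using K_gaussian_damped[OF T(1)[of j], of 1 0] by simp
    have "has_bochner_integral lborel (\<lambda>z. K (T j) z - K (T j) z * exp (- (1 / 4) * (norm z)\<^sup>2)) (1 - 1 / sqrt pi ^ DIM('a) * (LBINT w. exp (- T j * \<psi> w) * exp (- (norm w)\<^sup>2)))"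
      by (intro has_bochner_integral_diff d) (use K_has_integral_1[OF T(1)[of j]] in \<open>simp add: \<psi>_0\<close>)
    then show ?thesis by (simp add: right_diff_distrib has_bochner_integral_iff)
  qed
  ultimately show ?thesis by (simp only:)
qed

text \<open>The integrand may change with \<open>j\<close>, as it does when the time argument of a
  test function moves with the shrinking time lag. Near the origin it is close to \<open>L\<close>;
  away from it the Gaussian tail weight is bounded below.\<close>

lemma K_approx_identity:
  fixes f :: "nat \<Rightarrow> 'a \<Rightarrow> real"
  assumes T: "\<And>j. T j > 0" "T \<longlonglongrightarrow> 0"
    and [measurable]: "\<And>j. f j \<in> borel_measurable borel" and B: "\<And>j z. \<bar>f j z\<bar> \<le> B"
    and lim: "\<And>\<epsilon>. \<epsilon> > 0 \<Longrightarrow> \<exists>\<delta>>0. \<forall>\<^sub>F j in sequentially. \<forall>z. norm z < \<delta> \<longrightarrow> \<bar>f j z - L\<bar> \<le> \<epsilon>"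
  shows "(\<lambda>j. LBINT z. K (T j) z * f j z) \<longlonglongrightarrow> L"
proof (rule tendstoI)
  fix e :: real assume e: "e > 0"
  obtain \<delta> where \<delta>: "\<delta> > 0" and ev: "\<forall>\<^sub>F j in sequentially. \<forall>z. norm z < \<delta> \<longrightarrow> \<bar>f j z - L\<bar> \<le> e / 2"
    using lim[of "e / 2"] e by auto
  define g where "g z = 1 - exp (- (1 / 4) * (norm z)\<^sup>2)" for z :: 'a
  have [measurable]: "g \<in> borel_measurable borel" unfolding g_def by measurable
  define \<kappa> where "\<kappa> = 1 - exp (- (1 / 4) * \<delta>\<^sup>2)"
  have \<kappa>: "\<kappa> > 0" using \<delta> by (simp add: \<kappa>_def)
  have g0: "0 \<le> g z" "g z \<le> 1" for z by (auto simp: g_def)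
  have gk: "\<kappa> \<le> g z" if "norm z \<ge> \<delta>" for z
    using that \<delta> power_mono[of \<delta> "norm z" 2] by (simp add: g_def \<kappa>_def)
  have B0: "B \<ge> 0" using order.trans[OF abs_ge_zero B] .
  define M where "M = (B + \<bar>L\<bar>) / \<kappa>"
  have M0: "M \<ge> 0" using B0 \<kappa> by (simp add: M_def)
  have "(\<lambda>j. M * (LBINT z. K (T j) z * g z)) \<longlonglongrightarrow> M * 0"
    unfolding g_def by (intro tendsto_intros K_gaussian_tail T)
  then have "\<forall>\<^sub>F j in sequentially. M * (LBINT z. K (T j) z * g z) < e / 2"
    using e by (intro order_tendstoD) auto
  with ev show "\<forall>\<^sub>F j in sequentially. dist (LBINT z. K (T j) z * f j z) L < e"
  proof eventually_elim
    case (elim j)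
    have i1: "integrable lborel (\<lambda>z. K (T j) z * f j z)" using integrable_K_mult[of "f j" B "T j"] B by simp
    have i2: "integrable lborel (\<lambda>z. K (T j) z * g z)" using integrable_K_mult[of g 1 "T j"] g0 by simp
    have i3: "integrable lborel (\<lambda>z. K (T j) z * L)" using K_integrable by simp
    have "(LBINT z. K (T j) z * f j z) - L = (LBINT z. K (T j) z * f j z - K (T j) z * L)"
      using i1 i3 by (simp add: K_integral T)
    also have "\<bar>\<dots>\<bar> \<le> (LBINT z. e / 2 * K (T j) z + M * (K (T j) z * g z))"
    proof (intro order.trans[OF integral_abs_bound] integral_mono')
      show "integrable lborel (\<lambda>z. e / 2 * K (T j) z + M * (K (T j) z * g z))"
        by (intro Bochner_Integration.integrable_add integrable_mult_right i2 K_integrable)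
      fix z
      have "\<bar>f j z - L\<bar> \<le> e / 2 + M * g z"
      proof (cases "norm z < \<delta>")
        case True
        then show ?thesis using elim(1) M0 g0[of z] by (meson add_increasing2 mult_nonneg_nonneg)
      next
        case False
        have "\<bar>f j z - L\<bar> \<le> B + \<bar>L\<bar>" using B[of j z] by linarith
        also have "\<dots> = M * \<kappa>" using \<kappa> by (simp add: M_def)
        also have "\<dots> \<le> M * g z" using False by (intro mult_left_mono gk M0) auto
        finally show ?thesis using e by simp
      qed
      then have "K (T j) z * \<bar>f j z - L\<bar> \<le> K (T j) z * (e / 2 + M * g z)" by (intro mult_left_mono K_nonneg)
      moreover have "\<bar>K (T j) z * f j z - K (T j) z * L\<bar> = K (T j) z * \<bar>f j z - L\<bar>"
        by (simp only: right_diff_distrib[symmetric] abs_mult abs_of_nonneg[OF K_nonneg])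
      ultimately show "\<bar>K (T j) z * f j z - K (T j) z * L\<bar> \<le> e / 2 * K (T j) z + M * (K (T j) z * g z)"
        by (simp only: distrib_left mult_ac)
      then show "0 \<le> e / 2 * K (T j) z + M * (K (T j) z * g z)" by linarith
    qed
    also have "\<dots> = e / 2 + M * (LBINT z. K (T j) z * g z)"
      using i2 K_integrable by (simp add: K_integral T)
    finally show ?case using elim(2) by (simp add: dist_real_def)
  qed
qed

end

section \<open>The majorant of the perturbation series\<close>

lemma nn_integral_lborel_pair:
  fixes f :: "real \<times> 'a::euclidean_space \<Rightarrow> ennreal"
  assumes [measurable]: "f \<in> borel_measurable borel"
  shows "(\<integral>\<^sup>+W. f W \<partial>lborel) = (\<integral>\<^sup>+u. (\<integral>\<^sup>+z. f (u, z) \<partial>lborel) \<partial>lborel)"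
  unfolding lborel_prod[symmetric] by (rule lborel.nn_integral_fst[symmetric]) (simp add: lborel_prod)

text \<open>A time slice is a null set in space-time, so integrals may be split at time
  \<open>u\<close> without assigning the slice to either side.\<close>

lemma AE_lborel_fst_neq: "AE W in (lborel :: (real \<times> 'a::euclidean_space) measure). fst W \<noteq> u"
proof (rule AE_I)
  show "{W \<in> space lborel. \<not> fst W \<noteq> u} \<subseteq> {u} \<times> (UNIV :: 'a set)" by auto
  have m: "{u} \<times> (UNIV :: 'a set) \<in> sets borel" by (intro borel_closed closed_Times) auto
  have "emeasure lborel ({u} \<times> (UNIV :: 'a set)) = (\<integral>\<^sup>+W. indicator ({u} \<times> (UNIV :: 'a set)) W \<partial>lborel)"
    using m by simp
  also have "\<dots> = (\<integral>\<^sup>+a. (\<integral>\<^sup>+z. indicator ({u} \<times> (UNIV :: 'a set)) (a, z) \<partial>lborel) \<partial>lborel)"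
    using m by (intro nn_integral_lborel_pair) auto
  also have "\<dots> = (\<integral>\<^sup>+a. emeasure lborel (UNIV :: 'a set) * indicator {u} a \<partial>lborel)"
    by (intro nn_integral_cong) (auto simp: indicator_def)
  also have "\<dots> = 0" by (subst nn_integral_cmult) auto
  finally show "emeasure lborel ({u} \<times> (UNIV :: 'a set)) = 0" .
  show "{u} \<times> (UNIV :: 'a set) \<in> sets lborel" using m by simp
qed

section \<open>Superadditive functions and subdivision of time\<close>

lemma superadditive_mono:
  assumes "superadditive Q" "\<And>s t. 0 \<le> Q s t" "s \<le> s'" "s' < t'" "t' \<le> t"
  shows "Q s' t' \<le> Q s t"
proof -
  have sup: "Q r u + Q u v \<le> Q r v" if "r < u" "u < v" for r u v
    using assms(1) that by (auto simp: superadditive_def)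
  have "Q s' t' \<le> Q s t'"
    using sup[of s s' t'] assms(2)[of s s'] assms(3,4) by (cases "s = s'") auto
  also have "\<dots> \<le> Q s t"
    using sup[of s t' t] assms(2)[of t' t] assms(3-5) by (cases "t' = t") auto
  finally show ?thesis .
qed

text \<open>\<open>inner_le Q s t c\<close> bounds only the intervals strictly inside \<open>(s, t)\<close>: a superadditive
  \<open>Q\<close> may jump at an endpoint, and no subdivision makes \<open>Q\<close> itself small there.\<close>

definition inner_le :: "(real \<Rightarrow> real \<Rightarrow> real) \<Rightarrow> real \<Rightarrow> real \<Rightarrow> real \<Rightarrow> bool" where
  "inner_le Q s t c \<longleftrightarrow> (\<forall>s' t'. s < s' \<longrightarrow> s' < t' \<longrightarrow> t' < t \<longrightarrow> Q s' t' \<le> c)"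

lemma inner_le_subinterval:
  "inner_le Q s t c \<Longrightarrow> s \<le> s' \<Longrightarrow> t' \<le> t \<Longrightarrow> inner_le Q s' t' c"
  by (auto simp: inner_le_def)

text \<open>The cut is made at the last time up to which all inner intervals have weight at most
  \<open>h\<close>. Any later time admits an inner interval of larger weight to its left, and
  superadditivity deducts that \<open>h\<close> from the budget \<open>Suc n * h\<close>.\<close>

lemma superadditive_cut:
  assumes Q: "superadditive Q" "\<And>s t. 0 \<le> Q s t" and h: "h > 0" and st: "s < t"
    and bound: "inner_le Q s t (real (Suc n) * h)"
  shows "inner_le Q s t h \<or> (\<exists>u. s < u \<and> u < t \<and> inner_le Q s u h \<and> inner_le Q u t (real n * h))"
proof (cases "inner_le Q s t h")
  case False
  have sup: "Q r u + Q u v \<le> Q r v" if "r < u" "u < v" for r u v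
    using Q(1) that by (auto simp: superadditive_def)
  define U where "U = {u. s < u \<and> u \<le> t \<and> inner_le Q s u h}"
  \<comment> \<open>As \<open>u\<close> decreases to \<open>s\<close> the weight
    \<open>Q s u\<close> decreases but need not tend to 0. Once it is within \<open>h\<close> of its
    infimum, no inner interval of weight above \<open>h\<close> fits in.\<close>
  have ex: "\<exists>u\<in>U. u < t"
  proof -
    define F where "F = Q s ` {s<..<t}"
    have ne: "F \<noteq> {}" using st by (auto simp: F_def dense)
    have bdd: "bdd_below F" using Q(2) by (auto simp: F_def bdd_below_def)
    obtain f where f: "f \<in> F" "f < Inf F + h"
      using h cInf_lessD[OF ne, of "Inf F + h"] by auto
    then obtain u where u: "s < u" "u < t" "Q s u < Inf F + h" by (auto simp: F_def)
    have "inner_le Q s u h"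
      unfolding inner_le_def
    proof (intro allI impI)
      fix s' t' assume *: "s < s'" "s' < t'" "t' < u"
      have "Inf F + Q s' t' \<le> Q s s' + Q s' t'"
        using * u by (intro add_right_mono cInf_lower bdd) (auto simp: F_def)
      also have "\<dots> \<le> Q s t'" using * by (intro sup) auto
      also have "\<dots> \<le> Q s u" using * u by (intro superadditive_mono[OF Q]) auto
      finally show "Q s' t' \<le> h" using u by simp
    qed
    with u show ?thesis by (auto simp: U_def)
  qed
  define u1 where "u1 = Sup U"
  have bdd: "bdd_above U" by (auto simp: U_def bdd_above_def)
  from ex obtain u0 where u0: "u0 \<in> U" "u0 < t" by auto
  have su: "s < u1" using u0 cSup_upper[OF u0(1) bdd] by (auto simp: U_def u1_def)
  have ut: "u1 \<le> t" unfolding u1_def using u0(1) by (intro cSup_least) (auto simp: U_def)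
  have small: "inner_le Q s u1 h"
    unfolding inner_le_def
  proof (intro allI impI)
    fix s' t' assume *: "s < s'" "s' < t'" "t' < u1"
    then obtain u where "u \<in> U" "t' < u" using less_cSupD[of U t'] u0 by (auto simp: u1_def)
    with * show "Q s' t' \<le> h" by (auto simp: U_def inner_le_def)
  qed
  have "u1 < t" using ut small False by (cases "u1 = t") auto
  moreover have "inner_le Q u1 t (real n * h)"
    unfolding inner_le_def
  proof (intro allI impI)
    fix s'' t'' assume *: "u1 < s''" "s'' < t''" "t'' < t"
    have "s'' \<notin> U" using * cSup_upper[OF _ bdd, of s''] by (auto simp: u1_def)
    then have "\<not> inner_le Q s s'' h" using * su by (auto simp: U_def)
    then obtain s' t' where st': "s < s'" "s' < t'" "t' < s''" "h < Q s' t'" by (auto simp: inner_le_def)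
    have "h + Q s'' t'' \<le> Q s' t' + (Q t' s'' + Q s'' t'')" using st' Q(2)[of t' s''] by simp
    also have "\<dots> \<le> Q s' t' + Q t' t''" using st' * by (intro add_left_mono sup) auto
    also have "\<dots> \<le> Q s' t''" using st' * by (intro sup) auto
    also have "\<dots> \<le> real (Suc n) * h" using bound st' * by (auto simp: inner_le_def)
    finally show "Q s'' t'' \<le> real n * h" by (simp add: algebra_simps)
  qed
  ultimately show ?thesis using su small by blast
qed simp

text \<open>Points are pairs of time and position, so a space-time integral is a single Lebesgue
  integral. \<open>B W Y\<close> is the drift at \<open>W\<close> contracted with the gradient of
  \<open>p\<close> in its starting point. Since \<open>p\<close> and \<open>B\<close> vanish unless
  time increases, the integrals carry no explicit time limits. The equation for \<open>B\<close> is
  that of \<open>p\<close> differentiated in the starting point; \<open>B\<close> is signed, so it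
  is stated with absolute convergence.\<close>

locale perturbation =
  fixes p B :: "real \<times> 'a::euclidean_space \<Rightarrow> real \<times> 'a \<Rightarrow> real"
    and \<eta> :: real and Q :: "real \<Rightarrow> real \<Rightarrow> real"
  assumes p_meas0: "(\<lambda>(X, Y). p X Y) \<in> borel_measurable (borel \<Otimes>\<^sub>M borel)"
    and B_meas0: "(\<lambda>(X, Y). B X Y) \<in> borel_measurable (borel \<Otimes>\<^sub>M borel)"
    and p_nonneg: "\<And>X Y. 0 \<le> p X Y"
    and p_zero: "\<And>X Y. fst Y \<le> fst X \<Longrightarrow> p X Y = 0"
    and B_zero: "\<And>X Y. fst Y \<le> fst X \<Longrightarrow> B X Y = 0"
    and p_CK: "\<And>X Y u. fst X < u \<Longrightarrow> u < fst Y \<Longrightarrow>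
       (\<integral>\<^sup>+z. ennreal (p X (u, z)) * ennreal (p (u, z) Y) \<partial>lborel) = ennreal (p X Y)"
    and B_CK: "\<And>X Y u. fst X < u \<Longrightarrow> u < fst Y \<Longrightarrow>
       has_bochner_integral lborel (\<lambda>z. B X (u, z) * p (u, z) Y) (B X Y)"
    and kernel_bound: "\<And>X Y. fst X < fst Y \<Longrightarrow>
       (\<integral>\<^sup>+W. ennreal (p X W) * ennreal \<bar>B W Y\<bar> \<partial>lborel) \<le> ennreal ((\<eta> + Q (fst X) (fst Y)) * p X Y)"
    and \<eta>: "0 \<le> \<eta>" "\<eta> < 1 / 2"
    and Q_nonneg: "\<And>s t. 0 \<le> Q s t" and Q_super: "superadditive Q"
begin

section \<open>The majorant as least supersolution, and its bounds\<close>

lemma p_meas [measurable (raw)]: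
  "f \<in> borel_measurable M \<Longrightarrow> g \<in> borel_measurable M \<Longrightarrow> (\<lambda>x. p (f x) (g x)) \<in> borel_measurable M"
  using measurable_compose[OF measurable_Pair p_meas0, of f M g] by simp

lemma B_meas [measurable (raw)]:
  "f \<in> borel_measurable M \<Longrightarrow> g \<in> borel_measurable M \<Longrightarrow> (\<lambda>x. B (f x) (g x)) \<in> borel_measurable M"
  using measurable_compose[OF measurable_Pair B_meas0, of f M g] by simp

text \<open>Majorants of the terms of the series. Extended nonnegative values leave measurability as
  the only side condition; finiteness comes out of the bounds.\<close>

primrec P :: "nat \<Rightarrow> real \<times> 'a \<Rightarrow> real \<times> 'a \<Rightarrow> ennreal" where
  "P 0 X Y = ennreal (p X Y)"
| "P (Suc k) X Y = (\<integral>\<^sup>+W. P k X W * ennreal \<bar>B W Y\<bar> \<partial>lborel)"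

definition S :: "real \<times> 'a \<Rightarrow> real \<times> 'a \<Rightarrow> ennreal" where
  "S X Y = (\<Sum>k. P k X Y)"

lemma P_meas0: "(\<lambda>(X, Y). P k X Y) \<in> borel_measurable (borel \<Otimes>\<^sub>M borel)"
proof (induction k)
  case 0
  show ?case by simp
next
  case (Suc k)
  have [measurable]: "f \<in> borel_measurable M \<Longrightarrow> g \<in> borel_measurable M \<Longrightarrow> (\<lambda>x. P k (f x) (g x)) \<in> borel_measurable M"
    for f g :: "'c \<Rightarrow> real \<times> 'a" and M
    using measurable_compose[OF measurable_Pair Suc, of f M g] by simp
  show ?case by simp
qed

lemma P_meas [measurable (raw)]:
  "f \<in> borel_measurable M \<Longrightarrow> g \<in> borel_measurable M \<Longrightarrow> (\<lambda>x. P k (f x) (g x)) \<in> borel_measurable M"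
  using measurable_compose[OF measurable_Pair P_meas0, of f M g] by simp

lemma S_meas [measurable (raw)]:
  "f \<in> borel_measurable M \<Longrightarrow> g \<in> borel_measurable M \<Longrightarrow> (\<lambda>x. S (f x) (g x)) \<in> borel_measurable M"
  unfolding S_def by measurable

lemma P_zero: "fst Y \<le> fst X \<Longrightarrow> P k X Y = 0"
proof (induction k arbitrary: Y)
  case 0 then show ?case by (simp add: p_zero)
next
  case (Suc k)
  have z: "P k X W * ennreal \<bar>B W Y\<bar> = 0" for W
    using Suc.IH[of W] Suc.prems B_zero[of Y W] by (cases "fst W \<le> fst X") auto
  show ?case unfolding P.simps z by simp
qed

lemma S_zero: "fst Y \<le> fst X \<Longrightarrow> S X Y = 0"
  by (simp add: S_def P_zero)

lemma S_equation: "S X Y = ennreal (p X Y) + (\<integral>\<^sup>+W. S X W * ennreal \<bar>B W Y\<bar> \<partial>lborel)"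
proof -
  have "S X Y = P 0 X Y + (\<Sum>k. P (Suc k) X Y)"
    unfolding S_def using suminf_offset[of "\<lambda>k. P k X Y" 1] by simp
  also have "(\<Sum>k. P (Suc k) X Y) = (\<integral>\<^sup>+W. (\<Sum>k. P k X W * ennreal \<bar>B W Y\<bar>) \<partial>lborel)"
    by (subst nn_integral_suminf) auto
  also have "\<dots> = (\<integral>\<^sup>+W. S X W * ennreal \<bar>B W Y\<bar> \<partial>lborel)"
    by (simp add: S_def)
  finally show ?thesis by simp
qed

text \<open>\<open>S\<close> is the least supersolution, so exhibiting a supersolution bounds \<open>S\<close>.\<close>

lemma S_least:
  assumes V: "\<And>Y. ennreal (p X Y) + (\<integral>\<^sup>+W. V W * ennreal \<bar>B W Y\<bar> \<partial>lborel) \<le> V Y"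
  shows "S X Y \<le> V Y"
proof -
  have "(\<Sum>k<N. P k X Y) \<le> V Y" for N Y
  proof (induction N arbitrary: Y)
    case (Suc N)
    have "(\<Sum>k<Suc N. P k X Y) = P 0 X Y + (\<Sum>k<N. P (Suc k) X Y)"
      by (rule sum.lessThan_Suc_shift)
    also have "(\<Sum>k<N. P (Suc k) X Y) = (\<integral>\<^sup>+W. (\<Sum>k<N. P k X W) * ennreal \<bar>B W Y\<bar> \<partial>lborel)"
      by (simp add: nn_integral_sum sum_distrib_right)
    also have "P 0 X Y + \<dots> \<le> ennreal (p X Y) + (\<integral>\<^sup>+W. V W * ennreal \<bar>B W Y\<bar> \<partial>lborel)"
      using Suc.IH by (intro add_mono nn_integral_mono mult_right_mono) auto
    also have "\<dots> \<le> V Y" by (rule V)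
    finally show ?case .
  qed simp
  then show ?thesis unfolding S_def by (intro suminf_le_const) auto
qed

lemma B_CK_le:
  assumes "fst X < u" "u < fst Y"
  shows "ennreal \<bar>B X Y\<bar> \<le> (\<integral>\<^sup>+z. ennreal \<bar>B X (u, z)\<bar> * ennreal (p (u, z) Y) \<partial>lborel)"
proof -
  note hb = B_CK[OF assms]
  have "ennreal \<bar>B X Y\<bar> \<le> (\<integral>\<^sup>+z. norm (B X (u, z) * p (u, z) Y) \<partial>lborel)"
    using integral_norm_bound_ennreal[of lborel "\<lambda>z. B X (u, z) * p (u, z) Y"] hb
    by (simp add: has_bochner_integral_iff)
  also have "\<dots> = (\<integral>\<^sup>+z. ennreal \<bar>B X (u, z)\<bar> * ennreal (p (u, z) Y) \<partial>lborel)"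
    by (intro nn_integral_cong) (simp add: abs_mult p_nonneg ennreal_mult)
  finally show ?thesis .
qed

text \<open>Chapman-Kolmogorov inserts time \<open>s'\<close> before \<open>W\<close> and, as an
  inequality for \<open>\<bar>B\<bar>\<close>, time \<open>t'\<close> after it. The integral over
  \<open>W\<close> is then covered by the kernel bound on \<open>(s', t')\<close>, and two further
  applications reassemble \<open>p X Y\<close>.\<close>

lemma kernel_bound_inner:
  assumes XY: "fst X < s'" "s' < t'" "t' < fst Y"
  shows "(\<integral>\<^sup>+W. indicator {W. s' < fst W \<and> fst W < t'} W * (ennreal (p X W) * ennreal \<bar>B W Y\<bar>) \<partial>lborel)
     \<le> ennreal (\<eta> + Q s' t') * ennreal (p X Y)"
proof -
  have "(\<integral>\<^sup>+W. indicator {W. s' < fst W \<and> fst W < t'} W * (ennreal (p X W) * ennreal \<bar>B W Y\<bar>) \<partial>lborel)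
     \<le> (\<integral>\<^sup>+W. (\<integral>\<^sup>+z. (\<integral>\<^sup>+z'. ennreal (p X (s', z)) * (ennreal (p (s', z) W) * ennreal \<bar>B W (t', z')\<bar>) * ennreal (p (t', z') Y) \<partial>lborel) \<partial>lborel) \<partial>lborel)"
  proof (rule nn_integral_mono)
    fix W :: "real \<times> 'a"
    show "indicator {W. s' < fst W \<and> fst W < t'} W * (ennreal (p X W) * ennreal \<bar>B W Y\<bar>) \<le>
      (\<integral>\<^sup>+z. (\<integral>\<^sup>+z'. ennreal (p X (s', z)) * (ennreal (p (s', z) W) * ennreal \<bar>B W (t', z')\<bar>) * ennreal (p (t', z') Y) \<partial>lborel) \<partial>lborel)"
    proof (cases "s' < fst W \<and> fst W < t'")
      case True
      have "ennreal (p X W) * ennreal \<bar>B W Y\<bar> \<le>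
         (\<integral>\<^sup>+z. ennreal (p X (s', z)) * ennreal (p (s', z) W) \<partial>lborel) * (\<integral>\<^sup>+z'. ennreal \<bar>B W (t', z')\<bar> * ennreal (p (t', z') Y) \<partial>lborel)"
        using True XY by (intro mult_mono B_CK_le) (auto simp: p_CK)
      also have "\<dots> = (\<integral>\<^sup>+z. (\<integral>\<^sup>+z'. ennreal (p X (s', z)) * (ennreal (p (s', z) W) * ennreal \<bar>B W (t', z')\<bar>) * ennreal (p (t', z') Y) \<partial>lborel) \<partial>lborel)"
        by (subst nn_integral_multc[symmetric], simp, subst nn_integral_cmult[symmetric], simp) (simp only: mult.assoc)
      finally show ?thesis using True by simp
    qed simp
  qed
  also have "\<dots> = (\<integral>\<^sup>+z. (\<integral>\<^sup>+W. (\<integral>\<^sup>+z'. ennreal (p X (s', z)) * (ennreal (p (s', z) W) * ennreal \<bar>B W (t', z')\<bar>) * ennreal (p (t', z') Y) \<partial>lborel) \<partial>lborel) \<partial>lborel)"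
    by (rule lborel_pair.Fubini') measurable
  also have "\<dots> = (\<integral>\<^sup>+z. (\<integral>\<^sup>+z'. (\<integral>\<^sup>+W. ennreal (p X (s', z)) * (ennreal (p (s', z) W) * ennreal \<bar>B W (t', z')\<bar>) * ennreal (p (t', z') Y) \<partial>lborel) \<partial>lborel) \<partial>lborel)"
    by (intro nn_integral_cong lborel_pair.Fubini') measurable
  also have "\<dots> = (\<integral>\<^sup>+z. (\<integral>\<^sup>+z'. ennreal (p X (s', z)) * (\<integral>\<^sup>+W. ennreal (p (s', z) W) * ennreal \<bar>B W (t', z')\<bar> \<partial>lborel) * ennreal (p (t', z') Y) \<partial>lborel) \<partial>lborel)"
    by (intro nn_integral_cong) (simp add: nn_integral_multc nn_integral_cmult)
  also have "\<dots> \<le> (\<integral>\<^sup>+z. (\<integral>\<^sup>+z'. ennreal (p X (s', z)) * (ennreal (\<eta> + Q s' t') * ennreal (p (s', z) (t', z'))) * ennreal (p (t', z') Y) \<partial>lborel) \<partial>lborel)"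
  proof (intro nn_integral_mono mult_right_mono mult_left_mono)
    fix z z'
    show "(\<integral>\<^sup>+W. ennreal (p (s', z) W) * ennreal \<bar>B W (t', z')\<bar> \<partial>lborel) \<le> ennreal (\<eta> + Q s' t') * ennreal (p (s', z) (t', z'))"
      using kernel_bound[of "(s', z)" "(t', z')"] XY \<eta> Q_nonneg[of s' t'] by (simp add: ennreal_mult p_nonneg)
  qed auto
  also have "\<dots> = (\<integral>\<^sup>+z. ennreal (\<eta> + Q s' t') * (ennreal (p X (s', z)) * (\<integral>\<^sup>+z'. ennreal (p (s', z) (t', z')) * ennreal (p (t', z') Y) \<partial>lborel)) \<partial>lborel)"
  proof (rule nn_integral_cong)
    fix z
    have "(\<integral>\<^sup>+z'. ennreal (p X (s', z)) * (ennreal (\<eta> + Q s' t') * ennreal (p (s', z) (t', z'))) * ennreal (p (t', z') Y) \<partial>lborel) =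
       (\<integral>\<^sup>+z'. (ennreal (\<eta> + Q s' t') * ennreal (p X (s', z))) * (ennreal (p (s', z) (t', z')) * ennreal (p (t', z') Y)) \<partial>lborel)"
      by (simp only: mult_ac)
    also have "\<dots> = (ennreal (\<eta> + Q s' t') * ennreal (p X (s', z))) * (\<integral>\<^sup>+z'. ennreal (p (s', z) (t', z')) * ennreal (p (t', z') Y) \<partial>lborel)"
      by (rule nn_integral_cmult) measurable
    finally show "(\<integral>\<^sup>+z'. ennreal (p X (s', z)) * (ennreal (\<eta> + Q s' t') * ennreal (p (s', z) (t', z'))) * ennreal (p (t', z') Y) \<partial>lborel) =
       ennreal (\<eta> + Q s' t') * (ennreal (p X (s', z)) * (\<integral>\<^sup>+z'. ennreal (p (s', z) (t', z')) * ennreal (p (t', z') Y) \<partial>lborel))"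
      by (simp only: mult.assoc)
  qed
  also have "\<dots> = ennreal (\<eta> + Q s' t') * ennreal (p X Y)"
    using XY by (simp add: p_CK nn_integral_cmult)
  finally show ?thesis .
qed

text \<open>By the Chapman-Kolmogorov equations only \<open>Q\<close> on compact subintervals enters the bound.\<close>

lemma kernel_bound_small:
  assumes XY: "fst X < fst Y" and h: "h \<ge> 0" and small: "inner_le Q (fst X) (fst Y) h"
  shows "(\<integral>\<^sup>+W. ennreal (p X W) * ennreal \<bar>B W Y\<bar> \<partial>lborel) \<le> ennreal (\<eta> + h) * ennreal (p X Y)"
proof -
  define s t where "s = fst X" and "t = fst Y"
  \<comment> \<open>The 3 in the denominator keeps the two cut times strictly inside and in order
    for every \<open>k\<close>, including \<open>k = 0\<close>.\<close>
  define A where "A k = {W :: real \<times> 'a. s + (t - s) / (real k + 3) < fst W \<and> fst W < t - (t - s) / (real k + 3)}" for k :: nat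
  let ?f = "\<lambda>W. ennreal (p X W) * ennreal \<bar>B W Y\<bar>"
  have [measurable]: "A k \<in> sets borel" for k
  proof -
    have "A k = {s + (t - s) / (real k + 3)<..<t - (t - s) / (real k + 3)} \<times> UNIV" by (auto simp: A_def)
    then show ?thesis by (simp add: borel_open open_Times)
  qed
  have st: "s < t" using XY by (simp add: s_def t_def)
  have mono: "(t - s) / (real k + 3) \<le> (t - s) / (real j + 3)" if "j \<le> k" for j k
    using st that by (intro divide_left_mono) auto
  have inc: "incseq (\<lambda>k W. indicator (A k) W * ?f W)"
  proof (rule incseq_SucI, rule le_funI)
    fix k W
    have "A k \<subseteq> A (Suc k)" using mono[of k "Suc k"] by (auto simp: A_def)
    then show "indicator (A k) W * ?f W \<le> indicator (A (Suc k)) W * ?f W"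
      by (intro mult_right_mono) (auto simp: indicator_def)
  qed
  have sup: "(SUP k. indicator (A k) W * ?f W) = ?f W" for W
  proof (cases "s < fst W \<and> fst W < t")
    case True
    have "(\<lambda>k. (t - s) / (real k + 3)) \<longlonglongrightarrow> 0"
      by (rule real_tendsto_divide_at_top[OF tendsto_const])
         (auto intro: filterlim_at_top_add_at_top filterlim_real_sequentially filterlim_tendsto_add_at_top[OF tendsto_const] simp: add.commute[of _ 3])
    then have "eventually (\<lambda>k. (t - s) / (real k + 3) < min (fst W - s) (t - fst W)) sequentially"
      using True by (intro order_tendstoD) auto
    then obtain k where "(t - s) / (real k + 3) < min (fst W - s) (t - fst W)"
      by (auto simp: eventually_sequentially)
    then have "W \<in> A k" by (auto simp: A_def)
    then have "?f W \<le> (SUP k. indicator (A k) W * ?f W)"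
      by (intro SUP_upper2[of k]) auto
    moreover have "(SUP k. indicator (A k) W * ?f W) \<le> ?f W"
      by (intro SUP_least) (auto simp: indicator_def)
    ultimately show ?thesis by (rule antisym[rotated])
  next
    case False
    then have z: "?f W = 0" using p_zero[of W X] B_zero[of Y W] by (auto simp: s_def t_def)
    show ?thesis unfolding z by simp
  qed
  have "(\<integral>\<^sup>+W. ?f W \<partial>lborel) = (\<integral>\<^sup>+W. (SUP k. indicator (A k) W * ?f W) \<partial>lborel)" unfolding sup ..
  also have "\<dots> = (SUP k. (\<integral>\<^sup>+W. indicator (A k) W * ?f W \<partial>lborel))"
    by (rule nn_integral_monotone_convergence_SUP[OF inc]) measurable
  also have "\<dots> \<le> ennreal (\<eta> + h) * ennreal (p X Y)"
  proof (rule SUP_least)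
    fix k :: nat
    define e where "e = (t - s) / (real k + 3)"
    have e0: "e > 0" using st by (simp add: e_def)
    have "e * 2 < e * (real k + 3)" using e0 by simp
    also have "\<dots> = t - s" by (simp add: e_def)
    finally have e: "s < s + e" "s + e < t - e" "t - e < t" using e0 by linarith+
    have "(\<integral>\<^sup>+W. indicator (A k) W * ?f W \<partial>lborel) \<le> ennreal (\<eta> + Q (s + e) (t - e)) * ennreal (p X Y)"
      using kernel_bound_inner[of X "s + e" "t - e" Y] e by (simp add: A_def e_def s_def t_def)
    also have "\<dots> \<le> ennreal (\<eta> + h) * ennreal (p X Y)"
      using small e by (intro mult_right_mono ennreal_leI) (auto simp: inner_le_def s_def t_def)
    finally show "(\<integral>\<^sup>+W. indicator (A k) W * ?f W \<partial>lborel) \<le> ennreal (\<eta> + h) * ennreal (p X Y)" .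
  qed
  finally show ?thesis .
qed

text \<open>With ratio \<open>\<theta>\<close> the multiple \<open>1 / (1 - \<theta>)\<close> of
  \<open>p\<close> is a supersolution, since
  \<open>1 + \<theta> / (1 - \<theta>) = 1 / (1 - \<theta>)\<close>. The second estimate leaves out
  the leading term \<open>p\<close>; it controls the distance between \<open>q\<close> and
  \<open>p\<close>.\<close>

lemma S_small:
  assumes st: "s < t" and h: "h \<ge> 0" "\<eta> + h < 1" and small: "inner_le Q s t h"
  shows "S (s, x) (t, y) \<le> ennreal (1 / (1 - (\<eta> + h))) * ennreal (p (s, x) (t, y))"
    and "(\<integral>\<^sup>+W. S (s, x) W * ennreal \<bar>B W (t, y)\<bar> \<partial>lborel) \<le> ennreal ((\<eta> + h) / (1 - (\<eta> + h))) * ennreal (p (s, x) (t, y))"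
proof -
  define X where "X = (s, x)"
  define \<theta> where "\<theta> = \<eta> + h"
  have \<theta>: "0 \<le> \<theta>" "\<theta> < 1" using h \<eta> by (auto simp: \<theta>_def)
  have fX: "fst X = s" by (simp add: X_def)
  \<comment> \<open>Beyond \<open>t\<close> the value infinity makes the supersolution inequality
    trivial. It is not seen from times up to \<open>t\<close>, because \<open>B W Y\<close> vanishes
    when \<open>W\<close> is not earlier than \<open>Y\<close>.\<close>
  define V where "V W = (if fst W \<le> t then ennreal (1 / (1 - \<theta>)) * ennreal (p X W) else \<infinity>)" for W
  have VB: "(\<integral>\<^sup>+W. V W * ennreal \<bar>B W Y\<bar> \<partial>lborel) \<le> ennreal (\<theta> / (1 - \<theta>)) * ennreal (p X Y)" if Y: "fst Y \<le> t" for Y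
  proof (cases "s < fst Y")
    case True
    have "(\<integral>\<^sup>+W. V W * ennreal \<bar>B W Y\<bar> \<partial>lborel) = (\<integral>\<^sup>+W. ennreal (1 / (1 - \<theta>)) * (ennreal (p X W) * ennreal \<bar>B W Y\<bar>) \<partial>lborel)"
    proof (rule nn_integral_cong)
      fix W show "V W * ennreal \<bar>B W Y\<bar> = ennreal (1 / (1 - \<theta>)) * (ennreal (p X W) * ennreal \<bar>B W Y\<bar>)"
        using B_zero[of Y W] Y by (cases "fst W \<le> t") (auto simp: V_def mult.assoc)
    qed
    also have "\<dots> = ennreal (1 / (1 - \<theta>)) * (\<integral>\<^sup>+W. ennreal (p X W) * ennreal \<bar>B W Y\<bar> \<partial>lborel)"
      by (rule nn_integral_cmult) measurable
    also have "\<dots> \<le> ennreal (1 / (1 - \<theta>)) * (ennreal \<theta> * ennreal (p X Y))"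
      unfolding \<theta>_def using True Y h
      by (intro mult_left_mono kernel_bound_small) (auto simp: fX intro: inner_le_subinterval[OF small])
    also have "\<dots> = ennreal (\<theta> / (1 - \<theta>)) * ennreal (p X Y)"
      using \<theta> by (simp add: mult.assoc[symmetric] ennreal_mult[symmetric])
    finally show ?thesis .
  next
    case False
    have z: "V W * ennreal \<bar>B W Y\<bar> = 0" for W
      using False Y p_zero[of W X] B_zero[of Y W] fX by (cases "fst W < fst Y") (auto simp: V_def)
    show ?thesis unfolding z by simp
  qed
  have S_le: "S X Y \<le> V Y" for Y
  proof (rule S_least)
    fix Y
    show "ennreal (p X Y) + (\<integral>\<^sup>+W. V W * ennreal \<bar>B W Y\<bar> \<partial>lborel) \<le> V Y"
    proof (cases "fst Y \<le> t")
      case True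
      have "ennreal (p X Y) + (\<integral>\<^sup>+W. V W * ennreal \<bar>B W Y\<bar> \<partial>lborel) \<le> ennreal (p X Y) + ennreal (\<theta> / (1 - \<theta>)) * ennreal (p X Y)"
        by (intro add_left_mono VB True)
      also have "\<dots> = ennreal (1 + \<theta> / (1 - \<theta>)) * ennreal (p X Y)"
        using \<theta> by (simp add: ennreal_plus distrib_right)
      also have "1 + \<theta> / (1 - \<theta>) = 1 / (1 - \<theta>)" using \<theta> by (simp add: field_simps)
      finally show ?thesis using True by (simp add: V_def)
    qed (simp add: V_def)
  qed
  show "S (s, x) (t, y) \<le> ennreal (1 / (1 - (\<eta> + h))) * ennreal (p (s, x) (t, y))"
    using S_le[of "(t, y)"] by (simp add: V_def X_def \<theta>_def)
  have "(\<integral>\<^sup>+W. S X W * ennreal \<bar>B W (t, y)\<bar> \<partial>lborel) \<le> (\<integral>\<^sup>+W. V W * ennreal \<bar>B W (t, y)\<bar> \<partial>lborel)"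
    by (intro nn_integral_mono mult_right_mono S_le) auto
  also have "\<dots> \<le> ennreal (\<theta> / (1 - \<theta>)) * ennreal (p X (t, y))" by (rule VB) simp
  finally show "(\<integral>\<^sup>+W. S (s, x) W * ennreal \<bar>B W (t, y)\<bar> \<partial>lborel) \<le> ennreal ((\<eta> + h) / (1 - (\<eta> + h))) * ennreal (p (s, x) (t, y))"
    by (simp add: X_def \<theta>_def)
qed

text \<open>Following \<open>S\<close> up to time \<open>u\<close> and the convolution of two
  majorants through \<open>u\<close> afterwards gives a supersolution, which the least one cannot
  exceed.\<close>

lemma S_split:
  assumes u: "fst X < u" "u < fst Y"
  shows "S X Y \<le> (\<integral>\<^sup>+z. S X (u, z) * S (u, z) Y \<partial>lborel)"
proof -
  define V where "V W = (if fst W \<le> u then S X W else (\<integral>\<^sup>+z. S X (u, z) * S (u, z) W \<partial>lborel))" for W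
  have "S X Y \<le> V Y"
  proof (rule S_least)
    fix Y
    show "ennreal (p X Y) + (\<integral>\<^sup>+W. V W * ennreal \<bar>B W Y\<bar> \<partial>lborel) \<le> V Y"
    proof (cases "fst Y \<le> u")
      case True
      have "(\<integral>\<^sup>+W. V W * ennreal \<bar>B W Y\<bar> \<partial>lborel) = (\<integral>\<^sup>+W. S X W * ennreal \<bar>B W Y\<bar> \<partial>lborel)"
      proof (rule nn_integral_cong)
        fix W show "V W * ennreal \<bar>B W Y\<bar> = S X W * ennreal \<bar>B W Y\<bar>"
          using True B_zero[of Y W] by (cases "fst W \<le> u") (auto simp: V_def)
      qed
      then show ?thesis using True S_equation[of X Y] by (simp add: V_def)
    next
      case False
      \<comment> \<open>A drift point \<open>W\<close> before \<open>u\<close> is followed by a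
        passage through time \<open>u\<close>, one after \<open>u\<close> lies in the second factor.
        Together with the free term these are the terms obtained by expanding both factors of
        \<open>S X (u, z) * S (u, z) Y\<close> with the equation for \<open>S\<close>.\<close>
      let ?early = "\<integral>\<^sup>+W. (\<integral>\<^sup>+z. (S X W * ennreal \<bar>B W (u, z)\<bar>) * ennreal (p (u, z) Y) \<partial>lborel) \<partial>lborel"
      let ?late = "\<integral>\<^sup>+W. (\<integral>\<^sup>+z. S X (u, z) * (S (u, z) W * ennreal \<bar>B W Y\<bar>) \<partial>lborel) \<partial>lborel"
      have "AE W in (lborel :: (real \<times> 'a) measure). fst W \<noteq> u" by (rule AE_lborel_fst_neq)
      then have "(\<integral>\<^sup>+W. V W * ennreal \<bar>B W Y\<bar> \<partial>lborel) \<le>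
         (\<integral>\<^sup>+W. (\<integral>\<^sup>+z. (S X W * ennreal \<bar>B W (u, z)\<bar>) * ennreal (p (u, z) Y) \<partial>lborel) +
               (\<integral>\<^sup>+z. S X (u, z) * (S (u, z) W * ennreal \<bar>B W Y\<bar>) \<partial>lborel) \<partial>lborel)"
      proof (intro nn_integral_mono_AE, eventually_elim)
        case (elim W)
        show ?case
        proof (cases "fst W < u")
          case True
          have "V W * ennreal \<bar>B W Y\<bar> \<le> S X W * (\<integral>\<^sup>+z. ennreal \<bar>B W (u, z)\<bar> * ennreal (p (u, z) Y) \<partial>lborel)"
            using True False by (auto simp: V_def intro!: mult_left_mono B_CK_le)
          also have "\<dots> = (\<integral>\<^sup>+z. (S X W * ennreal \<bar>B W (u, z)\<bar>) * ennreal (p (u, z) Y) \<partial>lborel)"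
            by (subst nn_integral_cmult[symmetric]) (auto simp: mult.assoc)
          finally show ?thesis by (rule order.trans) simp
        next
          case False
          with elim have "V W * ennreal \<bar>B W Y\<bar> = (\<integral>\<^sup>+z. S X (u, z) * (S (u, z) W * ennreal \<bar>B W Y\<bar>) \<partial>lborel)"
            by (auto simp: V_def nn_integral_multc[symmetric] mult.assoc)
          then show ?thesis by simp
        qed
      qed
      also have "\<dots> = ?early + ?late" by (rule nn_integral_add) measurable
      also have "?early = (\<integral>\<^sup>+z. (\<integral>\<^sup>+W. (S X W * ennreal \<bar>B W (u, z)\<bar>) * ennreal (p (u, z) Y) \<partial>lborel) \<partial>lborel)"
        by (rule lborel_pair.Fubini') measurable
      also have "\<dots> = (\<integral>\<^sup>+z. (\<integral>\<^sup>+W. S X W * ennreal \<bar>B W (u, z)\<bar> \<partial>lborel) * ennreal (p (u, z) Y) \<partial>lborel)"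
        by (intro nn_integral_cong nn_integral_multc) measurable
      also have "?late = (\<integral>\<^sup>+z. (\<integral>\<^sup>+W. S X (u, z) * (S (u, z) W * ennreal \<bar>B W Y\<bar>) \<partial>lborel) \<partial>lborel)"
        by (rule lborel_pair.Fubini') measurable
      also have "\<dots> = (\<integral>\<^sup>+z. S X (u, z) * (\<integral>\<^sup>+W. S (u, z) W * ennreal \<bar>B W Y\<bar> \<partial>lborel) \<partial>lborel)"
        by (intro nn_integral_cong nn_integral_cmult) measurable
      finally have "ennreal (p X Y) + (\<integral>\<^sup>+W. V W * ennreal \<bar>B W Y\<bar> \<partial>lborel) \<le>
         (\<integral>\<^sup>+z. ennreal (p X (u, z)) * ennreal (p (u, z) Y) \<partial>lborel) +
         ((\<integral>\<^sup>+z. (\<integral>\<^sup>+W. S X W * ennreal \<bar>B W (u, z)\<bar> \<partial>lborel) * ennreal (p (u, z) Y) \<partial>lborel) +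
          (\<integral>\<^sup>+z. S X (u, z) * (\<integral>\<^sup>+W. S (u, z) W * ennreal \<bar>B W Y\<bar> \<partial>lborel) \<partial>lborel))"
        using u False by (subst p_CK) (auto intro: add_left_mono)
      also have "\<dots> = (\<integral>\<^sup>+z. S X (u, z) * S (u, z) Y \<partial>lborel)"
      proof -
        have e: "S X (u, z) * S (u, z) Y = ennreal (p X (u, z)) * ennreal (p (u, z) Y) + ((\<integral>\<^sup>+W. S X W * ennreal \<bar>B W (u, z)\<bar> \<partial>lborel) * ennreal (p (u, z) Y) +
            S X (u, z) * (\<integral>\<^sup>+W. S (u, z) W * ennreal \<bar>B W Y\<bar> \<partial>lborel))" for z
        proof -
          have "S X (u, z) * S (u, z) Y = S X (u, z) * ennreal (p (u, z) Y) + S X (u, z) * (\<integral>\<^sup>+W. S (u, z) W * ennreal \<bar>B W Y\<bar> \<partial>lborel)"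
            by (subst S_equation[of "(u, z)" Y]) (rule distrib_left)
          also have "S X (u, z) * ennreal (p (u, z) Y) = ennreal (p X (u, z)) * ennreal (p (u, z) Y) + (\<integral>\<^sup>+W. S X W * ennreal \<bar>B W (u, z)\<bar> \<partial>lborel) * ennreal (p (u, z) Y)"
            by (subst S_equation[of X "(u, z)"]) (rule distrib_right)
          finally show ?thesis by (simp only: add.assoc)
        qed
        show ?thesis unfolding e by (subst nn_integral_add, simp, simp, subst nn_integral_add, simp, simp) (rule refl)
      qed
      finally show ?thesis using False by (simp add: V_def)
    qed
  qed
  then show ?thesis using u by (simp add: V_def)
qed

text \<open>Induction on the pieces: each cut splits off one interval with inner weight at most
  \<open>h\<close> at the price of one factor, and Chapman-Kolmogorov for \<open>p\<close>
  recombines the rest. The number of pieces is \<open>Suc k\<close>.\<close>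

lemma S_bound:
  assumes h: "h > 0" "\<eta> + h < 1"
  shows "s < t \<Longrightarrow> inner_le Q s t (real (Suc k) * h) \<Longrightarrow> S (s, x) (t, y) \<le> ennreal ((1 / (1 - (\<eta> + h))) ^ Suc k) * ennreal (p (s, x) (t, y))"
proof (induction k arbitrary: s t x y)
  case 0
  then show ?case using S_small(1)[of s t h] h by simp
next
  case (Suc k)
  define M where "M = 1 / (1 - (\<eta> + h))"
  have M: "M \<ge> 1" using h \<eta> by (simp add: M_def)
  from superadditive_cut[OF Q_super Q_nonneg h(1) Suc.prems] show ?case
  proof
    assume "inner_le Q s t h"
    then have "S (s, x) (t, y) \<le> ennreal M * ennreal (p (s, x) (t, y))"
      unfolding M_def using h Suc.prems by (intro S_small) auto
    also have "\<dots> \<le> ennreal (M ^ Suc (Suc k)) * ennreal (p (s, x) (t, y))"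
      using M self_le_power[of M "Suc (Suc k)"] by (intro mult_right_mono ennreal_leI) auto
    finally show ?thesis by (simp add: M_def)
  next
    assume "\<exists>u. s < u \<and> u < t \<and> inner_le Q s u h \<and> inner_le Q u t (real (Suc k) * h)"
    then obtain u where u: "s < u" "u < t" "inner_le Q s u h" "inner_le Q u t (real (Suc k) * h)" by blast
    have "S (s, x) (t, y) \<le> (\<integral>\<^sup>+z. S (s, x) (u, z) * S (u, z) (t, y) \<partial>lborel)"
      using u by (intro S_split) auto
    also have "\<dots> \<le> (\<integral>\<^sup>+z. (ennreal M * ennreal (p (s, x) (u, z))) * (ennreal (M ^ Suc k) * ennreal (p (u, z) (t, y))) \<partial>lborel)"
      unfolding M_def using u h by (intro nn_integral_mono mult_mono Suc.IH S_small(1)) auto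
    also have "\<dots> = (\<integral>\<^sup>+z. (ennreal M * ennreal (M ^ Suc k)) * (ennreal (p (s, x) (u, z)) * ennreal (p (u, z) (t, y))) \<partial>lborel)"
      by (simp only: mult_ac)
    also have "\<dots> = (ennreal M * ennreal (M ^ Suc k)) * ennreal (p (s, x) (t, y))"
      using u by (subst nn_integral_cmult) (auto simp: p_CK)
    also have "ennreal M * ennreal (M ^ Suc k) = ennreal (M ^ Suc (Suc k))"
      using M by (subst ennreal_mult[symmetric]) auto
    finally show ?thesis by (simp add: M_def)
  qed
qed

section \<open>The perturbation series\<close>

primrec pn :: "nat \<Rightarrow> real \<times> 'a \<Rightarrow> real \<times> 'a \<Rightarrow> real" where
  "pn 0 X Y = p X Y"
| "pn (Suc k) X Y = (LBINT W. pn k X W * B W Y)"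

definition q :: "real \<times> 'a \<Rightarrow> real \<times> 'a \<Rightarrow> real" where
  "q X Y = (\<Sum>k. pn k X Y)"

lemma pn_meas0: "(\<lambda>(X, Y). pn k X Y) \<in> borel_measurable (borel \<Otimes>\<^sub>M borel)"
proof (induction k)
  case 0
  show ?case by simp
next
  case (Suc k)
  have [measurable]: "f \<in> borel_measurable M \<Longrightarrow> g \<in> borel_measurable M \<Longrightarrow> (\<lambda>x. pn k (f x) (g x)) \<in> borel_measurable M"
    for f g :: "'c \<Rightarrow> real \<times> 'a" and M
    using measurable_compose[OF measurable_Pair Suc, of f M g] by simp
  show ?case by simp
qed

lemma pn_meas [measurable (raw)]:
  "f \<in> borel_measurable M \<Longrightarrow> g \<in> borel_measurable M \<Longrightarrow> (\<lambda>x. pn k (f x) (g x)) \<in> borel_measurable M"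
  using measurable_compose[OF measurable_Pair pn_meas0, of f M g] by simp

lemma q_meas [measurable (raw)]:
  "f \<in> borel_measurable M \<Longrightarrow> g \<in> borel_measurable M \<Longrightarrow> (\<lambda>x. q (f x) (g x)) \<in> borel_measurable M"
  unfolding q_def by measurable

lemma pn_le_P: "ennreal \<bar>pn k X Y\<bar> \<le> P k X Y"
proof (induction k arbitrary: Y)
  case 0 then show ?case by (simp add: p_nonneg)
next
  case (Suc k)
  have "ennreal \<bar>pn (Suc k) X Y\<bar> \<le> (\<integral>\<^sup>+W. ennreal \<bar>pn k X W * B W Y\<bar> \<partial>lborel)"
  proof (cases "integrable lborel (\<lambda>W. pn k X W * B W Y)")
    case True
    then show ?thesis using integral_norm_bound_ennreal[OF True] by simp
  qed (simp add: not_integrable_integral_eq)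
  also have "\<dots> \<le> (\<integral>\<^sup>+W. P k X W * ennreal \<bar>B W Y\<bar> \<partial>lborel)"
    unfolding abs_mult using Suc.IH by (intro nn_integral_mono) (simp add: ennreal_mult mult_right_mono)
  finally show ?case by simp
qed

text \<open>The constant is uniform in the end point and in all end times up to \<open>T\<close>,
  because \<open>Q s T\<close> dominates \<open>Q\<close> on every subinterval. The choice
  \<open>h = (1 - \<eta>) / 2\<close> merely secures a ratio below 1.\<close>

lemma S_bound_ex:
  assumes "s < T"
  shows "\<exists>c\<ge>0. \<forall>t\<le>T. \<forall>x y. S (s, x) (t, y) \<le> ennreal c * ennreal (p (s, x) (t, y))"
proof -
  define h where "h = (1 - \<eta>) / 2"
  have h: "h > 0" "\<eta> + h < 1" using \<eta> by (auto simp: h_def field_simps)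
  obtain k :: nat where k: "Q s T / h \<le> real k" using real_arch_simple by blast
  have "S (s, x) (t, y) \<le> ennreal ((1 / (1 - (\<eta> + h))) ^ Suc k) * ennreal (p (s, x) (t, y))" if "t \<le> T" for t x y
  proof (cases "s < t")
    case True
    have "inner_le Q s t (real (Suc k) * h)"
      unfolding inner_le_def
    proof (intro allI impI)
      fix s' t' assume "s < s'" "s' < t'" "t' < t"
      then have "Q s' t' \<le> Q s T" using that by (intro superadditive_mono[OF Q_super Q_nonneg]) auto
      also have "\<dots> \<le> real k * h" using k h by (simp add: field_simps)
      finally show "Q s' t' \<le> real (Suc k) * h" using h by (simp add: algebra_simps)
    qed
    then show ?thesis using S_bound[OF h True] by simp
  next
    case False then show ?thesis by (simp add: S_zero)
  qed
  moreover have "0 \<le> (1 / (1 - (\<eta> + h))) ^ Suc k" using h by (intro zero_le_power) auto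
  ultimately show ?thesis by blast
qed

lemma S_finite: "S X Y < \<infinity>"
proof (cases "fst X < fst Y")
  case True
  from S_bound_ex[OF True] obtain c where "S X Y \<le> ennreal c * ennreal (p X Y)" by (metis order.refl prod.collapse)
  also have "\<dots> < \<infinity>" by (simp add: ennreal_mult_less_top)
  finally show ?thesis .
qed (simp add: S_zero)

lemma P_finite: "P k X Y < \<infinity>"
proof -
  have "P k X Y \<le> S X Y" unfolding S_def using sum_le_suminf[of "\<lambda>k. P k X Y" "{k}"] by simp
  then show ?thesis using S_finite[of X Y] by (rule le_less_trans)
qed

lemma P_summable: "summable (\<lambda>k. enn2real (P k X Y))"
proof (rule summable_suminf_not_top)
  have "(\<Sum>k. ennreal (enn2real (P k X Y))) = S X Y" using P_finite by (simp add: S_def)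
  then show "(\<Sum>k. ennreal (enn2real (P k X Y))) \<noteq> \<top>" using S_finite[of X Y] by auto
qed simp

lemma pn_le_P_real: "\<bar>pn k X Y\<bar> \<le> enn2real (P k X Y)"
  using enn2real_mono[OF pn_le_P[of k X Y]] P_finite[of k X Y] by simp

lemma pn_summable: "summable (\<lambda>k. \<bar>pn k X Y\<bar>)"
  by (rule summable_comparison_test'[OF P_summable[of X Y], of 0]) (simp add: pn_le_P_real)

lemma q_le_S: "ennreal \<bar>q X Y\<bar> \<le> S X Y"
proof -
  have "\<bar>q X Y\<bar> \<le> (\<Sum>k. \<bar>pn k X Y\<bar>)"
    unfolding q_def by (rule summable_rabs[OF pn_summable])
  then have "ennreal \<bar>q X Y\<bar> \<le> ennreal (\<Sum>k. \<bar>pn k X Y\<bar>)" by (rule ennreal_leI)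
  also have "\<dots> = (\<Sum>k. ennreal \<bar>pn k X Y\<bar>)" by (rule suminf_ennreal2[symmetric]) (auto simp: pn_summable)
  also have "\<dots> \<le> S X Y" unfolding S_def by (intro suminf_le pn_le_P) auto
  finally show ?thesis .
qed

lemma q_zero: "fst Y \<le> fst X \<Longrightarrow> q X Y = 0"
  using q_le_S[of X Y] S_zero[of Y X] by (simp add: ennreal_eq_0_iff)

lemma S_B_finite: "(\<integral>\<^sup>+W. S X W * ennreal \<bar>B W Y\<bar> \<partial>lborel) < \<infinity>"
  using S_equation[of X Y] S_finite[of X Y] by (simp add: top.not_eq_extremum)

lemma integrable_pn_B: "integrable lborel (\<lambda>W. pn k X W * B W Y)"
proof (rule integrableI_bounded)
  have "(\<integral>\<^sup>+W. ennreal (norm (pn k X W * B W Y)) \<partial>lborel) \<le> P (Suc k) X Y"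
    by (auto simp: abs_mult ennreal_mult intro!: nn_integral_mono mult_right_mono pn_le_P)
  then show "(\<integral>\<^sup>+W. ennreal (norm (pn k X W * B W Y)) \<partial>lborel) < \<infinity>"
    using P_finite[of "Suc k" X Y] by (rule le_less_trans)
qed measurable

lemma integrable_q_B: "integrable lborel (\<lambda>W. q X W * B W Y)"
proof (rule integrableI_bounded)
  have "(\<integral>\<^sup>+W. ennreal (norm (q X W * B W Y)) \<partial>lborel) \<le> (\<integral>\<^sup>+W. S X W * ennreal \<bar>B W Y\<bar> \<partial>lborel)"
    by (auto simp: abs_mult ennreal_mult intro!: nn_integral_mono mult_right_mono q_le_S)
  then show "(\<integral>\<^sup>+W. ennreal (norm (q X W * B W Y)) \<partial>lborel) < \<infinity>"
    using S_B_finite[of X Y] by (rule le_less_trans)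
qed measurable

text \<open>Sum and integral may be exchanged because the absolute integral of the
  \<open>k\<close>-th term is at most \<open>P (Suc k) X Y\<close>, and these are summable.\<close>

lemma q_equation: "q X Y = p X Y + (LBINT W. q X W * B W Y)"
proof -
  have bound: "(LBINT W. norm (pn k X W * B W Y)) \<le> enn2real (P (Suc k) X Y)" for k
  proof -
    have "ennreal (LBINT W. norm (pn k X W * B W Y)) = (\<integral>\<^sup>+W. ennreal (norm (pn k X W * B W Y)) \<partial>lborel)"
      by (intro nn_integral_eq_integral[symmetric] integrable_norm integrable_pn_B) auto
    also have "\<dots> \<le> P (Suc k) X Y"
      by (auto simp: abs_mult ennreal_mult intro!: nn_integral_mono mult_right_mono pn_le_P)
    finally show ?thesis using enn2real_mono[of _ "P (Suc k) X Y"] P_finite[of "Suc k" X Y]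
      by (metis (no_types, lifting) Bochner_Integration.integral_nonneg enn2real_ennreal norm_ge_zero infinity_ennreal_def)
  qed
  have "(LBINT W. (\<Sum>k. pn k X W * B W Y)) = (\<Sum>k. LBINT W. pn k X W * B W Y)"
  proof (rule integral_suminf)
    show "integrable lborel (\<lambda>W. pn k X W * B W Y)" for k by (rule integrable_pn_B)
    show "AE W in lborel. summable (\<lambda>k. norm (pn k X W * B W Y))"
      by (auto simp: abs_mult intro!: AE_I2 summable_mult2 pn_summable)
    have sP: "summable (\<lambda>k. enn2real (P (Suc k) X Y))" using P_summable[of X Y] by (subst summable_Suc_iff)
    show "summable (\<lambda>k. LBINT W. norm (pn k X W * B W Y))"
      by (rule summable_comparison_test'[OF sP, of 0]) (use bound in auto)
  qed
  moreover have "(\<Sum>k. pn k X W * B W Y) = q X W * B W Y" for W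
    unfolding q_def using suminf_mult2[OF summable_rabs_cancel[OF pn_summable]] by simp
  moreover have "q X Y = pn 0 X Y + (\<Sum>k. pn (Suc k) X Y)"
    unfolding q_def using suminf_split_head[OF summable_rabs_cancel[OF pn_summable[of X Y]]] by simp
  ultimately show ?thesis by simp
qed

lemma q_minus_p: "ennreal \<bar>q X Y - p X Y\<bar> \<le> (\<integral>\<^sup>+W. S X W * ennreal \<bar>B W Y\<bar> \<partial>lborel)"
proof -
  have "q X Y - p X Y = (LBINT W. q X W * B W Y)" using q_equation[of X Y] by simp
  then have "ennreal \<bar>q X Y - p X Y\<bar> \<le> (\<integral>\<^sup>+W. ennreal (norm (q X W * B W Y)) \<partial>lborel)"
    using integral_norm_bound_ennreal[OF integrable_q_B[of X Y]] by simp
  also have "\<dots> \<le> (\<integral>\<^sup>+W. S X W * ennreal \<bar>B W Y\<bar> \<partial>lborel)"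
    by (auto simp: abs_mult ennreal_mult intro!: nn_integral_mono mult_right_mono q_le_S)
  finally show ?thesis .
qed

section \<open>The Chapman-Kolmogorov equation for the perturbed density\<close>

lemma SS_finite:
  assumes "fst X < u" "u < fst Y"
  shows "(\<integral>\<^sup>+z. S X (u, z) * S (u, z) Y \<partial>lborel) < \<infinity>"
proof -
  obtain s x t y where XY: "X = (s, x)" "Y = (t, y)" by (cases X, cases Y)
  have su: "s < u" "u < t" using assms XY by auto
  from S_bound_ex[OF su(1)] obtain c1 where c1: "\<And>z. S (s, x) (u, z) \<le> ennreal c1 * ennreal (p (s, x) (u, z))" by auto
  from S_bound_ex[OF su(2)] obtain c2 where c2: "\<And>z. S (u, z) (t, y) \<le> ennreal c2 * ennreal (p (u, z) (t, y))" by auto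
  have "(\<integral>\<^sup>+z. S X (u, z) * S (u, z) Y \<partial>lborel) \<le> (\<integral>\<^sup>+z. (ennreal c1 * ennreal c2) * (ennreal (p X (u, z)) * ennreal (p (u, z) Y)) \<partial>lborel)"
  proof (rule nn_integral_mono)
    fix z
    have "S X (u, z) * S (u, z) Y \<le> (ennreal c1 * ennreal (p X (u, z))) * (ennreal c2 * ennreal (p (u, z) Y))"
      unfolding XY by (intro mult_mono c1 c2) auto
    then show "S X (u, z) * S (u, z) Y \<le> (ennreal c1 * ennreal c2) * (ennreal (p X (u, z)) * ennreal (p (u, z) Y))"
      by (simp only: mult_ac)
  qed
  also have "\<dots> = (ennreal c1 * ennreal c2) * ennreal (p X Y)"
    using assms by (subst nn_integral_cmult) (auto simp: p_CK)
  also have "\<dots> < \<infinity>" by (simp add: ennreal_mult_less_top)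
  finally show ?thesis .
qed

lemma integrable_qq:
  assumes "fst X < u" "u < fst Y"
  shows "integrable lborel (\<lambda>z. q X (u, z) * q (u, z) Y)"
proof (rule integrableI_bounded)
  have "(\<integral>\<^sup>+z. ennreal (norm (q X (u, z) * q (u, z) Y)) \<partial>lborel) \<le> (\<integral>\<^sup>+z. S X (u, z) * S (u, z) Y \<partial>lborel)"
    by (auto simp: abs_mult ennreal_mult intro!: nn_integral_mono mult_mono q_le_S)
  then show "(\<integral>\<^sup>+z. ennreal (norm (q X (u, z) * q (u, z) Y)) \<partial>lborel) < \<infinity>"
    using SS_finite[OF assms] by (rule le_less_trans)
qed measurable

text \<open>The equation is inserted in the first factor and Chapman-Kolmogorov is applied to
  \<open>p\<close> and \<open>B\<close>. Only drift points before \<open>u\<close> survive, as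
  \<open>B W (u, z)\<close> vanishes for the others.\<close>

lemma qp_equation:
  assumes u: "fst X < u" "u < fst Y"
  shows "integrable lborel (\<lambda>z. q X (u, z) * p (u, z) Y)"
    and "(LBINT z. q X (u, z) * p (u, z) Y) = p X Y + (LBINT W. indicator {W. fst W < u} W * (q X W * B W Y))"
proof -
  have pS: "ennreal (p X Y) \<le> S X Y" for X Y using S_equation[of X Y] by (metis add_increasing2 order.refl zero_le)
  show I1: "integrable lborel (\<lambda>z. q X (u, z) * p (u, z) Y)"
  proof (rule integrableI_bounded)
    have "(\<integral>\<^sup>+z. ennreal (norm (q X (u, z) * p (u, z) Y)) \<partial>lborel) \<le> (\<integral>\<^sup>+z. S X (u, z) * S (u, z) Y \<partial>lborel)"
      by (auto simp: abs_mult ennreal_mult p_nonneg intro!: nn_integral_mono mult_mono q_le_S pS)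
    then show "(\<integral>\<^sup>+z. ennreal (norm (q X (u, z) * p (u, z) Y)) \<partial>lborel) < \<infinity>"
      using SS_finite[OF u] by (rule le_less_trans)
  qed measurable
  have Ip: "has_bochner_integral lborel (\<lambda>z. p X (u, z) * p (u, z) Y) (p X Y)"
    using p_CK[OF u] by (intro has_bochner_integral_nn_integral) (auto simp: p_nonneg ennreal_mult)
  let ?h = "\<lambda>z W. q X W * B W (u, z) * p (u, z) Y"
  have int: "integrable (lborel \<Otimes>\<^sub>M lborel) (\<lambda>(z, W). ?h z W)"
  proof (rule integrableI_bounded)
    have "(\<integral>\<^sup>+a. ennreal (norm (case a of (z, W) \<Rightarrow> ?h z W)) \<partial>(lborel \<Otimes>\<^sub>M lborel)) =
       (\<integral>\<^sup>+z. (\<integral>\<^sup>+W. ennreal (norm (?h z W)) \<partial>lborel) \<partial>lborel)"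
      by (subst lborel.nn_integral_fst[symmetric]) auto
    also have "\<dots> \<le> (\<integral>\<^sup>+z. (\<integral>\<^sup>+W. (S X W * ennreal \<bar>B W (u, z)\<bar>) * S (u, z) Y \<partial>lborel) \<partial>lborel)"
      by (auto simp: abs_mult ennreal_mult p_nonneg intro!: nn_integral_mono mult_mono q_le_S pS)
    also have "\<dots> = (\<integral>\<^sup>+z. (\<integral>\<^sup>+W. S X W * ennreal \<bar>B W (u, z)\<bar> \<partial>lborel) * S (u, z) Y \<partial>lborel)"
      by (intro nn_integral_cong nn_integral_multc) measurable
    also have "\<dots> \<le> (\<integral>\<^sup>+z. S X (u, z) * S (u, z) Y \<partial>lborel)"
      by (intro nn_integral_mono mult_right_mono) (subst (2) S_equation, auto)
    also have "\<dots> < \<infinity>" by (rule SS_finite[OF u])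
    finally show "(\<integral>\<^sup>+a. ennreal (norm (case a of (z, W) \<Rightarrow> ?h z W)) \<partial>(lborel \<Otimes>\<^sub>M lborel)) < \<infinity>" .
  qed measurable
  have iz: "(LBINT W. ?h z W) = (q X (u, z) - p X (u, z)) * p (u, z) Y" for z
    using q_equation[of X "(u, z)"] by simp
  have iW: "(LBINT z. ?h z W) = indicator {W. fst W < u} W * (q X W * B W Y)" for W
  proof (cases "fst W < u")
    case True
    have "(LBINT z. ?h z W) = q X W * (LBINT z. B W (u, z) * p (u, z) Y)"
      by (simp add: mult.assoc)
    also have "(LBINT z. B W (u, z) * p (u, z) Y) = B W Y"
      using B_CK[OF True u(2)] by (simp add: has_bochner_integral_iff)
    finally show ?thesis using True by simp
  next
    case False
    then have "B W (u, z) = 0" for z by (simp add: B_zero)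
    then show ?thesis using False by simp
  qed
  have "(LBINT z. q X (u, z) * p (u, z) Y) - p X Y = (LBINT z. q X (u, z) * p (u, z) Y - p X (u, z) * p (u, z) Y)"
    using I1 Ip by (simp add: has_bochner_integral_iff)
  also have "\<dots> = (LBINT z. (LBINT W. ?h z W))" unfolding iz by (simp add: left_diff_distrib)
  also have "\<dots> = (LBINT W. (LBINT z. ?h z W))"
    using lborel_pair.Fubini_integral[OF int] by simp
  finally show "(LBINT z. q X (u, z) * p (u, z) Y) = p X Y + (LBINT W. indicator {W. fst W < u} W * (q X W * B W Y))"
    unfolding iW by simp
qed

text \<open>Now the equation is inserted in the second factor. The convolution of \<open>q\<close>
  with itself thereby solves an equation with kernel \<open>B\<close> whose free term is the
  convolution of \<open>q\<close> with \<open>p\<close>.\<close>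

lemma qq_equation:
  assumes u: "fst X < u" "u < fst Y"
  shows "integrable lborel (\<lambda>W. (LBINT z. q X (u, z) * q (u, z) W) * B W Y)"
    and "(LBINT z. q X (u, z) * q (u, z) Y) = (LBINT z. q X (u, z) * p (u, z) Y) + (LBINT W. (LBINT z. q X (u, z) * q (u, z) W) * B W Y)"
proof -
  let ?h = "\<lambda>z W. q X (u, z) * q (u, z) W * B W Y"
  have int: "integrable (lborel \<Otimes>\<^sub>M lborel) (\<lambda>(z, W). ?h z W)"
  proof (rule integrableI_bounded)
    have "(\<integral>\<^sup>+a. ennreal (norm (case a of (z, W) \<Rightarrow> ?h z W)) \<partial>(lborel \<Otimes>\<^sub>M lborel)) =
       (\<integral>\<^sup>+z. (\<integral>\<^sup>+W. ennreal (norm (?h z W)) \<partial>lborel) \<partial>lborel)"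
      by (subst lborel.nn_integral_fst[symmetric]) auto
    also have "\<dots> \<le> (\<integral>\<^sup>+z. (\<integral>\<^sup>+W. S X (u, z) * (S (u, z) W * ennreal \<bar>B W Y\<bar>) \<partial>lborel) \<partial>lborel)"
      by (auto simp: abs_mult ennreal_mult mult.assoc intro!: nn_integral_mono mult_mono q_le_S)
    also have "\<dots> = (\<integral>\<^sup>+z. S X (u, z) * (\<integral>\<^sup>+W. S (u, z) W * ennreal \<bar>B W Y\<bar> \<partial>lborel) \<partial>lborel)"
      by (intro nn_integral_cong nn_integral_cmult) measurable
    also have "\<dots> \<le> (\<integral>\<^sup>+z. S X (u, z) * S (u, z) Y \<partial>lborel)"
      by (intro nn_integral_mono mult_left_mono) (subst (2) S_equation, auto)
    also have "\<dots> < \<infinity>" by (rule SS_finite[OF u])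
    finally show "(\<integral>\<^sup>+a. ennreal (norm (case a of (z, W) \<Rightarrow> ?h z W)) \<partial>(lborel \<Otimes>\<^sub>M lborel)) < \<infinity>" .
  qed measurable
  have iz: "(LBINT W. ?h z W) = q X (u, z) * q (u, z) Y - q X (u, z) * p (u, z) Y" for z
  proof -
    have "(LBINT W. ?h z W) = q X (u, z) * (LBINT W. q (u, z) W * B W Y)" by (simp add: mult.assoc)
    also have "(LBINT W. q (u, z) W * B W Y) = q (u, z) Y - p (u, z) Y" using q_equation[of "(u, z)" Y] by simp
    finally show ?thesis by (simp add: right_diff_distrib)
  qed
  have iW: "(LBINT z. ?h z W) = (LBINT z. q X (u, z) * q (u, z) W) * B W Y" for W
    by simp
  show "integrable lborel (\<lambda>W. (LBINT z. q X (u, z) * q (u, z) W) * B W Y)"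
    using lborel_pair.integrable_snd[OF int] by simp
  have "(LBINT z. q X (u, z) * q (u, z) Y) - (LBINT z. q X (u, z) * p (u, z) Y) = (LBINT z. (LBINT W. ?h z W))"
    unfolding iz using integrable_qq[OF u] qp_equation(1)[OF u] by simp
  also have "\<dots> = (LBINT W. (LBINT z. ?h z W))"
    using lborel_pair.Fubini_integral[OF int] by simp
  finally show "(LBINT z. q X (u, z) * q (u, z) Y) = (LBINT z. q X (u, z) * p (u, z) Y) + (LBINT W. (LBINT z. q X (u, z) * q (u, z) W) * B W Y)"
    unfolding iW by simp
qed

text \<open>Both sides solve the same linear equation after time \<open>u\<close>; iterating it bounds their difference by
  a multiple of \<open>P k\<close>, which tends to 0.\<close>

lemma q_CK:
  assumes u: "fst X < u" "u < fst Y"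
  shows "has_bochner_integral lborel (\<lambda>z. q X (u, z) * q (u, z) Y) (q X Y)"
proof -
  define T where "T = fst Y"
  define qh where "qh W = (LBINT z. q X (u, z) * q (u, z) W)" for W
  have [measurable]: "qh \<in> borel_measurable borel" unfolding qh_def by measurable
  have [measurable]: "{W :: real \<times> 'a. fst W < u} \<in> sets borel" "{W :: real \<times> 'a. u < fst W} \<in> sets borel"
    by (auto intro!: borel_open open_Collect_less continuous_intros)
  \<comment> \<open>The free term for the convolution contains the drift contributions before
    \<open>u\<close>. They also occur in the equation for \<open>q\<close> and cancel in the
    difference, so \<open>r\<close> solves the homogeneous equation.\<close>
  define r where "r W = indicator {W. u < fst W} W * (q X W - qh W)" for W
  have qh0: "qh W = 0" if "fst W \<le> u" for W
    unfolding qh_def using that by (simp add: q_zero)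
  have eq: "r V = (LBINT W. r W * B W V)" and int: "integrable lborel (\<lambda>W. r W * B W V)" if V: "u < fst V" for V
  proof -
    let ?g = "\<lambda>W. q X W * B W V - indicator {W. fst W < u} W * (q X W * B W V) - qh W * B W V"
    have i1: "integrable lborel (\<lambda>W. indicator {W. fst W < u} W * (q X W * B W V))"
      by (rule Bochner_Integration.integrable_bound[OF integrable_q_B[of X V]]) (measurable, auto simp: indicator_def)
    have i2: "integrable lborel (\<lambda>W. qh W * B W V)"
      unfolding qh_def by (rule qq_equation(1)[OF u(1) V])
    have ae: "AE W in lborel. ?g W = r W * B W V"
      using AE_lborel_fst_neq[of u]
    proof eventually_elim
      case (elim W)
      then show ?case using qh0[of W] by (cases "fst W < u") (auto simp: r_def algebra_simps)
    qed
    have ig: "integrable lborel ?g"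
      by (intro Bochner_Integration.integrable_diff i1 i2 integrable_q_B)
    show "integrable lborel (\<lambda>W. r W * B W V)"
      by (rule integrable_cong_AE_imp[OF ig]) (use ae in \<open>auto simp: r_def elim: AE_mp\<close>)
    have "r V = q X V - qh V" using V by (simp add: r_def)
    also have "\<dots> = (LBINT W. q X W * B W V) - (LBINT W. indicator {W. fst W < u} W * (q X W * B W V)) - (LBINT W. qh W * B W V)"
      using q_equation[of X V] qq_equation(2)[OF u(1) V] qp_equation(2)[OF u(1) V] by (simp add: qh_def)
    also have "\<dots> = (LBINT W. ?g W)"
      using i1 i2 integrable_q_B[of X V] by simp
    also have "\<dots> = (LBINT W. r W * B W V)"
      using ae by (intro integral_cong_AE) (auto simp: r_def)
    finally show "r V = (LBINT W. r W * B W V)" .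
  qed
  have [measurable]: "r \<in> borel_measurable borel" unfolding r_def by measurable
  obtain s x where X: "X = (s, x)" by (cases X)
  have sT: "s < T" "u < T" using u by (auto simp: X T_def)
  from S_bound_ex[OF sT(1)] obtain c1 where c1: "c1 \<ge> 0" "\<And>t x y. t \<le> T \<Longrightarrow> S (s, x) (t, y) \<le> ennreal c1 * ennreal (p (s, x) (t, y))" by blast
  from S_bound_ex[OF sT(2)] obtain c2 where c2: "c2 \<ge> 0" "\<And>t x y. t \<le> T \<Longrightarrow> S (u, x) (t, y) \<le> ennreal c2 * ennreal (p (u, x) (t, y))" by blast
  \<comment> \<open>\<open>c1\<close> bounds \<open>q\<close> and \<open>c1 * c2\<close> bounds the
    convolution \<open>qh\<close>, both relative to \<open>p X\<close>; this starts the iteration at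
    \<open>P 0\<close>.\<close>
  define c where "c = c1 + c1 * c2"
  have c: "c \<ge> 0" using c1 c2 by (simp add: c_def)
  have iter: "ennreal \<bar>r W\<bar> \<le> ennreal c * P k X W" if "fst W \<le> T" for k W
    using that
  proof (induction k arbitrary: W)
    case (0 W)
    show ?case
    proof (cases "u < fst W")
      case True
      have "ennreal \<bar>qh W\<bar> \<le> (\<integral>\<^sup>+z. ennreal (norm (q X (u, z) * q (u, z) W)) \<partial>lborel)"
        unfolding qh_def using integral_norm_bound_ennreal[OF integrable_qq[OF u(1) True]] by simp
      also have "\<dots> \<le> (\<integral>\<^sup>+z. (ennreal c1 * ennreal c2) * (ennreal (p X (u, z)) * ennreal (p (u, z) W)) \<partial>lborel)"
      proof (rule nn_integral_mono)
        fix z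
        have "ennreal (norm (q X (u, z) * q (u, z) W)) = ennreal \<bar>q X (u, z)\<bar> * ennreal \<bar>q (u, z) W\<bar>" by (simp add: abs_mult ennreal_mult)
        also have "\<dots> \<le> (ennreal c1 * ennreal (p X (u, z))) * (ennreal c2 * ennreal (p (u, z) W))"
          using c1(2)[of u x z] c2(2)[of "fst W" z "snd W"] sT 0
          by (intro mult_mono order.trans[OF q_le_S]) (auto simp: X)
        finally show "ennreal (norm (q X (u, z) * q (u, z) W)) \<le> (ennreal c1 * ennreal c2) * (ennreal (p X (u, z)) * ennreal (p (u, z) W))"
          by (simp only: mult_ac)
      qed
      also have "\<dots> = ennreal (c1 * c2) * ennreal (p X W)"
        using u True c1 c2 by (subst nn_integral_cmult) (auto simp: p_CK ennreal_mult)
      finally have 1: "ennreal \<bar>qh W\<bar> \<le> ennreal (c1 * c2) * ennreal (p X W)" .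
      have 2: "ennreal \<bar>q X W\<bar> \<le> ennreal c1 * ennreal (p X W)"
        using order.trans[OF q_le_S c1(2)[of "fst W" x "snd W"]] 0 by (simp add: X)
      have "ennreal \<bar>r W\<bar> \<le> ennreal \<bar>q X W\<bar> + ennreal \<bar>qh W\<bar>"
      proof -
        have "\<bar>r W\<bar> \<le> \<bar>q X W\<bar> + \<bar>qh W\<bar>" using True by (simp add: r_def abs_triangle_ineq4)
        then have "ennreal \<bar>r W\<bar> \<le> ennreal (\<bar>q X W\<bar> + \<bar>qh W\<bar>)" by (rule ennreal_leI)
        then show ?thesis by (simp only: ennreal_plus[OF abs_ge_zero abs_ge_zero])
      qed
      also have "\<dots> \<le> ennreal c1 * ennreal (p X W) + ennreal (c1 * c2) * ennreal (p X W)"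
        by (intro add_mono 1 2)
      also have "\<dots> = ennreal c * P 0 X W"
        using c1 c2 by (simp add: c_def ennreal_plus distrib_right)
      finally show ?thesis .
    qed (simp add: r_def)
  next
    case (Suc k W)
    show ?case
    proof (cases "u < fst W")
      case True
      have "ennreal \<bar>r W\<bar> \<le> (\<integral>\<^sup>+V. ennreal (norm (r V * B V W)) \<partial>lborel)"
        by (subst eq[OF True]) (use integral_norm_bound_ennreal[OF int[OF True]] in simp)
      also have "\<dots> \<le> (\<integral>\<^sup>+V. ennreal c * (P k X V * ennreal \<bar>B V W\<bar>) \<partial>lborel)"
      proof (rule nn_integral_mono)
        fix V
        show "ennreal (norm (r V * B V W)) \<le> ennreal c * (P k X V * ennreal \<bar>B V W\<bar>)"
        proof (cases "fst V < fst W")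
          case True
          then have "ennreal \<bar>r V\<bar> * ennreal \<bar>B V W\<bar> \<le> (ennreal c * P k X V) * ennreal \<bar>B V W\<bar>"
            using Suc by (intro mult_right_mono Suc.IH) auto
          then show ?thesis by (simp add: abs_mult ennreal_mult mult.assoc)
        qed (simp add: B_zero)
      qed
      also have "\<dots> = ennreal c * P (Suc k) X W" by (simp add: nn_integral_cmult)
      finally show ?thesis .
    qed (simp add: r_def)
  qed
  have "\<bar>r Y\<bar> \<le> c * enn2real (P k X Y)" for k
  proof -
    have "enn2real (ennreal \<bar>r Y\<bar>) \<le> enn2real (ennreal c * P k X Y)"
      using P_finite[of k X Y] by (intro enn2real_mono iter) (auto simp: T_def ennreal_mult_less_top)
    then show ?thesis using c by (simp add: enn2real_mult)
  qed
  moreover have "(\<lambda>k. c * enn2real (P k X Y)) \<longlonglongrightarrow> c * 0"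
    by (intro tendsto_intros summable_LIMSEQ_zero P_summable)
  ultimately have "\<bar>r Y\<bar> \<le> 0"
    by (intro LIMSEQ_le_const[of "\<lambda>k. c * enn2real (P k X Y)"]) auto
  then have "q X Y = qh Y" using u by (simp add: r_def)
  then show ?thesis using integrable_qq[OF u] by (simp add: has_bochner_integral_iff qh_def)
qed

section \<open>Two-sided comparison with the unperturbed density\<close>

lemma q_small_lower:
  assumes st: "s < t" and h: "h \<ge> 0" "\<eta> + h < 1" and small: "inner_le Q s t h"
  shows "(1 - (\<eta> + h) / (1 - (\<eta> + h))) * p (s, x) (t, y) \<le> q (s, x) (t, y)"
proof -
  define \<theta> where "\<theta> = (\<eta> + h) / (1 - (\<eta> + h))"
  have \<theta>: "\<theta> \<ge> 0" using \<eta> h by (simp add: \<theta>_def)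
  have "ennreal \<bar>q (s, x) (t, y) - p (s, x) (t, y)\<bar> \<le> ennreal \<theta> * ennreal (p (s, x) (t, y))"
    unfolding \<theta>_def by (rule order.trans[OF q_minus_p S_small(2)[OF st h small]])
  then have "\<bar>q (s, x) (t, y) - p (s, x) (t, y)\<bar> \<le> \<theta> * p (s, x) (t, y)"
    using \<theta> by (simp add: ennreal_mult[symmetric] p_nonneg)
  then show ?thesis unfolding \<theta>_def[symmetric] by (simp add: algebra_simps)
qed

text \<open>As \<open>\<kappa>\<close> is nonnegative, the lower bounds of the two factors are
  nonnegative and may be multiplied, although nonnegativity of \<open>q\<close> has not been proved
  yet; it is deduced from this lemma.\<close>

lemma q_lower:
  assumes h: "h > 0" "\<eta> + h < 1 / 2"
  defines "\<kappa> \<equiv> 1 - (\<eta> + h) / (1 - (\<eta> + h))"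
  shows "s < t \<Longrightarrow> inner_le Q s t (real (Suc k) * h) \<Longrightarrow> \<kappa> ^ Suc k * p (s, x) (t, y) \<le> q (s, x) (t, y)"
proof (induction k arbitrary: s t x y)
  case 0
  then show ?case unfolding \<kappa>_def using q_small_lower[of s t h] h by simp
next
  case (Suc k)
  have \<kappa>: "0 \<le> \<kappa>" "\<kappa> \<le> 1" using h \<eta> by (auto simp: \<kappa>_def field_simps)
  from superadditive_cut[OF Q_super Q_nonneg h(1) Suc.prems] show ?case
  proof
    assume "inner_le Q s t h"
    then have 1: "\<kappa> * p (s, x) (t, y) \<le> q (s, x) (t, y)"
      unfolding \<kappa>_def using h Suc.prems by (intro q_small_lower) auto
    have "\<kappa> ^ Suc (Suc k) \<le> \<kappa>" using \<kappa> power_decreasing[of 1 "Suc (Suc k)" \<kappa>] by simp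
    then have "\<kappa> ^ Suc (Suc k) * p (s, x) (t, y) \<le> \<kappa> * p (s, x) (t, y)"
      by (intro mult_right_mono p_nonneg)
    with 1 show ?thesis by simp
  next
    assume "\<exists>u. s < u \<and> u < t \<and> inner_le Q s u h \<and> inner_le Q u t (real (Suc k) * h)"
    then obtain u where u: "s < u" "u < t" "inner_le Q s u h" "inner_le Q u t (real (Suc k) * h)" by blast
    have Ip: "has_bochner_integral lborel (\<lambda>z. p (s, x) (u, z) * p (u, z) (t, y)) (p (s, x) (t, y))"
      using p_CK[of "(s, x)" u "(t, y)"] u by (intro has_bochner_integral_nn_integral) (auto simp: p_nonneg ennreal_mult)
    have Iq: "has_bochner_integral lborel (\<lambda>z. q (s, x) (u, z) * q (u, z) (t, y)) (q (s, x) (t, y))"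
      using u by (intro q_CK) auto
    have "\<kappa> ^ Suc (Suc k) * p (s, x) (t, y) = (LBINT z. \<kappa> ^ Suc (Suc k) * (p (s, x) (u, z) * p (u, z) (t, y)))"
      using Ip by (simp add: has_bochner_integral_iff)
    also have "\<dots> \<le> (LBINT z. q (s, x) (u, z) * q (u, z) (t, y))"
    proof (rule integral_mono)
      show "integrable lborel (\<lambda>z. \<kappa> ^ Suc (Suc k) * (p (s, x) (u, z) * p (u, z) (t, y)))"
        using Ip by (intro integrable_mult_right) (simp add: has_bochner_integral_iff)
      show "integrable lborel (\<lambda>z. q (s, x) (u, z) * q (u, z) (t, y))"
        using Iq by (simp add: has_bochner_integral_iff)
      fix z
      have 1: "\<kappa> * p (s, x) (u, z) \<le> q (s, x) (u, z)"
        unfolding \<kappa>_def using h u by (intro q_small_lower) auto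
      have 2: "\<kappa> ^ Suc k * p (u, z) (t, y) \<le> q (u, z) (t, y)"
        using u by (intro Suc.IH) auto
      have 0: "0 \<le> \<kappa> * p (s, x) (u, z)" "0 \<le> \<kappa> ^ Suc k * p (u, z) (t, y)"
        using \<kappa> p_nonneg by auto
      have "(\<kappa> * p (s, x) (u, z)) * (\<kappa> ^ Suc k * p (u, z) (t, y)) \<le> q (s, x) (u, z) * q (u, z) (t, y)"
        using 0 1 2 by (intro mult_mono) auto
      then show "\<kappa> ^ Suc (Suc k) * (p (s, x) (u, z) * p (u, z) (t, y)) \<le> q (s, x) (u, z) * q (u, z) (t, y)"
        by (simp add: mult_ac)
    qed
    also have "\<dots> = q (s, x) (t, y)" using Iq by (simp add: has_bochner_integral_iff)
    finally show ?thesis .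
  qed
qed

lemma inner_le_pieces:
  assumes h: "h > 0"
  obtains k where "inner_le Q s t (real (Suc k) * h)" "real (Suc k) \<le> 1 + Q s t / h"
proof -
  define m where "m = nat \<lceil>Q s t / h\<rceil>"
  \<comment> \<open>Truncated subtraction covers \<open>Q s t = 0\<close>, where
    \<open>m = 0\<close> and a single piece remains; otherwise \<open>Suc k\<close> is the ceiling
    of \<open>Q s t / h\<close>.\<close>
  define k where "k = m - 1"
  have Qh: "0 \<le> Q s t / h" using h Q_nonneg by simp
  have "Q s t / h \<le> real m" unfolding m_def using Qh by linarith
  also have "real m \<le> real (Suc k)" by (simp add: k_def)
  finally have 1: "Q s t \<le> real (Suc k) * h" using h by (simp add: field_simps)
  have "real m < 1 + Q s t / h" unfolding m_def using Qh by linarith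
  then have "real (Suc k) \<le> 1 + Q s t / h" using Qh by (cases m) (auto simp: k_def)
  moreover have "inner_le Q s t (real (Suc k) * h)"
    unfolding inner_le_def
  proof (intro allI impI)
    fix s' t' assume "s < s'" "s' < t'" "t' < t"
    then have "Q s' t' \<le> Q s t" by (intro superadditive_mono[OF Q_super Q_nonneg]) auto
    with 1 show "Q s' t' \<le> real (Suc k) * h" by simp
  qed
  ultimately show ?thesis using that by blast
qed

lemma q_nonneg: "0 \<le> q X Y"
proof (cases "fst X < fst Y")
  case True
  define h where "h = (1 / 2 - \<eta>) / 2"
  have h: "h > 0" "\<eta> + h < 1 / 2" using \<eta> by (auto simp: h_def field_simps)
  obtain k where "inner_le Q (fst X) (fst Y) (real (Suc k) * h)" using inner_le_pieces[OF h(1)] by blast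
  from q_lower[OF h True this, of "snd X" "snd Y"]
  have "(1 - (\<eta> + h) / (1 - (\<eta> + h))) ^ Suc k * p X Y \<le> q X Y" by simp
  moreover have "0 \<le> 1 - (\<eta> + h) / (1 - (\<eta> + h))" using h \<eta> by (simp add: field_simps)
  then have "0 \<le> (1 - (\<eta> + h) / (1 - (\<eta> + h))) ^ Suc k * p X Y" by (intro mult_nonneg_nonneg zero_le_power p_nonneg)
  ultimately show ?thesis by linarith
qed (simp add: q_zero)

lemma q_le_real:
  assumes "S X Y \<le> ennreal M * ennreal (p X Y)" "M \<ge> 0"
  shows "q X Y \<le> M * p X Y"
proof -
  have "ennreal \<bar>q X Y\<bar> \<le> ennreal (M * p X Y)"
    using order.trans[OF q_le_S assms(1)] assms(2) by (simp add: ennreal_mult p_nonneg)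
  then show ?thesis using assms(2) p_nonneg[of X Y] by (simp add: ennreal_le_iff)
qed

lemma q_upper_pos:
  assumes \<eta>0: "\<eta> > 0" and st: "s < t"
  shows "q (s, x) (t, y) \<le> p (s, x) (t, y) * (1 / (1 - 2 * \<eta>)) powr (1 + Q s t / \<eta>)"
proof -
  define M where "M = 1 / (1 - 2 * \<eta>)"
  have M: "M \<ge> 1" using \<eta> by (simp add: M_def field_simps)
  obtain k where k: "inner_le Q s t (real (Suc k) * \<eta>)" "real (Suc k) \<le> 1 + Q s t / \<eta>"
    using inner_le_pieces[OF \<eta>0] by blast
  have "S (s, x) (t, y) \<le> ennreal (M ^ Suc k) * ennreal (p (s, x) (t, y))"
    using S_bound[OF \<eta>0 _ st k(1), of x y] \<eta> by (simp add: M_def)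
  then have "q (s, x) (t, y) \<le> M ^ Suc k * p (s, x) (t, y)"
    using M by (intro q_le_real) auto
  also have "M ^ Suc k = M powr real (Suc k)" using M by (subst powr_realpow) auto
  also have "M powr real (Suc k) * p (s, x) (t, y) \<le> M powr (1 + Q s t / \<eta>) * p (s, x) (t, y)"
    using M k(2) by (intro mult_right_mono powr_mono p_nonneg) auto
  finally show ?thesis by (simp add: M_def mult.commute)
qed

text \<open>Two limits: the number of pieces grows for a fixed \<open>R\<close> above
  \<open>Q s t\<close>, then \<open>R\<close> decreases to \<open>Q s t\<close>. The strict excess
  keeps \<open>h = R / k\<close> positive even if \<open>Q s t = 0\<close>.\<close>

lemma q_upper_zero:
  assumes \<eta>0: "\<eta> = 0" and st: "s < t"
  shows "q (s, x) (t, y) \<le> p (s, x) (t, y) * exp (Q s t)"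
proof -
  have 1: "q (s, x) (t, y) \<le> exp R * p (s, x) (t, y)" if R: "R > Q s t" for R
  proof -
    have R0: "R > 0" using R Q_nonneg[of s t] by linarith
    have "(\<lambda>k. (1 + (- R) / real k) ^ k) \<longlonglongrightarrow> exp (- R)" by (rule tendsto_exp_limit_sequentially)
    then have "(\<lambda>k. inverse ((1 + (- R) / real (Suc k)) ^ Suc k) * p (s, x) (t, y)) \<longlonglongrightarrow> inverse (exp (- R)) * p (s, x) (t, y)"
      by (intro tendsto_intros LIMSEQ_Suc[of "\<lambda>k. (1 + (- R) / real k) ^ k"]) auto
    then have lim: "(\<lambda>k. inverse ((1 + (- R) / real (Suc k)) ^ Suc k) * p (s, x) (t, y)) \<longlonglongrightarrow> exp R * p (s, x) (t, y)"
      by (simp add: exp_minus)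
    have "q (s, x) (t, y) \<le> inverse ((1 + (- R) / real (Suc k)) ^ Suc k) * p (s, x) (t, y)" if k: "R < real (Suc k)" for k
    proof -
      define h where "h = R / real (Suc k)"
      have h: "h > 0" "\<eta> + h < 1" using R0 k by (auto simp: h_def \<eta>0 field_simps)
      have hk: "real (Suc k) * h = R" by (simp add: h_def)
      have "inner_le Q s t (real (Suc k) * h)"
        unfolding inner_le_def hk
      proof (intro allI impI)
        fix s' t' assume "s < s'" "s' < t'" "t' < t"
        then have "Q s' t' \<le> Q s t" by (intro superadditive_mono[OF Q_super Q_nonneg]) auto
        with R show "Q s' t' \<le> R" by simp
      qed
      from S_bound[OF h st this, of x y]
      have "q (s, x) (t, y) \<le> (1 / (1 - (\<eta> + h))) ^ Suc k * p (s, x) (t, y)"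
        using h by (intro q_le_real) auto
      also have "(1 / (1 - (\<eta> + h))) ^ Suc k = inverse ((1 + (- R) / real (Suc k)) ^ Suc k)"
        by (simp only: \<eta>0 h_def add_0 power_one_over inverse_eq_divide minus_divide_left[symmetric] diff_conv_add_uminus)
      finally show ?thesis .
    qed
    moreover obtain N :: nat where "R < real N" using reals_Archimedean2 by blast
    ultimately have "\<exists>N. \<forall>k\<ge>N. q (s, x) (t, y) \<le> inverse ((1 + (- R) / real (Suc k)) ^ Suc k) * p (s, x) (t, y)"
      by (intro exI[of _ N]) auto
    with lim show ?thesis by (rule LIMSEQ_le_const)
  qed
  have c0: "(\<lambda>j. 1 / real (Suc j)) \<longlonglongrightarrow> 0" by (rule LIMSEQ_Suc[OF lim_1_over_n])
  have "(\<lambda>j. exp (Q s t + 1 / real (Suc j)) * p (s, x) (t, y)) \<longlonglongrightarrow> exp (Q s t + 0) * p (s, x) (t, y)"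
    by (intro tendsto_intros c0)
  then have "q (s, x) (t, y) \<le> exp (Q s t + 0) * p (s, x) (t, y)"
    by (rule LIMSEQ_le_const) (use 1 in auto)
  then show ?thesis by (simp add: mult.commute)
qed

lemma q_lower_ex:
  "\<exists>C>1. \<forall>s t x y. s < t \<longrightarrow> p (s, x) (t, y) / C powr (1 + Q s t) \<le> q (s, x) (t, y)"
proof -
  define h where "h = (1 / 2 - \<eta>) / 2"
  have h: "h > 0" "\<eta> + h < 1 / 2" using \<eta> by (auto simp: h_def field_simps)
  define \<kappa> where "\<kappa> = 1 - (\<eta> + h) / (1 - (\<eta> + h))"
  have \<kappa>: "0 < \<kappa>" "\<kappa> \<le> 1" using h \<eta> by (auto simp: \<kappa>_def field_simps)
  \<comment> \<open>\<open>1 + Q s t / h \<le> m * (1 + Q s t)\<close>, so the number of pieces is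
    absorbed into the base \<open>(1 / \<kappa>) powr m\<close>. The maximum with 2 makes
    \<open>C > 1\<close> immediate.\<close>
  define m where "m = max 1 (1 / h)"
  define C where "C = max 2 ((1 / \<kappa>) powr m)"
  have "p (s, x) (t, y) / C powr (1 + Q s t) \<le> q (s, x) (t, y)" if st: "s < t" for s t x y
  proof -
    obtain k where k: "inner_le Q s t (real (Suc k) * h)" "real (Suc k) \<le> 1 + Q s t / h"
      using inner_le_pieces[OF h(1)] by blast
    have Q0: "0 \<le> Q s t" by (rule Q_nonneg)
    have "1 + Q s t / h \<le> m * (1 + Q s t)"
    proof -
      have "1 / h * Q s t \<le> m * Q s t" by (intro mult_right_mono Q0) (simp add: m_def)
      moreover have "1 \<le> m" by (simp add: m_def)
      ultimately show ?thesis by (simp add: distrib_left)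
    qed
    with k have km: "real (Suc k) \<le> m * (1 + Q s t)" by linarith
    have "(1 / \<kappa>) ^ Suc k = (1 / \<kappa>) powr real (Suc k)" using \<kappa> by (subst powr_realpow) auto
    also have "\<dots> \<le> (1 / \<kappa>) powr (m * (1 + Q s t))" using \<kappa> km by (intro powr_mono) auto
    also have "\<dots> = ((1 / \<kappa>) powr m) powr (1 + Q s t)" by (rule powr_powr[symmetric])
    also have "\<dots> \<le> C powr (1 + Q s t)" using Q0 by (intro powr_mono2) (auto simp: C_def)
    finally have le: "(1 / \<kappa>) ^ Suc k \<le> C powr (1 + Q s t)" .
    have "C powr (1 + Q s t) > 0" by (simp add: C_def)
    then have "1 / C powr (1 + Q s t) \<le> 1 / (1 / \<kappa>) ^ Suc k"
      using le \<kappa> by (intro divide_left_mono mult_pos_pos) auto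
    also have "1 / (1 / \<kappa>) ^ Suc k = \<kappa> ^ Suc k" by (simp add: power_one_over)
    finally have "1 / C powr (1 + Q s t) * p (s, x) (t, y) \<le> \<kappa> ^ Suc k * p (s, x) (t, y)"
      by (intro mult_right_mono p_nonneg)
    also have "\<dots> \<le> q (s, x) (t, y)" unfolding \<kappa>_def by (rule q_lower[OF h st k(1)])
    finally show ?thesis by simp
  qed
  moreover have "C > 1" by (simp add: C_def)
  ultimately show ?thesis by blast
qed

end

section \<open>Test functions\<close>

lemma bounded_of_compact_support:
  fixes f :: "'a::euclidean_space \<Rightarrow> real"
  assumes f: "continuous_on UNIV f" and K: "compact (closure {x. f x \<noteq> 0})"
  shows "\<exists>B\<ge>0. \<forall>x. \<bar>f x\<bar> \<le> B"
proof -
  have "compact (f ` closure {x. f x \<noteq> 0})"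
    using f K by (intro compact_continuous_image) (auto intro: continuous_on_subset)
  then have "bounded (f ` closure {x. f x \<noteq> 0})" by (rule compact_imp_bounded)
  then obtain B where "\<forall>x\<in>closure {x. f x \<noteq> 0}. \<bar>f x\<bar> \<le> B" unfolding bounded_iff by auto
  then have B: "\<bar>f x\<bar> \<le> B" if "x \<in> closure {x. f x \<noteq> 0}" for x using that by blast
  have "\<bar>f x\<bar> \<le> max 0 B" for x
    using B[of x] closure_subset[of "{x. f x \<noteq> 0}"] by (cases "f x = 0") auto
  then show ?thesis by (intro exI[of _ "max 0 B"]) auto
qed

lemma frechet_derivative_outside_support:
  fixes f :: "'a::euclidean_space \<Rightarrow> real"
  assumes "x \<notin> closure {x. f x \<noteq> 0}"
  shows "frechet_derivative f (at x) v = 0"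
proof -
  have "((\<lambda>_. 0) has_derivative (\<lambda>_. 0)) (at x)" by (rule has_derivative_const)
  moreover have "open (- closure {x. f x \<noteq> 0})" by (simp add: open_Compl)
  moreover have "x \<in> - closure {x. f x \<noteq> 0}" using assms by simp
  moreover have "0 = f y" if "y \<in> - closure {x. f x \<noteq> 0}" for y
    using that closure_subset[of "{x. f x \<noteq> 0}"] by auto
  ultimately have "(f has_derivative (\<lambda>_. 0)) (at x)"
    by (rule has_derivative_transform_within_open)
  then have "frechet_derivative f (at x) = (\<lambda>_. 0)" by (rule frechet_derivative_at[symmetric])
  then show ?thesis by simp
qed

lemma compact_support_derivative:
  fixes f :: "'a::euclidean_space \<Rightarrow> real"
  assumes "compact (closure {x. f x \<noteq> 0})"
  shows "compact (closure {x. frechet_derivative f (at x) v \<noteq> 0})"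
proof -
  have "{x. frechet_derivative f (at x) v \<noteq> 0} \<subseteq> closure {x. f x \<noteq> 0}"
    using frechet_derivative_outside_support[of _ f v] by blast
  then have "closure {x. frechet_derivative f (at x) v \<noteq> 0} \<subseteq> closure {x. f x \<noteq> 0}"
    by (simp add: closure_minimal)
  then show ?thesis using assms by (meson closed_closure compact_closure bounded_subset compact_eq_bounded_closed)
qed

lemma Cc_infinity_derivative:
  assumes "f \<in> Cc_infinity" shows "(\<lambda>x. frechet_derivative f (at x) v) \<in> Cc_infinity"
proof -
  have "cont_diff k (\<lambda>x. frechet_derivative f (at x) v)" for k
    using assms cont_diff.simps(2)[of k f] by (auto simp: Cc_infinity_def)
  moreover have "compact (closure {x. frechet_derivative f (at x) v \<noteq> 0})"
    using assms by (intro compact_support_derivative) (unfold Cc_infinity_def, blast)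
  ultimately show ?thesis unfolding Cc_infinity_def by blast
qed

lemma Cc_infinity_has_derivative:
  assumes "f \<in> Cc_infinity" shows "(f has_derivative frechet_derivative f (at x)) (at x)"
proof -
  have "cont_diff (Suc 0) f" using assms by (simp add: Cc_infinity_def)
  then show ?thesis by (simp add: frechet_derivative_works[symmetric])
qed

lemma Cc_infinity_continuous: "f \<in> Cc_infinity \<Longrightarrow> continuous_on UNIV f"
  using cont_diff.simps(1)[of f] by (auto simp: Cc_infinity_def)

lemma Cc_infinity_bounded: "f \<in> Cc_infinity \<Longrightarrow> \<exists>B\<ge>0. \<forall>x. \<bar>f x\<bar> \<le> B"
  by (rule bounded_of_compact_support[OF Cc_infinity_continuous]) (auto simp: Cc_infinity_def)

lemma Cc_infinity_support:
  assumes "f \<in> Cc_infinity" shows "\<exists>R>0. \<forall>x. f x \<noteq> 0 \<longrightarrow> norm x \<le> R"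
proof -
  have "bounded (closure {x. f x \<noteq> 0})" using assms by (auto simp: Cc_infinity_def compact_imp_bounded)
  then have "bounded {x. f x \<noteq> 0}" by (rule bounded_subset) (rule closure_subset)
  then show ?thesis by (auto simp: bounded_pos)
qed

lemma linear_basis_sum:
  fixes g :: "'a::euclidean_space \<Rightarrow> real"
  assumes "linear g" shows "g v = (\<Sum>b\<in>Basis. (v \<bullet> b) * g b)"
proof -
  have "g v = g (\<Sum>b\<in>Basis. (v \<bullet> b) *\<^sub>R b)" by (simp only: euclidean_representation)
  also have "\<dots> = (\<Sum>b\<in>Basis. (v \<bullet> b) * g b)"
    by (simp only: linear_sum[OF assms] linear_scale[OF assms] real_scaleR_def)
  finally show ?thesis .
qed

lemma Cc_infinity_lipschitz:
  fixes f :: "'a::euclidean_space \<Rightarrow> real"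
  assumes f: "f \<in> Cc_infinity"
  shows "\<exists>L\<ge>0. \<forall>x y. \<bar>f x - f y\<bar> \<le> L * norm (x - y)"
proof -
  have "\<forall>b. \<exists>B\<ge>0. \<forall>x. \<bar>frechet_derivative f (at x) b\<bar> \<le> B"
    using Cc_infinity_bounded[OF Cc_infinity_derivative[OF f]] by blast
  then obtain M where M: "\<And>b. 0 \<le> M b" "\<And>b x. \<bar>frechet_derivative f (at x) b\<bar> \<le> M b" by metis
  define L where "L = (\<Sum>b\<in>Basis. M b)"
  have "norm (f x - f y) \<le> L * norm (x - y)" for x y
  proof (rule differentiable_bound[of UNIV])
    fix x :: 'a
    show "(f has_derivative frechet_derivative f (at x)) (at x within UNIV)"
      using Cc_infinity_has_derivative[OF f] by simp
    have lin: "linear (frechet_derivative f (at x))"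
      using Cc_infinity_has_derivative[OF f] by (rule has_derivative_linear)
    show "onorm (frechet_derivative f (at x)) \<le> L"
    proof (rule onorm_bound)
      show "0 \<le> L" by (auto simp: L_def intro: sum_nonneg M)
      fix v :: 'a
      have "frechet_derivative f (at x) v = (\<Sum>b\<in>Basis. (v \<bullet> b) * frechet_derivative f (at x) b)"
        by (rule linear_basis_sum[OF lin])
      also have "\<bar>\<dots>\<bar> \<le> (\<Sum>b\<in>Basis. \<bar>(v \<bullet> b) * frechet_derivative f (at x) b\<bar>)" by (rule sum_abs)
      also have "\<dots> \<le> (\<Sum>b\<in>Basis. norm v * M b)"
        unfolding abs_mult by (intro sum_mono mult_mono M Basis_le_norm) auto
      also have "\<dots> = L * norm v" by (simp only: L_def sum_distrib_left[symmetric] mult.commute[of "sum M Basis"])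
      finally show "norm (frechet_derivative f (at x) v) \<le> L * norm v" by simp
    qed
  qed auto
  moreover have "L \<ge> 0" by (auto simp: L_def intro: sum_nonneg M)
  ultimately show ?thesis by auto
qed

text \<open>Boundedness handles large \<open>y\<close>. For small \<open>y\<close> the function
  \<open>r \<mapsto> f (x + r y) + f (x - r y)\<close> has a derivative of size
  \<open>(norm y)\<^sup>2\<close>, because the first derivatives are Lipschitz. The shape of the
  bound is the one against which a Levy density is integrable.\<close>

lemma Cc_infinity_second_difference:
  fixes f :: "'a::euclidean_space \<Rightarrow> real"
  assumes f: "f \<in> Cc_infinity"
  shows "\<exists>A\<ge>0. \<forall>x y. \<bar>f (x + y) + f (x - y) - 2 * f x\<bar> \<le> A * min 1 ((norm y)\<^sup>2)"
proof -
  obtain B where B: "B \<ge> 0" "\<And>x. \<bar>f x\<bar> \<le> B" using Cc_infinity_bounded[OF f] by blast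
  have "\<forall>b. \<exists>L\<ge>0. \<forall>x y. \<bar>frechet_derivative f (at x) b - frechet_derivative f (at y) b\<bar> \<le> L * norm (x - y)"
    using Cc_infinity_lipschitz[OF Cc_infinity_derivative[OF f]] by blast
  then obtain M where M: "\<And>b. 0 \<le> M b" "\<And>b x y. \<bar>frechet_derivative f (at x) b - frechet_derivative f (at y) b\<bar> \<le> M b * norm (x - y)" by metis
  define L where "L = (\<Sum>b\<in>Basis. M b)"
  have L: "L \<ge> 0" by (auto simp: L_def intro: sum_nonneg M)
  have D: "\<bar>frechet_derivative f (at x) v - frechet_derivative f (at x') v\<bar> \<le> L * norm v * norm (x - x')" for x x' v
  proof -
    have lin: "linear (frechet_derivative f (at x))" for x
      using Cc_infinity_has_derivative[OF f] by (rule has_derivative_linear)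
    have rep: "frechet_derivative f (at x) v = (\<Sum>b\<in>Basis. (v \<bullet> b) * frechet_derivative f (at x) b)" for x
      by (rule linear_basis_sum[OF lin])
    have "frechet_derivative f (at x) v - frechet_derivative f (at x') v =
       (\<Sum>b\<in>Basis. (v \<bullet> b) * (frechet_derivative f (at x) b - frechet_derivative f (at x') b))"
      unfolding rep[of x] rep[of x'] by (simp only: sum_subtractf right_diff_distrib)
    also have "\<bar>\<dots>\<bar> \<le> (\<Sum>b\<in>Basis. \<bar>(v \<bullet> b) * (frechet_derivative f (at x) b - frechet_derivative f (at x') b)\<bar>)" by (rule sum_abs)
    also have "\<dots> \<le> (\<Sum>b\<in>Basis. norm v * (M b * norm (x - x')))"
      unfolding abs_mult by (intro sum_mono mult_mono M Basis_le_norm) auto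
    also have "\<dots> = L * norm v * norm (x - x')"
      by (simp add: L_def sum_distrib_left[symmetric] sum_distrib_right[symmetric] mult_ac)
    finally show ?thesis .
  qed
  define A where "A = max (4 * B) (2 * L)"
  have "\<bar>f (x + y) + f (x - y) - 2 * f x\<bar> \<le> A * min 1 ((norm y)\<^sup>2)" for x y
  proof -
    have 1: "\<bar>f (x + y) + f (x - y) - 2 * f x\<bar> \<le> 4 * B" using B(2)[of "x + y"] B(2)[of "x - y"] B(2)[of x] by linarith
    let ?g = "\<lambda>r::real. f (x + r *\<^sub>R y) + f (x - r *\<^sub>R y)"
    let ?g' = "\<lambda>r::real. frechet_derivative f (at (x + r *\<^sub>R y)) y - frechet_derivative f (at (x - r *\<^sub>R y)) y"
    have "norm (?g 1 - ?g 0) \<le> (2 * L * (norm y)\<^sup>2) * norm (1 - 0 :: real)"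
    proof (rule field_differentiable_bound[where S="{0..1}" and f'="?g'"])
      fix r :: real assume r: "r \<in> {0..1}"
      have d1: "((\<lambda>r. x + r *\<^sub>R y) has_derivative (\<lambda>h. h *\<^sub>R y)) (at r)"
        by (auto intro!: derivative_eq_intros)
      have d2: "((\<lambda>r. x - r *\<^sub>R y) has_derivative (\<lambda>h. - (h *\<^sub>R y))) (at r)"
        by (auto intro!: derivative_eq_intros)
      have lin: "linear (frechet_derivative f (at x))" for x
        using Cc_infinity_has_derivative[OF f] by (rule has_derivative_linear)
      have "(?g has_derivative (\<lambda>h. frechet_derivative f (at (x + r *\<^sub>R y)) (h *\<^sub>R y) + frechet_derivative f (at (x - r *\<^sub>R y)) (- (h *\<^sub>R y)))) (at r)"
        by (intro has_derivative_add has_derivative_compose[OF d1 Cc_infinity_has_derivative[OF f]] has_derivative_compose[OF d2 Cc_infinity_has_derivative[OF f]])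
      also have "(\<lambda>h. frechet_derivative f (at (x + r *\<^sub>R y)) (h *\<^sub>R y) + frechet_derivative f (at (x - r *\<^sub>R y)) (- (h *\<^sub>R y))) = (*) (?g' r)"
        by (simp add: fun_eq_iff linear_scale[OF lin] linear_neg[OF lin] algebra_simps)
      finally show "(?g has_field_derivative ?g' r) (at r within {0..1})"
        unfolding has_field_derivative_def by (rule has_derivative_at_withinI)
      have "\<bar>?g' r\<bar> \<le> L * norm y * norm ((x + r *\<^sub>R y) - (x - r *\<^sub>R y))" by (rule D)
      also have "(x + r *\<^sub>R y) - (x - r *\<^sub>R y) = (2 * r) *\<^sub>R y" by (simp add: scaleR_2 algebra_simps flip: scaleR_scaleR)
      also have "L * norm y * norm ((2 * r) *\<^sub>R y) \<le> 2 * L * (norm y)\<^sup>2"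
      proof -
        have "L * (norm y)\<^sup>2 * r \<le> L * (norm y)\<^sup>2 * 1" using r L by (intro mult_left_mono) auto
        then show ?thesis using r by (simp add: power2_eq_square mult_ac)
      qed
      finally show "norm (?g' r) \<le> 2 * L * (norm y)\<^sup>2" by simp
    qed auto
    then have 2: "\<bar>f (x + y) + f (x - y) - 2 * f x\<bar> \<le> 2 * L * (norm y)\<^sup>2" by simp
    have "2 * L * (norm y)\<^sup>2 \<le> A * (norm y)\<^sup>2" by (intro mult_right_mono) (auto simp: A_def)
    moreover have "4 * B \<le> A" by (simp add: A_def)
    ultimately show ?thesis using 1 2 by (auto simp: min_def)
  qed
  moreover have "A \<ge> 0" using L by (simp add: A_def)
  ultimately show ?thesis by blast
qed

section \<open>Partial derivatives in time and space\<close>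

lemma Cc_infinity_time_derivative:
  fixes \<phi> :: "real \<times> 'a::euclidean_space \<Rightarrow> real"
  assumes f: "\<phi> \<in> Cc_infinity"
  shows "((\<lambda>v. \<phi> (v, z)) has_real_derivative frechet_derivative \<phi> (at (u, z)) (1, 0)) (at u)"
proof -
  have d: "((\<lambda>v. (v, z)) has_derivative (\<lambda>h. (h, 0))) (at u)"
    by (auto intro!: derivative_eq_intros)
  have lin: "linear (frechet_derivative \<phi> (at (u, z)))"
    using Cc_infinity_has_derivative[OF f] by (rule has_derivative_linear)
  have "((\<lambda>v. \<phi> (v, z)) has_derivative (\<lambda>h. frechet_derivative \<phi> (at (u, z)) (h, 0))) (at u)"
    by (rule has_derivative_compose[OF d Cc_infinity_has_derivative[OF f]])
  also have "(\<lambda>h. frechet_derivative \<phi> (at (u, z)) (h, 0)) = (*) (frechet_derivative \<phi> (at (u, z)) (1, 0))"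
  proof
    fix h :: real
    have "(h, 0) = h *\<^sub>R (1, 0 :: 'a)" by simp
    then show "frechet_derivative \<phi> (at (u, z)) (h, 0) = frechet_derivative \<phi> (at (u, z)) (1, 0) * h"
      by (metis linear_scale[OF lin] mult.commute real_scaleR_def)
  qed
  finally show ?thesis unfolding has_field_derivative_def .
qed

text \<open>Assembled from the joint derivative, so that boundedness and joint continuity in time
  and space come from the derivatives of \<open>\<phi>\<close> as a function on space-time.\<close>

definition space_grad :: "(real \<times> 'a::euclidean_space \<Rightarrow> real) \<Rightarrow> real \<Rightarrow> 'a \<Rightarrow> 'a" where
  "space_grad \<phi> u z = (\<Sum>b\<in>Basis. frechet_derivative \<phi> (at (u, z)) (0, b) *\<^sub>R b)"

lemma Cc_infinity_space_grad:
  fixes \<phi> :: "real \<times> 'a::euclidean_space \<Rightarrow> real"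
  assumes f: "\<phi> \<in> Cc_infinity"
  shows "GDERIV (\<lambda>w. \<phi> (u, w)) z :> space_grad \<phi> u z"
proof -
  have d: "((\<lambda>w. (u, w)) has_derivative (\<lambda>h. (0, h))) (at z)"
    by (auto intro!: derivative_eq_intros)
  have lin: "linear (frechet_derivative \<phi> (at (u, z)))"
    using Cc_infinity_has_derivative[OF f] by (rule has_derivative_linear)
  have "((\<lambda>w. \<phi> (u, w)) has_derivative (\<lambda>h. frechet_derivative \<phi> (at (u, z)) (0, h))) (at z)"
    by (rule has_derivative_compose[OF d Cc_infinity_has_derivative[OF f]])
  also have "(\<lambda>h. frechet_derivative \<phi> (at (u, z)) (0, h)) = (\<lambda>h. h \<bullet> space_grad \<phi> u z)"
  proof
    fix h :: 'a
    have "(0, h) = (\<Sum>b\<in>Basis. (h \<bullet> b) *\<^sub>R (0 :: real, b))"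
      by (simp add: sum_prod euclidean_representation)
    then have "frechet_derivative \<phi> (at (u, z)) (0, h) = (\<Sum>b\<in>Basis. (h \<bullet> b) * frechet_derivative \<phi> (at (u, z)) (0, b))"
      by (simp only: linear_sum[OF lin] linear_scale[OF lin] real_scaleR_def)
    then show "frechet_derivative \<phi> (at (u, z)) (0, h) = h \<bullet> space_grad \<phi> u z"
      by (simp add: space_grad_def inner_sum_right mult.commute)
  qed
  finally show ?thesis unfolding gderiv_def .
qed

lemma Cc_infinity_space_grad_bounded:
  fixes \<phi> :: "real \<times> 'a::euclidean_space \<Rightarrow> real"
  assumes f: "\<phi> \<in> Cc_infinity"
  shows "\<exists>B\<ge>0. \<forall>u z. norm (space_grad \<phi> u z) \<le> B"
proof -
  have "\<forall>b. \<exists>B\<ge>0. \<forall>x. \<bar>frechet_derivative \<phi> (at x) b\<bar> \<le> B"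
    using Cc_infinity_bounded[OF Cc_infinity_derivative[OF f]] by blast
  then obtain M where M: "\<And>b. 0 \<le> M b" "\<And>b x. \<bar>frechet_derivative \<phi> (at x) b\<bar> \<le> M b" by metis
  have "norm (space_grad \<phi> u z) \<le> (\<Sum>b\<in>Basis. M (0, b))" for u z
    unfolding space_grad_def by (rule order.trans[OF norm_sum]) (auto intro!: sum_mono M)
  moreover have "0 \<le> (\<Sum>b\<in>(Basis::'a set). M (0, b))" by (intro sum_nonneg M)
  ultimately show ?thesis by blast
qed

lemma Cc_infinity_space_grad_continuous:
  fixes \<phi> :: "real \<times> 'a::euclidean_space \<Rightarrow> real"
  assumes f: "\<phi> \<in> Cc_infinity"
  shows "continuous_on UNIV (\<lambda>(u, z). space_grad \<phi> u z)"
  unfolding space_grad_def case_prod_beta prod.collapse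
  by (intro continuous_on_sum continuous_on_scaleR continuous_on_const Cc_infinity_continuous Cc_infinity_derivative f)

section \<open>The generator\<close>

context levy_exponent
begin

text \<open>The generator in symmetrised form. Averaging over \<open>y\<close> and
  \<open>- y\<close> cancels the first-order term, so the integral converges absolutely and not just
  as a principal value.\<close>

definition gen :: "('a \<Rightarrow> real) \<Rightarrow> 'a \<Rightarrow> real" where
  "gen f z = (1 / 2) * (LBINT y. n y * (f (z + y) + f (z - y) - 2 * f z))"

lemma integrable_gen:
  assumes [measurable]: "f \<in> borel_measurable borel"
    and A: "\<And>z y. \<bar>f (z + y) + f (z - y) - 2 * f z\<bar> \<le> A * min 1 ((norm y)\<^sup>2)"
  shows "integrable lborel (\<lambda>y. n y * (f (z + y) + f (z - y) - 2 * f z))"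
proof (rule Bochner_Integration.integrable_bound[OF integrable_mult_right[OF integrable_n_min, of A]])
  show "AE y in lborel. norm (n y * (f (z + y) + f (z - y) - 2 * f z)) \<le> norm (A * (n y * min 1 ((norm y)\<^sup>2)))"
  proof (rule AE_I2)
    fix y
    have "n y * \<bar>f (z + y) + f (z - y) - 2 * f z\<bar> \<le> n y * (A * min 1 ((norm y)\<^sup>2))" by (intro mult_left_mono A n_nonneg)
    then show "norm (n y * (f (z + y) + f (z - y) - 2 * f z)) \<le> norm (A * (n y * min 1 ((norm y)\<^sup>2)))"
      unfolding real_norm_def abs_mult[of "n y"] abs_of_nonneg[OF n_nonneg] by (simp only: mult_ac)
  qed
qed measurable

text \<open>Away from the origin the integral is averaged with its reflection, which is legitimate
  since \<open>n\<close> is even; the truncation of the resulting absolutely convergent integral is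
  then removed by dominated convergence.\<close>

lemma gen_tendsto:
  assumes [measurable]: "f \<in> borel_measurable borel" and B: "\<And>x. \<bar>f x\<bar> \<le> B"
    and A: "\<And>z y. \<bar>f (z + y) + f (z - y) - 2 * f z\<bar> \<le> A * min 1 ((norm y)\<^sup>2)"
  shows "((\<lambda>\<epsilon>. LINT y:{y. norm y > \<epsilon>}|lborel. n y * (f (x + y) - f x)) \<longlongrightarrow> gen f x) (at_right 0)"
proof (rule tendsto_at_right_sequentially[of 0 1])
  fix e :: "nat \<Rightarrow> real" assume e: "\<And>j. 0 < e j" "e \<longlonglongrightarrow> 0"
  let ?d = "\<lambda>y. f (x + y) + f (x - y) - 2 * f x"
  have sym: "(LINT y:{y. norm y > \<epsilon>}|lborel. n y * (f (x + y) - f x)) = (LBINT y. (1 / 2) * (indicator {y. norm y > \<epsilon>} y * (n y * ?d y)))" if \<epsilon>: "\<epsilon> > 0" for \<epsilon>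
  proof -
    let ?g = "\<lambda>y. indicator {y. norm y > \<epsilon>} y * n y * (f (x + y) - f x)"
    have "integrable lborel (\<lambda>y. (2 * B) * (indicator {y. norm y > \<epsilon>} y * n y))"
      by (intro integrable_mult_right integrable_n_outside \<epsilon>)
    then have ig: "integrable lborel ?g"
    proof (rule Bochner_Integration.integrable_bound)
      show "AE y in lborel. norm (?g y) \<le> norm ((2 * B) * (indicator {y. norm y > \<epsilon>} y * n y))"
      proof (rule AE_I2)
        fix y
        have "\<bar>f (x + y) - f x\<bar> \<le> 2 * B" using B[of "x + y"] B[of x] by linarith
        then have "(indicator {y. norm y > \<epsilon>} y * n y) * \<bar>f (x + y) - f x\<bar> \<le> (indicator {y. norm y > \<epsilon>} y * n y) * (2 * B)"
          by (intro mult_left_mono) (auto simp: n_nonneg)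
        then show "norm (?g y) \<le> norm ((2 * B) * (indicator {y. norm y > \<epsilon>} y * n y))"
          using order.trans[OF abs_ge_zero B] by (simp add: abs_mult n_nonneg mult.commute)
      qed
    qed measurable
    have "(LINT y:{y. norm y > \<epsilon>}|lborel. n y * (f (x + y) - f x)) = (LBINT y. ?g y)"
      by (simp add: set_lebesgue_integral_def mult.assoc)
    moreover have "(LBINT y. ?g y) = (LBINT y. ?g (- y))"
      by (rule integral_lborel_reflect[symmetric]) measurable
    moreover have "(LBINT y. ?g y + ?g (- y)) = (LBINT y. ?g y) + (LBINT y. ?g (- y))"
      by (rule Bochner_Integration.integral_add[OF ig integrable_lborel_reflect[OF ig]])
    ultimately have "(LINT y:{y. norm y > \<epsilon>}|lborel. n y * (f (x + y) - f x)) = (1 / 2) * (LBINT y. ?g y + ?g (- y))"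
      by simp
    also have "(\<lambda>y. ?g y + ?g (- y)) = (\<lambda>y. indicator {y. norm y > \<epsilon>} y * (n y * ?d y))"
      by (auto simp: fun_eq_iff n_even indicator_def algebra_simps)
    finally show ?thesis by simp
  qed
  have "(\<lambda>j. LBINT y. (1 / 2) * (indicator {y. norm y > e j} y * (n y * ?d y))) \<longlonglongrightarrow> (LBINT y. (1 / 2) * (n y * ?d y))"
  proof (rule integral_dominated_convergence)
    show "integrable lborel (\<lambda>y. \<bar>n y * ?d y\<bar>)" by (intro integrable_abs integrable_gen[OF _ A]) simp
    show "AE y in lborel. (\<lambda>j. (1 / 2) * (indicator {y. norm y > e j} y * (n y * ?d y))) \<longlonglongrightarrow> (1 / 2) * (n y * ?d y)"
    proof (rule AE_I2)
      fix y :: 'a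
      show "(\<lambda>j. (1 / 2) * (indicator {y. norm y > e j} y * (n y * ?d y))) \<longlonglongrightarrow> (1 / 2) * (n y * ?d y)"
      proof (cases "y = 0")
        case False
        then have "eventually (\<lambda>j. e j < norm y) sequentially" using e(2) by (intro order_tendstoD) auto
        then have "eventually (\<lambda>j. (1 / 2) * (indicator {y. norm y > e j} y * (n y * ?d y)) = (1 / 2) * (n y * ?d y)) sequentially"
          by eventually_elim simp
        then show ?thesis by (rule tendsto_eventually)
      qed simp
    qed
    show "AE y in lborel. norm ((1 / 2) * (indicator {y. norm y > e j} y * (n y * ?d y))) \<le> \<bar>n y * ?d y\<bar>" for j
      by (rule AE_I2) (auto simp: indicator_def)
  qed measurable
  then show "(\<lambda>j. LINT y:{y. norm y > e j}|lborel. n y * (f (x + y) - f x)) \<longlonglongrightarrow> gen f x"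
    unfolding sym[OF e(1)] gen_def by simp
qed simp

text \<open>The absolute Fourier integrals decrease in \<open>t\<close> because
  \<open>\<psi>\<close> is nonnegative, so their values at \<open>t0\<close> serve for all later
  times and all points.\<close>

lemma K'_bound:
  assumes t0: "t0 > 0"
  shows "\<exists>M\<ge>0. \<forall>t\<ge>t0. \<forall>x. \<bar>K' t x\<bar> \<le> M \<and> K t x \<le> M"
proof -
  define I1 where "I1 = (LBINT \<xi>. exp (- t0 * \<psi> \<xi>) * \<bar>\<psi> \<xi>\<bar>)"
  define I2 where "I2 = (LBINT \<xi>. exp (- t0 * \<psi> \<xi>) * \<bar>1\<bar>)"
  have 1: "(LBINT \<xi>. exp (- t * \<psi> \<xi>) * \<bar>w \<xi>\<bar>) \<le> (LBINT \<xi>. exp (- t0 * \<psi> \<xi>) * \<bar>w \<xi>\<bar>)"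
    if "t \<ge> t0" and [measurable]: "w \<in> borel_measurable borel" and w: "\<And>\<xi>. \<bar>w \<xi>\<bar> \<le> D * (1 + norm \<xi>) ^ k" for t w D k
  proof (rule integral_mono)
    show "integrable lborel (\<lambda>\<xi>. exp (- t * \<psi> \<xi>) * \<bar>w \<xi>\<bar>)"
      by (rule integrable_damped_real[where B=D and k=k]) (use that t0 in auto)
    show "integrable lborel (\<lambda>\<xi>. exp (- t0 * \<psi> \<xi>) * \<bar>w \<xi>\<bar>)"
      by (rule integrable_damped_real[where B=D and k=k]) (use that t0 in auto)
    show "exp (- t * \<psi> \<xi>) * \<bar>w \<xi>\<bar> \<le> exp (- t0 * \<psi> \<xi>) * \<bar>w \<xi>\<bar>" for \<xi>
      using that(1) \<psi>_nonneg[of \<xi>] by (intro mult_right_mono) (auto simp: mult_right_mono)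
  qed
  have k1: "\<bar>K' t x\<bar> \<le> 1 / (2 * pi) ^ DIM('a) * I1" if t: "t \<ge> t0" for t x
  proof -
    have "\<bar>trig t \<psi> 0 x\<bar> \<le> I1"
      using order.trans[OF trig_bound[OF _ \<psi>_meas \<psi>_poly] 1[OF t \<psi>_meas \<psi>_poly]] t t0 unfolding I1_def by simp
    then show ?thesis by (simp add: K'_def abs_mult divide_right_mono)
  qed
  have k2: "K t x \<le> 1 / (2 * pi) ^ DIM('a) * I2" if t: "t \<ge> t0" for t x
  proof -
    have "\<bar>trig t (\<lambda>_. 1) 0 x\<bar> \<le> (LBINT \<xi>. exp (- t * \<psi> \<xi>) * \<bar>1\<bar>)"
      by (rule trig_bound[where B=1 and k=0]) (use t t0 in auto)
    also have "\<dots> \<le> I2" unfolding I2_def by (rule 1[OF t, where D=1 and k=0]) auto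
    finally have "\<bar>trig t (\<lambda>_. 1) 0 x\<bar> \<le> I2" .
    then show ?thesis using t t0 by (simp add: K_trig abs_le_iff divide_right_mono)
  qed
  define M where "M = max 0 (max (1 / (2 * pi) ^ DIM('a) * I1) (1 / (2 * pi) ^ DIM('a) * I2))"
  have "\<bar>K' t x\<bar> \<le> M \<and> K t x \<le> M" if "t \<ge> t0" for t x
    using k1[OF that, of x] k2[OF that, of x] unfolding M_def by linarith
  moreover have "M \<ge> 0" by (simp add: M_def)
  ultimately show ?thesis by blast
qed

lemma K'_meas0: "(\<lambda>z. K' (fst z) (snd z)) \<in> borel_measurable borel"
  unfolding borel_prod[symmetric] K'_def trig_def by measurable

lemma K'_meas [measurable (raw)]:
  assumes "f \<in> borel_measurable M" "g \<in> borel_measurable M"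
  shows "(\<lambda>x. K' (f x) (g x)) \<in> borel_measurable M"
  using measurable_compose[OF borel_measurable_Pair[OF assms] K'_meas0] by simp

lemma integrable_K_times:
  assumes "integrable lborel f" shows "integrable lborel (\<lambda>z. K t (c + z) * f z)"
proof (rule Bochner_Integration.integrable_bound[OF integrable_mult_right[OF assms, of "K t 0"]])
  have [measurable]: "f \<in> borel_measurable borel" using assms by auto
  show "(\<lambda>z. K t (c + z) * f z) \<in> borel_measurable lborel" by measurable
  show "AE z in lborel. norm (K t (c + z) * f z) \<le> norm (K t 0 * f z)"
    by (rule AE_I2) (auto simp: abs_mult K_nonneg intro!: mult_right_mono K_le)
qed

text \<open>Symmetry of the generator. The heat equation writes \<open>K'\<close> as an integral of
  second differences of \<open>K\<close>; Fubini and a translation in \<open>z\<close> for fixed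
  \<open>y\<close> move the differences from \<open>K\<close> to \<open>f\<close>. Each double
  integral has its own dominating function: the drop of \<open>K\<close> from its maximum, or the
  second-difference bound of \<open>f\<close>.\<close>

lemma K_generator_duality:
  assumes t: "t > 0" and f: "integrable lborel f" and B: "\<And>x. \<bar>f x\<bar> \<le> B"
    and A: "\<And>z y. \<bar>f (z + y) + f (z - y) - 2 * f z\<bar> \<le> A * min 1 ((norm y)\<^sup>2)"
  shows "(LBINT z. K' t z * f z) = (LBINT z. K t z * gen f z)"
proof -
  have [measurable]: "f \<in> borel_measurable borel" using f by auto
  let ?h1 = "\<lambda>z y. f z * (n y * (K t (z + y) + K t (z - y) - 2 * K t z))"
  let ?h2 = "\<lambda>z y. K t z * (n y * (f (z + y) + f (z - y) - 2 * f z))"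
  have int1: "integrable (lborel \<Otimes>\<^sub>M lborel) (\<lambda>(z, y). ?h1 z y)"
  proof (rule Bochner_Integration.integrable_bound)
    show "integrable (lborel \<Otimes>\<^sub>M lborel) (\<lambda>(z, y). (2 * \<bar>f z\<bar>) * (n y * (K t 0 - K t y)))"
      by (intro integrable_lborel_tensor integrable_mult_right integrable_abs f integrable_n_K_difference t)
    show "AE a in lborel \<Otimes>\<^sub>M lborel. norm (case a of (z, y) \<Rightarrow> ?h1 z y) \<le> norm (case a of (z, y) \<Rightarrow> (2 * \<bar>f z\<bar>) * (n y * (K t 0 - K t y)))"
    proof (rule AE_I2, safe)
      fix z y :: 'a
      have "\<bar>f z\<bar> * (n y * \<bar>K t (z + y) + K t (z - y) - 2 * K t z\<bar>) \<le> \<bar>f z\<bar> * (n y * (2 * (K t 0 - K t y)))"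
        by (intro mult_left_mono K_second_difference_bound t n_nonneg) auto
      then show "norm (?h1 z y) \<le> norm ((2 * \<bar>f z\<bar>) * (n y * (K t 0 - K t y)))"
        using K_le[of t y] by (simp add: abs_mult n_nonneg mult_ac)
    qed
  qed measurable
  have int2: "integrable (lborel \<Otimes>\<^sub>M lborel) (\<lambda>(z, y). ?h2 z y)"
  proof (rule Bochner_Integration.integrable_bound)
    show "integrable (lborel \<Otimes>\<^sub>M lborel) (\<lambda>(z, y). K t z * (A * (n y * min 1 ((norm y)\<^sup>2))))"
      by (intro integrable_lborel_tensor integrable_mult_right K_integrable integrable_n_min)
    show "AE a in lborel \<Otimes>\<^sub>M lborel. norm (case a of (z, y) \<Rightarrow> ?h2 z y) \<le> norm (case a of (z, y) \<Rightarrow> K t z * (A * (n y * min 1 ((norm y)\<^sup>2))))"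
    proof (rule AE_I2, safe)
      fix z y :: 'a
      have "K t z * (n y * \<bar>f (z + y) + f (z - y) - 2 * f z\<bar>) \<le> K t z * (n y * (A * min 1 ((norm y)\<^sup>2)))"
        by (intro mult_left_mono A n_nonneg K_nonneg)
      also have "\<dots> \<le> \<bar>K t z * (A * (n y * min 1 ((norm y)\<^sup>2)))\<bar>" by (simp only: mult.left_commute[of "n y"])
      finally show "norm (?h2 z y) \<le> norm (K t z * (A * (n y * min 1 ((norm y)\<^sup>2))))"
        by (simp add: abs_mult n_nonneg K_nonneg)
    qed
  qed measurable
  have z1: "(LBINT y. ?h1 z y) = 2 * (K' t z * f z)" for z
    using K_generator[OF t, of z] by (simp add: has_bochner_integral_iff)
  have z2: "(LBINT y. ?h2 z y) = 2 * (K t z * gen f z)" for z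
    by (simp add: gen_def)
  have y12: "(LBINT z. ?h1 z y) = (LBINT z. ?h2 z y)" for y
  proof -
    have i1: "integrable lborel (\<lambda>z. K t (y + z) * f z)" "integrable lborel (\<lambda>z. K t (- y + z) * f z)" "integrable lborel (\<lambda>z. K t z * f z)"
      using integrable_K_times[OF f, of t y] integrable_K_times[OF f, of t "- y"] integrable_K_times[OF f, of t 0] by auto
    have i2: "integrable lborel (\<lambda>z. K t z * f (- y + z))" "integrable lborel (\<lambda>z. K t z * f (y + z))"
      using integrable_lborel_translation[OF i1(1), of "- y"] integrable_lborel_translation[OF i1(2), of y] by (simp_all add: algebra_simps)
    have e1: "(LBINT z. K t (y + z) * f z) = (LBINT z. K t z * f (- y + z))"
      using integral_lborel_translation[where f="\<lambda>z. K t (y + z) * f z" and c="- y"] by simp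
    have e2: "(LBINT z. K t (- y + z) * f z) = (LBINT z. K t z * f (y + z))"
      using integral_lborel_translation[where f="\<lambda>z. K t (- y + z) * f z" and c="y"] by simp
    have "(LBINT z. ?h1 z y) = n y * ((LBINT z. K t (y + z) * f z) + (LBINT z. K t (- y + z) * f z) - 2 * (LBINT z. K t z * f z))"
    proof -
      have "?h1 z y = n y * (K t (y + z) * f z + K t (- y + z) * f z - 2 * (K t z * f z))" for z
        by (simp add: algebra_simps)
      note e = this
      show ?thesis unfolding e using i1
        by (simp only: integral_mult_right_zero Bochner_Integration.integral_diff Bochner_Integration.integral_add
            Bochner_Integration.integrable_add integrable_mult_right)
    qed
    also have "\<dots> = n y * ((LBINT z. K t z * f (- y + z)) + (LBINT z. K t z * f (y + z)) - 2 * (LBINT z. K t z * f z))"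
      unfolding e1 e2 ..
    also have "\<dots> = (LBINT z. ?h2 z y)"
    proof -
      have "?h2 z y = n y * (K t z * f (- y + z) + K t z * f (y + z) - 2 * (K t z * f z))" for z
        by (simp add: algebra_simps)
      note e = this
      show ?thesis unfolding e using i1 i2
        by (simp only: integral_mult_right_zero Bochner_Integration.integral_diff Bochner_Integration.integral_add
            Bochner_Integration.integrable_add integrable_mult_right)
    qed
    finally show ?thesis .
  qed
  have "2 * (LBINT z. K' t z * f z) = (LBINT z. (LBINT y. ?h1 z y))" unfolding z1 by simp
  also have "\<dots> = (LBINT y. (LBINT z. ?h1 z y))" using lborel_pair.Fubini_integral[OF int1] by simp
  also have "\<dots> = (LBINT y. (LBINT z. ?h2 z y))" unfolding y12 ..
  also have "\<dots> = (LBINT z. (LBINT y. ?h2 z y))" using lborel_pair.Fubini_integral[OF int2] by simp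
  also have "\<dots> = 2 * (LBINT z. K t z * gen f z)" unfolding z2 by simp
  finally show ?thesis by simp
qed

end

section \<open>Test functions under the unperturbed space-time operator\<close>

locale levy_test = levy_exponent \<psi> n C for \<psi> n :: "'a::euclidean_space \<Rightarrow> real" and C +
  fixes \<phi> :: "real \<times> 'a \<Rightarrow> real"
  assumes \<phi>: "\<phi> \<in> Cc_infinity"
begin

definition \<phi>' :: "real \<times> 'a \<Rightarrow> real" where
  "\<phi>' U = frechet_derivative \<phi> (at U) (1, 0)"

text \<open>The time derivative plus the spatial generator of \<open>\<phi>\<close>. The generator
  is nonlocal, so compact support in space is lost; what remains is continuity, boundedness and
  support in a bounded time interval.\<close>

definition \<zeta> :: "real \<times> 'a \<Rightarrow> real" where
  "\<zeta> U = \<phi>' U + gen (\<lambda>w. \<phi> (fst U, w)) (snd U)"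

lemma \<phi>'_Cc: "\<phi>' \<in> Cc_infinity"
  unfolding \<phi>'_def by (rule Cc_infinity_derivative[OF \<phi>])

lemma \<phi>_meas [measurable]: "\<phi> \<in> borel_measurable borel" "\<phi>' \<in> borel_measurable borel"
  using Cc_infinity_continuous[OF \<phi>] Cc_infinity_continuous[OF \<phi>'_Cc] by (auto intro: borel_measurable_continuous_onI)

lemma \<phi>_second_difference:
  "\<exists>A\<ge>0. \<forall>u z y. \<bar>\<phi> (u, z + y) + \<phi> (u, z - y) - 2 * \<phi> (u, z)\<bar> \<le> A * min 1 ((norm y)\<^sup>2)"
proof -
  obtain A where A: "A \<ge> 0" "\<And>X Y. \<bar>\<phi> (X + Y) + \<phi> (X - Y) - 2 * \<phi> X\<bar> \<le> A * min 1 ((norm Y)\<^sup>2)"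
    using Cc_infinity_second_difference[OF \<phi>] by blast
  have "\<bar>\<phi> (u, z + y) + \<phi> (u, z - y) - 2 * \<phi> (u, z)\<bar> \<le> A * min 1 ((norm y)\<^sup>2)" for u z y
    using A(2)[of "(u, z)" "(0, y)"] by (simp add: norm_Pair)
  with A(1) show ?thesis by blast
qed

lemma \<zeta>_continuous: "continuous_on UNIV \<zeta>"
  unfolding \<zeta>_def
proof (intro continuous_on_add)
  show "continuous_on UNIV \<phi>'" by (rule Cc_infinity_continuous[OF \<phi>'_Cc])
  obtain A where A: "A \<ge> 0" "\<And>u z y. \<bar>\<phi> (u, z + y) + \<phi> (u, z - y) - 2 * \<phi> (u, z)\<bar> \<le> A * min 1 ((norm y)\<^sup>2)"
    using \<phi>_second_difference by blast
  show "continuous_on UNIV (\<lambda>U. gen (\<lambda>w. \<phi> (fst U, w)) (snd U))"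
  proof (rule continuous_on_sequentiallyI)
    fix V :: "nat \<Rightarrow> real \<times> 'a" and U assume lim: "V \<longlonglongrightarrow> U"
    have c: "(\<lambda>j. \<phi> (fst (V j), snd (V j) + y)) \<longlonglongrightarrow> \<phi> (fst U, snd U + y)" for y
      by (rule continuous_on_tendsto_compose[OF Cc_infinity_continuous[OF \<phi>]]) (auto intro!: tendsto_intros lim)
    have "(\<lambda>j. LBINT y. n y * (\<phi> (fst (V j), snd (V j) + y) + \<phi> (fst (V j), snd (V j) - y) - 2 * \<phi> (fst (V j), snd (V j)))) \<longlonglongrightarrow>
       (LBINT y. n y * (\<phi> (fst U, snd U + y) + \<phi> (fst U, snd U - y) - 2 * \<phi> (fst U, snd U)))"
    proof (rule integral_dominated_convergence[where w="\<lambda>y. A * (n y * min 1 ((norm y)\<^sup>2))"])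
      show "integrable lborel (\<lambda>y. A * (n y * min 1 ((norm y)\<^sup>2)))" by (intro integrable_mult_right integrable_n_min)
      show "AE y in lborel. (\<lambda>j. n y * (\<phi> (fst (V j), snd (V j) + y) + \<phi> (fst (V j), snd (V j) - y) - 2 * \<phi> (fst (V j), snd (V j)))) \<longlonglongrightarrow>
         n y * (\<phi> (fst U, snd U + y) + \<phi> (fst U, snd U - y) - 2 * \<phi> (fst U, snd U))"
        using c c[of 0] c[of "- _"] by (intro AE_I2 tendsto_intros) auto
      show "AE y in lborel. norm (n y * (\<phi> (fst (V j), snd (V j) + y) + \<phi> (fst (V j), snd (V j) - y) - 2 * \<phi> (fst (V j), snd (V j)))) \<le> A * (n y * min 1 ((norm y)\<^sup>2))" for j
      proof (rule AE_I2)
        fix y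
        have "n y * \<bar>\<phi> (fst (V j), snd (V j) + y) + \<phi> (fst (V j), snd (V j) - y) - 2 * \<phi> (fst (V j), snd (V j))\<bar> \<le> n y * (A * min 1 ((norm y)\<^sup>2))"
          by (intro mult_left_mono A n_nonneg)
        then show "norm (n y * (\<phi> (fst (V j), snd (V j) + y) + \<phi> (fst (V j), snd (V j) - y) - 2 * \<phi> (fst (V j), snd (V j)))) \<le> A * (n y * min 1 ((norm y)\<^sup>2))"
          by (simp only: real_norm_def abs_mult abs_of_nonneg[OF n_nonneg] mult.left_commute[of A])
      qed
    qed measurable
    then show "(\<lambda>j. gen (\<lambda>w. \<phi> (fst (V j), w)) (snd (V j))) \<longlonglongrightarrow> gen (\<lambda>w. \<phi> (fst U, w)) (snd U)"
      unfolding gen_def by (intro tendsto_intros)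
  qed
qed

lemma \<zeta>_meas [measurable]: "\<zeta> \<in> borel_measurable borel"
  using \<zeta>_continuous by (rule borel_measurable_continuous_onI)

lemma \<zeta>_bounded: "\<exists>B\<ge>0. \<forall>U. \<bar>\<zeta> U\<bar> \<le> B"
proof -
  obtain A where A: "A \<ge> 0" "\<And>u z y. \<bar>\<phi> (u, z + y) + \<phi> (u, z - y) - 2 * \<phi> (u, z)\<bar> \<le> A * min 1 ((norm y)\<^sup>2)"
    using \<phi>_second_difference by blast
  obtain D where D: "D \<ge> 0" "\<And>U. \<bar>\<phi>' U\<bar> \<le> D" using Cc_infinity_bounded[OF \<phi>'_Cc] by blast
  define E where "E = (LBINT y. A * (n y * min 1 ((norm y)\<^sup>2)))"
  have E0: "E \<ge> 0" unfolding E_def using A n_nonneg by (intro Bochner_Integration.integral_nonneg mult_nonneg_nonneg) auto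
  have "\<bar>gen (\<lambda>w. \<phi> (u, w)) z\<bar> \<le> E" for u z
  proof -
    have "\<bar>LBINT y. n y * (\<phi> (u, z + y) + \<phi> (u, z - y) - 2 * \<phi> (u, z))\<bar> \<le> E"
      unfolding E_def
    proof (intro order.trans[OF integral_abs_bound] integral_mono')
      show "integrable lborel (\<lambda>y. A * (n y * min 1 ((norm y)\<^sup>2)))" by (intro integrable_mult_right integrable_n_min)
      fix y
      have "n y * \<bar>\<phi> (u, z + y) + \<phi> (u, z - y) - 2 * \<phi> (u, z)\<bar> \<le> n y * (A * min 1 ((norm y)\<^sup>2))"
        by (intro mult_left_mono A n_nonneg)
      then show "\<bar>n y * (\<phi> (u, z + y) + \<phi> (u, z - y) - 2 * \<phi> (u, z))\<bar> \<le> A * (n y * min 1 ((norm y)\<^sup>2))"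
        by (simp only: abs_mult abs_of_nonneg[OF n_nonneg] mult.left_commute[of A])
      show "0 \<le> A * (n y * min 1 ((norm y)\<^sup>2))" using A n_nonneg[of y] by simp
    qed
    then show ?thesis using E0 by (simp add: gen_def abs_mult)
  qed
  then have "\<bar>\<zeta> U\<bar> \<le> D + E" for U
    unfolding \<zeta>_def using D(2)[of U] by (meson abs_triangle_ineq add_mono order.trans)
  moreover have "0 \<le> D + E" using D E0 by simp
  ultimately show ?thesis by blast
qed

lemma \<phi>_support: "\<exists>R>0. (\<forall>u z. (R < \<bar>u\<bar> \<or> R < norm z) \<longrightarrow> \<phi> (u, z) = 0 \<and> \<phi>' (u, z) = 0) \<and> (\<forall>u z. R < \<bar>u\<bar> \<longrightarrow> \<zeta> (u, z) = 0)"
proof -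
  obtain R1 where R1: "R1 > 0" "\<And>X. \<phi> X \<noteq> 0 \<Longrightarrow> norm X \<le> R1" using Cc_infinity_support[OF \<phi>] by blast
  obtain R2 where R2: "R2 > 0" "\<And>X. \<phi>' X \<noteq> 0 \<Longrightarrow> norm X \<le> R2" using Cc_infinity_support[OF \<phi>'_Cc] by blast
  define R where "R = max R1 R2"
  have le: "\<bar>u\<bar> \<le> norm (u, z)" "norm z \<le> norm (u, z)" for u :: real and z :: 'a
    using norm_fst_le[of u z] norm_snd_le[of z u] by auto
  have 1: "\<phi> (u, z) = 0 \<and> \<phi>' (u, z) = 0" if "R < \<bar>u\<bar> \<or> R < norm z" for u z
  proof -
    have "R1 < norm (u, z)" "R2 < norm (u, z)" using that le[where u=u and z=z] by (auto simp: R_def)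
    then show ?thesis using R1(2)[of "(u, z)"] R2(2)[of "(u, z)"] by force
  qed
  have "\<zeta> (u, z) = 0" if "R < \<bar>u\<bar>" for u z
    using 1[of u] that by (simp add: \<zeta>_def gen_def)
  with 1 R1(1) show ?thesis by (intro exI[of _ R]) (auto simp: R_def)
qed

end

section \<open>The unperturbed equation\<close>

context levy_exponent
begin

lemma nn_integral_K: "(\<integral>\<^sup>+z. ennreal (K t (z - x)) \<partial>lborel) = (if t > 0 then 1 else 0)"
proof (cases "t > 0")
  case True
  have "(\<integral>\<^sup>+z. ennreal (K t (z - x)) \<partial>lborel) = (\<integral>\<^sup>+z. ennreal (K t (- x + z)) \<partial>lborel)" by simp
  also have "\<dots> = (\<integral>\<^sup>+z. ennreal (K t z) \<partial>lborel)"
    by (rule nn_integral_lborel_translation) measurable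
  also have "\<dots> = ennreal (LBINT z. K t z)"
    by (rule nn_integral_eq_integral[OF K_integrable]) (simp add: K_nonneg)
  finally show ?thesis using True by (simp add: K_integral)
qed (simp add: K_def)

lemma nn_integral_K_strip:
  "(\<integral>\<^sup>+U. indicator {..T} (fst U) * ennreal (K (fst U - s) (snd U - x)) \<partial>lborel) \<le> ennreal (max 0 (T - s))"
proof -
  have "(\<integral>\<^sup>+U. indicator {..T} (fst U) * ennreal (K (fst U - s) (snd U - x)) \<partial>lborel) =
     (\<integral>\<^sup>+u. (\<integral>\<^sup>+z. indicator {..T} u * ennreal (K (u - s) (z - x)) \<partial>lborel) \<partial>lborel)"
    by (subst nn_integral_lborel_pair) (auto simp: borel_prod[symmetric])
  also have "\<dots> = (\<integral>\<^sup>+u. indicator {s<..T} u \<partial>lborel)"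
    by (intro nn_integral_cong) (auto simp: nn_integral_cmult nn_integral_K indicator_def)
  also have "\<dots> = emeasure lborel {s<..T}" by simp
  also have "\<dots> \<le> ennreal (max 0 (T - s))" by (cases "s \<le> T") auto
  finally show ?thesis .
qed

lemma integrable_K_strip: "integrable lborel (\<lambda>U. indicator {..T} (fst U) * K (fst U - s) (snd U - x))"
proof (rule integrableI_nonneg)
  show "(\<lambda>U. indicator {..T} (fst U) * K (fst U - s) (snd U - x)) \<in> borel_measurable lborel"
    unfolding lborel_prod[symmetric] by measurable
  have "(\<integral>\<^sup>+U. ennreal (indicator {..T} (fst U) * K (fst U - s) (snd U - x)) \<partial>lborel) =
     (\<integral>\<^sup>+U. indicator {..T} (fst U) * ennreal (K (fst U - s) (snd U - x)) \<partial>lborel)"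
    by (intro nn_integral_cong) (auto simp: indicator_def)
  also have "\<dots> \<le> ennreal (max 0 (T - s))" by (rule nn_integral_K_strip)
  also have "\<dots> < \<infinity>" by simp
  finally show "(\<integral>\<^sup>+U. ennreal (indicator {..T} (fst U) * K (fst U - s) (snd U - x)) \<partial>lborel) < \<infinity>" .
qed (simp add: K_nonneg)

end

context levy_test
begin

lemma gen_shift: "gen (\<lambda>w. \<phi> (u, x + w)) z = gen (\<lambda>w. \<phi> (u, w)) (x + z)"
  by (simp add: gen_def add.assoc diff_add_eq[symmetric] add_diff_eq)

definition Z :: "real \<Rightarrow> 'a \<Rightarrow> real \<Rightarrow> real" where
  "Z s x u = (LBINT z. K (u - s) z * \<zeta> (u, x + z))"

text \<open>The integrand is the time derivative of \<open>K (u - s) z * \<phi> (u, x + z)\<close>;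
  duality replaces the time derivative of the kernel by the generator acting on
  \<open>\<phi>\<close>.\<close>

lemma Z_density:
  assumes u: "s < u"
  shows "(LBINT z. K' (u - s) z * \<phi> (u, x + z) + K (u - s) z * \<phi>' (u, x + z)) = Z s x u"
proof -
  obtain R where R: "R > 0" "\<And>u z. R < \<bar>u\<bar> \<or> R < norm z \<Longrightarrow> \<phi> (u, z) = 0 \<and> \<phi>' (u, z) = 0"
    using \<phi>_support by blast
  obtain B where B: "B \<ge> 0" "\<And>X. \<bar>\<phi> X\<bar> \<le> B" using Cc_infinity_bounded[OF \<phi>] by blast
  obtain D where D: "D \<ge> 0" "\<And>X. \<bar>\<phi>' X\<bar> \<le> D" using Cc_infinity_bounded[OF \<phi>'_Cc] by blast
  obtain A where A: "A \<ge> 0" "\<And>u z y. \<bar>\<phi> (u, z + y) + \<phi> (u, z - y) - 2 * \<phi> (u, z)\<bar> \<le> A * min 1 ((norm y)\<^sup>2)"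
    using \<phi>_second_difference by blast
  obtain E where E: "E \<ge> 0" "\<And>U. \<bar>\<zeta> U\<bar> \<le> E" using \<zeta>_bounded by blast
  obtain M where M: "M \<ge> 0" "\<And>t x. t \<ge> u - s \<Longrightarrow> \<bar>K' t x\<bar> \<le> M" using K'_bound[of "u - s"] u by auto
  have t: "u - s > 0" using u by simp
  let ?f = "\<lambda>z. \<phi> (u, x + z)"
  have f: "integrable lborel ?f"
  proof (rule Bochner_Integration.integrable_bound)
    show "integrable lborel (\<lambda>z. B * indicator (cball (- x) R) z)"
      by (intro integrable_mult_right integrable_real_indicator) (auto intro: emeasure_bounded_finite[unfolded infinity_ennreal_def])
    show "AE z in lborel. norm (?f z) \<le> norm (B * indicator (cball (- x) R) z)"
    proof (rule AE_I2)
      fix z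
      show "norm (?f z) \<le> norm (B * indicator (cball (- x) R) z)"
      proof (cases "norm (x + z) \<le> R")
        case True
        then have "z \<in> cball (- x) R" by (simp add: dist_norm norm_minus_commute add.commute)
        then show ?thesis using B by simp
      next
        case False
        then show ?thesis using R(2)[of u "x + z"] by simp
      qed
    qed
  qed measurable
  have i1: "integrable lborel (\<lambda>z. K' (u - s) z * ?f z)"
    by (rule Bochner_Integration.integrable_bound[OF integrable_mult_right[OF f, of M]])
       (auto simp: abs_mult M(1) intro!: mult_right_mono M(2))
  have i2: "integrable lborel (\<lambda>z. K (u - s) z * \<phi>' (u, x + z))"
    using integrable_K_mult[of "\<lambda>z. \<phi>' (u, x + z)" D "u - s"] D by simp
  have i3: "integrable lborel (\<lambda>z. K (u - s) z * \<zeta> (u, x + z))"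
    using integrable_K_mult[of "\<lambda>z. \<zeta> (u, x + z)" E "u - s"] E by simp
  have dual: "(LBINT z. K' (u - s) z * ?f z) = (LBINT z. K (u - s) z * gen ?f z)"
    by (rule K_generator_duality[OF t f, where B=B and A=A]) (use B A in \<open>auto simp: add.assoc[symmetric] add_diff_eq\<close>)
  have "(LBINT z. K' (u - s) z * \<phi> (u, x + z) + K (u - s) z * \<phi>' (u, x + z)) =
     (LBINT z. K (u - s) z * gen ?f z) + (LBINT z. K (u - s) z * \<phi>' (u, x + z))"
    using i1 i2 dual by simp
  also have "(LBINT z. K (u - s) z * gen ?f z) = (LBINT z. K (u - s) z * \<zeta> (u, x + z) - K (u - s) z * \<phi>' (u, x + z))"
    unfolding \<zeta>_def fst_conv snd_conv gen_shift[symmetric] by (simp add: distrib_left)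
  also have "\<dots> = Z s x u - (LBINT z. K (u - s) z * \<phi>' (u, x + z))"
    using i2 i3 by (simp add: Z_def)
  finally show ?thesis by simp
qed

text \<open>The fundamental theorem of calculus in time for each fixed \<open>z\<close>, followed by
  Fubini. Starting strictly after \<open>s\<close> keeps \<open>K\<close> and its time derivative
  bounded.\<close>

lemma free_interval:
  assumes u: "s < u1" "u1 \<le> u2"
  shows "(LBINT u. indicator {u1..u2} u * Z s x u) =
    (LBINT z. K (u2 - s) z * \<phi> (u2, x + z)) - (LBINT z. K (u1 - s) z * \<phi> (u1, x + z))"
proof -
  obtain R where R: "R > 0" "\<And>u z. R < \<bar>u\<bar> \<or> R < norm z \<Longrightarrow> \<phi> (u, z) = 0 \<and> \<phi>' (u, z) = 0"
    using \<phi>_support by blast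
  obtain B where B: "B \<ge> 0" "\<And>X. \<bar>\<phi> X\<bar> \<le> B" using Cc_infinity_bounded[OF \<phi>] by blast
  obtain D where D: "D \<ge> 0" "\<And>X. \<bar>\<phi>' X\<bar> \<le> D" using Cc_infinity_bounded[OF \<phi>'_Cc] by blast
  obtain M where M: "M \<ge> 0" "\<And>t x. t \<ge> u1 - s \<Longrightarrow> \<bar>K' t x\<bar> \<le> M" "\<And>t x. t \<ge> u1 - s \<Longrightarrow> K t x \<le> M"
    using K'_bound[of "u1 - s"] u by auto
  let ?k = "\<lambda>u z. K' (u - s) z * \<phi> (u, x + z) + K (u - s) z * \<phi>' (u, x + z)"
  let ?g = "\<lambda>u z. indicator {u1..u2} u * ?k u z"
  define c where "c = M * B + M * D"
  have c: "c \<ge> 0" using M B D by (simp add: c_def)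
  have kb: "\<bar>?k u z\<bar> \<le> c" if "u1 \<le> u" for u z
  proof -
    have "\<bar>?k u z\<bar> \<le> \<bar>K' (u - s) z\<bar> * \<bar>\<phi> (u, x + z)\<bar> + \<bar>K (u - s) z\<bar> * \<bar>\<phi>' (u, x + z)\<bar>"
      by (metis abs_mult abs_triangle_ineq)
    also have "\<dots> \<le> M * B + M * D"
      using that M B D K_nonneg[of "u - s" z] by (intro add_mono mult_mono) auto
    finally show ?thesis by (simp add: c_def)
  qed
  have ball: "z \<in> cball (- x) R \<longleftrightarrow> norm (x + z) \<le> R" for z
  proof -
    have "dist (- x) z = norm (x + z)" unfolding dist_norm by (metis minus_add_distrib norm_minus_cancel uminus_add_conv_diff add_uminus_conv_diff)
    then show ?thesis by simp
  qed
  have int: "integrable (lborel \<Otimes>\<^sub>M lborel) (\<lambda>(u, z). ?g u z)"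
  proof (rule Bochner_Integration.integrable_bound)
    show "integrable (lborel \<Otimes>\<^sub>M lborel) (\<lambda>(u, z). (c * indicator {u1..u2} u) * indicator (cball (- x) R) z)"
      by (intro integrable_lborel_tensor integrable_mult_right integrable_real_indicator) (auto intro: emeasure_bounded_finite[unfolded infinity_ennreal_def])
    show "AE a in lborel \<Otimes>\<^sub>M lborel. norm (case a of (u, z) \<Rightarrow> ?g u z) \<le> norm (case a of (u, z) \<Rightarrow> (c * indicator {u1..u2} u) * indicator (cball (- x) R) z)"
    proof (rule AE_I2, safe)
      fix u :: real and z :: 'a
      show "norm (?g u z) \<le> norm ((c * indicator {u1..u2} u) * indicator (cball (- x) R) z)"
      proof (cases "u \<in> {u1..u2} \<and> norm (x + z) \<le> R")
        case True
        then show ?thesis using kb[of u z] c ball[of z] by (simp add: indicator_def)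
      next
        case False
        then have z: "?g u z = 0" using R(2)[of u "x + z"] by (auto simp: indicator_def)
        show ?thesis unfolding z by simp
      qed
    qed
  qed measurable
  have iz: "(LBINT u. ?g u z) = K (u2 - s) z * \<phi> (u2, x + z) - K (u1 - s) z * \<phi> (u1, x + z)" for z
  proof -
    have "((\<lambda>u. ?k u z) has_integral K (u2 - s) z * \<phi> (u2, x + z) - K (u1 - s) z * \<phi> (u1, x + z)) {u1..u2}"
    proof (rule fundamental_theorem_of_calculus[OF u(2)])
      fix v assume v: "v \<in> {u1..u2}"
      then have t: "v - s > 0" using u by auto
      have d1: "((\<lambda>v. K (v - s) z) has_real_derivative K' (v - s) z * 1) (at v)"
        by (rule DERIV_chain2[where f="\<lambda>t. K t z" and g="\<lambda>v. v - s", OF K_has_derivative_t[OF t]]) (auto intro!: derivative_eq_intros)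
      have d2: "((\<lambda>v. \<phi> (v, x + z)) has_real_derivative \<phi>' (v, x + z)) (at v)"
        unfolding \<phi>'_def by (rule Cc_infinity_time_derivative[OF \<phi>])
      have "((\<lambda>v. K (v - s) z * \<phi> (v, x + z)) has_real_derivative ?k v z) (at v)"
        using DERIV_mult[OF d1 d2] by (simp add: algebra_simps)
      then show "((\<lambda>v. K (v - s) z * \<phi> (v, x + z)) has_vector_derivative ?k v z) (at v within {u1..u2})"
        by (simp add: has_real_derivative_iff_has_vector_derivative has_vector_derivative_at_within)
    qed
    moreover have "set_integrable lborel {u1..u2} (\<lambda>u. ?k u z)"
      unfolding set_integrable_def
    proof (rule Bochner_Integration.integrable_bound)
      show "integrable lborel (\<lambda>u. c * indicator {u1..u2} u)"
        by (intro integrable_mult_right integrable_real_indicator) (auto intro: emeasure_bounded_finite[unfolded infinity_ennreal_def])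
      show "AE u in lborel. norm (indicator {u1..u2} u *\<^sub>R ?k u z) \<le> norm (c * indicator {u1..u2} u)"
        using kb[of _ z] c by (auto simp: indicator_def intro!: AE_I2)
    qed measurable
    ultimately show ?thesis
      using set_borel_integral_eq_integral(2) by (metis (no_types, lifting) integral_unique set_lebesgue_integral_def real_scaleR_def Bochner_Integration.integral_cong)
  qed
  have iu: "(LBINT z. ?g u z) = indicator {u1..u2} u * Z s x u" for u
    using Z_density[of s u x] u by (auto simp: indicator_def)
  have "(LBINT u. indicator {u1..u2} u * Z s x u) = (LBINT u. (LBINT z. ?g u z))" unfolding iu ..
  also have "\<dots> = (LBINT z. (LBINT u. ?g u z))" using lborel_pair.Fubini_integral[OF int] by simp
  also have "\<dots> = (LBINT z. K (u2 - s) z * \<phi> (u2, x + z)) - (LBINT z. K (u1 - s) z * \<phi> (u1, x + z))"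
    unfolding iz
    using integrable_K_mult[of "\<lambda>z. \<phi> (u2, x + z)" B "u2 - s"] integrable_K_mult[of "\<lambda>z. \<phi> (u1, x + z)" B "u1 - s"] B
    by simp
  finally show ?thesis .
qed

lemma integrable_K_\<zeta>: "integrable lborel (\<lambda>U. K (fst U - s) (snd U - x) * \<zeta> U)"
proof -
  obtain R where R: "R > 0" "\<And>u z. R < \<bar>u\<bar> \<Longrightarrow> \<zeta> (u, z) = 0" using \<phi>_support by blast
  obtain E where E: "E \<ge> 0" "\<And>U. \<bar>\<zeta> U\<bar> \<le> E" using \<zeta>_bounded by blast
  show ?thesis
  proof (rule Bochner_Integration.integrable_bound[OF integrable_mult_right[OF integrable_K_strip[of R s x], of E]])
    show "(\<lambda>U. K (fst U - s) (snd U - x) * \<zeta> U) \<in> borel_measurable lborel"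
    proof -
      have [measurable]: "\<zeta> \<in> borel_measurable (borel \<Otimes>\<^sub>M borel)" using \<zeta>_meas by (simp add: borel_prod)
      show ?thesis by (simp add: borel_prod[symmetric])
    qed
    show "AE U in lborel. norm (K (fst U - s) (snd U - x) * \<zeta> U) \<le> norm (E * (indicator {..R} (fst U) * K (fst U - s) (snd U - x)))"
    proof (rule AE_I2)
      fix U :: "real \<times> 'a"
      show "norm (K (fst U - s) (snd U - x) * \<zeta> U) \<le> norm (E * (indicator {..R} (fst U) * K (fst U - s) (snd U - x)))"
      proof (cases "fst U \<le> R")
        case True
        then show ?thesis using E by (simp add: abs_mult K_nonneg mult.commute[of E] mult_left_mono)
      next
        case False
        then have "\<zeta> U = 0" using R(2)[of "fst U" "snd U"] R(1) by simp
        then show ?thesis by simp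
      qed
    qed
  qed
qed

text \<open>The lower end tends to \<open>s\<close>, where the boundary term converges by the
  approximate identity property; the upper boundary term vanishes because \<open>\<phi>\<close>
  does.\<close>

lemma free_equation: "has_bochner_integral lborel (\<lambda>U. K (fst U - s) (snd U - x) * \<zeta> U) (- \<phi> (s, x))"
proof -
  obtain R where R: "R > 0" "\<And>u z. R < \<bar>u\<bar> \<or> R < norm z \<Longrightarrow> \<phi> (u, z) = 0" "\<And>u z. R < \<bar>u\<bar> \<Longrightarrow> \<zeta> (u, z) = 0"
    using \<phi>_support by blast
  obtain B where B: "B \<ge> 0" "\<And>X. \<bar>\<phi> X\<bar> \<le> B" using Cc_infinity_bounded[OF \<phi>] by blast
  have int: "integrable (lborel \<Otimes>\<^sub>M lborel) (\<lambda>(u, z). K (u - s) (z - x) * \<zeta> (u, z))"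
    using integrable_K_\<zeta>[of s x] by (simp add: lborel_prod case_prod_beta')
  have inner: "(LBINT z. K (u - s) (z - x) * \<zeta> (u, z)) = Z s x u" for u
    using integral_lborel_translation[where f="\<lambda>z. K (u - s) (z - x) * \<zeta> (u, z)" and c=x] by (simp add: Z_def)
  have Zint: "integrable lborel (Z s x)"
    using lborel_pair.integrable_fst[OF int] by (simp add: inner)
  have tot: "(LBINT U. K (fst U - s) (snd U - x) * \<zeta> U) = (LBINT u. Z s x u)"
    using lborel_pair.integral_fst[OF int] by (simp add: inner lborel_prod case_prod_beta')
  \<comment> \<open>Late enough for \<open>\<phi>\<close> to vanish there, and at least
    \<open>s + 1\<close>, so that the lower ends \<open>s + t j\<close> stay below it.\<close>
  define u2 where "u2 = max s R + 2"
  define t where "t j = 1 / real (Suc j)" for j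
  have t: "t j > 0" "t j \<le> 1" for j by (auto simp: t_def)
  have t0: "t \<longlonglongrightarrow> 0" unfolding t_def by (rule LIMSEQ_Suc[OF lim_1_over_n])
  have Z0: "Z s x u = 0" if "u \<le> s \<or> u > u2" for u
    using that R(1) R(3)[of u] by (auto simp: Z_def K_def u2_def)
  have "(\<lambda>j. LBINT u. indicator {s + t j..u2} u * Z s x u) \<longlonglongrightarrow> (LBINT u. Z s x u)"
  proof (rule integral_dominated_convergence[where w="\<lambda>u. \<bar>Z s x u\<bar>"])
    show "integrable lborel (\<lambda>u. \<bar>Z s x u\<bar>)" using Zint by (rule integrable_abs)
    show "AE u in lborel. (\<lambda>j. indicator {s + t j..u2} u * Z s x u) \<longlonglongrightarrow> Z s x u"
    proof (rule AE_I2)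
      fix u
      show "(\<lambda>j. indicator {s + t j..u2} u * Z s x u) \<longlonglongrightarrow> Z s x u"
      proof (cases "u \<le> s \<or> u > u2")
        case False
        then have "eventually (\<lambda>j. t j < u - s) sequentially" using t0 by (intro order_tendstoD) auto
        then have "eventually (\<lambda>j. indicator {s + t j..u2} u * Z s x u = Z s x u) sequentially"
        proof eventually_elim
          case (elim j)
          then show ?case using False by (auto simp: indicator_def)
        qed
        then show ?thesis by (rule tendsto_eventually)
      qed (simp add: Z0)
    qed
    show "AE u in lborel. norm (indicator {s + t j..u2} u * Z s x u) \<le> \<bar>Z s x u\<bar>" for j
      by (rule AE_I2) (auto simp: indicator_def)
  qed (use Zint in auto)
  moreover have "(LBINT u. indicator {s + t j..u2} u * Z s x u) = - (LBINT z. K (t j) z * \<phi> (s + t j, x + z))" for j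
  proof -
    have "s + t j \<le> u2" using t(2)[of j] by (auto simp: u2_def)
    moreover have "R < \<bar>u2\<bar>" using R(1) by (simp add: u2_def)
    ultimately show ?thesis using free_interval[of s "s + t j" u2 x] t(1)[of j] R(2)[of u2] by simp
  qed
  moreover have "(\<lambda>j. - (LBINT z. K (t j) z * \<phi> (s + t j, x + z))) \<longlonglongrightarrow> - \<phi> (s, x)"
  proof (intro tendsto_minus K_approx_identity[where B=B] t(1) t0 B(2))
    fix e :: real assume e: "e > 0"
    have "isCont \<phi> (s, x)" using Cc_infinity_continuous[OF \<phi>] by (simp add: continuous_on_eq_continuous_at)
    then obtain d where d: "d > 0" "\<And>X. dist X (s, x) < d \<Longrightarrow> dist (\<phi> X) (\<phi> (s, x)) < e"
      using e unfolding continuous_at_eps_delta by blast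
    have "eventually (\<lambda>j. t j < d / 2) sequentially" using t0 d by (intro order_tendstoD) auto
    then have "\<forall>\<^sub>F j in sequentially. \<forall>z. norm z < d / 2 \<longrightarrow> \<bar>\<phi> (s + t j, x + z) - \<phi> (s, x)\<bar> \<le> e"
    proof eventually_elim
      case (elim j)
      show ?case
      proof (intro allI impI)
        fix z :: 'a assume z: "norm z < d / 2"
        have "dist (s + t j, x + z) (s, x) \<le> \<bar>t j\<bar> + norm z"
          unfolding dist_norm by (simp add: norm_Pair_le[of "t j" z, simplified])
        also have "\<dots> < d" using z elim t(1)[of j] by simp
        finally have "dist (\<phi> (s + t j, x + z)) (\<phi> (s, x)) < e" by (rule d(2))
        then show "\<bar>\<phi> (s + t j, x + z) - \<phi> (s, x)\<bar> \<le> e" by (simp add: dist_real_def)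
      qed
    qed
    then show "\<exists>\<delta>>0. \<forall>\<^sub>F j in sequentially. \<forall>z. norm z < \<delta> \<longrightarrow> \<bar>\<phi> (s + t j, x + z) - \<phi> (s, x)\<bar> \<le> e"
      using d(1) by (intro exI[of _ "d / 2"]) auto
  qed measurable
  ultimately have "(LBINT u. Z s x u) = - \<phi> (s, x)" using LIMSEQ_unique by auto
  then show ?thesis using integrable_K_\<zeta>[of s x] tot by (simp add: has_bochner_integral_iff)
qed

lemma G_meas_strip [measurable]: "(\<lambda>U::real \<times> 'a. G (fst U - r) (c + snd U)) \<in> borel_measurable borel"
  unfolding borel_prod[symmetric] by measurable

text \<open>The kernel is not differentiated under the integral: the unperturbed equation at \<open>w\<close> and \<open>w + h v\<close>
  differs by a line integral of \<open>G\<close>, and the fundamental theorem of calculus does the rest.\<close>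

lemma gradient_identity:
  assumes R: "\<And>u z. R < u \<Longrightarrow> \<zeta> (u, z) = 0"
    and fin: "(\<integral>\<^sup>+U. indicator {..R} (fst U) * ennreal (norm (G (fst U - r) (snd U))) \<partial>lborel) < \<infinity>"
  shows "has_bochner_integral lborel (\<lambda>U. (G (fst U - r) (- w + snd U) \<bullet> v) * \<zeta> U) (space_grad \<phi> r w \<bullet> v)"
proof -
  obtain E where E: "E \<ge> 0" "\<And>U. \<bar>\<zeta> U\<bar> \<le> E" using \<zeta>_bounded by blast
  have [measurable]: "(\<lambda>U::real \<times> 'a. indicator {..R} (fst U) :: real) \<in> borel_measurable borel"
    unfolding borel_prod[symmetric] by measurable
  define d where "d U = norm v * E * (indicator {..R} (fst U) * norm (G (fst U - r) (snd U)))" for U :: "real \<times> 'a"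
  have G0 [measurable]: "(\<lambda>U::real \<times> 'a. G (fst U - r) (snd U)) \<in> borel_measurable borel"
    using G_meas_strip[of r 0] by simp
  have d: "integrable lborel d"
    unfolding d_def
  proof (intro integrable_mult_right integrableI_nonneg)
    have "(\<integral>\<^sup>+U. ennreal (indicator {..R} (fst U) * norm (G (fst U - r) (snd U))) \<partial>lborel) =
       (\<integral>\<^sup>+U. indicator {..R} (fst U) * ennreal (norm (G (fst U - r) (snd U))) \<partial>lborel)"
      by (intro nn_integral_cong) (auto simp: indicator_def)
    then show "(\<integral>\<^sup>+U. ennreal (indicator {..R} (fst U) * norm (G (fst U - r) (snd U))) \<partial>lborel) < \<infinity>" using fin by simp
  qed auto
  have dom: "\<bar>(G (fst U - r) (snd U) \<bullet> v) * \<zeta> (c + U)\<bar> \<le> d U" if "fst c = 0" for c U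
  proof (cases "fst U \<le> R")
    case True
    have "\<bar>G (fst U - r) (snd U) \<bullet> v\<bar> * \<bar>\<zeta> (c + U)\<bar> \<le> (norm (G (fst U - r) (snd U)) * norm v) * E"
      by (intro mult_mono Cauchy_Schwarz_ineq2 E) auto
    then show ?thesis using True by (simp add: d_def abs_mult mult_ac)
  next
    case False
    then have "\<zeta> (c + U) = 0" using R[of "fst U" "snd c + snd U"] that by (metis add_0 fst_add not_le prod.collapse snd_add)
    then show ?thesis using E by (simp add: d_def)
  qed
  have \<zeta>m [measurable]: "(\<lambda>U. \<zeta> (c + U)) \<in> borel_measurable borel" for c
    by (rule measurable_compose[OF _ \<zeta>_meas]) (auto intro!: borel_measurable_continuous_onI continuous_intros)
  \<comment> \<open>The shift by \<open>y\<close> is carried by \<open>\<zeta>\<close> instead of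
    the gradient kernel, so that one function \<open>d\<close> dominates for all base
    points.\<close>
  define H where "H y U = (G (fst U - r) (snd U) \<bullet> v) * \<zeta> ((0, y) + U)" for y U
  have Hint: "integrable lborel (H y)" for y
    unfolding H_def by (rule Bochner_Integration.integrable_bound[OF d]) (auto intro!: AE_I2 order.trans[OF dom])
  define \<Gamma> where "\<Gamma> y = (LBINT U. H y U)" for y
  have H_shift: "H y (- (0, y) + U) = (G (fst U - r) (- y + snd U) \<bullet> v) * \<zeta> U" for y U
  proof -
    have e: "(0, y) + (- (0, y) + U) = U" by (simp only: add_minus_cancel)
    show ?thesis unfolding H_def e by simp
  qed
  have Gint: "integrable lborel (\<lambda>U. (G (fst U - r) (- y + snd U) \<bullet> v) * \<zeta> U)" for y
    using integrable_lborel_translation[OF Hint[of y], of "- (0, y)"] unfolding H_shift .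
  have Gval: "(LBINT U. (G (fst U - r) (- y + snd U) \<bullet> v) * \<zeta> U) = \<Gamma> y" for y
    using integral_lborel_translation[where f="H y" and c="- (0, y)"] unfolding H_shift \<Gamma>_def .
  \<comment> \<open>Only the bounded continuous factor \<open>\<zeta>\<close> depends on
    \<open>y\<close>, so dominated convergence suffices.\<close>
  have \<Gamma>_cont: "continuous_on UNIV \<Gamma>"
  proof (rule continuous_on_sequentiallyI)
    fix y :: "nat \<Rightarrow> 'a" and y0 assume lim: "y \<longlonglongrightarrow> y0"
    show "(\<lambda>j. \<Gamma> (y j)) \<longlonglongrightarrow> \<Gamma> y0"
      unfolding \<Gamma>_def
    proof (rule integral_dominated_convergence[OF _ _ d])
      show "AE U in lborel. (\<lambda>j. H (y j) U) \<longlonglongrightarrow> H y0 U"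
        unfolding H_def
        by (intro AE_I2 tendsto_intros continuous_on_tendsto_compose[OF \<zeta>_continuous]) (auto intro!: tendsto_intros lim)
      show "AE U in lborel. norm (H (y j) U) \<le> d U" for j
        unfolding H_def by (auto intro!: AE_I2 order.trans[OF dom])
    qed (use Hint in auto)
  qed
  have line: "\<phi> (r, w + h *\<^sub>R v) - \<phi> (r, w) = (LBINT \<rho>. indicator {0..h} \<rho> * \<Gamma> (w + \<rho> *\<^sub>R v))" if h: "0 \<le> h" for h
  proof -
    let ?k = "\<lambda>\<rho> U. indicator {0..h} \<rho> * ((G (fst U - r) (- (w + \<rho> *\<^sub>R v) + snd U) \<bullet> v) * \<zeta> U)"
    have km: "(\<lambda>(\<rho>, U). ?k \<rho> U) \<in> borel_measurable (lborel \<Otimes>\<^sub>M lborel)"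
    proof -
      have m: "(\<lambda>x::real \<times> (real \<times> 'a). G (fst (snd x) - r) (- (w + fst x *\<^sub>R v) + snd (snd x))) \<in> measurable (borel \<Otimes>\<^sub>M (borel \<Otimes>\<^sub>M borel)) borel"
        by measurable
      have e: "sets (borel \<Otimes>\<^sub>M (borel \<Otimes>\<^sub>M borel)) = sets ((lborel :: real measure) \<Otimes>\<^sub>M (lborel :: (real \<times> 'a) measure))"
        by (intro sets_pair_measure_cong) (simp_all only: sets_lborel borel_prod)
      have [measurable]: "(\<lambda>x::real \<times> (real \<times> 'a). G (fst (snd x) - r) (- (w + fst x *\<^sub>R v) + snd (snd x))) \<in> borel_measurable (lborel \<Otimes>\<^sub>M lborel)"
        using m unfolding measurable_cong_sets[OF e refl] .
      show ?thesis unfolding case_prod_beta' by measurable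
    qed
    have int: "integrable (lborel \<Otimes>\<^sub>M lborel) (\<lambda>(\<rho>, U). ?k \<rho> U)"
    proof (rule lborel_pair.Fubini_integrable[OF km])
      show "AE \<rho> in lborel. integrable lborel (\<lambda>U. case (\<rho>, U) of (\<rho>, U) \<Rightarrow> ?k \<rho> U)"
        unfolding prod.case by (intro AE_I2 integrable_mult_right Gint)
      show "integrable lborel (\<lambda>\<rho>. LBINT U. norm (case (\<rho>, U) of (\<rho>, U) \<Rightarrow> ?k \<rho> U))"
      proof (rule Bochner_Integration.integrable_bound)
        show "integrable lborel (\<lambda>\<rho>::real. (LBINT U. d U) * indicator {0..h} \<rho>)"
          by (intro integrable_mult_right integrable_real_indicator) (auto intro: emeasure_bounded_finite[unfolded infinity_ennreal_def])
        show "(\<lambda>\<rho>. LBINT U. norm (case (\<rho>, U) of (\<rho>, U) \<Rightarrow> ?k \<rho> U)) \<in> borel_measurable lborel"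
          using km by (intro lborel.borel_measurable_lebesgue_integral) (simp add: case_prod_beta')
        show "AE \<rho> in lborel. norm (LBINT U. norm (case (\<rho>, U) of (\<rho>, U) \<Rightarrow> ?k \<rho> U)) \<le> norm ((LBINT U. d U) * indicator {0..h} \<rho>)"
        proof (rule AE_I2)
          fix \<rho> :: real
          define y where "y = w + \<rho> *\<^sub>R v"
          have "(LBINT U. norm (?k \<rho> U)) = indicator {0..h} \<rho> * (LBINT U. \<bar>(G (fst U - r) (- y + snd U) \<bullet> v) * \<zeta> U\<bar>)"
            unfolding y_def by (simp add: abs_mult)
          also have "(LBINT U. \<bar>(G (fst U - r) (- y + snd U) \<bullet> v) * \<zeta> U\<bar>) = (LBINT U. \<bar>H y U\<bar>)"
            using integral_lborel_translation[where f="\<lambda>U. \<bar>H y U\<bar>" and c="- (0, y)"] unfolding H_shift .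
          finally have e: "(LBINT U. norm (?k \<rho> U)) = indicator {0..h} \<rho> * (LBINT U. \<bar>H y U\<bar>)" .
          have "(LBINT U. \<bar>H y U\<bar>) \<le> (LBINT U. d U)"
            by (intro integral_mono integrable_abs Hint d) (simp add: H_def dom)
          moreover have "0 \<le> (LBINT U. \<bar>H y U\<bar>)" by simp
          ultimately show "norm (LBINT U. norm (case (\<rho>, U) of (\<rho>, U) \<Rightarrow> ?k \<rho> U)) \<le> norm ((LBINT U. d U) * indicator {0..h} \<rho>)"
            unfolding prod.case e by (cases "\<rho> \<in> {0..h}") auto
        qed
      qed
    qed
    have iU: "(LBINT \<rho>. ?k \<rho> U) = (K (fst U - r) (snd U - w) - K (fst U - r) (snd U - (w + h *\<^sub>R v))) * \<zeta> U" for U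
    proof (cases "fst U - r > 0")
      case True
      have "(LBINT \<rho>. ?k \<rho> U) = (LBINT \<rho>. (- \<zeta> U) * ((G (fst U - r) ((snd U - w) + \<rho> *\<^sub>R (- v)) \<bullet> (- v)) * indicator {0..h} \<rho>))"
        by (intro Bochner_Integration.integral_cong refl) (simp add: algebra_simps)
      also have "\<dots> = (- \<zeta> U) * (K (fst U - r) ((snd U - w) + h *\<^sub>R (- v)) - K (fst U - r) (snd U - w))"
        by (subst integral_mult_right_zero) (simp only: K_line_integral[OF True h])
      finally show ?thesis by (simp add: algebra_simps)
    next
      case False
      then show ?thesis by (simp add: G_def K_def)
    qed
    have i\<rho>: "(LBINT U. ?k \<rho> U) = indicator {0..h} \<rho> * \<Gamma> (w + \<rho> *\<^sub>R v)" for \<rho>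
      by (simp only: integral_mult_right_zero Gval)
    have "(LBINT \<rho>. indicator {0..h} \<rho> * \<Gamma> (w + \<rho> *\<^sub>R v)) = (LBINT \<rho>. (LBINT U. ?k \<rho> U))" unfolding i\<rho> ..
    also have "\<dots> = (LBINT U. (LBINT \<rho>. ?k \<rho> U))" using lborel_pair.Fubini_integral[OF int] by simp
    also have "\<dots> = (LBINT U. K (fst U - r) (snd U - w) * \<zeta> U) - (LBINT U. K (fst U - r) (snd U - (w + h *\<^sub>R v)) * \<zeta> U)"
      unfolding iU left_diff_distrib by (rule Bochner_Integration.integral_diff[OF integrable_K_\<zeta> integrable_K_\<zeta>])
    also have "\<dots> = \<phi> (r, w + h *\<^sub>R v) - \<phi> (r, w)"
      using free_equation[of r w] free_equation[of r "w + h *\<^sub>R v"] by (simp add: has_bochner_integral_iff)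
    finally show ?thesis ..
  qed
  have gc: "continuous_on {0..1} (\<lambda>\<rho>. \<Gamma> (w + \<rho> *\<^sub>R v))"
    by (rule continuous_on_compose2[OF \<Gamma>_cont]) (auto intro!: continuous_intros)
  have lineHK: "\<phi> (r, w + h *\<^sub>R v) = \<phi> (r, w) + integral {0..h} (\<lambda>\<rho>. \<Gamma> (w + \<rho> *\<^sub>R v))" if h: "h \<in> {0..1}" for h
  proof -
    have "set_integrable lborel {0..h} (\<lambda>\<rho>. \<Gamma> (w + \<rho> *\<^sub>R v))"
      using h by (intro borel_integrable_atLeastAtMost' continuous_on_subset[OF gc]) auto
    then have "integral {0..h} (\<lambda>\<rho>. \<Gamma> (w + \<rho> *\<^sub>R v)) = (LBINT \<rho>. indicator {0..h} \<rho> * \<Gamma> (w + \<rho> *\<^sub>R v))"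
      by (simp add: set_borel_integral_eq_integral(2)[symmetric] set_lebesgue_integral_def)
    then show ?thesis using line[of h] h by simp
  qed
  \<comment> \<open>The integral formula is available for nonnegative \<open>h\<close>; one-sided
    derivatives at 0 within [0, 1] are enough, since they are unique there.\<close>
  have "((\<lambda>h. integral {0..h} (\<lambda>\<rho>. \<Gamma> (w + \<rho> *\<^sub>R v))) has_real_derivative \<Gamma> (w + 0 *\<^sub>R v)) (at 0 within {0..1})"
    by (rule integral_has_real_derivative[OF gc]) simp
  then have "((\<lambda>h. \<phi> (r, w) + integral {0..h} (\<lambda>\<rho>. \<Gamma> (w + \<rho> *\<^sub>R v))) has_real_derivative \<Gamma> w) (at 0 within {0..1})"
    by (auto intro!: derivative_eq_intros)
  then have d1: "((\<lambda>h. \<phi> (r, w + h *\<^sub>R v)) has_real_derivative \<Gamma> w) (at 0 within {0..1})"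
    by (rule has_field_derivative_transform_within[of _ _ _ _ 1]) (use lineHK in auto)
  have "((\<lambda>h. w + h *\<^sub>R v) has_derivative (\<lambda>h. h *\<^sub>R v)) (at 0)"
    by (auto intro!: derivative_eq_intros)
  moreover have "((\<lambda>y. \<phi> (r, y)) has_derivative (\<lambda>k. k \<bullet> space_grad \<phi> r w)) (at (w + 0 *\<^sub>R v))"
    using Cc_infinity_space_grad[OF \<phi>, of r w] by (simp add: gderiv_def)
  ultimately have "((\<lambda>h. \<phi> (r, w + h *\<^sub>R v)) has_derivative (\<lambda>h. (h *\<^sub>R v) \<bullet> space_grad \<phi> r w)) (at 0)"
    by (rule has_derivative_compose)
  then have "((\<lambda>h. \<phi> (r, w + h *\<^sub>R v)) has_real_derivative space_grad \<phi> r w \<bullet> v) (at 0)"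
    by (simp add: has_field_derivative_def inner_commute mult.commute[of _ "_ \<bullet> _"])
  then have d2: "((\<lambda>h. \<phi> (r, w + h *\<^sub>R v)) has_real_derivative space_grad \<phi> r w \<bullet> v) (at 0 within {0..1})"
    by (rule has_field_derivative_at_within)
  have "at (0::real) within {0..1} \<noteq> bot"
    by (simp add: trivial_limit_within islimpt_Icc)
  then have "\<Gamma> w = space_grad \<phi> r w \<bullet> v"
    using d1 d2 unfolding has_real_derivative_iff_has_vector_derivative by (rule vector_derivative_unique_within)
  then show ?thesis using Gint[of w] Gval[of w] by (simp add: has_bochner_integral_iff)
qed

end

section \<open>Perturbation by a drift\<close>

lemma has_bochner_integral_lborel_reflect_shift:
  fixes F :: "'a::euclidean_space \<Rightarrow> real"
  assumes "has_bochner_integral lborel F I"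
  shows "has_bochner_integral lborel (\<lambda>z. F (y - z)) I"
proof -
  have F: "integrable lborel F" and I: "(LBINT z. F z) = I" using assms by (auto simp: has_bochner_integral_iff)
  have [measurable]: "F \<in> borel_measurable borel" using F by auto
  have "integrable lborel (\<lambda>z. F (y + z))" by (rule integrable_lborel_translation[OF F])
  then have 1: "integrable lborel (\<lambda>z. F (y + (- z)))" by (rule integrable_lborel_reflect)
  have "(LBINT z. F (y + (- z))) = (LBINT z. F (y + z))"
    by (rule integral_lborel_reflect) measurable
  also have "\<dots> = I" using I by (simp add: integral_lborel_translation)
  finally show ?thesis using 1 by (simp add: has_bochner_integral_iff)
qed

locale gradient_perturbation = levy_exponent \<psi> n C for \<psi> n :: "'a::euclidean_space \<Rightarrow> real" and C +
  fixes b :: "real \<Rightarrow> 'a \<Rightarrow> 'a" and \<eta> :: real and Q :: "real \<Rightarrow> real \<Rightarrow> real"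
  assumes b_meas0: "(\<lambda>(u, z). b u z) \<in> borel_measurable borel"
    and b_class: "\<And>s t x y. s < t \<Longrightarrow>
       (\<integral>\<^sup>+u\<in>{s<..<t}. (\<integral>\<^sup>+z. ennreal (K (u - s) (z - x) * norm (b u z) * norm (G (t - u) (y - z))) \<partial>lborel) \<partial>lborel)
         \<le> ennreal ((\<eta> + Q s t) * K (t - s) (y - x))"
    and \<eta>_range: "0 \<le> \<eta>" "\<eta> < 1 / 2"
    and Q_nonneg0: "\<And>s t. 0 \<le> Q s t" and Q_super0: "superadditive Q"
begin

definition p :: "real \<times> 'a \<Rightarrow> real \<times> 'a \<Rightarrow> real" where
  "p X Y = K (fst Y - fst X) (snd Y - snd X)"

definition bb :: "real \<times> 'a \<Rightarrow> 'a" where "bb W = b (fst W) (snd W)"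

definition GG :: "real \<times> 'a \<Rightarrow> real \<times> 'a \<Rightarrow> 'a" where
  "GG W Y = G (fst Y - fst W) (snd Y - snd W)"

text \<open>The gradient is taken in the starting point \<open>W\<close>, and \<open>p W Y\<close>
  depends on \<open>snd Y - snd W\<close>; the chain rule produces the minus sign.\<close>

definition B :: "real \<times> 'a \<Rightarrow> real \<times> 'a \<Rightarrow> real" where
  "B W Y = - (bb W \<bullet> GG W Y)"

lemma bb_meas [measurable]: "bb \<in> borel_measurable borel"
  using b_meas0 unfolding bb_def by (simp add: case_prod_beta')

lemma p_meas1: "(\<lambda>(X, Y). p X Y) \<in> borel_measurable (borel \<Otimes>\<^sub>M borel)"
  unfolding p_def borel_prod[symmetric] case_prod_beta' by measurable

lemma GG_meas1: "(\<lambda>(X, Y). GG X Y) \<in> borel_measurable (borel \<Otimes>\<^sub>M borel)"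
  unfolding GG_def borel_prod[symmetric] case_prod_beta' by measurable

lemma p_meas' [measurable (raw)]:
  "f \<in> borel_measurable M \<Longrightarrow> g \<in> borel_measurable M \<Longrightarrow> (\<lambda>x. p (f x) (g x)) \<in> borel_measurable M"
  using measurable_compose[OF measurable_Pair p_meas1, of f M g] by simp

lemma GG_meas' [measurable (raw)]:
  "f \<in> borel_measurable M \<Longrightarrow> g \<in> borel_measurable M \<Longrightarrow> (\<lambda>x. GG (f x) (g x)) \<in> borel_measurable M"
  using measurable_compose[OF measurable_Pair GG_meas1, of f M g] by simp

lemma p_pos: "0 \<le> p X Y"
  by (simp add: p_def K_nonneg)

lemma p_0: "fst Y \<le> fst X \<Longrightarrow> p X Y = 0"
  by (simp add: p_def K_def)

lemma GG_0: "fst Y \<le> fst X \<Longrightarrow> GG X Y = 0"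
  by (simp add: GG_def G_def)

text \<open>The class condition as one integral over space-time: outside the time interval one of
  the factors \<open>p\<close> and \<open>GG\<close> vanishes. The full norm of the gradient is
  kept, not just its component along the drift, for the integrability results below.\<close>

lemma b_kernel:
  assumes XY: "fst X < fst Y"
  shows "(\<integral>\<^sup>+W. ennreal (p X W) * ennreal (norm (bb W)) * ennreal (norm (GG W Y)) \<partial>lborel)
     \<le> ennreal (\<eta> + Q (fst X) (fst Y)) * ennreal (p X Y)"
proof -
  obtain s x t y where e: "X = (s, x)" "Y = (t, y)" by (cases X, cases Y)
  have "(\<integral>\<^sup>+W. ennreal (p X W) * ennreal (norm (bb W)) * ennreal (norm (GG W Y)) \<partial>lborel) =
     (\<integral>\<^sup>+u. (\<integral>\<^sup>+z. ennreal (p X (u, z)) * ennreal (norm (bb (u, z))) * ennreal (norm (GG (u, z) Y)) \<partial>lborel) \<partial>lborel)"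
    by (rule nn_integral_lborel_pair) measurable
  also have "\<dots> = (\<integral>\<^sup>+u\<in>{s<..<t}. (\<integral>\<^sup>+z. ennreal (K (u - s) (z - x) * norm (b u z) * norm (G (t - u) (y - z))) \<partial>lborel) \<partial>lborel)"
  proof (rule nn_integral_cong)
    fix u
    show "(\<integral>\<^sup>+z. ennreal (p X (u, z)) * ennreal (norm (bb (u, z))) * ennreal (norm (GG (u, z) Y)) \<partial>lborel) =
       (\<integral>\<^sup>+z. ennreal (K (u - s) (z - x) * norm (b u z) * norm (G (t - u) (y - z))) \<partial>lborel) * indicator {s<..<t} u"
    proof (cases "u \<in> {s<..<t}")
      case True
      then show ?thesis by (simp add: e p_def bb_def GG_def ennreal_mult K_nonneg)
    next
      case False
      then have "ennreal (p X (u, z)) * ennreal (norm (bb (u, z))) * ennreal (norm (GG (u, z) Y)) = 0" for z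
        using p_0[of "(u, z)" X] GG_0[of Y "(u, z)"] by (auto simp: e)
      note z = this
      show ?thesis unfolding z using False by simp
    qed
  qed
  also have "\<dots> \<le> ennreal ((\<eta> + Q s t) * K (t - s) (y - x))" using b_class XY by (simp add: e)
  also have "\<dots> = ennreal (\<eta> + Q (fst X) (fst Y)) * ennreal (p X Y)"
    using \<eta>_range Q_nonneg0[of s t] by (simp add: e p_def ennreal_mult K_nonneg)
  finally show ?thesis .
qed

sublocale perturbation p B \<eta> Q
proof
  show "(\<lambda>(X, Y). p X Y) \<in> borel_measurable (borel \<Otimes>\<^sub>M borel)" by (rule p_meas1)
  show "(\<lambda>(X, Y). B X Y) \<in> borel_measurable (borel \<Otimes>\<^sub>M borel)"
    unfolding B_def case_prod_beta' by measurable
  show "0 \<le> p X Y" for X Y by (rule p_pos)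
  show "p X Y = 0" if "fst Y \<le> fst X" for X Y using that by (rule p_0)
  show "B X Y = 0" if "fst Y \<le> fst X" for X Y using GG_0[OF that] by (simp add: B_def)
  show "(\<integral>\<^sup>+z. ennreal (p X (u, z)) * ennreal (p (u, z) Y) \<partial>lborel) = ennreal (p X Y)" if u: "fst X < u" "u < fst Y" for X Y u
  proof -
    have hb: "has_bochner_integral lborel (\<lambda>z. K (u - fst X) z * K (fst Y - u) ((snd Y - snd X) - z)) (K ((u - fst X) + (fst Y - u)) (snd Y - snd X))"
      using u by (intro K_convolution) auto
    then have "(\<integral>\<^sup>+z. ennreal (K (u - fst X) z * K (fst Y - u) ((snd Y - snd X) - z)) \<partial>lborel) = ennreal (p X Y)"
      by (subst nn_integral_eq_integral) (auto simp: has_bochner_integral_iff K_nonneg p_def)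
    moreover have "(\<integral>\<^sup>+z. ennreal (K (u - fst X) (- snd X + z) * K (fst Y - u) ((snd Y - snd X) - (- snd X + z))) \<partial>lborel) =
       (\<integral>\<^sup>+z. ennreal (K (u - fst X) z * K (fst Y - u) ((snd Y - snd X) - z)) \<partial>lborel)"
      by (rule nn_integral_lborel_translation) measurable
    ultimately show ?thesis by (simp add: p_def ennreal_mult K_nonneg)
  qed
  show "has_bochner_integral lborel (\<lambda>z. B X (u, z) * p (u, z) Y) (B X Y)" if u: "fst X < u" "u < fst Y" for X Y u
  proof -
    have "has_bochner_integral lborel (\<lambda>z. K (fst Y - u) z * (G (u - fst X) ((snd Y - snd X) - z) \<bullet> bb X)) (G ((fst Y - u) + (u - fst X)) (snd Y - snd X) \<bullet> bb X)"
      using u by (intro G_convolution) auto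
    \<comment> \<open>The convolution formula carries the gradient on the second kernel;
      substituting \<open>snd Y - z\<close> for \<open>z\<close> places it on the first time
      interval.\<close>
    from has_bochner_integral_lborel_reflect_shift[OF this, of "snd Y"]
    have "has_bochner_integral lborel (\<lambda>z. K (fst Y - u) (snd Y - z) * (G (u - fst X) (z - snd X) \<bullet> bb X)) (G (fst Y - fst X) (snd Y - snd X) \<bullet> bb X)"
      by (simp add: algebra_simps)
    from has_bochner_integral_minus[OF this] show ?thesis
      by (simp add: B_def GG_def p_def inner_commute mult.commute)
  qed
  show "(\<integral>\<^sup>+W. ennreal (p X W) * ennreal \<bar>B W Y\<bar> \<partial>lborel) \<le> ennreal ((\<eta> + Q (fst X) (fst Y)) * p X Y)" if XY: "fst X < fst Y" for X Y
  proof -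
    have "(\<integral>\<^sup>+W. ennreal (p X W) * ennreal \<bar>B W Y\<bar> \<partial>lborel) \<le> (\<integral>\<^sup>+W. ennreal (p X W) * ennreal (norm (bb W)) * ennreal (norm (GG W Y)) \<partial>lborel)"
    proof (rule nn_integral_mono)
      fix W
      have "ennreal \<bar>B W Y\<bar> \<le> ennreal (norm (bb W) * norm (GG W Y))"
        unfolding B_def abs_minus_cancel by (intro ennreal_leI Cauchy_Schwarz_ineq2)
      then show "ennreal (p X W) * ennreal \<bar>B W Y\<bar> \<le> ennreal (p X W) * ennreal (norm (bb W)) * ennreal (norm (GG W Y))"
        by (simp add: ennreal_mult mult.assoc mult_left_mono)
    qed
    also note b_kernel[OF XY]
    finally show ?thesis using \<eta>_range Q_nonneg0[of "fst X" "fst Y"] by (simp add: ennreal_mult p_pos)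
  qed
qed (use \<eta>_range Q_nonneg0 Q_super0 in auto)

section \<open>Integrability of the drift and of the gradient kernel\<close>

lemma nn_integral_p_time: "s < t \<Longrightarrow> (\<integral>\<^sup>+y. ennreal (p (s, x) (t, y)) \<partial>lborel) = 1"
  using nn_integral_K[of "t - s" x] by (simp add: p_def)

text \<open>Integrating the class condition over the end point: the gradient kernel has total mass bounded
  below, so the drift itself is integrable against \<open>p\<close>.\<close>

lemma drift_integrable:
  assumes sT: "fst X < T"
  shows "(\<integral>\<^sup>+W. indicator {..<T} (fst W) * (ennreal (p X W) * ennreal (norm (bb W))) \<partial>lborel) < \<infinity>"
proof -
  obtain s x where X: "X = (s, x)" by (cases X)
  obtain v :: 'a where v: "v \<in> Basis" using nonempty_Basis by blast
  \<comment> \<open>The lower bound for the gradient mass decreases with the time lag, so the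
    largest lag \<open>T - s\<close> gives a constant valid throughout
    \<open>(s, T)\<close>.\<close>
  define c where "c = (1 - cos 1) * exp (- (T - s) * \<psi> v)"
  have "cos 1 < (1::real)" using cos_monotone_0_pi[of 0 1] pi_gt3 by simp
  then have c: "c > 0" by (simp add: c_def)
  have lower: "ennreal c \<le> (\<integral>\<^sup>+y. ennreal (norm (GG W (T, y))) \<partial>lborel)" if W: "s < fst W" "fst W < T" for W
  proof -
    have "c \<le> (1 - cos 1) * exp (- (T - fst W) * \<psi> v)"
      unfolding c_def using W \<psi>_nonneg[of v] by (intro mult_left_mono) (auto simp: mult_right_mono)
    then have "ennreal c \<le> ennreal ((1 - cos 1) * exp (- (T - fst W) * \<psi> v))" by (rule ennreal_leI)
    also have "\<dots> \<le> (\<integral>\<^sup>+y. ennreal (norm (G (T - fst W) y)) \<partial>lborel)"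
      using W v by (intro gradient_mass_lower) auto
    also have "\<dots> = (\<integral>\<^sup>+y. ennreal (norm (G (T - fst W) (- snd W + y))) \<partial>lborel)"
      by (rule nn_integral_lborel_translation[symmetric]) measurable
    finally show ?thesis by (simp add: GG_def)
  qed
  have "ennreal c * (\<integral>\<^sup>+W. indicator {..<T} (fst W) * (ennreal (p X W) * ennreal (norm (bb W))) \<partial>lborel) =
     (\<integral>\<^sup>+W. ennreal c * (indicator {..<T} (fst W) * (ennreal (p X W) * ennreal (norm (bb W)))) \<partial>lborel)"
    by (rule nn_integral_cmult[symmetric]) (simp add: borel_prod[symmetric] p_def bb_def, measurable, simp add: bb_meas[unfolded bb_def] borel_prod)
  also have "\<dots> \<le> (\<integral>\<^sup>+W. (\<integral>\<^sup>+y. ennreal (p X W) * ennreal (norm (bb W)) * ennreal (norm (GG W (T, y))) \<partial>lborel) \<partial>lborel)"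
  proof (rule nn_integral_mono)
    fix W
    show "ennreal c * (indicator {..<T} (fst W) * (ennreal (p X W) * ennreal (norm (bb W)))) \<le> (\<integral>\<^sup>+y. ennreal (p X W) * ennreal (norm (bb W)) * ennreal (norm (GG W (T, y))) \<partial>lborel)"
    proof (cases "s < fst W \<and> fst W < T")
      case True
      have "ennreal c * (ennreal (p X W) * ennreal (norm (bb W))) \<le> (\<integral>\<^sup>+y. ennreal (norm (GG W (T, y))) \<partial>lborel) * (ennreal (p X W) * ennreal (norm (bb W)))"
        using True by (intro mult_right_mono lower) auto
      also have "\<dots> = (\<integral>\<^sup>+y. ennreal (p X W) * ennreal (norm (bb W)) * ennreal (norm (GG W (T, y))) \<partial>lborel)"
        by (subst nn_integral_cmult) (auto simp: mult.commute)
      finally show ?thesis using True by simp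
    next
      case False
      then show ?thesis using p_0[of W X] by (auto simp: X indicator_def)
    qed
  qed
  also have "\<dots> = (\<integral>\<^sup>+y. (\<integral>\<^sup>+W. ennreal (p X W) * ennreal (norm (bb W)) * ennreal (norm (GG W (T, y))) \<partial>lborel) \<partial>lborel)"
    by (rule lborel_pair.Fubini') measurable
  also have "\<dots> \<le> (\<integral>\<^sup>+y. ennreal (\<eta> + Q s T) * ennreal (p X (T, y)) \<partial>lborel)"
    using b_kernel[of X "(T, _)"] sT by (intro nn_integral_mono) (auto simp: X)
  also have "\<dots> = ennreal (\<eta> + Q s T)"
    using sT by (simp add: nn_integral_cmult nn_integral_p_time X)
  also have "\<dots> < \<infinity>" by simp
  finally have "ennreal c * (\<integral>\<^sup>+W. indicator {..<T} (fst W) * (ennreal (p X W) * ennreal (norm (bb W))) \<partial>lborel) < \<infinity>" .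
  then show ?thesis using c by (auto simp: ennreal_mult_less_top)
qed

text \<open>The class condition is integrated over end points in the strip up to \<open>T\<close>,
  where \<open>p\<close> has finite total mass. Hence \<open>p X W * norm (bb W)\<close> times the
  gradient mass issuing from \<open>W\<close> is integrable in \<open>W\<close>, thus finite almost
  everywhere; where the first factor is nonzero, the second must be finite. A translation puts the
  gradient mass in the form with base point 0.\<close>

lemma gradient_finite_AE:
  "AE W in lborel. ennreal (p X W) * ennreal (norm (bb W)) = 0 \<or>
     (\<integral>\<^sup>+U. indicator {..T} (fst U) * ennreal (norm (G (fst U - fst W) (snd U))) \<partial>lborel) < \<infinity>"
proof -
  obtain s x where X: "X = (s, x)" by (cases X)
  have [measurable]: "(\<lambda>U::real \<times> 'a. indicator {..T} (fst U) :: ennreal) \<in> borel_measurable borel"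
    unfolding borel_prod[symmetric] by measurable
  define J where "J W = (\<integral>\<^sup>+U. indicator {..T} (fst U) * ennreal (norm (GG W U)) \<partial>lborel)" for W
  have J: "J W = (\<integral>\<^sup>+U. indicator {..T} (fst U) * ennreal (norm (G (fst U - fst W) (snd U))) \<partial>lborel)" for W
  proof -
    have [measurable]: "(\<lambda>U. GG W U) \<in> borel_measurable borel" by measurable
    have "J W = (\<integral>\<^sup>+U. indicator {..T} (fst ((0, snd W) + U)) * ennreal (norm (GG W ((0, snd W) + U))) \<partial>lborel)"
      unfolding J_def by (rule nn_integral_lborel_translation[symmetric]) measurable
    then show ?thesis by (simp add: GG_def)
  qed
  have [measurable]: "J \<in> borel_measurable borel" unfolding J_def by measurable
  have "(\<integral>\<^sup>+W. (ennreal (p X W) * ennreal (norm (bb W))) * J W \<partial>lborel) =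
     (\<integral>\<^sup>+W. (\<integral>\<^sup>+U. indicator {..T} (fst U) * (ennreal (p X W) * ennreal (norm (bb W)) * ennreal (norm (GG W U))) \<partial>lborel) \<partial>lborel)"
    unfolding J_def by (intro nn_integral_cong, subst nn_integral_cmult[symmetric]) (auto simp: mult_ac)
  also have "\<dots> = (\<integral>\<^sup>+U. (\<integral>\<^sup>+W. indicator {..T} (fst U) * (ennreal (p X W) * ennreal (norm (bb W)) * ennreal (norm (GG W U))) \<partial>lborel) \<partial>lborel)"
    by (rule lborel_pair.Fubini') measurable
  also have "\<dots> \<le> (\<integral>\<^sup>+U. ennreal (\<eta> + Q s T) * (indicator {..T} (fst U) * ennreal (p X U)) \<partial>lborel)"
  proof (rule nn_integral_mono)
    fix U :: "real \<times> 'a"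
    have "(\<integral>\<^sup>+W. indicator {..T} (fst U) * (ennreal (p X W) * ennreal (norm (bb W)) * ennreal (norm (GG W U))) \<partial>lborel) =
       indicator {..T} (fst U) * (\<integral>\<^sup>+W. ennreal (p X W) * ennreal (norm (bb W)) * ennreal (norm (GG W U)) \<partial>lborel)"
      by (rule nn_integral_cmult) measurable
    also have "\<dots> \<le> ennreal (\<eta> + Q s T) * (indicator {..T} (fst U) * ennreal (p X U))"
    proof (cases "fst U \<le> T \<and> s < fst U")
      case True
      have "(\<integral>\<^sup>+W. ennreal (p X W) * ennreal (norm (bb W)) * ennreal (norm (GG W U)) \<partial>lborel) \<le> ennreal (\<eta> + Q s (fst U)) * ennreal (p X U)"
        using b_kernel[of X U] True by (simp add: X)
      also have "\<dots> \<le> ennreal (\<eta> + Q s T) * ennreal (p X U)"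
        using True superadditive_mono[OF Q_super0 Q_nonneg0, of s s "fst U" T] by (intro mult_right_mono ennreal_leI) auto
      finally show ?thesis using True by simp
    next
      case False
      show ?thesis
      proof (cases "fst U \<le> T")
        case True
        with False have "ennreal (p X W) * ennreal (norm (bb W)) * ennreal (norm (GG W U)) = 0" for W
          using p_0[of W X] GG_0[of U W] by (cases "fst W \<le> s") (auto simp: X)
        note z = this
        show ?thesis unfolding z by simp
      qed simp
    qed
    finally show "(\<integral>\<^sup>+W. indicator {..T} (fst U) * (ennreal (p X W) * ennreal (norm (bb W)) * ennreal (norm (GG W U))) \<partial>lborel) \<le> ennreal (\<eta> + Q s T) * (indicator {..T} (fst U) * ennreal (p X U))" .
  qed
  also have "\<dots> = ennreal (\<eta> + Q s T) * (\<integral>\<^sup>+U. indicator {..T} (fst U) * ennreal (p X U) \<partial>lborel)"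
    by (rule nn_integral_cmult) measurable
  also have "\<dots> \<le> ennreal (\<eta> + Q s T) * ennreal (max 0 (T - s))"
    using nn_integral_K_strip[of T s x] by (intro mult_left_mono) (auto simp: p_def X)
  also have "\<dots> < \<infinity>" by (simp add: ennreal_mult_less_top)
  finally have "(\<integral>\<^sup>+W. (ennreal (p X W) * ennreal (norm (bb W))) * J W \<partial>lborel) \<noteq> \<infinity>" by simp
  then have "AE W in lborel. (ennreal (p X W) * ennreal (norm (bb W))) * J W \<noteq> \<infinity>"
    by (intro nn_integral_noteq_infinite) measurable
  then show ?thesis
    unfolding J[symmetric]
  proof eventually_elim
    case (elim W)
    then show ?case by (auto simp: ennreal_mult_eq_top_iff top.not_eq_extremum)
  qed
qed

text \<open>\<open>q X U = p X U + \<integral> q X W * B W U\<close> is integrated against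
  \<open>\<zeta>\<close>. The term with \<open>p\<close> gives \<open>- \<phi> X\<close>. In the
  other one Fubini leaves the integral of \<open>B W\<close> against \<open>\<zeta>\<close>, which
  is the unperturbed equation differentiated in the starting point, namely minus the drift applied
  to the gradient of \<open>\<phi>\<close>; it moves to the left with a plus sign.\<close>

theorem weak_equation:
  assumes \<phi>: "\<phi> \<in> Cc_infinity"
  shows "has_bochner_integral lborel
    (\<lambda>U. q X U * (frechet_derivative \<phi> (at U) (1, 0) + gen (\<lambda>w. \<phi> (fst U, w)) (snd U) + bb U \<bullet> space_grad \<phi> (fst U) (snd U)))
    (- \<phi> X)"
proof -
  interpret levy_test \<psi> n C \<phi> by unfold_locales (rule \<phi>)
  obtain s x where X: "X = (s, x)" by (cases X)
  obtain R where R: "R > 0" "\<And>u z. R < \<bar>u\<bar> \<Longrightarrow> \<phi> (u, z) = 0" "\<And>u z. R < \<bar>u\<bar> \<Longrightarrow> \<zeta> (u, z) = 0"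
    using \<phi>_support by blast
  define T where "T = max R s + 1"
  have T: "s < T" "R < T" by (auto simp: T_def)
  have \<zeta>0: "\<zeta> U = 0" if "T \<le> fst U" for U
    using R(3)[of "fst U" "snd U"] that T R(1) by simp
  have g0: "space_grad \<phi> u z = 0" if "T \<le> u" for u z
  proof -
    have "(\<lambda>w. \<phi> (u, w)) = (\<lambda>_. 0)" using R(2)[of u] that T R(1) by auto
    then have "GDERIV (\<lambda>w. \<phi> (u, w)) z :> 0" by (simp add: GDERIV_const)
    from grad_eqI[OF this] grad_eqI[OF Cc_infinity_space_grad[OF \<phi>, of u z]] show ?thesis by simp
  qed
  obtain E where E: "E \<ge> 0" "\<And>U. \<bar>\<zeta> U\<bar> \<le> E" using \<zeta>_bounded by blast
  obtain D where D: "D \<ge> 0" "\<And>u z. norm (space_grad \<phi> u z) \<le> D" using Cc_infinity_space_grad_bounded[OF \<phi>] by blast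
  from S_bound_ex[OF T(1)] obtain c where c: "c \<ge> 0" "\<And>t y. t \<le> T \<Longrightarrow> S (s, x) (t, y) \<le> ennreal c * ennreal (p (s, x) (t, y))" by blast
  have Sc: "S X U \<le> ennreal c * ennreal (p X U)" if "fst U \<le> T" for U
    using c(2)[of "fst U" "snd U"] that by (simp add: X)
  have qc: "\<bar>q X U\<bar> \<le> c * p X U" if "fst U \<le> T" for U
  proof -
    have "ennreal \<bar>q X U\<bar> \<le> ennreal (c * p X U)"
      using order.trans[OF q_le_S Sc[OF that]] c(1) by (simp add: ennreal_mult p_pos)
    then show ?thesis using c(1) p_pos[of X U] by (simp add: ennreal_le_iff)
  qed
  have sgm [measurable]: "(\<lambda>U. space_grad \<phi> (fst U) (snd U)) \<in> borel_measurable borel"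
    using Cc_infinity_space_grad_continuous[OF \<phi>] by (intro borel_measurable_continuous_onI) (simp add: case_prod_beta')
  have [measurable]: "(\<lambda>U::real \<times> 'a. indicator {..T} (fst U) :: ennreal) \<in> borel_measurable borel"
    "(\<lambda>U::real \<times> 'a. indicator {..<T} (fst U) :: ennreal) \<in> borel_measurable borel"
    "(\<lambda>U::real \<times> 'a. indicator {..<T} (fst U) :: real) \<in> borel_measurable borel"
    unfolding borel_prod[symmetric] by measurable
  have Iq\<zeta>: "integrable lborel (\<lambda>U. q X U * \<zeta> U)"
  proof (rule Bochner_Integration.integrable_bound[OF integrable_mult_right[OF integrable_K_strip[of T s x], of "c * E"]])
    show "AE U in lborel. norm (q X U * \<zeta> U) \<le> norm (c * E * (indicator {..T} (fst U) * K (fst U - s) (snd U - x)))"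
    proof (rule AE_I2)
      fix U
      show "norm (q X U * \<zeta> U) \<le> norm (c * E * (indicator {..T} (fst U) * K (fst U - s) (snd U - x)))"
      proof (cases "fst U \<le> T")
        case True
        have "\<bar>q X U\<bar> * \<bar>\<zeta> U\<bar> \<le> (c * p X U) * E"
          using c(1) p_pos[of X U] by (intro mult_mono qc True E) auto
        then show ?thesis using True c E by (simp add: abs_mult p_def X K_nonneg mult_ac)
      next
        case False then show ?thesis by (simp add: \<zeta>0)
      qed
    qed
  qed measurable
  have Iqb: "integrable lborel (\<lambda>U. q X U * (bb U \<bullet> space_grad \<phi> (fst U) (snd U)))"
  proof (rule integrableI_bounded)
    have "(\<integral>\<^sup>+U. ennreal (norm (q X U * (bb U \<bullet> space_grad \<phi> (fst U) (snd U)))) \<partial>lborel) \<le>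
       (\<integral>\<^sup>+U. ennreal (c * D) * (indicator {..<T} (fst U) * (ennreal (p X U) * ennreal (norm (bb U)))) \<partial>lborel)"
    proof (rule nn_integral_mono)
      fix U :: "real \<times> 'a"
      show "ennreal (norm (q X U * (bb U \<bullet> space_grad \<phi> (fst U) (snd U)))) \<le> ennreal (c * D) * (indicator {..<T} (fst U) * (ennreal (p X U) * ennreal (norm (bb U))))"
      proof (cases "fst U < T")
        case True
        have "\<bar>bb U \<bullet> space_grad \<phi> (fst U) (snd U)\<bar> \<le> norm (bb U) * D"
          by (rule order.trans[OF Cauchy_Schwarz_ineq2]) (intro mult_left_mono D, simp)
        then have "\<bar>q X U\<bar> * \<bar>bb U \<bullet> space_grad \<phi> (fst U) (snd U)\<bar> \<le> (c * p X U) * (norm (bb U) * D)"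
          using True c(1) p_pos[of X U] by (intro mult_mono qc) auto
        then have "ennreal (norm (q X U * (bb U \<bullet> space_grad \<phi> (fst U) (snd U)))) \<le> ennreal ((c * D) * (p X U * norm (bb U)))"
          by (intro ennreal_leI) (simp add: abs_mult mult_ac)
        also have "\<dots> = ennreal (c * D) * (ennreal (p X U) * ennreal (norm (bb U)))"
          using c(1) D(1) p_pos[of X U] by (simp add: ennreal_mult)
        finally show ?thesis using True by simp
      next
        case False then show ?thesis by (simp add: g0)
      qed
    qed
    also have "\<dots> = ennreal (c * D) * (\<integral>\<^sup>+U. indicator {..<T} (fst U) * (ennreal (p X U) * ennreal (norm (bb U))) \<partial>lborel)"
      by (rule nn_integral_cmult) measurable
    also have "\<dots> < \<infinity>" using drift_integrable[of X T] T by (simp add: X ennreal_mult_less_top)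
    finally show "(\<integral>\<^sup>+U. ennreal (norm (q X U * (bb U \<bullet> space_grad \<phi> (fst U) (snd U)))) \<partial>lborel) < \<infinity>" .
  qed measurable
  let ?h = "\<lambda>U W. q X W * B W U * \<zeta> U"
  have int: "integrable (lborel \<Otimes>\<^sub>M lborel) (\<lambda>(U, W). ?h U W)"
  proof (rule integrableI_bounded)
    have "(\<integral>\<^sup>+a. ennreal (norm (case a of (U, W) \<Rightarrow> ?h U W)) \<partial>(lborel \<Otimes>\<^sub>M lborel)) =
       (\<integral>\<^sup>+U. (\<integral>\<^sup>+W. ennreal (norm (?h U W)) \<partial>lborel) \<partial>lborel)"
      by (subst lborel.nn_integral_fst[symmetric]) auto
    also have "\<dots> \<le> (\<integral>\<^sup>+U. (\<integral>\<^sup>+W. (S X W * ennreal \<bar>B W U\<bar>) * (ennreal E * indicator {..T} (fst U)) \<partial>lborel) \<partial>lborel)"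
    proof (intro nn_integral_mono)
      fix U W
      have "ennreal \<bar>\<zeta> U\<bar> \<le> ennreal E * indicator {..T} (fst U)"
        using E(2)[of U] \<zeta>0[of U] by (cases "fst U \<le> T") (auto intro: ennreal_leI)
      then have "ennreal \<bar>q X W\<bar> * ennreal \<bar>B W U\<bar> * ennreal \<bar>\<zeta> U\<bar> \<le> (S X W * ennreal \<bar>B W U\<bar>) * (ennreal E * indicator {..T} (fst U))"
        by (intro mult_mono q_le_S) auto
      then show "ennreal (norm (?h U W)) \<le> (S X W * ennreal \<bar>B W U\<bar>) * (ennreal E * indicator {..T} (fst U))"
        by (simp add: abs_mult ennreal_mult)
    qed
    also have "\<dots> = (\<integral>\<^sup>+U. (\<integral>\<^sup>+W. S X W * ennreal \<bar>B W U\<bar> \<partial>lborel) * (ennreal E * indicator {..T} (fst U)) \<partial>lborel)"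
      by (intro nn_integral_cong nn_integral_multc) measurable
    also have "\<dots> \<le> (\<integral>\<^sup>+U. (ennreal E * ennreal c) * (indicator {..T} (fst U) * ennreal (K (fst U - s) (snd U - x))) \<partial>lborel)"
    proof (rule nn_integral_mono)
      fix U :: "real \<times> 'a"
      show "(\<integral>\<^sup>+W. S X W * ennreal \<bar>B W U\<bar> \<partial>lborel) * (ennreal E * indicator {..T} (fst U)) \<le> (ennreal E * ennreal c) * (indicator {..T} (fst U) * ennreal (K (fst U - s) (snd U - x)))"
      proof (cases "fst U \<le> T")
        case True
        have "(\<integral>\<^sup>+W. S X W * ennreal \<bar>B W U\<bar> \<partial>lborel) \<le> S X U" by (subst (2) S_equation) simp
        also have "\<dots> \<le> ennreal c * ennreal (p X U)" by (rule Sc[OF True])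
        finally have "(\<integral>\<^sup>+W. S X W * ennreal \<bar>B W U\<bar> \<partial>lborel) * ennreal E \<le> ennreal c * ennreal (p X U) * ennreal E"
          by (intro mult_right_mono) auto
        then show ?thesis using True by (simp add: p_def X mult_ac)
      qed simp
    qed
    also have "\<dots> = (ennreal E * ennreal c) * (\<integral>\<^sup>+U. indicator {..T} (fst U) * ennreal (K (fst U - s) (snd U - x)) \<partial>lborel)"
    proof (rule nn_integral_cmult)
      show "(\<lambda>U. indicator {..T} (fst U) * ennreal (K (fst U - s) (snd U - x))) \<in> borel_measurable lborel"
        unfolding lborel_prod[symmetric] by measurable
    qed
    also have "\<dots> \<le> (ennreal E * ennreal c) * ennreal (max 0 (T - s))"
      by (intro mult_left_mono nn_integral_K_strip) auto
    also have "\<dots> < \<infinity>" by (simp add: ennreal_mult_less_top)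
    finally show "(\<integral>\<^sup>+a. ennreal (norm (case a of (U, W) \<Rightarrow> ?h U W)) \<partial>(lborel \<Otimes>\<^sub>M lborel)) < \<infinity>" .
  qed measurable
  have iU: "(LBINT W. ?h U W) = q X U * \<zeta> U - p X U * \<zeta> U" for U
    using q_equation[of X U] by (simp add: left_diff_distrib[symmetric])
  \<comment> \<open>The gradient identity needs a finite gradient mass, which is known almost
    everywhere where \<open>p\<close> and the drift are nonzero. Elsewhere both sides vanish:
    \<open>p X W = 0\<close> forces \<open>q X W = 0\<close> by the upper bound, and no drift means
    \<open>B W U = 0\<close>.\<close>
  have iW: "AE W in lborel. (LBINT U. ?h U W) = - (q X W * (bb W \<bullet> space_grad \<phi> (fst W) (snd W)))"
    using gradient_finite_AE[of X T]
  proof eventually_elim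
    case (elim W)
    have h: "(LBINT U. ?h U W) = q X W * (LBINT U. B W U * \<zeta> U)" by (simp add: mult.assoc)
    show ?case
    proof (cases "T \<le> fst W")
      case True
      have "B W U * \<zeta> U = 0" for U
        using B_zero[of U W] \<zeta>0[of U] True by (cases "fst U \<le> fst W") auto
      note z = this
      show ?thesis unfolding h z using True by (simp add: g0)
    next
      case False
      show ?thesis
      proof (cases "ennreal (p X W) * ennreal (norm (bb W)) = 0")
        case True
        then have "p X W = 0 \<or> bb W = 0" using p_pos[of X W] by (auto simp: ennreal_eq_0_iff)
        then show ?thesis
        proof
          assume "p X W = 0"
          then have "q X W = 0" using qc[of W] False by simp
          then show ?thesis by simp
        next
          assume b0: "bb W = 0"
          then have z: "B W U = 0" for U by (simp add: B_def)
          show ?thesis unfolding h z b0 by simp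
        qed
      next
        case nz: False
        with elim have fin: "(\<integral>\<^sup>+U. indicator {..T} (fst U) * ennreal (norm (G (fst U - fst W) (snd U))) \<partial>lborel) < \<infinity>" by blast
        have "has_bochner_integral lborel (\<lambda>U. (G (fst U - fst W) (- snd W + snd U) \<bullet> bb W) * \<zeta> U) (space_grad \<phi> (fst W) (snd W) \<bullet> bb W)"
          using \<zeta>0 by (intro gradient_identity[OF _ fin]) auto
        from has_bochner_integral_minus[OF this]
        have "has_bochner_integral lborel (\<lambda>U. B W U * \<zeta> U) (- (space_grad \<phi> (fst W) (snd W) \<bullet> bb W))"
          by (simp add: B_def GG_def inner_commute)
        then have "(LBINT U. B W U * \<zeta> U) = - (bb W \<bullet> space_grad \<phi> (fst W) (snd W))"
          by (simp add: has_bochner_integral_iff inner_commute)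
        then show ?thesis unfolding h by simp
      qed
    qed
  qed
  have Ip: "integrable lborel (\<lambda>U. p X U * \<zeta> U)" and Vp: "(LBINT U. p X U * \<zeta> U) = - \<phi> X"
    using free_equation[of s x] by (auto simp: has_bochner_integral_iff p_def X)
  have "(LBINT U. q X U * \<zeta> U) - (LBINT U. p X U * \<zeta> U) = (LBINT U. (LBINT W. ?h U W))"
    unfolding iU using Iq\<zeta> Ip by simp
  also have "\<dots> = (LBINT W. (LBINT U. ?h U W))" using lborel_pair.Fubini_integral[OF int] by simp
  also have "\<dots> = (LBINT W. - (q X W * (bb W \<bullet> space_grad \<phi> (fst W) (snd W))))"
    using iW by (intro integral_cong_AE) measurable
  also have "\<dots> = - (LBINT W. q X W * (bb W \<bullet> space_grad \<phi> (fst W) (snd W)))" by simp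
  finally have "(LBINT U. q X U * \<zeta> U) + (LBINT W. q X W * (bb W \<bullet> space_grad \<phi> (fst W) (snd W))) = - \<phi> X"
    using Vp by simp
  then have "has_bochner_integral lborel (\<lambda>U. q X U * \<zeta> U + q X U * (bb U \<bullet> space_grad \<phi> (fst U) (snd U))) (- \<phi> X)"
    using Iq\<zeta> Iqb by (simp add: has_bochner_integral_iff)
  then show ?thesis by (simp add: \<zeta>_def \<phi>'_def distrib_left)
qed

end

section \<open>The stable case\<close>

definition stable_symbol :: "real \<Rightarrow> real \<Rightarrow> real \<Rightarrow> 'a::euclidean_space \<Rightarrow> real" where
  "stable_symbol \<alpha> \<beta> a \<xi> = norm \<xi> powr \<alpha> + a powr \<beta> * norm \<xi> powr \<beta>"

definition stable_levy :: "real \<Rightarrow> real \<Rightarrow> real \<Rightarrow> 'a::euclidean_space \<Rightarrow> real" where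
  "stable_levy \<alpha> \<beta> a y = riesz_const DIM('a) (- \<alpha>) / norm y powr (real DIM('a) + \<alpha>) +
     a powr \<beta> * riesz_const DIM('a) (- \<beta>) / norm y powr (real DIM('a) + \<beta>)"

text \<open>Linear growth from below comes from the power \<open>\<alpha> > 1\<close>. The constant
  \<open>1 + a powr \<beta>\<close> arises because a power of the norm with exponent between 0 and 2
  is at most \<open>1 + (norm \<xi>)\<^sup>2\<close>. The Levy-Khintchine formula is the sum of
  those for the two Riesz kernels.\<close>

lemma levy_exponent_stable:
  assumes ab: "1 < \<beta>" "\<beta> < \<alpha>" "\<alpha> < 2"
  shows "levy_exponent (stable_symbol \<alpha> \<beta> a) (stable_levy \<alpha> \<beta> a :: 'a::euclidean_space \<Rightarrow> real) (1 + a powr \<beta>)"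
proof
  show "continuous_on UNIV (stable_symbol \<alpha> \<beta> a :: 'a \<Rightarrow> real)"
    unfolding stable_symbol_def using ab by (intro continuous_intros continuous_on_powr') auto
  show "0 \<le> stable_symbol \<alpha> \<beta> a \<xi>" for \<xi> :: 'a by (simp add: stable_symbol_def)
  show "norm \<xi> - 1 \<le> stable_symbol \<alpha> \<beta> a \<xi>" for \<xi> :: 'a
  proof -
    have "norm \<xi> - 1 \<le> norm \<xi> powr \<alpha>"
    proof (cases "norm \<xi> \<ge> 1")
      case True
      then have "norm \<xi> powr 1 \<le> norm \<xi> powr \<alpha>" using ab by (intro powr_mono) auto
      then show ?thesis using True by simp
    next
      case False
      then show ?thesis using powr_ge_zero[of "norm \<xi>" \<alpha>] by linarith
    qed
    moreover have "0 \<le> a powr \<beta> * norm \<xi> powr \<beta>" by simp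
    ultimately show ?thesis unfolding stable_symbol_def by linarith
  qed
  have pw: "norm \<xi> powr \<gamma> \<le> 1 + (norm \<xi>)\<^sup>2" if "0 < \<gamma>" "\<gamma> < 2" for \<xi> :: 'a and \<gamma> :: real
  proof (cases "norm \<xi> \<ge> 1")
    case True
    then have "norm \<xi> powr \<gamma> \<le> norm \<xi> powr 2" using that by (intro powr_mono) auto
    also have "\<dots> = (norm \<xi>)\<^sup>2" using True by (subst powr_numeral) auto
    finally show ?thesis by simp
  next
    case False
    then have "norm \<xi> powr \<gamma> \<le> 1 powr \<gamma>" using that by (intro powr_mono2) auto
    then show ?thesis by (simp add: add_increasing2)
  qed
  show "stable_symbol \<alpha> \<beta> a \<xi> \<le> (1 + a powr \<beta>) * (1 + (norm \<xi>)\<^sup>2)" for \<xi> :: 'a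
  proof -
    have "a powr \<beta> * norm \<xi> powr \<beta> \<le> a powr \<beta> * (1 + (norm \<xi>)\<^sup>2)"
      using ab by (intro mult_left_mono pw) auto
    then show ?thesis unfolding stable_symbol_def using pw[of \<alpha> \<xi>] ab unfolding distrib_right by simp
  qed
  show "(stable_levy \<alpha> \<beta> a :: 'a \<Rightarrow> real) \<in> borel_measurable borel"
    unfolding stable_levy_def by measurable
  have r: "0 \<le> riesz_const DIM('a) (- \<alpha>)" "0 \<le> riesz_const DIM('a) (- \<beta>)"
    using ab by (auto intro!: riesz_const_nonneg)
  show "0 \<le> stable_levy \<alpha> \<beta> a y" for y :: 'a
    unfolding stable_levy_def using r by (intro add_nonneg_nonneg divide_nonneg_nonneg mult_nonneg_nonneg) auto
  show "stable_levy \<alpha> \<beta> a (- y) = stable_levy \<alpha> \<beta> a y" for y :: 'a by (simp add: stable_levy_def)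
  show "(\<integral>\<^sup>+y. ennreal (stable_levy \<alpha> \<beta> a y * (1 - cos (\<xi> \<bullet> y))) \<partial>lborel) = ennreal (stable_symbol \<alpha> \<beta> a \<xi>)" for \<xi> :: 'a
  proof -
    let ?f = "\<lambda>\<gamma> y::'a. riesz_const DIM('a) (- \<gamma>) / norm y powr (real DIM('a) + \<gamma>) * (1 - cos (\<xi> \<bullet> y))"
    have f0: "0 \<le> ?f \<alpha> y" "0 \<le> ?f \<beta> y" for y using r by (auto intro!: mult_nonneg_nonneg)
    have "(\<integral>\<^sup>+y. ennreal (stable_levy \<alpha> \<beta> a y * (1 - cos (\<xi> \<bullet> y))) \<partial>lborel) = (\<integral>\<^sup>+y. ennreal (?f \<alpha> y) + ennreal (a powr \<beta>) * ennreal (?f \<beta> y) \<partial>lborel)"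
    proof (rule nn_integral_cong)
      fix y :: 'a
      have "stable_levy \<alpha> \<beta> a y * (1 - cos (\<xi> \<bullet> y)) = ?f \<alpha> y + a powr \<beta> * ?f \<beta> y"
        by (simp add: stable_levy_def distrib_right)
      then show "ennreal (stable_levy \<alpha> \<beta> a y * (1 - cos (\<xi> \<bullet> y))) = ennreal (?f \<alpha> y) + ennreal (a powr \<beta>) * ennreal (?f \<beta> y)"
        using f0[of y] by (simp only: ennreal_plus ennreal_mult powr_ge_zero mult_nonneg_nonneg)
    qed
    also have "\<dots> = (\<integral>\<^sup>+y. ennreal (?f \<alpha> y) \<partial>lborel) + ennreal (a powr \<beta>) * (\<integral>\<^sup>+y. ennreal (?f \<beta> y) \<partial>lborel)"
      by (subst nn_integral_add, simp, simp, subst nn_integral_cmult, simp) (rule refl)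
    also have "\<dots> = ennreal (norm \<xi> powr \<alpha>) + ennreal (a powr \<beta>) * ennreal (norm \<xi> powr \<beta>)"
      using ab by (simp only: riesz_levy_khintchine)
    finally show ?thesis by (simp add: stable_symbol_def ennreal_plus ennreal_mult)
  qed
qed

context
  fixes \<alpha> \<beta> a :: real
  assumes ab: "1 < \<beta>" "\<beta> < \<alpha>" "\<alpha> < 2"
begin

interpretation st: levy_exponent "stable_symbol \<alpha> \<beta> a" "stable_levy \<alpha> \<beta> a :: 'a::euclidean_space \<Rightarrow> real" "1 + a powr \<beta>"
  by (rule levy_exponent_stable[OF ab])

lemma stable_kernel_eq: "stable_kernel \<alpha> \<beta> a t (x::'a::euclidean_space) = levy_exponent.K (stable_symbol \<alpha> \<beta> a) t x"
proof (cases "t > 0")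
  case t: True
  let ?f = "\<lambda>\<xi>::'a. exp (complex_of_real (- t * (norm \<xi> powr \<alpha> + a powr \<beta> * norm \<xi> powr \<beta>))) * exp (- (\<i> * complex_of_real (x \<bullet> \<xi>)))"
  have n: "norm (?f \<xi>) = exp (- t * stable_symbol \<alpha> \<beta> a \<xi>)" for \<xi>
    unfolding norm_mult norm_exp_eq_Re by (simp add: stable_symbol_def)
  have re: "Re (?f \<xi>) = exp (- t * stable_symbol \<alpha> \<beta> a \<xi>) * cos (x \<bullet> \<xi>)" for \<xi>
    unfolding exp_of_real by (simp add: Re_exp stable_symbol_def)
  have "integrable lborel ?f"
  proof (rule Bochner_Integration.integrable_bound[OF st.integrable_exp[OF t]])
    show "AE \<xi> in lborel. norm (?f \<xi>) \<le> norm (exp (- t * stable_symbol \<alpha> \<beta> a \<xi>))"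
      unfolding n by simp
  qed measurable
  then have "Re (LBINT \<xi>. ?f \<xi>) = (LBINT \<xi>. Re (?f \<xi>))"
    by (rule integral_bounded_linear[OF bounded_linear_Re, symmetric])
  then show ?thesis using t unfolding stable_kernel_def st.K_def re by simp
next
  case False
  then show ?thesis by (simp add: stable_kernel_def st.K_def)
qed

text \<open>Differentiation is in the starting point, whence the sign; \<open>G\<close> itself is
  the gradient in the increment.\<close>

lemma stable_density_grad:
  assumes "u < t"
  shows "grad (\<lambda>w. stable_density \<alpha> \<beta> a u w t y) (z::'a::euclidean_space) = - levy_exponent.G (stable_symbol \<alpha> \<beta> a) (t - u) (y - z)"
proof (rule grad_eqI)
  have tu: "t - u > 0" using assms by simp
  have d1: "((\<lambda>w. y - w) has_derivative (\<lambda>h. - h)) (at z)" by (auto intro!: derivative_eq_intros)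
  have "(st.K (t - u) has_derivative (\<lambda>h. h \<bullet> st.G (t - u) (y - z))) (at (y - z))"
    using st.GDERIV_K[OF tu] by (simp add: gderiv_def)
  from has_derivative_compose[OF d1 this]
  show "GDERIV (\<lambda>w. stable_density \<alpha> \<beta> a u w t y) z :> - st.G (t - u) (y - z)"
    by (simp add: gderiv_def stable_density_def stable_kernel_eq)
qed

lemma stable_generator_eq:
  fixes \<phi> :: "real \<times> 'a::euclidean_space \<Rightarrow> real"
  assumes \<phi>: "\<phi> \<in> Cc_infinity"
  shows "stable_generator \<alpha> \<beta> a (\<lambda>w. \<phi> (u, w)) z = levy_exponent.gen (stable_levy \<alpha> \<beta> a) (\<lambda>w. \<phi> (u, w)) z"
proof -
  interpret levy_test "stable_symbol \<alpha> \<beta> a" "stable_levy \<alpha> \<beta> a :: 'a \<Rightarrow> real" "1 + a powr \<beta>" \<phi>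
    by unfold_locales (rule \<phi>)
  obtain B where B: "\<And>X. \<bar>\<phi> X\<bar> \<le> B" using Cc_infinity_bounded[OF \<phi>] by blast
  obtain A where A: "\<And>u z y. \<bar>\<phi> (u, z + y) + \<phi> (u, z - y) - 2 * \<phi> (u, z)\<bar> \<le> A * min 1 ((norm y)\<^sup>2)"
    using \<phi>_second_difference by blast
  have "((\<lambda>\<epsilon>. LINT y:{y. norm y > \<epsilon>}|lborel. stable_levy \<alpha> \<beta> a y * (\<phi> (u, z + y) - \<phi> (u, z))) \<longlongrightarrow> st.gen (\<lambda>w. \<phi> (u, w)) z) (at_right 0)"
    by (rule st.gen_tendsto[where B=B and A=A]) (use A B in auto)
  then show ?thesis
    unfolding stable_generator_def stable_levy_def
    by (intro tendsto_Lim) (auto simp: trivial_limit_at_right_real)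
qed

end

theorem theorem2:
  fixes \<alpha> \<beta> a \<eta> :: real
    and Q :: "real \<Rightarrow> real \<Rightarrow> real"
    and b :: "real \<Rightarrow> real ^ 'n \<Rightarrow> real ^ 'n"
  assumes "1 < \<beta>" and "\<beta> < \<alpha>" and "\<alpha> < 2" and "a > 0"
    and "(\<lambda>(u, z). b u z) \<in> borel_measurable borel"
    and "\<And>s t. 0 \<le> Q s t" and "superadditive Q"
    and "0 \<le> \<eta>" and "\<eta> < 1 / 2"
    and "b \<in> class_N \<eta> Q (stable_density \<alpha> \<beta> a)"
  shows "\<exists>q :: real \<Rightarrow> real ^ 'n \<Rightarrow> real \<Rightarrow> real ^ 'n \<Rightarrow> real.
    transition_density q \<and>
    (\<exists>C>1. \<forall>s t x y. s < t \<longrightarrow>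
       stable_density \<alpha> \<beta> a s x t y / C powr (1 + Q s t) \<le> q s x t y \<and>
       q s x t y \<le> stable_density \<alpha> \<beta> a s x t y *
         (if \<eta> = 0 then exp (Q s t) else (1 / (1 - 2 * \<eta>)) powr (1 + Q s t / \<eta>))) \<and>
    (\<forall>s x. \<forall>\<phi> \<in> Cc_infinity.
       let g = (\<lambda>u z. q s x u z *
                 (deriv (\<lambda>v. \<phi> (v, z)) u
                  + stable_generator \<alpha> \<beta> a (\<lambda>w. \<phi> (u, w)) z
                  + b u z \<bullet> grad (\<lambda>w. \<phi> (u, w)) z))
       in set_integrable lborel ({s<..} \<times> UNIV) (\<lambda>(u, z). g u z) \<and>
          (LINT u:{s<..}|lborel. (LINT z|lborel. g u z)) = - \<phi> (s, x))"
proof -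
  note ab = assms(1-3)
  interpret levy_exponent "stable_symbol \<alpha> \<beta> a" "stable_levy \<alpha> \<beta> a :: real ^ 'n \<Rightarrow> real" "1 + a powr \<beta>"
    by (rule levy_exponent_stable[OF ab])
  have dens: "stable_density \<alpha> \<beta> a s x t y = K (t - s) (y - x)" for s t and x y :: "real ^ 'n"
    by (simp add: stable_density_def stable_kernel_eq[OF ab])
  interpret gradient_perturbation "stable_symbol \<alpha> \<beta> a" "stable_levy \<alpha> \<beta> a :: real ^ 'n \<Rightarrow> real" "1 + a powr \<beta>" b \<eta> Q
  proof
    fix s t :: real and x y :: "real ^ 'n" assume st: "s < t"
    have "(\<integral>\<^sup>+u\<in>{s<..<t}. (\<integral>\<^sup>+z. ennreal (K (u - s) (z - x) * norm (b u z) * norm (G (t - u) (y - z))) \<partial>lborel) \<partial>lborel) =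
      (\<integral>\<^sup>+u\<in>{s<..<t}. (\<integral>\<^sup>+z. ennreal (stable_density \<alpha> \<beta> a s x u z * norm (b u z) * norm (grad (\<lambda>w. stable_density \<alpha> \<beta> a u w t y) z)) \<partial>lborel) \<partial>lborel)"
    proof (rule nn_integral_cong)
      fix u :: real
      show "(\<integral>\<^sup>+z. ennreal (K (u - s) (z - x) * norm (b u z) * norm (G (t - u) (y - z))) \<partial>lborel) * indicator {s<..<t} u =
        (\<integral>\<^sup>+z. ennreal (stable_density \<alpha> \<beta> a s x u z * norm (b u z) * norm (grad (\<lambda>w. stable_density \<alpha> \<beta> a u w t y) z)) \<partial>lborel) * indicator {s<..<t} u"
      proof (cases "u < t")
        case True
        show ?thesis by (simp only: stable_density_grad[OF ab True] norm_minus_cancel) (simp only: dens)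
      qed simp
    qed
    also have "\<dots> \<le> ennreal ((\<eta> + Q s t) * stable_density \<alpha> \<beta> a s x t y)"
      using assms(10) st by (simp add: class_N_def)
    finally show "(\<integral>\<^sup>+u\<in>{s<..<t}. (\<integral>\<^sup>+z. ennreal (K (u - s) (z - x) * norm (b u z) * norm (G (t - u) (y - z))) \<partial>lborel) \<partial>lborel) \<le> ennreal ((\<eta> + Q s t) * K (t - s) (y - x))"
      by (simp add: dens)
  qed (use assms in auto)
  have p_dens: "p (s, x) (t, y) = stable_density \<alpha> \<beta> a s x t y" for s t and x y :: "real ^ 'n"
    by (simp add: p_def dens)
  have "transition_density (\<lambda>s x t y. q (s, x) (t, y))"
    unfolding transition_density_def using q_nonneg q_CK by simp
  moreover have "\<exists>C>1. \<forall>s t x y. s < t \<longrightarrow>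
       stable_density \<alpha> \<beta> a s x t y / C powr (1 + Q s t) \<le> q (s, x) (t, y) \<and>
       q (s, x) (t, y) \<le> stable_density \<alpha> \<beta> a s x t y *
         (if \<eta> = 0 then exp (Q s t) else (1 / (1 - 2 * \<eta>)) powr (1 + Q s t / \<eta>))"
  proof -
    obtain C where C: "C > 1" "\<And>s t x y. s < t \<Longrightarrow> p (s, x) (t, y) / C powr (1 + Q s t) \<le> q (s, x) (t, y)"
      using q_lower_ex by blast
    have "q (s, x) (t, y) \<le> p (s, x) (t, y) * (if \<eta> = 0 then exp (Q s t) else (1 / (1 - 2 * \<eta>)) powr (1 + Q s t / \<eta>))" if "s < t" for s t x y
      using q_upper_zero[OF _ that] q_upper_pos[OF _ that] assms(8) by auto
    with C show ?thesis unfolding p_dens by blast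
  qed
  moreover have "let g = (\<lambda>u z. q (s, x) (u, z) *
                 (deriv (\<lambda>v. \<phi> (v, z)) u
                  + stable_generator \<alpha> \<beta> a (\<lambda>w. \<phi> (u, w)) z
                  + b u z \<bullet> grad (\<lambda>w. \<phi> (u, w)) z))
       in set_integrable lborel ({s<..} \<times> UNIV) (\<lambda>(u, z). g u z) \<and>
          (LINT u:{s<..}|lborel. (LINT z|lborel. g u z)) = - \<phi> (s, x)" if \<phi>: "\<phi> \<in> Cc_infinity" for s x \<phi>
  proof -
    define g where "g u z = q (s, x) (u, z) *
                 (deriv (\<lambda>v. \<phi> (v, z)) u
                  + stable_generator \<alpha> \<beta> a (\<lambda>w. \<phi> (u, w)) z
                  + b u z \<bullet> grad (\<lambda>w. \<phi> (u, w)) z)" for u z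
    have g: "g (fst U) (snd U) = q (s, x) U * (frechet_derivative \<phi> (at U) (1, 0) + gen (\<lambda>w. \<phi> (fst U, w)) (snd U) + bb U \<bullet> space_grad \<phi> (fst U) (snd U))" for U
      unfolding g_def bb_def
      by (simp add: DERIV_imp_deriv[OF Cc_infinity_time_derivative[OF \<phi>]] stable_generator_eq[OF ab \<phi>] grad_eqI[OF Cc_infinity_space_grad[OF \<phi>]])
    have w: "has_bochner_integral lborel (\<lambda>U. g (fst U) (snd U)) (- \<phi> (s, x))"
      unfolding g by (rule weak_equation[OF \<phi>])
    \<comment> \<open>\<open>q\<close> vanishes up to time \<open>s\<close>, so the integral over
      later times in the claim agrees with the integral over all of space-time.\<close>
    have g0: "g u z = 0" if "u \<le> s" for u z using that q_zero[of "(u, z)" "(s, x)"] by (simp add: g_def)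
    have ind: "indicator ({s<..} \<times> UNIV) U *\<^sub>R (case U of (u, z) \<Rightarrow> g u z) = g (fst U) (snd U)" for U
      using g0[of "fst U" "snd U"] by (cases U) (auto simp: indicator_def)
    have 1: "set_integrable lborel ({s<..} \<times> UNIV) (\<lambda>(u, z). g u z)"
      unfolding set_integrable_def ind using w by (simp add: has_bochner_integral_iff)
    have int: "integrable (lborel \<Otimes>\<^sub>M lborel) (\<lambda>(u, z). g u z)"
      using w by (simp add: has_bochner_integral_iff lborel_prod case_prod_beta')
    have "(LINT u:{s<..}|lborel. (LINT z|lborel. g u z)) = (LINT u|lborel. (LINT z|lborel. g u z))"
      unfolding set_lebesgue_integral_def
    proof (intro Bochner_Integration.integral_cong refl)
      fix u :: real
      show "indicator {s<..} u *\<^sub>R (LINT z|lborel. g u z) = (LINT z|lborel. g u z)"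
      proof (cases "s < u")
        case False
        then have z: "g u z = 0" for z by (simp add: g0)
        show ?thesis unfolding z by simp
      qed simp
    qed
    also have "\<dots> = (LINT U|(lborel \<Otimes>\<^sub>M lborel). (case U of (u, z) \<Rightarrow> g u z))"
      by (rule lborel_pair.integral_fst[OF int])
    also have "\<dots> = - \<phi> (s, x)"
      using w by (simp add: has_bochner_integral_iff lborel_prod case_prod_beta')
    finally show ?thesis unfolding Let_def using 1 by (simp add: g_def)
  qed
  ultimately show ?thesis by (intro exI[of _ "\<lambda>s x t y. q (s, x) (t, y)"] conjI allI ballI) blast+
qed

end
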